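(* Let $\lambda>0$, let $\mu_{\min}>0$ be the minimal eigenvalue of $\boldsymbol{P}-\varepsilon\triangle'$, and let $\mu_{\min}>\varepsilon^{-1}$. Let $(\boldsymbol{i}(t),\eta(t))_{t\ge0}$ be the stochastic approximation of the discrete Allen--Cahn equation with switching rate $\lambda$, as defined in the context. Then the stochastic approximation $(\eta(t))_{t\ge0}$ has a unique stationary measure $\pi_\dagger\in\mathrm{Prob}(X)$, and for any initial value $\eta(0)=\eta^{(0)}\in X$ and any $p\in(0,1)$ there are constants $c,c'>0$ such that $$\mathrm{W}_p\big(\pi_\dagger,\mathbb{P}(\eta(t)\in\cdot)\big)\le c\exp(-c't)\qquad(t\ge0).$$
   Context: Let $n\in\mathbb{N}$, $X=\mathbb{R}^n$, $\alpha,\varepsilon>0$, $X'$ a linear subspace of $X$, $d\in X'$, and $P_{X'}:X\to X'$ the canonical (orthogonal) projection. Set $\boldsymbol{P}=\alpha P_{X'}^TP_{X'}$ and $\boldsymbol{d}=\alpha P_{X'}^Td$. Let $\nabla'$ be a linear map (discrete gradient) on $X$ such that the matrix $\triangle'=-\nabla'^T\nabla'\in\mathbb{R}^{n\times n}$ (discrete Laplacian) is symmetric and strictly negative definite. The double-well potential $W:\mathbb{R}\to\mathbb{R}$ is $W(s)=-s-1$ for $s\le-1$, $W(s)=-\frac{s^2}{2}+\frac12$ for $s\in(-1,1)$, $W(s)=s-1$ for $s\ge1$. Its (proximal) subdifferential is $\partial W(s)=\{-1\}$ for $s<-1$, $\{-s\}$ for $s\in(-1,1)$, $\{1\}$ for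 $s>1$, and $[-1,1]$ for $s\in\{-1,1\}$. Set $\Phi_{\ell}(\eta)=\frac{\alpha}{2}\|P_{X'}\eta-d\|_2^2+\frac{\varepsilon}{2}\|\nabla'\eta\|_2^2$, so $-\nabla\Phi_\ell(\eta)=-\boldsymbol{P}\eta+\boldsymbol{d}+\varepsilon\triangle'\eta$, and $\Phi_{\rm w}(\eta)=\varepsilon^{-1}\sum_{i=1}^nW(\eta_i)$, with $\partial\Phi_{\rm w}(\eta)=\varepsilon^{-1}(\partial W(\eta_1)\times\cdots\times\partial W(\eta_n))$. Let $(\boldsymbol{i}(t))_{t\ge0}$ be a right-continuous continuous-time Markov process on $\{0,1\}$ with transition rate matrix $\begin{pmatrix}-\lambda&\lambda\\ \lambda&-\lambda\end{pmatrix}$ (with arbitrary initial state). The stochastic approximation $(\boldsymbol{i}(t),\eta(t))_{t\ge0}$ is the (almost surely well-defined) process whose $X$-component has continuous paths, obtained by concatenating the unique solutions, on the intervals between consecutive jumps of $\boldsymbol{i}$, of $$\frac{\mathrm{d}\eta(t)}{\mathrm{d}t}\in\begin{cases}\{-\nabla\Phi_\ell(\eta(t))\},&\boldsymbol{i}(t)=0,\\-\partial\Phi_{\rm w}(\eta(t)),&\boldsymbol{i}(t)=1,\end{cases}\qquad\eta(0)=\eta^{(0)}\in X.$$ $\mathrm{Prob}(X)$ is the set of Borel probability measures on $X$. A stationary measure of $(\eta(t))_{t\ge0}$ means the $X$-marginal of an invariant probability measure of the Markov process $(\boldsymbol{i}(t),\eta(t))_{t\ge0}$ on $\{0,1\}\times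 X$. For $\pi,\pi'\in\mathrm{Prob}(X)$ and $p\in(0,1)$, $$\mathrm{W}_p(\pi,\pi'):=\inf_{\Gamma\in\mathrm{Coup}(\pi,\pi')}\int_{X\times X}\min\{1,\|\zeta-\zeta'\|_2^p\}\,\Gamma(\mathrm{d}\zeta,\mathrm{d}\zeta'),$$ where $\mathrm{Coup}(\pi,\pi')$ is the set of couplings of $\pi$ and $\pi'$. *)

theory Defs
  imports "HOL-Probability.Probability"
begin

section \<open>Linear algebra\<close>

definition orth_proj :: "'a::euclidean_space set \<Rightarrow> 'a \<Rightarrow> 'a" where
  "orth_proj S x = (THE y. y \<in> S \<and> (\<forall>z\<in>S. orthogonal (x - y) z))"

text \<open>
  The projection is regarded as a map from the whole space into itself. Its transpose then restricts
  to the inclusion of \<open>X'\<close> on \<open>X'\<close>, where the data \<open>d\<close> live, so the two operators below agree with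
  the ones formed from the projection as a map onto \<open>X'\<close>.
\<close>

definition proj_mat :: "(real^'n) set \<Rightarrow> real^'n^'n" where
  "proj_mat X' = matrix (orth_proj X')"

definition data_op :: "real \<Rightarrow> (real^'n) set \<Rightarrow> real^'n^'n" where
  "data_op \<alpha> X' = \<alpha> *\<^sub>R (transpose (proj_mat X') ** proj_mat X')"

definition data_vec :: "real \<Rightarrow> (real^'n) set \<Rightarrow> real^'n \<Rightarrow> real^'n" where
  "data_vec \<alpha> X' d = \<alpha> *\<^sub>R (transpose (proj_mat X') *v d)"

definition laplacian :: "real^'n^'m \<Rightarrow> real^'n^'n" where
  "laplacian G = - (transpose G ** G)"

definition symmetric_matrix :: "real^'n^'n \<Rightarrow> bool" where
  "symmetric_matrix A \<longleftrightarrow> transpose A = A"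

definition negative_definite :: "real^'n^'n \<Rightarrow> bool" where
  "negative_definite A \<longleftrightarrow> (\<forall>v. v \<noteq> 0 \<longrightarrow> v \<bullet> (A *v v) < 0)"

definition eigenvalues :: "real^'n^'n \<Rightarrow> real set" where
  "eigenvalues A = {l. \<exists>v. v \<noteq> 0 \<and> A *v v = l *\<^sub>R v}"

definition is_min_eigenvalue :: "real^'n^'n \<Rightarrow> real \<Rightarrow> bool" where
  "is_min_eigenvalue A l \<longleftrightarrow> l \<in> eigenvalues A \<and> (\<forall>l'\<in>eigenvalues A. l \<le> l')"

lemma orth_proj_ex1:
  fixes x :: "'a::euclidean_space"
  assumes "subspace S"
  shows "\<exists>!y. y \<in> S \<and> (\<forall>z\<in>S. orthogonal (x - y) z)"
proof -
  obtain y z where y: "y \<in> span S" and z: "\<And>w. w \<in> span S \<Longrightarrow> orthogonal z w" and x: "x = y + z"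
    using orthogonal_subspace_decomp_exists by blast
  have sp: "span S = S" using assms by (simp add: span_eq_iff)
  show ?thesis
  proof (rule ex1I)
    show "y \<in> S \<and> (\<forall>z\<in>S. orthogonal (x - y) z)" using y z x sp by auto
  next
    fix y' assume y': "y' \<in> S \<and> (\<forall>z\<in>S. orthogonal (x - y') z)"
    have d: "y' - y \<in> S" using y y' sp assms by (simp add: subspace_diff)
    have "(x - y') \<bullet> (y' - y) = 0" "(x - y) \<bullet> (y' - y) = 0"
      using y' d z x sp by (auto simp: orthogonal_def)
    then have "(y' - y) \<bullet> (y' - y) = 0" by (simp add: inner_diff_left)
    then show "y' = y" by simp
  qed
qed

lemma
  fixes x :: "'a::euclidean_space"
  assumes "subspace S"
  shows orth_proj_in: "orth_proj S x \<in> S"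
    and orth_proj_orthogonal: "z \<in> S \<Longrightarrow> orthogonal (x - orth_proj S x) z"
  using theI'[OF orth_proj_ex1[OF assms, of x]] unfolding orth_proj_def[symmetric] by auto

lemma orth_proj_unique:
  fixes x :: "'a::euclidean_space"
  assumes "subspace S" "y \<in> S" "\<And>z. z \<in> S \<Longrightarrow> orthogonal (x - y) z"
  shows "orth_proj S x = y"
  using orth_proj_ex1[OF assms(1), of x] assms(2,3) orth_proj_in[OF assms(1), of x]
    orth_proj_orthogonal[OF assms(1), of _ x] by blast

lemma linear_orth_proj:
  assumes S: "subspace S"
  shows "linear (orth_proj S)"
proof (rule linearI)
  fix x y
  show "orth_proj S (x + y) = orth_proj S x + orth_proj S y"
  proof (rule orth_proj_unique[OF S])
    show "orth_proj S x + orth_proj S y \<in> S" using S by (simp add: orth_proj_in subspace_add)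
    fix z assume "z \<in> S"
    then have "(x - orth_proj S x) \<bullet> z = 0" "(y - orth_proj S y) \<bullet> z = 0"
      using orth_proj_orthogonal[OF S] by (auto simp: orthogonal_def)
    then show "orthogonal (x + y - (orth_proj S x + orth_proj S y)) z"
      by (simp add: orthogonal_def inner_diff_left inner_add_left)
  qed
next
  fix c :: real and x
  show "orth_proj S (c *\<^sub>R x) = c *\<^sub>R orth_proj S x"
  proof (rule orth_proj_unique[OF S])
    show "c *\<^sub>R orth_proj S x \<in> S" using S by (simp add: orth_proj_in subspace_scale)
    fix z assume "z \<in> S"
    then have "(x - orth_proj S x) \<bullet> z = 0"
      using orth_proj_orthogonal[OF S] by (auto simp: orthogonal_def)
    then show "orthogonal (c *\<^sub>R x - c *\<^sub>R orth_proj S x) z"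
      by (simp add: orthogonal_def inner_diff_left)
  qed
qed

lemma proj_mat_works: "subspace X' \<Longrightarrow> proj_mat X' *v x = orth_proj X' x"
  by (simp add: proj_mat_def linear_orth_proj matrix_works)


section \<open>The two parts of the Allen--Cahn energy\<close>

definition prox_subdiff :: "('a::real_inner \<Rightarrow> real) \<Rightarrow> 'a \<Rightarrow> 'a set" where
  "prox_subdiff f x =
    {v. \<exists>\<sigma>>0. \<exists>\<delta>>0. \<forall>y\<in>ball x \<delta>. f y \<ge> f x + v \<bullet> (y - x) - \<sigma> * (norm (y - x))\<^sup>2}"

definition double_well :: "real \<Rightarrow> real" where
  "double_well s = (if s \<le> -1 then - s - 1 else if s < 1 then - s\<^sup>2 / 2 + 1 / 2 else s - 1)"

definition Phi_w :: "real \<Rightarrow> real^'n \<Rightarrow> real" where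
  "Phi_w \<epsilon> \<eta> = (\<Sum>k\<in>UNIV. double_well (\<eta> $ k)) / \<epsilon>"

definition Phi_l :: "real \<Rightarrow> real \<Rightarrow> (real^'n) set \<Rightarrow> real^'n \<Rightarrow> real^'n^'m \<Rightarrow> real^'n \<Rightarrow> real" where
  "Phi_l \<alpha> \<epsilon> X' d G \<eta> =
     \<alpha> / 2 * (norm (orth_proj X' \<eta> - d))\<^sup>2 + \<epsilon> / 2 * (norm (G *v \<eta>))\<^sup>2"

text \<open>
  The type \<open>2\<close> has exactly the two elements \<open>0\<close> and \<open>1\<close> and serves as the state space of the
  switching process.
\<close>

definition drift ::
  "real \<Rightarrow> real \<Rightarrow> (real^'n) set \<Rightarrow> real^'n \<Rightarrow> real^'n^'m \<Rightarrow> 2 \<Rightarrow> real^'n \<Rightarrow> (real^'n) set" where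
  "drift \<alpha> \<epsilon> X' d G j \<eta> =
    (if j = 0 then {- g | g. GDERIV (Phi_l \<alpha> \<epsilon> X' d G) \<eta> :> g}
     else {- g | g. g \<in> prox_subdiff (Phi_w \<epsilon>) \<eta>})"

lemma GDERIV_half_norm_square_affine:
  fixes A :: "real^'n^'m" and b :: "real^'m"
  shows "GDERIV (\<lambda>x. c / 2 * (norm (A *v x - b))\<^sup>2) x :> c *\<^sub>R (transpose A *v (A *v x - b))"
proof -
  have lin: "((\<lambda>x. A *v x) has_derivative (\<lambda>h. A *v h)) (at x)"
    by (intro bounded_linear_imp_has_derivative) (simp add: matrix_vector_mul_bounded_linear)
  have "((\<lambda>x. c / 2 * ((A *v x - b) \<bullet> (A *v x - b))) has_derivative
      (\<lambda>h. c / 2 * ((A *v x - b) \<bullet> (A *v h) + (A *v h) \<bullet> (A *v x - b)))) (at x)"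
    by (auto intro!: derivative_eq_intros lin)
  also have "(\<lambda>h. c / 2 * ((A *v x - b) \<bullet> (A *v h) + (A *v h) \<bullet> (A *v x - b))) =
      (\<lambda>h. h \<bullet> (c *\<^sub>R (transpose A *v (A *v x - b))))"
  proof
    fix h
    have "h \<bullet> (transpose A *v (A *v x - b)) = (A *v h) \<bullet> (A *v x - b)"
      by (metis dot_lmul_matrix inner_commute transpose_matrix_vector)
    then show "c / 2 * ((A *v x - b) \<bullet> (A *v h) + (A *v h) \<bullet> (A *v x - b)) =
        h \<bullet> (c *\<^sub>R (transpose A *v (A *v x - b)))"
      by (simp add: inner_commute)
  qed
  finally show ?thesis by (simp add: gderiv_def power2_norm_eq_inner)
qed

lemma GDERIV_Phi_l:
  assumes "subspace X'"
  shows "GDERIV (Phi_l \<alpha> \<epsilon> X' d G) \<eta> :>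
    (data_op \<alpha> X' *v \<eta> - data_vec \<alpha> X' d - \<epsilon> *\<^sub>R (laplacian G *v \<eta>))"
proof -
  have "GDERIV (\<lambda>x. \<alpha> / 2 * (norm (proj_mat X' *v x - d))\<^sup>2 + \<epsilon> / 2 * (norm (G *v x - 0))\<^sup>2) \<eta> :>
      (\<alpha> *\<^sub>R (transpose (proj_mat X') *v (proj_mat X' *v \<eta> - d)) +
       \<epsilon> *\<^sub>R (transpose G *v (G *v \<eta> - 0)))"
    by (intro GDERIV_add GDERIV_half_norm_square_affine)
  moreover have "(\<lambda>x. \<alpha> / 2 * (norm (proj_mat X' *v x - d))\<^sup>2 + \<epsilon> / 2 * (norm (G *v x - 0))\<^sup>2) =
      Phi_l \<alpha> \<epsilon> X' d G"
    by (rule ext) (simp add: Phi_l_def proj_mat_works assms)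
  moreover have "\<alpha> *\<^sub>R (transpose (proj_mat X') *v (proj_mat X' *v \<eta> - d)) +
       \<epsilon> *\<^sub>R (transpose G *v (G *v \<eta> - 0)) =
      data_op \<alpha> X' *v \<eta> - data_vec \<alpha> X' d - \<epsilon> *\<^sub>R (laplacian G *v \<eta>)"
  proof -
    have neg: "laplacian G *v \<eta> = - (transpose G *v (G *v \<eta>))"
      using matrix_vector_mult_diff_rdistrib[of 0 "transpose G ** G" \<eta>]
      by (simp add: laplacian_def matrix_vector_mul_assoc)
    have sc: "data_op \<alpha> X' *v \<eta> = \<alpha> *\<^sub>R (transpose (proj_mat X') *v (proj_mat X' *v \<eta>))"
      by (simp add: data_op_def scaleR_matrix_vector_assoc[symmetric] matrix_vector_mul_assoc)
    show ?thesis
      by (simp only: neg sc data_vec_def matrix_vector_mult_diff_distrib)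
         (simp add: scaleR_diff_right)
  qed
  ultimately show ?thesis by simp
qed

lemma GDERIV_unique:
  assumes "GDERIV f x :> a" "GDERIV f x :> b"
  shows "a = b"
proof -
  have "(\<lambda>h. h \<bullet> a) = (\<lambda>h. h \<bullet> b)"
    using assms unfolding gderiv_def by (rule has_derivative_unique)
  then have "(a - b) \<bullet> a = (a - b) \<bullet> b" by metis
  then have "(a - b) \<bullet> (a - b) = 0" by (simp add: inner_diff_right)
  then show ?thesis by simp
qed

lemma drift_0:
  assumes "subspace X'"
  shows "drift \<alpha> \<epsilon> X' d G 0 \<eta> =
    {- (data_op \<alpha> X' *v \<eta>) + data_vec \<alpha> X' d + \<epsilon> *\<^sub>R (laplacian G *v \<eta>)}"
proof -
  have "GDERIV (Phi_l \<alpha> \<epsilon> X' d G) \<eta> :> g \<longleftrightarrow>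
      g = data_op \<alpha> X' *v \<eta> - data_vec \<alpha> X' d - \<epsilon> *\<^sub>R (laplacian G *v \<eta>)" for g
    using GDERIV_Phi_l[OF assms] GDERIV_unique by blast
  then show ?thesis by (simp add: drift_def)
qed

lemma prox_subdiff_I:
  assumes "\<sigma> > 0" "\<And>y. f y \<ge> f x + v \<bullet> (y - x) - \<sigma> * (norm (y - x))\<^sup>2"
  shows "v \<in> prox_subdiff f x"
  unfolding prox_subdiff_def using assms zero_less_one by blast

lemma prox_subdiff_le_right_slope:
  fixes f :: "real \<Rightarrow> real"
  assumes v: "v \<in> prox_subdiff f x" and r: "r > 0"
    and f: "\<And>h. 0 < h \<Longrightarrow> h < r \<Longrightarrow> f (x + h) \<le> f x + m * h"
  shows "v \<le> m"
proof (rule ccontr)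
  assume "\<not> v \<le> m"
  from v obtain \<sigma> \<delta> where \<sigma>: "\<sigma> > 0" and \<delta>: "\<delta> > 0"
    and lb: "\<And>y. y \<in> ball x \<delta> \<Longrightarrow> f y \<ge> f x + v \<bullet> (y - x) - \<sigma> * (norm (y - x))\<^sup>2"
    unfolding prox_subdiff_def by blast
  define h where "h = min (min (r / 2) (\<delta> / 2)) ((v - m) / (2 * \<sigma>))"
  have h: "h > 0" "h < r" "h < \<delta>" "h \<le> (v - m) / (2 * \<sigma>)"
    using r \<delta> \<sigma> \<open>\<not> v \<le> m\<close> by (auto simp: h_def)
  have "f (x + h) \<ge> f x + v * h - \<sigma> * h\<^sup>2"
    using lb[of "x + h"] h by (simp add: dist_norm)
  with f[OF h(1,2)] have "(v - m) * h \<le> (\<sigma> * h) * h" by (simp add: algebra_simps power2_eq_square)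
  then have "v - m \<le> \<sigma> * h" using h(1) by simp
  also have "\<dots> \<le> (v - m) / 2" using h(4) \<sigma> by (simp add: field_simps)
  finally show False using \<open>\<not> v \<le> m\<close> by simp
qed

lemma prox_subdiff_ge_left_slope:
  fixes f :: "real \<Rightarrow> real"
  assumes v: "v \<in> prox_subdiff f x" and r: "r > 0"
    and f: "\<And>h. 0 < h \<Longrightarrow> h < r \<Longrightarrow> f (x - h) \<le> f x - m * h"
  shows "m \<le> v"
proof -
  from v obtain \<sigma> \<delta> where \<sigma>: "\<sigma> > 0" and \<delta>: "\<delta> > 0"
    and lb: "\<And>y. y \<in> ball x \<delta> \<Longrightarrow> f y \<ge> f x + v \<bullet> (y - x) - \<sigma> * (norm (y - x))\<^sup>2"
    unfolding prox_subdiff_def by blast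
  have "- v \<in> prox_subdiff (\<lambda>y. f (- y)) (- x)"
    unfolding prox_subdiff_def
  proof (intro CollectI exI conjI ballI)
    fix y assume "y \<in> ball (- x) \<delta>"
    then have "- y \<in> ball x \<delta>" by (auto simp: dist_real_def)
    from lb[OF this] show "f (- (- x)) + (- v) \<bullet> (y - - x) - \<sigma> * (norm (y - - x))\<^sup>2 \<le> f (- y)"
      by (simp add: algebra_simps power2_eq_square)
  qed (use \<sigma> \<delta> in auto)
  then have "- v \<le> - m"
    by (rule prox_subdiff_le_right_slope[OF _ r]) (use f in auto)
  then show ?thesis by simp
qed

lemma double_well_lower_bound:
  assumes "s < -1 \<Longrightarrow> v = -1" "-1 < s \<Longrightarrow> s < 1 \<Longrightarrow> v = - s" "s > 1 \<Longrightarrow> v = 1" "-1 \<le> v" "v \<le> 1"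
  shows "double_well y \<ge> double_well s + v * (y - s) - (y - s)\<^sup>2 / 2"
proof -
  have dw1: "double_well y = \<bar>y\<bar> - 1" if "\<bar>y\<bar> \<ge> 1" for y
    using that by (auto simp: double_well_def abs_if split: if_splits)
  have dw2: "double_well y = 1 / 2 - y\<^sup>2 / 2" if "\<bar>y\<bar> \<le> 1" for y
    using that by (auto simp: double_well_def abs_if power2_eq_square split: if_splits)
  have lower: "double_well y \<ge> 1 / 2 - y\<^sup>2 / 2" for y
  proof (cases "\<bar>y\<bar> \<le> 1")
    case False
    have "0 \<le> (\<bar>y\<bar> + 3) * (\<bar>y\<bar> - 1)" using False by simp
    then show ?thesis using False dw1[of y] by (simp add: algebra_simps power2_eq_square)
  qed (simp add: dw2)
  have lower': "double_well y \<ge> \<bar>y\<bar> - 1" for y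
  proof (cases "\<bar>y\<bar> \<le> 1")
    case True
    have "0 \<le> (\<bar>y\<bar> + 3) * (1 - \<bar>y\<bar>)" using True by simp
    then show ?thesis using True dw2[of y] by (simp add: algebra_simps power2_eq_square)
  qed (simp add: dw1)
  have sq: "0 \<le> (y - s)\<^sup>2" by simp
  consider "s < -1" | "s = -1" | "-1 < s" "s < 1" | "s = 1" | "s > 1" by linarith
  then show ?thesis
  proof cases
    case 1
    then have "double_well s + v * (y - s) = - 1 - y" using assms(1) dw1[of s] by simp
    then show ?thesis using lower'[of y] sq by linarith
  next
    case 3
    then show ?thesis using assms(2) dw2[of s] lower[of y] by (simp add: field_simps power2_eq_square)
  next
    case 5
    then have "double_well s + v * (y - s) = y - 1" using assms(3) dw1[of s] by simp
    then show ?thesis using lower'[of y] sq by linarith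
  next
    case 2
    show ?thesis
    proof (cases "y \<le> -1")
      case True
      then have "0 \<le> (1 + v) * (- 1 - y)" using assms(4) by simp
      then have "double_well s + v * (y - s) \<le> - 1 - y" using 2 dw1[of s] by (simp add: algebra_simps)
      then show ?thesis using True dw1[of y] sq by linarith
    next
      case False
      have "0 \<le> (1 - v) * (y + 1)" using False assms(5) by simp
      then show ?thesis using 2 dw1[of s] lower[of y] by (simp add: field_simps power2_eq_square)
    qed
  next
    case 4
    show ?thesis
    proof (cases "y \<ge> 1")
      case True
      then have "0 \<le> (1 - v) * (y - 1)" using assms(5) by simp
      then have "double_well s + v * (y - s) \<le> y - 1" using 4 dw1[of s] by (simp add: algebra_simps)
      then show ?thesis using True dw1[of y] sq by linarith
    next
      case False
      have "0 \<le> (1 + v) * (1 - y)" using False assms(4) by simp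
      then show ?thesis using 4 dw1[of s] lower[of y] by (simp add: field_simps power2_eq_square)
    qed
  qed
qed

lemma prox_subdiff_double_well:
  "prox_subdiff double_well s =
    (if s < -1 then {-1} else if s = -1 \<or> s = 1 then {-1..1} else if s < 1 then {- s} else {1})"
    (is "_ = ?D")
proof (rule set_eqI, rule iffI)
  fix v assume "v \<in> ?D"
  then have "double_well y \<ge> double_well s + v * (y - s) - (y - s)\<^sup>2 / 2" for y
    by (intro double_well_lower_bound) (auto split: if_splits)
  then show "v \<in> prox_subdiff double_well s"
    by (intro prox_subdiff_I[where \<sigma> = "1/2"]) auto
next
  fix v assume v: "v \<in> prox_subdiff double_well s"
  note right = prox_subdiff_le_right_slope[OF v]
  note left = prox_subdiff_ge_left_slope[OF v]
  consider "s < -1" | "s = -1" | "-1 < s" "s < 1" | "s = 1" | "s > 1" by linarith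
  then show "v \<in> ?D"
  proof cases
    case 1
    have "v \<le> -1" by (rule right[of "- 1 - s"]) (use 1 in \<open>auto simp: double_well_def\<close>)
    moreover have "-1 \<le> v" by (rule left[of 1]) (use 1 in \<open>auto simp: double_well_def\<close>)
    ultimately show ?thesis using 1 by simp
  next
    case 2
    have "v \<le> 1" by (rule right[of 1]) (use 2 in \<open>auto simp: double_well_def field_simps power2_eq_square\<close>)
    moreover have "-1 \<le> v" by (rule left[of 1]) (use 2 in \<open>auto simp: double_well_def\<close>)
    ultimately show ?thesis using 2 by simp
  next
    case 3
    have "v \<le> - s"
      by (rule right[of "1 - s"]) (use 3 in \<open>auto simp: double_well_def field_simps power2_eq_square\<close>)
    moreover have "- s \<le> v"
      by (rule left[of "s + 1"]) (use 3 in \<open>auto simp: double_well_def field_simps power2_eq_square\<close>)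
    ultimately show ?thesis using 3 by simp
  next
    case 4
    have "v \<le> 1" by (rule right[of 1]) (use 4 in \<open>auto simp: double_well_def\<close>)
    moreover have "-1 \<le> v"
      by (rule left[of 1]) (use 4 in \<open>auto simp: double_well_def field_simps power2_eq_square\<close>)
    ultimately show ?thesis using 4 by simp
  next
    case 5
    have "v \<le> 1" by (rule right[of 1]) (use 5 in \<open>auto simp: double_well_def\<close>)
    moreover have "1 \<le> v" by (rule left[of "s - 1"]) (use 5 in \<open>auto simp: double_well_def\<close>)
    ultimately show ?thesis using 5 by simp
  qed
qed

lemma prox_subdiff_Phi_w:
  fixes \<eta> :: "real^'n"
  assumes "\<epsilon> > 0"
  shows "prox_subdiff (Phi_w \<epsilon>) \<eta> =
    {(1 / \<epsilon>) *\<^sub>R w | w. \<forall>k. w $ k \<in> prox_subdiff double_well (\<eta> $ k)}"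
proof (rule set_eqI, rule iffI)
  fix v assume "v \<in> prox_subdiff (Phi_w \<epsilon>) \<eta>"
  then obtain \<sigma> \<delta> where \<sigma>: "\<sigma> > 0" and \<delta>: "\<delta> > 0"
    and lb: "\<And>y. y \<in> ball \<eta> \<delta> \<Longrightarrow>
      Phi_w \<epsilon> y \<ge> Phi_w \<epsilon> \<eta> + v \<bullet> (y - \<eta>) - \<sigma> * (norm (y - \<eta>))\<^sup>2"
    unfolding prox_subdiff_def by blast
  have "(\<epsilon> *\<^sub>R v) $ k \<in> prox_subdiff double_well (\<eta> $ k)" for k
    unfolding prox_subdiff_def
  proof (intro CollectI exI conjI ballI)
    fix s assume s: "s \<in> ball (\<eta> $ k) \<delta>"
    define y where "y = \<eta> + axis k (s - \<eta> $ k)"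
    have nrm: "norm (y - \<eta>) = \<bar>s - \<eta> $ k\<bar>" by (simp add: y_def norm_eq_sqrt_inner inner_axis_axis)
    have "y \<in> ball \<eta> \<delta>" using s nrm by (simp add: dist_norm norm_minus_commute dist_commute)
    note lb[OF this]
    moreover have "v \<bullet> (y - \<eta>) = v $ k * (s - \<eta> $ k)"
      by (simp add: y_def inner_axis)
    moreover have "Phi_w \<epsilon> y - Phi_w \<epsilon> \<eta> = (double_well s - double_well (\<eta> $ k)) / \<epsilon>"
    proof -
      have "(\<Sum>l\<in>UNIV. double_well (y $ l)) - (\<Sum>l\<in>UNIV. double_well (\<eta> $ l)) =
          (\<Sum>l\<in>UNIV. if l = k then double_well s - double_well (\<eta> $ k) else 0)"
        unfolding sum_subtractf[symmetric]
        by (rule sum.cong) (auto simp: y_def axis_def)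
      also have "\<dots> = double_well s - double_well (\<eta> $ k)" by simp
      finally show ?thesis by (simp add: Phi_w_def diff_divide_distrib[symmetric])
    qed
    ultimately have "(double_well s - double_well (\<eta> $ k)) / \<epsilon> \<ge>
        v $ k * (s - \<eta> $ k) - \<sigma> * (s - \<eta> $ k)\<^sup>2"
      by (simp add: nrm)
    then have "(v $ k * (s - \<eta> $ k) - \<sigma> * (s - \<eta> $ k)\<^sup>2) * \<epsilon> \<le> double_well s - double_well (\<eta> $ k)"
      using assms by (simp add: pos_le_divide_eq)
    then show "double_well (\<eta> $ k) + (\<epsilon> *\<^sub>R v) $ k \<bullet> (s - \<eta> $ k) - (\<epsilon> * \<sigma>) * (norm (s - \<eta> $ k))\<^sup>2 \<le> double_well s"
      by (simp add: algebra_simps)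
  qed (use assms \<sigma> \<delta> in auto)
  then show "v \<in> {(1 / \<epsilon>) *\<^sub>R w | w. \<forall>k. w $ k \<in> prox_subdiff double_well (\<eta> $ k)}"
    using assms by (intro CollectI exI[of _ "\<epsilon> *\<^sub>R v"]) auto
next
  fix v assume "v \<in> {(1 / \<epsilon>) *\<^sub>R w | w. \<forall>k. w $ k \<in> prox_subdiff double_well (\<eta> $ k)}"
  then obtain w where v: "v = (1 / \<epsilon>) *\<^sub>R w"
    and w: "\<And>k. w $ k \<in> prox_subdiff double_well (\<eta> $ k)" by blast
  have lb: "double_well (y $ k) \<ge>
      double_well (\<eta> $ k) + w $ k * (y $ k - \<eta> $ k) - (y $ k - \<eta> $ k)\<^sup>2 / 2" for y k
    using w[of k] by (intro double_well_lower_bound) (auto simp: prox_subdiff_double_well split: if_splits)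
  show "v \<in> prox_subdiff (Phi_w \<epsilon>) \<eta>"
  proof (rule prox_subdiff_I)
    show "1 / (2 * \<epsilon>) > 0" using assms by simp
    fix y
    have "(\<Sum>k\<in>UNIV. double_well (y $ k)) \<ge>
        (\<Sum>k\<in>UNIV. double_well (\<eta> $ k) + w $ k * (y $ k - \<eta> $ k) - (y $ k - \<eta> $ k)\<^sup>2 / 2)"
      by (intro sum_mono lb)
    also have "(\<Sum>k\<in>UNIV. double_well (\<eta> $ k) + w $ k * (y $ k - \<eta> $ k) - (y $ k - \<eta> $ k)\<^sup>2 / 2) =
        (\<Sum>k\<in>UNIV. double_well (\<eta> $ k)) + w \<bullet> (y - \<eta>) - (norm (y - \<eta>))\<^sup>2 / 2"
      unfolding power2_norm_eq_inner
      by (simp add: inner_vec_def sum.distrib sum_subtractf sum_divide_distrib power2_eq_square)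
    finally have "((\<Sum>k\<in>UNIV. double_well (\<eta> $ k)) + w \<bullet> (y - \<eta>) - (norm (y - \<eta>))\<^sup>2 / 2) / \<epsilon> \<le>
        (\<Sum>k\<in>UNIV. double_well (y $ k)) / \<epsilon>"
      using assms by (intro divide_right_mono) auto
    then show "Phi_w \<epsilon> y \<ge> Phi_w \<epsilon> \<eta> + v \<bullet> (y - \<eta>) - 1 / (2 * \<epsilon>) * (norm (y - \<eta>))\<^sup>2"
      by (simp add: Phi_w_def v add_divide_distrib diff_divide_distrib)
  qed
qed


section \<open>Differential inclusions\<close>

definition abs_cont_on :: "real set \<Rightarrow> (real \<Rightarrow> 'a::real_normed_vector) \<Rightarrow> bool" where
  "abs_cont_on I f \<longleftrightarrow>
    (\<forall>e>0. \<exists>\<delta>>0. \<forall>D :: (real \<times> real) set.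
       finite D \<longrightarrow> (\<forall>(u,v)\<in>D. u < v \<and> {u..v} \<subseteq> I) \<longrightarrow>
       pairwise (\<lambda>p q. disjnt {fst p<..<snd p} {fst q<..<snd q}) D \<longrightarrow>
       (\<Sum>(u,v)\<in>D. v - u) < \<delta> \<longrightarrow> (\<Sum>(u,v)\<in>D. norm (f v - f u)) < e)"

definition solves_inclusion ::
  "('a::real_normed_vector \<Rightarrow> 'a set) \<Rightarrow> real \<Rightarrow> real \<Rightarrow> (real \<Rightarrow> 'a) \<Rightarrow> bool" where
  "solves_inclusion F a b f \<longleftrightarrow>
    abs_cont_on {a..b} f \<and>
    (AE t in lborel. a < t \<and> t < b \<longrightarrow> (\<exists>v\<in>F (f t). (f has_vector_derivative v) (at t)))"


section \<open>Continuous-time Markov chains\<close>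

definition mat_exp :: "real^'s^'s \<Rightarrow> real^'s^'s" where
  "mat_exp A = (\<Sum>k. (1 / fact k) *\<^sub>R (((**) A ^^ k) (mat 1)))"

text \<open>
  The Markov property is stated in product form for the finite-dimensional distributions, with
  transition function \<open>exp (t Q)\<close>; the initial distribution is left open. Row \<open>j\<close> of \<open>Q\<close> contains
  the rates out of state \<open>j\<close>. The state space is discrete, so right-continuity of a path means that
  the path is constant on a right neighbourhood of each time.
\<close>

definition markov_chain ::
  "real^'s^'s \<Rightarrow> 'w measure \<Rightarrow> (real \<Rightarrow> 'w \<Rightarrow> 's::finite) \<Rightarrow> bool" where
  "markov_chain Q M i \<longleftrightarrow>
    prob_space M \<and>
    (\<forall>t\<ge>0. i t \<in> measurable M (count_space UNIV)) \<and>
    (\<forall>(m::nat) (t::nat \<Rightarrow> real) (y::nat \<Rightarrow> 's). 0 \<le> t 0 \<longrightarrow> mono t \<longrightarrow>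
       measure M {\<omega>\<in>space M. \<forall>k\<le>Suc m. i (t k) \<omega> = y k} =
       measure M {\<omega>\<in>space M. \<forall>k\<le>m. i (t k) \<omega> = y k} *
         (mat_exp ((t (Suc m) - t m) *\<^sub>R Q) $ y m $ y (Suc m)))"

definition right_continuous_path :: "(real \<Rightarrow> 's) \<Rightarrow> bool" where
  "right_continuous_path w \<longleftrightarrow> (\<forall>t\<ge>0. \<forall>\<^sub>F s in at_right t. w s = w t)"

definition switch_rates :: "real \<Rightarrow> real^2^2" where
  "switch_rates r = (\<chi> j k. if j = k then - r else r)"

lemma mat_exp_switch_rates:
  "mat_exp (t *\<^sub>R switch_rates r) $ j $ k =
    (if j = k then (1 + exp (- 2 * r * t)) / 2 else (1 - exp (- 2 * r * t)) / 2)"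
proof -
  define E :: "real^2^2" where "E = (\<chi> j k. if j = k then 1 / 2 else - 1 / 2)"
  define x where "x = - 2 * r * t"
  have Q: "t *\<^sub>R switch_rates r = x *\<^sub>R E"
    by (simp add: vec_eq_iff switch_rates_def E_def x_def)
  have EE: "E ** E = E"
    by (simp add: vec_eq_iff matrix_matrix_mult_def E_def sum_2 forall_2)
  have pow: "((**) (x *\<^sub>R E) ^^ Suc n) (mat 1) = x ^ Suc n *\<^sub>R E" for n
    by (induction n)
       (simp_all add: scalar_matrix_assoc[symmetric] matrix_scalar_ac EE)
  have summand: "(1 / fact n) *\<^sub>R (((**) (x *\<^sub>R E) ^^ n) (mat 1)) =
      (x ^ n /\<^sub>R fact n) *\<^sub>R E + (if n = 0 then mat 1 - E else 0)" for n
    using pow[of "n - 1"] by (cases n) (auto simp: field_simps)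
  have "(\<lambda>n. (x ^ n /\<^sub>R fact n) *\<^sub>R E + (if n = 0 then mat 1 - E else 0)) sums
      (exp x *\<^sub>R E + (mat 1 - E))"
    by (intro sums_add sums_scaleR_left exp_converges sums_single[of 0 "\<lambda>_. mat 1 - E"])
  then have exp_E: "mat_exp (x *\<^sub>R E) = exp x *\<^sub>R E + (mat 1 - E)"
    unfolding mat_exp_def summand by (rule sums_unique[symmetric])
  then show ?thesis
    unfolding Q exp_E by (simp add: E_def mat_def x_def field_simps)
qed


section \<open>The stochastic approximation\<close>

text \<open>
  \<open>stochastic_approximation \<alpha> \<epsilon> X' d G r \<mu> x M i \<eta>\<close>: the processes \<open>i\<close> and \<open>\<eta>\<close> on \<open>M\<close> form the
  stochastic approximation with switching rate \<open>r\<close>, with \<open>i 0\<close> distributed according to \<open>\<mu>\<close> and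
  with \<open>\<eta> 0 = x\<close>. Consecutive jump times bound the maximal intervals on which \<open>i\<close> is constant, so
  concatenating the solutions means being continuous and solving the inclusion of the current state
  on the closure of each bounded interval \<open>{a..<b}\<close> on which \<open>i\<close> is constant.
\<close>

definition stochastic_approximation ::
  "real \<Rightarrow> real \<Rightarrow> (real^'n) set \<Rightarrow> real^'n \<Rightarrow> real^'n^'m \<Rightarrow> real \<Rightarrow> 2 pmf \<Rightarrow> real^'n \<Rightarrow>
   'w measure \<Rightarrow> (real \<Rightarrow> 'w \<Rightarrow> 2) \<Rightarrow> (real \<Rightarrow> 'w \<Rightarrow> real^'n) \<Rightarrow> bool" where
  "stochastic_approximation \<alpha> \<epsilon> X' d G r \<mu> x M i \<eta> \<longleftrightarrow>
    markov_chain (switch_rates r) M i \<and>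
    distr M (count_space UNIV) (i 0) = measure_pmf \<mu> \<and>
    (\<forall>t\<ge>0. \<eta> t \<in> borel_measurable M) \<and>
    (AE \<omega> in M.
       right_continuous_path (\<lambda>t. i t \<omega>) \<and>
       \<eta> 0 \<omega> = x \<and>
       continuous_on {0..} (\<lambda>t. \<eta> t \<omega>) \<and>
       (\<forall>a b. 0 \<le> a \<longrightarrow> a < b \<longrightarrow> (\<forall>s\<in>{a..<b}. i s \<omega> = i a \<omega>) \<longrightarrow>
          solves_inclusion (drift \<alpha> \<epsilon> X' d G (i a \<omega>)) a b (\<lambda>t. \<eta> t \<omega>)))"

text \<open>
  Here \<open>M\<close>, \<open>i\<close> and \<open>\<eta>\<close> are families indexed by the distribution of the initial state of the switching
  process and by the initial value of \<open>\<eta>\<close>. The transition kernel is read off from the members with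
  a deterministic initial state.
\<close>

definition transition_kernel ::
  "(2 pmf \<Rightarrow> 'a \<Rightarrow> 'w measure) \<Rightarrow> (2 pmf \<Rightarrow> 'a \<Rightarrow> real \<Rightarrow> 'w \<Rightarrow> 2) \<Rightarrow>
   (2 pmf \<Rightarrow> 'a \<Rightarrow> real \<Rightarrow> 'w \<Rightarrow> 'a::topological_space) \<Rightarrow> real \<Rightarrow> 2 \<times> 'a \<Rightarrow> (2 \<times> 'a) measure" where
  "transition_kernel M i \<eta> t z =
    (let \<mu> = return_pmf (fst z); x = snd z
     in distr (M \<mu> x) (count_space UNIV \<Otimes>\<^sub>M borel) (\<lambda>\<omega>. (i \<mu> x t \<omega>, \<eta> \<mu> x t \<omega>)))"

definition invariant_measure ::
  "(real \<Rightarrow> 2 \<times> 'a \<Rightarrow> (2 \<times> 'a::topological_space) measure) \<Rightarrow> (2 \<times> 'a) measure \<Rightarrow> bool" where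
  "invariant_measure K \<nu> \<longleftrightarrow>
    prob_space \<nu> \<and> sets \<nu> = sets (count_space UNIV \<Otimes>\<^sub>M borel) \<and>
    (\<forall>t\<ge>0. \<forall>A\<in>sets \<nu>. emeasure \<nu> A = (\<integral>\<^sup>+z. emeasure (K t z) A \<partial>\<nu>))"

definition stationary_measure ::
  "(real \<Rightarrow> 2 \<times> 'a \<Rightarrow> (2 \<times> 'a::topological_space) measure) \<Rightarrow> 'a measure \<Rightarrow> bool" where
  "stationary_measure K \<pi> \<longleftrightarrow> (\<exists>\<nu>. invariant_measure K \<nu> \<and> \<pi> = distr \<nu> borel snd)"


section \<open>The Wasserstein distance\<close>

definition couplings :: "'a::topological_space measure \<Rightarrow> 'a measure \<Rightarrow> ('a \<times> 'a) measure set" where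
  "couplings \<pi> \<pi>' = {\<Gamma>. prob_space \<Gamma> \<and> sets \<Gamma> = sets (borel \<Otimes>\<^sub>M borel) \<and>
     distr \<Gamma> borel fst = \<pi> \<and> distr \<Gamma> borel snd = \<pi>'}"

definition wasserstein :: "real \<Rightarrow> 'a::real_normed_vector measure \<Rightarrow> 'a measure \<Rightarrow> real" where
  "wasserstein p \<pi> \<pi>' =
    (INF \<Gamma>\<in>couplings \<pi> \<pi>'. \<integral>z. min 1 (norm (fst z - snd z) powr p) \<partial>\<Gamma>)"

end

theory Submission
  imports Defs
begin

text \<open>
  The linear flow contracts distances at rate \<open>\<mu>_min\<close>, whereas the double-well flow, being one-sided
  Lipschitz, expands them at most at rate \<open>1 / \<epsilon> < \<mu>_min\<close>. The switching process spends half of its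
  time in each state in the long run, so two solutions along the same switching path approach each
  other exponentially fast, in the sense that small moments of the growth factor decay. Two copies
  of the switching process are coupled by letting both refresh their state at the same exponential
  time. Reversing the stationary switching process in time turns the solution started at the
  origin into an almost surely convergent pullback sequence, whose limit has the stationary law.
  Everything is transported to the space of switching paths by approximating the solution by
  compositions of the two flows over equidistant grids. The two flows themselves are obtained from
  the process: with positive probability there is no jump during a given time interval.
\<close>

section \<open>Absolutely continuous functions and differential inclusions\<close>

text \<open>Every pair of an initial law and an initial value comes with its own probability space,
  so two solutions cannot be coupled where they are given; only the law of the switching path is
  common to them. Path space in turn carries the product sigma-algebra, in which right-continuity is
  not an event. Hence the solution is rebuilt there from countably many evaluations of the path, and
  an almost sure property is transferred only in the form of a measurable event, such as the Cauchy
  property of the grid approximations. The long-run growth rate, half of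
  \<open>1 / \<epsilon> - \<mu>_min\<close>, is negative, but the mean of the growth factor itself
  may increase when switching is slow. Only moments of a small order q need decay, and the
  truncation at 1 in the Wasserstein cost is what allows p to be replaced by such a q. The Markov
  property of the pair of state and position is not part of the hypotheses. It holds exactly for the
  grid approximations, where it is a finite computation with sampled states, and passes to the limit
  for bounded Lipschitz functions.\<close>

lemma abs_cont_onE:
  assumes "abs_cont_on I f" "e > 0"
  obtains \<delta> where "\<delta> > 0" "\<And>D :: (real \<times> real) set.
       finite D \<Longrightarrow> \<forall>(u,v)\<in>D. u < v \<and> {u..v} \<subseteq> I \<Longrightarrow>
       pairwise (\<lambda>p q. disjnt {fst p<..<snd p} {fst q<..<snd q}) D \<Longrightarrow>
       (\<Sum>(u,v)\<in>D. v - u) < \<delta> \<Longrightarrow> (\<Sum>(u,v)\<in>D. norm (f v - f u)) < e"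
  using assms unfolding abs_cont_on_def by (elim allE[of _ e]) (erule impE, assumption, elim exE conjE, simp)

text \<open>The absolute continuity claims below reduce to this criterion: an inner product with a
  fixed vector and an exponentially weighted square have increments bounded by those of given
  absolutely continuous curves and by the length of the interval.\<close>

lemma abs_cont_on_dominated:
  fixes f :: "real \<Rightarrow> 'a::real_normed_vector" and f' :: "real \<Rightarrow> 'b::real_normed_vector"
    and g :: "real \<Rightarrow> 'c::real_normed_vector"
  assumes f: "abs_cont_on I f" and f': "abs_cont_on I' f'" and C: "C \<ge> 0"
    and J: "J \<subseteq> I" "J \<subseteq> I'"
    and dom: "\<And>u v. u \<in> J \<Longrightarrow> v \<in> J \<Longrightarrow> u < v \<Longrightarrow>
      norm (g v - g u) \<le> C * (norm (f v - f u) + norm (f' v - f' u) + (v - u))"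
  shows "abs_cont_on J g"
  unfolding abs_cont_on_def
proof (intro allI impI)
  fix e :: real assume e: "e > 0"
  \<comment> \<open>Three sums contribute at most \<open>e'\<close> each; \<open>C + 1\<close>
    instead of C avoids division by zero and leaves the final inequality strict.\<close>
  define e' where "e' = e / (3 * (C + 1))"
  have e': "e' > 0" using e C by (simp add: e'_def)
  obtain \<delta>1 where \<delta>1: "\<delta>1 > 0" "\<And>D :: (real \<times> real) set.
       finite D \<Longrightarrow> \<forall>(u,v)\<in>D. u < v \<and> {u..v} \<subseteq> I \<Longrightarrow>
       pairwise (\<lambda>p q. disjnt {fst p<..<snd p} {fst q<..<snd q}) D \<Longrightarrow>
       (\<Sum>(u,v)\<in>D. v - u) < \<delta>1 \<Longrightarrow> (\<Sum>(u,v)\<in>D. norm (f v - f u)) < e'"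
    using abs_cont_onE[OF f e'] by blast
  obtain \<delta>2 where \<delta>2: "\<delta>2 > 0" "\<And>D :: (real \<times> real) set.
       finite D \<Longrightarrow> \<forall>(u,v)\<in>D. u < v \<and> {u..v} \<subseteq> I' \<Longrightarrow>
       pairwise (\<lambda>p q. disjnt {fst p<..<snd p} {fst q<..<snd q}) D \<Longrightarrow>
       (\<Sum>(u,v)\<in>D. v - u) < \<delta>2 \<Longrightarrow> (\<Sum>(u,v)\<in>D. norm (f' v - f' u)) < e'"
    using abs_cont_onE[OF f' e'] by blast
  show "\<exists>\<delta>>0. \<forall>D :: (real \<times> real) set.
       finite D \<longrightarrow> (\<forall>(u,v)\<in>D. u < v \<and> {u..v} \<subseteq> J) \<longrightarrow>
       pairwise (\<lambda>p q. disjnt {fst p<..<snd p} {fst q<..<snd q}) D \<longrightarrow>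
       (\<Sum>(u,v)\<in>D. v - u) < \<delta> \<longrightarrow> (\<Sum>(u,v)\<in>D. norm (g v - g u)) < e"
  proof (intro exI conjI allI impI)
    show "min (min \<delta>1 \<delta>2) e' > 0" using \<delta>1 \<delta>2 e' by simp
    fix D :: "(real \<times> real) set"
    assume D: "finite D" "\<forall>(u,v)\<in>D. u < v \<and> {u..v} \<subseteq> J"
      "pairwise (\<lambda>p q. disjnt {fst p<..<snd p} {fst q<..<snd q}) D"
      "(\<Sum>(u,v)\<in>D. v - u) < min (min \<delta>1 \<delta>2) e'"
    have DI: "\<forall>(u,v)\<in>D. u < v \<and> {u..v} \<subseteq> I" "\<forall>(u,v)\<in>D. u < v \<and> {u..v} \<subseteq> I'"
      using D(2) J by blast+
    have "(\<Sum>(u,v)\<in>D. norm (g v - g u)) \<le>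
        (\<Sum>(u,v)\<in>D. C * (norm (f v - f u) + norm (f' v - f' u) + (v - u)))"
    proof (rule sum_mono, clarify)
      fix u v assume "(u, v) \<in> D"
      then have "u < v" "{u..v} \<subseteq> J" using D(2) by auto
      then show "norm (g v - g u) \<le> C * (norm (f v - f u) + norm (f' v - f' u) + (v - u))"
        by (intro dom) auto
    qed
    also have "\<dots> = C * ((\<Sum>(u,v)\<in>D. norm (f v - f u)) + (\<Sum>(u,v)\<in>D. norm (f' v - f' u)) + (\<Sum>(u,v)\<in>D. v - u))"
      by (simp add: sum_distrib_left[symmetric] sum.distrib split_beta)
    also have "\<dots> \<le> C * (e' + e' + e')"
      using \<delta>1(2)[OF D(1) DI(1) D(3)] \<delta>2(2)[OF D(1) DI(2) D(3)] D(4) C by (intro mult_left_mono add_mono) auto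
    also have "\<dots> < e"
    proof -
      have "3 * (C + 1) * e' = e" using C by (simp add: e'_def)
      moreover have "3 * C * e' < 3 * (C + 1) * e'" using e' by simp
      ultimately show ?thesis by (simp add: algebra_simps)
    qed
    finally show "(\<Sum>(u,v)\<in>D. norm (g v - g u)) < e" .
  qed
qed

lemma abs_cont_on_subset: "abs_cont_on I f \<Longrightarrow> J \<subseteq> I \<Longrightarrow> abs_cont_on J f"
  by (rule abs_cont_on_dominated[of I f I f 1]) auto

text \<open>Openness matters: in \<open>abs_cont_deriv_le\<close> the cover itself serves as the
  gauge at exceptional points, and its small measure limits the total length of the cells tagged
  there. Outer regularity is applied to a measurable null set containing the exceptional
  points.\<close>

lemma AE_lborel_open_cover:
  assumes "AE t in (lborel :: real measure). P t" "0 < (e :: real)"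
  obtains U where "open U" "{t. \<not> P t} \<subseteq> U" "emeasure lborel U < ennreal e"
proof -
  from assms(1) obtain N where N: "N \<in> null_sets lborel" "{t. \<not> P t} \<subseteq> N"
    by (auto elim!: AE_E simp: null_sets_def)
  have "N \<in> sets borel" using N(1) by (auto simp: null_sets_def)
  then obtain U where U: "open U" "N \<subseteq> U" "emeasure lborel (U - N) < ennreal e"
    using outer_regular_lborel[of N "e"] assms(2) by auto
  have "emeasure lborel (U - N) = emeasure lborel U"
    using U(1) N(1) by (intro emeasure_Diff_null_set) auto
  with U N that show ?thesis by (metis order_trans)
qed

text \<open>Splitting the increment at t, each half is controlled by differentiability at t alone,
  so one radius serves all small intervals containing t, wherever their end points lie.\<close>

lemma deriv_straddle:
  fixes g :: "real \<Rightarrow> real"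
  assumes "(g has_real_derivative v) (at t)" "e > 0"
  obtains d where "d > 0" "\<And>p q. p \<in> ball t d \<Longrightarrow> q \<in> ball t d \<Longrightarrow> p \<le> t \<Longrightarrow> t \<le> q \<Longrightarrow>
    g q - g p \<le> (v + e) * (q - p)"
proof -
  from assms obtain d where d: "d > 0"
    "\<And>y. norm (y - t) < d \<Longrightarrow> norm (g y - g t - v * (y - t)) \<le> e * norm (y - t)"
    unfolding has_field_derivative_def has_derivative_at_alt by (metis)
  show ?thesis
  proof (rule that[OF d(1)])
    fix p q assume pq: "p \<in> ball t d" "q \<in> ball t d" "p \<le> t" "t \<le> q"
    have "g q - g t - v * (q - t) \<le> e * (q - t)"
      using d(2)[of q] pq by (auto simp: dist_real_def)
    moreover have "- (g p - g t - v * (p - t)) \<le> e * (t - p)"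
      using d(2)[of p] pq by (auto simp: dist_real_def)
    ultimately show "g q - g p \<le> (v + e) * (q - p)" by (simp add: algebra_simps)
  qed
qed

text \<open>A gauge argument. In a fine tagged division, cells with a good tag obey the straddle
  estimate. Cells with a bad tag lie in an open set of small measure, so absolute continuity makes
  their total increment small.\<close>

lemma abs_cont_deriv_le:
  fixes g :: "real \<Rightarrow> real"
  assumes ab: "a \<le> b" and ac: "abs_cont_on {a..b} g"
    and der: "AE t in lborel. a < t \<and> t < b \<longrightarrow> (\<exists>v. v \<le> L \<and> (g has_real_derivative v) (at t))"
  shows "g b - g a \<le> L * (b - a)"
proof (rule field_le_epsilon)
  fix e0 :: real assume e0: "e0 > 0"
  \<comment> \<open>The error consists of \<open>e * (b - a)\<close> from the slopes, e from the
    increments over bad cells and \<open>\<bar>L\<bar> * e\<close> from the length of the bad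
    cells.\<close>
  define e where "e = e0 / (b - a + 1 + \<bar>L\<bar>)"
  have e: "e > 0" using e0 ab by (simp add: e_def add_nonneg_pos add_pos_nonneg)
  obtain \<delta> where \<delta>: "\<delta> > 0" "\<And>D :: (real \<times> real) set.
       finite D \<Longrightarrow> \<forall>(u,v)\<in>D. u < v \<and> {u..v} \<subseteq> {a..b} \<Longrightarrow>
       pairwise (\<lambda>p q. disjnt {fst p<..<snd p} {fst q<..<snd q}) D \<Longrightarrow>
       (\<Sum>(u,v)\<in>D. v - u) < \<delta> \<Longrightarrow> (\<Sum>(u,v)\<in>D. norm (g v - g u)) < e"
    using abs_cont_onE[OF ac e] by blast
  define good where "good t \<longleftrightarrow> (\<exists>v. v \<le> L \<and> (g has_real_derivative v) (at t))" for t
  \<comment> \<open>The end points are counted as exceptional, so that every tag outside U lies in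
    the open interval and is good.\<close>
  have AEg: "AE t in lborel. a \<noteq> t \<and> b \<noteq> t \<and> (a < t \<and> t < b \<longrightarrow> good t)"
    using der AE_lborel_singleton[of a] AE_lborel_singleton[of b] unfolding good_def by eventually_elim auto
  have "0 < min \<delta> e" using e \<delta>(1) by simp
  with AEg obtain U where U: "open U"
    "{t. \<not> (a \<noteq> t \<and> b \<noteq> t \<and> (a < t \<and> t < b \<longrightarrow> good t))} \<subseteq> U"
    "emeasure lborel U < ennreal (min \<delta> e)"
    by (rule AE_lborel_open_cover)
  have "\<exists>d>0. \<forall>p q. p \<in> ball t d \<longrightarrow> q \<in> ball t d \<longrightarrow> p \<le> t \<longrightarrow> t \<le> q \<longrightarrow>
      g q - g p \<le> (L + e) * (q - p)" if "good t" for t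
  proof -
    from that obtain v where v: "v \<le> L" "(g has_real_derivative v) (at t)" unfolding good_def by auto
    obtain d where d: "d > 0" "\<And>p q. p \<in> ball t d \<Longrightarrow> q \<in> ball t d \<Longrightarrow> p \<le> t \<Longrightarrow> t \<le> q \<Longrightarrow>
      g q - g p \<le> (v + e) * (q - p)" using deriv_straddle[OF v(2) e] by metis
    show ?thesis
    proof (intro exI[of _ d] conjI allI impI d)
      fix p q assume pq: "p \<in> ball t d" "q \<in> ball t d" "p \<le> t" "t \<le> q"
      have "(v + e) * (q - p) \<le> (L + e) * (q - p)" using v pq by (intro mult_right_mono) auto
      with d(2)[OF pq] show "g q - g p \<le> (L + e) * (q - p)" by linarith
    qed
  qed
  then obtain d where d: "\<And>t. good t \<Longrightarrow> d t > 0" "\<And>t p q. good t \<Longrightarrow> p \<in> ball t (d t) \<Longrightarrow> q \<in> ball t (d t) \<Longrightarrow>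
      p \<le> t \<Longrightarrow> t \<le> q \<Longrightarrow> g q - g p \<le> (L + e) * (q - p)"
    by metis
  \<comment> \<open>On U the gauge is U itself, which forces every cell with a tag in U to lie
    inside U.\<close>
  define \<gamma> where "\<gamma> t = (if t \<in> U then U else if good t then ball t (d t) else ball t 1)" for t
  have "gauge \<gamma>" unfolding gauge_def \<gamma>_def using U(1) d(1) by auto
  then obtain p where p: "p tagged_division_of {a..b}" "\<gamma> fine p"
    by (rule fine_division_exists_real)
  note pD = tagged_division_ofD[OF p(1)]
  have K: "\<exists>u v. K = {u..v} \<and> u \<le> v \<and> a \<le> u \<and> v \<le> b \<and> u \<le> x \<and> x \<le> v" if "(x, K) \<in> p" for x K
    using pD(2,3,4)[OF that] by (fastforce simp: box_real)
  \<comment> \<open>Degenerate cells are dropped: absolute continuity speaks of intervals with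
    distinct end points, and two different nondegenerate cells cannot share both end points, which
    makes J injective on B.\<close>
  define B where "B = {z \<in> p. fst z \<in> U \<and> Inf (snd z) < Sup (snd z)}"
  define J where "J z = (Inf (snd z), Sup (snd z))" for z :: "real \<times> real set"
  have finB: "finite B" using pD(1) by (simp add: B_def)
  have disj: "{fst (J z)<..<snd (J z)} \<inter> {fst (J z')<..<snd (J z')} = {}" if zz: "z \<in> p" "z' \<in> p" "z \<noteq> z'" for z z'
  proof -
    obtain x K x' K' where z: "z = (x, K)" "z' = (x', K')" by (cases z, cases z') auto
    obtain u v u' v' where "K = {u..v}" "u \<le> v" "K' = {u'..v'}" "u' \<le> v'"
      using K[of x K] K[of x' K'] zz(1,2) z by blast
    then show ?thesis using pD(5)[of x K x' K'] zz z by (simp add: J_def)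
  qed
  have inj: "inj_on J B"
  proof (rule inj_onI, rule ccontr)
    fix z z' assume "z \<in> B" "z' \<in> B" "J z = J z'" "z \<noteq> z'"
    then have "{fst (J z)<..<snd (J z)} = {}" using disj[of z z'] by (auto simp: B_def)
    then show False using \<open>z \<in> B\<close> by (auto simp: B_def J_def)
  qed
  have BD: "\<forall>(u,v)\<in>J ` B. u < v \<and> {u..v} \<subseteq> {a..b}"
  proof safe
    fix u v x K assume *: "(u, v) = J (x, K)" "(x, K) \<in> B"
    then obtain u' v' where "K = {u'..v'}" "u' \<le> v'" "a \<le> u'" "v' \<le> b" using K[of x K] by (auto simp: B_def)
    with * show "u < v" "\<And>y. y \<in> {u..v} \<Longrightarrow> y \<in> {a..b}" by (auto simp: J_def B_def)
  qed
  have lenB: "(\<Sum>z\<in>B. snd (J z) - fst (J z)) < min \<delta> e"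
  proof -
    have "ennreal (\<Sum>z\<in>B. snd (J z) - fst (J z)) = (\<Sum>z\<in>B. ennreal (snd (J z) - fst (J z)))"
      using BD by (intro sum_ennreal[symmetric]) (auto simp: B_def J_def)
    also have "\<dots> = (\<Sum>z\<in>B. emeasure lborel {fst (J z)<..<snd (J z)})"
      by (intro sum.cong) (auto simp: B_def J_def)
    also have "\<dots> = emeasure lborel (\<Union>z\<in>B. {fst (J z)<..<snd (J z)})"
      using disj finB by (intro sum_emeasure) (auto simp: disjoint_family_on_def B_def)
    also have "\<dots> \<le> emeasure lborel U"
    proof (rule emeasure_mono)
      show "(\<Union>z\<in>B. {fst (J z)<..<snd (J z)}) \<subseteq> U"
      proof (rule UN_least)
        fix z assume z: "z \<in> B"
        obtain x K' where xK: "z = (x, K')" by (cases z)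
        have "K' \<subseteq> U" using p(2) z xK unfolding fine_def B_def \<gamma>_def by fastforce
        moreover have "{Inf K'<..<Sup K'} \<subseteq> K'" using K[of x K'] z xK by (auto simp: B_def)
        ultimately show "{fst (J z)<..<snd (J z)} \<subseteq> U" by (simp add: J_def xK)
      qed
    qed (use U(1) in auto)
    also have "\<dots> < ennreal (min \<delta> e)" by (rule U(3))
    finally show ?thesis by (metis ennreal_less_iff ennreal_lessI linorder_not_less min_less_iff_conj e \<delta>(1) ennreal_leI)
  qed
  have sumB: "(\<Sum>z\<in>B. norm (g (snd (J z)) - g (fst (J z)))) < e"
  proof -
    have "(\<Sum>(u,v)\<in>J ` B. norm (g v - g u)) < e"
    proof (rule \<delta>(2))
      show "finite (J ` B)" using finB by simp
      show "pairwise (\<lambda>p q. disjnt {fst p<..<snd p} {fst q<..<snd q}) (J ` B)"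
      proof (rule pairwise_imageI)
        fix z z' assume "z \<in> B" "z' \<in> B" "z \<noteq> z'" "J z \<noteq> J z'"
        then show "disjnt {fst (J z)<..<snd (J z)} {fst (J z')<..<snd (J z')}"
          using disj[of z z'] by (simp add: disjnt_def B_def)
      qed
      show "(\<Sum>(u,v)\<in>J ` B. v - u) < \<delta>"
        using lenB by (simp add: sum.reindex[OF inj] split_beta)
    qed (rule BD)
    then show ?thesis by (simp add: sum.reindex[OF inj] split_beta)
  qed
  have "g b - g a = (\<Sum>z\<in>p. g (Sup (snd z)) - g (Inf (snd z)))"
    using additive_tagged_division_1[OF ab p(1), of g] by (simp add: split_beta)
  \<comment> \<open>On a bad cell \<open>(L + e) * length\<close> may be negative; the term with
    \<open>\<bar>L\<bar>\<close> compensates for it.\<close>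
  also have "\<dots> \<le> (\<Sum>z\<in>p. (L + e) * (Sup (snd z) - Inf (snd z)) + (if z \<in> B then
      norm (g (snd (J z)) - g (fst (J z))) + \<bar>L\<bar> * (snd (J z) - fst (J z)) else 0))"
  proof (rule sum_mono)
    fix z assume z: "z \<in> p"
    obtain x K' where xK: "z = (x, K')" by (cases z)
    obtain u v where uv: "K' = {u..v}" "u \<le> v" "a \<le> u" "v \<le> b" "u \<le> x" "x \<le> v" using K[of x K'] z xK by blast
    show "g (Sup (snd z)) - g (Inf (snd z)) \<le> (L + e) * (Sup (snd z) - Inf (snd z)) + (if z \<in> B then
      norm (g (snd (J z)) - g (fst (J z))) + \<bar>L\<bar> * (snd (J z) - fst (J z)) else 0)"
    proof (cases "x \<in> U")
      case True
      show ?thesis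
      proof (cases "u < v")
        case T: True
        have "z \<in> B" using True T z uv xK by (simp add: B_def)
        moreover have "0 \<le> (L + e) * (v - u) + \<bar>L\<bar> * (v - u)"
          using e T by (simp add: distrib_right[symmetric])
        moreover have "g v - g u \<le> norm (g v - g u)" by simp
        ultimately show ?thesis using uv xK by (simp add: J_def)
      next
        case False
        then show ?thesis using uv xK True by (simp add: B_def)
      qed
    next
      case False
      then have "z \<notin> B" by (simp add: B_def xK)
      have "a \<noteq> x \<and> b \<noteq> x \<and> (a < x \<and> x < b \<longrightarrow> good x)" using False U(2) by blast
      then have x: "a < x" "x < b" "good x" using uv by auto
      have "K' \<subseteq> ball x (d x)" using p(2) z xK x False unfolding fine_def \<gamma>_def by fastforce
      moreover have "u \<in> K'" "v \<in> K'" using uv by auto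
      ultimately have "u \<in> ball x (d x)" "v \<in> ball x (d x)" by blast+
      then have "g v - g u \<le> (L + e) * (v - u)" using uv x by (intro d(2)[of x]) auto
      then show ?thesis using uv xK \<open>z \<notin> B\<close> by simp
    qed
  qed
  also have "\<dots> = (L + e) * (\<Sum>z\<in>p. (Sup (snd z) - Inf (snd z))) +
      ((\<Sum>z\<in>B. norm (g (snd (J z)) - g (fst (J z)))) + \<bar>L\<bar> * (\<Sum>z\<in>B. snd (J z) - fst (J z)))"
  proof -
    have "(\<Sum>z\<in>p. if z \<in> B then h z else 0) = (\<Sum>z\<in>B. h z)" for h :: "_ \<Rightarrow> real"
      by (rule sum.mono_neutral_cong_right) (use pD(1) in \<open>auto simp: B_def\<close>)
    then show ?thesis by (simp add: sum.distrib sum_distrib_left)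
  qed
  also have "(\<Sum>z\<in>p. (Sup (snd z) - Inf (snd z))) = b - a"
    using additive_tagged_division_1[OF ab p(1), of "\<lambda>x. x"] by (simp add: split_beta)
  also have "(L + e) * (b - a) + ((\<Sum>z\<in>B. norm (g (snd (J z)) - g (fst (J z)))) + \<bar>L\<bar> * (\<Sum>z\<in>B. snd (J z) - fst (J z)))
     \<le> (L + e) * (b - a) + (e + \<bar>L\<bar> * e)"
    using sumB lenB by (intro add_mono order_refl mult_left_mono) auto
  also have "\<dots> = L * (b - a) + e * (b - a + 1 + \<bar>L\<bar>)" by (simp add: algebra_simps)
  also have "e * (b - a + 1 + \<bar>L\<bar>) = e0" using ab by (simp add: e_def)
  finally show "g b - g a \<le> L * (b - a) + e0" .
qed

text \<open>The squared distance weighted by \<open>exp (- 2 * c * (t - a))\<close> is absolutely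
  continuous with nonpositive derivative almost everywhere. The estimate holds for whichever
  velocities the inclusions select. Two right-hand sides are allowed so that a solution can also be
  compared with the constant curve 0.\<close>

lemma solves_inclusion_gronwall:
  fixes f f' :: "real \<Rightarrow> 'a::real_inner"
  assumes ab: "a \<le> b" and f: "solves_inclusion F a b f" and f': "solves_inclusion F' a b f'"
    and mono: "\<And>t v v'. a < t \<Longrightarrow> t < b \<Longrightarrow> v \<in> F (f t) \<Longrightarrow> v' \<in> F' (f' t) \<Longrightarrow>
      (v - v') \<bullet> (f t - f' t) \<le> c * (norm (f t - f' t))\<^sup>2"
    and cont: "continuous_on {a..b} f" "continuous_on {a..b} f'"
  shows "norm (f b - f' b) \<le> exp (c * (b - a)) * norm (f a - f' a)"
proof -
  define u where "u s = f s - f' s" for s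
  define g where "g s = exp (- 2 * c * (s - a)) * (u s \<bullet> u s)" for s
  have contu: "continuous_on {a..b} u" unfolding u_def by (intro continuous_intros cont)
  have "compact (u ` {a..b})" by (intro compact_continuous_image contu) auto
  then obtain B where B: "B > 0" "\<And>s. s \<in> {a..b} \<Longrightarrow> norm (u s) \<le> B"
    by (force simp: bounded_pos dest: compact_imp_bounded)
  define E where "E = exp (2 * \<bar>c\<bar> * (b - a))"
  have E: "exp (- 2 * c * (s - a)) \<le> E" if "s \<in> {a..b}" for s
  proof -
    have "- 2 * c * (s - a) \<le> 2 * \<bar>c\<bar> * (s - a)" using that by (intro mult_right_mono) auto
    also have "\<dots> \<le> 2 * \<bar>c\<bar> * (b - a)" using that by (intro mult_left_mono) auto
    finally show ?thesis by (simp add: E_def)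
  qed
  have E0: "E > 0" by (simp add: E_def)
  have ac: "abs_cont_on {a..b} g"
  proof (rule abs_cont_on_dominated)
    show "abs_cont_on {a..b} f" "abs_cont_on {a..b} f'"
      using f f' by (auto simp: solves_inclusion_def)
    show "0 \<le> E * 2 * B + 2 * \<bar>c\<bar> * E * B\<^sup>2" using E0 B by (intro add_nonneg_nonneg mult_nonneg_nonneg) auto
    fix p q assume pq: "p \<in> {a..b}" "q \<in> {a..b}" "p < q"
    let ?e = "\<lambda>s. exp (- 2 * c * (s - a))"
    have 1: "\<bar>?e q - ?e p\<bar> \<le> 2 * \<bar>c\<bar> * E * (q - p)"
    proof -
      obtain z where z: "z > p" "z < q" "?e q - ?e p = (q - p) * (?e z * (- 2 * c))"
      proof -
        have "DERIV ?e x :> ?e x * (- 2 * c)" for x by (auto intro!: derivative_eq_intros)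
        then have "\<exists>z>p. z < q \<and> ?e q - ?e p = (q - p) * (?e z * (- 2 * c))"
          using pq(3) by (intro MVT2) auto
        with that show thesis by blast
      qed
      have "\<bar>?e q - ?e p\<bar> = (q - p) * ?e z * (2 * \<bar>c\<bar>)"
        unfolding z(3) using pq by (simp add: abs_mult)
      also have "\<dots> \<le> (q - p) * E * (2 * \<bar>c\<bar>)"
        using pq z E[of z] by (intro mult_right_mono mult_left_mono) auto
      finally show ?thesis by (simp add: algebra_simps)
    qed
    have 2: "\<bar>u q \<bullet> u q - u p \<bullet> u p\<bar> \<le> 2 * B * (norm (f q - f p) + norm (f' q - f' p))"
    proof -
      have "u q \<bullet> u q - u p \<bullet> u p = (u q - u p) \<bullet> (u q + u p)"
        by (simp add: inner_diff_left inner_diff_right inner_add_right inner_add_left inner_commute)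
      also have "\<bar>\<dots>\<bar> \<le> norm (u q - u p) * norm (u q + u p)" by (rule Cauchy_Schwarz_ineq2)
      also have "\<dots> \<le> (norm (f q - f p) + norm (f' q - f' p)) * (B + B)"
      proof (intro mult_mono)
        have "u q - u p = (f q - f p) - (f' q - f' p)" by (simp add: u_def)
        then show "norm (u q - u p) \<le> norm (f q - f p) + norm (f' q - f' p)" by (metis norm_triangle_ineq4)
        show "norm (u q + u p) \<le> B + B" using B(2)[OF pq(1)] B(2)[OF pq(2)] by norm
      qed auto
      finally show ?thesis by (simp add: algebra_simps)
    qed
    have "g q - g p = ?e q * (u q \<bullet> u q - u p \<bullet> u p) + (?e q - ?e p) * (u p \<bullet> u p)"
      by (simp add: g_def algebra_simps)
    also have "norm \<dots> \<le> E * (2 * B * (norm (f q - f p) + norm (f' q - f' p))) + (2 * \<bar>c\<bar> * E * (q - p)) * B\<^sup>2"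
    proof (rule order_trans[OF norm_triangle_ineq], rule add_mono)
      show "norm (?e q * (u q \<bullet> u q - u p \<bullet> u p)) \<le> E * (2 * B * (norm (f q - f p) + norm (f' q - f' p)))"
        using E[OF pq(2)] 2 by (simp add: abs_mult) (intro mult_mono, auto simp: E_def)
      show "norm ((?e q - ?e p) * (u p \<bullet> u p)) \<le> 2 * \<bar>c\<bar> * E * (q - p) * B\<^sup>2"
        using 1 B pq(1) E0 pq by (simp add: abs_mult power2_norm_eq_inner[symmetric])
          (intro mult_mono power_mono, auto)
    qed
    also have "\<dots> \<le> (E * 2 * B + 2 * \<bar>c\<bar> * E * B\<^sup>2) * (norm (f q - f p) + norm (f' q - f' p)) +
       (E * 2 * B + 2 * \<bar>c\<bar> * E * B\<^sup>2) * (q - p)"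
    proof (rule add_mono)
      show "E * (2 * B * (norm (f q - f p) + norm (f' q - f' p))) \<le>
        (E * 2 * B + 2 * \<bar>c\<bar> * E * B\<^sup>2) * (norm (f q - f p) + norm (f' q - f' p))"
        unfolding mult.assoc[symmetric] by (rule mult_right_mono) (use E0 B in auto)
      have "2 * \<bar>c\<bar> * E * (q - p) * B\<^sup>2 = 2 * \<bar>c\<bar> * E * B\<^sup>2 * (q - p)" by simp
      also have "\<dots> \<le> (E * 2 * B + 2 * \<bar>c\<bar> * E * B\<^sup>2) * (q - p)"
        by (rule mult_right_mono) (use E0 B pq in auto)
      finally show "2 * \<bar>c\<bar> * E * (q - p) * B\<^sup>2 \<le> (E * 2 * B + 2 * \<bar>c\<bar> * E * B\<^sup>2) * (q - p)" .
    qed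
    also have "\<dots> = (E * 2 * B + 2 * \<bar>c\<bar> * E * B\<^sup>2) * (norm (f q - f p) + norm (f' q - f' p) + (q - p))"
      by (simp add: algebra_simps)
    finally show "norm (g q - g p) \<le>
      (E * 2 * B + 2 * \<bar>c\<bar> * E * B\<^sup>2) * (norm (f q - f p) + norm (f' q - f' p) + (q - p))" .
  qed auto
  have "g b - g a \<le> 0 * (b - a)"
  proof (rule abs_cont_deriv_le[OF ab ac])
    have "AE t in lborel. a < t \<and> t < b \<longrightarrow> (\<exists>v\<in>F (f t). (f has_vector_derivative v) (at t))"
      "AE t in lborel. a < t \<and> t < b \<longrightarrow> (\<exists>v\<in>F' (f' t). (f' has_vector_derivative v) (at t))"
      using f f' by (auto simp: solves_inclusion_def)
    then show "AE t in lborel. a < t \<and> t < b \<longrightarrow> (\<exists>v\<le>0. (g has_real_derivative v) (at t))"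
    proof (eventually_elim, safe)
      fix t v v' assume t: "a < t" "t < b" and v: "v \<in> F (f t)" "v' \<in> F' (f' t)"
        and d: "(f has_vector_derivative v) (at t)" "(f' has_vector_derivative v') (at t)"
      have du: "(u has_vector_derivative (v - v')) (at t)"
        unfolding u_def by (intro has_vector_derivative_diff d)
      have "((\<lambda>s. u s \<bullet> u s) has_vector_derivative (u t \<bullet> (v - v') + (v - v') \<bullet> u t)) (at t)"
        by (rule bounded_bilinear.has_vector_derivative[OF bounded_bilinear_inner du du])
      then have d2: "((\<lambda>s. u s \<bullet> u s) has_real_derivative (2 * ((v - v') \<bullet> u t))) (at t)"
        by (simp add: has_real_derivative_iff_has_vector_derivative inner_commute)
      let ?D = "exp (- 2 * c * (t - a)) * (- 2 * c) * (u t \<bullet> u t) + exp (- 2 * c * (t - a)) * (2 * ((v - v') \<bullet> u t))"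
      have "(g has_real_derivative ?D) (at t)"
        unfolding g_def by (auto intro!: derivative_eq_intros d2)
      moreover have "?D \<le> 0"
      proof -
        have "?D = 2 * exp (- 2 * c * (t - a)) * ((v - v') \<bullet> u t - c * (norm (u t))\<^sup>2)"
          by (simp add: power2_norm_eq_inner algebra_simps)
        then show ?thesis using mono[OF t v] by (simp add: u_def mult_nonneg_nonpos)
      qed
      ultimately show "\<exists>v\<le>0. (g has_real_derivative v) (at t)" by blast
    qed
  qed
  then have "exp (- 2 * c * (b - a)) * (norm (u b))\<^sup>2 \<le> (norm (u a))\<^sup>2"
    by (simp add: g_def power2_norm_eq_inner)
  then have "(exp (- c * (b - a)) * norm (u b))\<^sup>2 \<le> (norm (u a))\<^sup>2"
    by (simp add: power_mult_distrib power2_eq_square exp_add[symmetric] algebra_simps)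
  then have "exp (- c * (b - a)) * norm (u b) \<le> norm (u a)" by (rule power2_le_imp_le) simp
  then have "exp (c * (b - a)) * (exp (- c * (b - a)) * norm (u b)) \<le> exp (c * (b - a)) * norm (u a)"
    by (intro mult_left_mono) auto
  then show ?thesis by (simp add: u_def mult.assoc[symmetric] exp_add[symmetric])
qed

text \<open>Pairing the curve with the unit vector in the direction of its total increment reduces
  the claim to the real-valued \<open>abs_cont_deriv_le\<close>, without a loss in the constant. If
  the increment vanishes, \<open>sgn\<close> gives 0.\<close>

lemma solves_inclusion_lipschitz:
  fixes f :: "real \<Rightarrow> 'a::real_inner"
  assumes ab: "a \<le> b" and f: "solves_inclusion F a b f"
    and bd: "\<And>t v. a < t \<Longrightarrow> t < b \<Longrightarrow> v \<in> F (f t) \<Longrightarrow> norm v \<le> C"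
  shows "norm (f b - f a) \<le> C * (b - a)"
proof -
  define e where "e = sgn (f b - f a)"
  have e1: "norm e \<le> 1" by (simp add: e_def norm_sgn)
  have "(f b \<bullet> e) - (f a \<bullet> e) \<le> C * (b - a)"
  proof (rule abs_cont_deriv_le[OF ab])
    have ac: "abs_cont_on {a..b} f" using f by (simp add: solves_inclusion_def)
    show "abs_cont_on {a..b} (\<lambda>t. f t \<bullet> e)"
    proof (rule abs_cont_on_dominated[OF ac ac, of 1])
      fix u v :: real assume "u < v"
      have "\<bar>(f v - f u) \<bullet> e\<bar> \<le> norm (f v - f u) * norm e" by (rule Cauchy_Schwarz_ineq2)
      also have "\<dots> \<le> norm (f v - f u)" using e1 by (simp add: mult_left_le)
      finally show "norm (f v \<bullet> e - f u \<bullet> e) \<le> 1 * (norm (f v - f u) + norm (f v - f u) + (v - u))"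
        using \<open>u < v\<close> by (simp add: inner_diff_left)
    qed auto
    have "AE t in lborel. a < t \<and> t < b \<longrightarrow> (\<exists>v\<in>F (f t). (f has_vector_derivative v) (at t))"
      using f by (simp add: solves_inclusion_def)
    then show "AE t in lborel. a < t \<and> t < b \<longrightarrow> (\<exists>v\<le>C. ((\<lambda>t. f t \<bullet> e) has_real_derivative v) (at t))"
    proof (eventually_elim, safe)
      fix t v assume t: "a < t" "t < b" and v: "v \<in> F (f t)" and d: "(f has_vector_derivative v) (at t)"
      have "((\<lambda>t. f t \<bullet> e) has_real_derivative (v \<bullet> e)) (at t)"
        unfolding has_real_derivative_iff_has_vector_derivative
        by (rule bounded_linear.has_vector_derivative[OF bounded_linear_inner_left d])
      moreover have "v \<bullet> e \<le> C"
      proof -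
        have "v \<bullet> e \<le> norm v * norm e" by (rule norm_cauchy_schwarz)
        also have "\<dots> \<le> norm v" using e1 by (simp add: mult_left_le)
        finally show ?thesis using bd[OF t v] by simp
      qed
      ultimately show "\<exists>v\<le>C. ((\<lambda>t. f t \<bullet> e) has_real_derivative v) (at t)" by blast
    qed
  qed
  moreover have "(f b \<bullet> e) - (f a \<bullet> e) = norm (f b - f a)"
  proof -
    have "(f b \<bullet> e) - (f a \<bullet> e) = (f b - f a) \<bullet> e" by (simp add: inner_diff_left)
    also have "\<dots> = inverse (norm (f b - f a)) * (norm (f b - f a))\<^sup>2"
      unfolding e_def sgn_div_norm inner_scaleR_right power2_norm_eq_inner ..
    also have "\<dots> = norm (f b - f a)" by (cases "f b = f a") (simp_all add: power2_eq_square)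
    finally show ?thesis .
  qed
  ultimately show ?thesis by simp
qed

lemma solves_inclusion_subinterval:
  assumes "solves_inclusion F a b f" "a \<le> a'" "b' \<le> b"
  shows "solves_inclusion F a' b' f"
  using assms unfolding solves_inclusion_def
  by (auto intro: abs_cont_on_subset elim!: eventually_mono)

lemma abs_cont_on_imp_continuous_on:
  fixes f :: "real \<Rightarrow> 'a::real_normed_vector"
  assumes "abs_cont_on {a..b} f"
  shows "continuous_on {a..b} f"
  unfolding continuous_on_iff
proof (intro ballI allI impI)
  fix x e :: real assume x: "x \<in> {a..b}" and e: "e > 0"
  obtain \<delta> where \<delta>: "\<delta> > 0" "\<And>D :: (real \<times> real) set.
       finite D \<Longrightarrow> \<forall>(u,v)\<in>D. u < v \<and> {u..v} \<subseteq> {a..b} \<Longrightarrow>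
       pairwise (\<lambda>p q. disjnt {fst p<..<snd p} {fst q<..<snd q}) D \<Longrightarrow>
       (\<Sum>(u,v)\<in>D. v - u) < \<delta> \<Longrightarrow> (\<Sum>(u,v)\<in>D. norm (f v - f u)) < e"
    using abs_cont_onE[OF assms e] by blast
  have *: "norm (f v - f u) < e" if "u < v" "u \<in> {a..b}" "v \<in> {a..b}" "v - u < \<delta>" for u v
    using \<delta>(2)[of "{(u, v)}"] that by (simp add: pairwise_def)
  show "\<exists>d>0. \<forall>x'\<in>{a..b}. dist x' x < d \<longrightarrow> dist (f x') (f x) < e"
  proof (intro exI[of _ \<delta>] conjI ballI impI \<delta>(1))
    fix x' assume x': "x' \<in> {a..b}" "dist x' x < \<delta>"
    then show "dist (f x') (f x) < e"
      using *[of x x'] *[of x' x] x e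
      by (cases x x' rule: linorder_cases) (auto simp: dist_norm norm_minus_commute)
  qed
qed

section \<open>The Allen--Cahn drift\<close>

text \<open>The quadratic form attains its minimum on the unit sphere, a minimizer is an
  eigenvector, and the minimum is its eigenvalue; so it is at least \<mu>.\<close>

lemma min_eigenvalue_le_quadratic_form:
  fixes A :: "real^'n^'n"
  assumes sym: "transpose A = A" and min: "is_min_eigenvalue A \<mu>"
  shows "\<mu> * (norm x)\<^sup>2 \<le> x \<bullet> (A *v x)"
proof -
  have lin: "bounded_linear (\<lambda>x. A *v x)" by (rule matrix_vector_mul_bounded_linear)
  then have lin': "linear (\<lambda>x. A *v x)" by (rule bounded_linear.linear)
  have symA: "x \<bullet> (A *v y) = y \<bullet> (A *v x)" for x y
    by (metis sym dot_lmul_matrix inner_commute transpose_matrix_vector)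
  have "continuous_on (sphere 0 1) (\<lambda>x. x \<bullet> (A *v x))"
    by (intro continuous_intros linear_continuous_on_compose[OF _ lin'])
  moreover have "compact (sphere (0::real^'n) 1)" "sphere (0::real^'n) 1 \<noteq> {}" by auto
  ultimately obtain v where v: "norm v = 1" "\<And>x. norm x = 1 \<Longrightarrow> v \<bullet> (A *v v) \<le> x \<bullet> (A *v x)"
    using continuous_attains_inf[of "sphere (0::real^'n) 1" "\<lambda>x. x \<bullet> (A *v x)"] by auto
  define l where "l = v \<bullet> (A *v v)"
  have lower: "l * (norm x)\<^sup>2 \<le> x \<bullet> (A *v x)" for x
  proof (cases "x = 0")
    case False
    have "l \<le> (x /\<^sub>R norm x) \<bullet> (A *v (x /\<^sub>R norm x))"
      unfolding l_def using False by (intro v(2)) simp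
    also have "\<dots> = (x \<bullet> (A *v x)) / (norm x)\<^sup>2"
      by (simp add: linear_scale[OF lin'] power2_eq_square divide_inverse)
    finally show ?thesis using False by (simp add: pos_le_divide_eq)
  qed simp
  define B where "B x = A *v x - l *\<^sub>R x" for x
  have "B v = 0"
  proof (rule ccontr)
    assume "B v \<noteq> 0"
    define y where "y = B v"
    define \<beta> where "\<beta> = y \<bullet> y"
    have \<beta>: "\<beta> > 0" using \<open>B v \<noteq> 0\<close> by (simp add: \<beta>_def y_def)
    define \<gamma> where "\<gamma> = y \<bullet> B y"
    \<comment> \<open>Moving from v against \<open>B v\<close> by s changes the nonnegative form of
      B by \<open>s * (s * \<gamma> - 2 * \<beta>)\<close>; this s gives
      \<open>s * \<gamma> \<le> \<beta>\<close>, so the linear decrease wins, a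
      contradiction.\<close>
    define s where "s = \<beta> / (\<bar>\<gamma>\<bar> + 1)"
    have s: "s > 0" using \<beta> by (simp add: s_def add_nonneg_pos)
    have "0 \<le> (v - s *\<^sub>R y) \<bullet> B (v - s *\<^sub>R y)"
      using lower[of "v - s *\<^sub>R y"] by (simp add: B_def inner_diff_right dot_square_norm)
    also have "\<dots> = v \<bullet> B v - s * (y \<bullet> B v) - s * (v \<bullet> B y) + s * s * (y \<bullet> B y)"
      by (simp add: B_def linear_diff[OF lin'] linear_scale[OF lin']
          inner_diff_left inner_diff_right algebra_simps)
    also have "v \<bullet> B v = 0" using v(1) by (simp add: B_def inner_diff_right l_def dot_square_norm)
    also have "v \<bullet> B y = y \<bullet> B v" using symA[of v y] by (simp add: B_def inner_diff_right inner_commute)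
    finally have "0 \<le> s * (s * \<gamma> - 2 * \<beta>)" by (simp add: \<gamma>_def \<beta>_def y_def algebra_simps)
    then have "2 * \<beta> \<le> s * \<gamma>" using s by (simp add: zero_le_mult_iff)
    also have "\<dots> \<le> s * (\<bar>\<gamma>\<bar> + 1)" using s by (intro mult_left_mono) auto
    also have "\<dots> = \<beta>" by (simp add: s_def)
    finally show False using \<beta> by simp
  qed
  then have "A *v v = l *\<^sub>R v" by (simp add: B_def)
  then have "l \<in> eigenvalues A" using v(1) by (auto simp: eigenvalues_def intro!: exI[of _ v])
  then have "\<mu> \<le> l" using min by (auto simp: is_min_eigenvalue_def)
  then have "\<mu> * (norm x)\<^sup>2 \<le> l * (norm x)\<^sup>2" by (intro mult_right_mono) auto
  with lower show ?thesis by (rule order_trans[rotated])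
qed

text \<open>The double well becomes convex after adding \<open>s\<^sup>2 / 2\<close>. Accordingly,
  adding the two quadratic lower bounds with exchanged points leaves a defect of modulus 1.\<close>

lemma prox_subdiff_double_well_monotone:
  assumes "w \<in> prox_subdiff double_well s" "w' \<in> prox_subdiff double_well s'"
  shows "(w - w') * (s - s') \<ge> - (s - s')\<^sup>2"
proof -
  have "double_well s' \<ge> double_well s + w * (s' - s) - (s' - s)\<^sup>2 / 2"
    using assms(1) by (intro double_well_lower_bound) (auto simp: prox_subdiff_double_well split: if_splits)
  moreover have "double_well s \<ge> double_well s' + w' * (s - s') - (s - s')\<^sup>2 / 2"
    using assms(2) by (intro double_well_lower_bound) (auto simp: prox_subdiff_double_well split: if_splits)
  ultimately have "0 \<le> w * (s - s') + w' * (s' - s) + (s - s')\<^sup>2"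
    by (simp add: power2_commute[of s' s] right_diff_distrib)
  then show ?thesis by (simp add: algebra_simps)
qed

text \<open>Outside the wells the slope points away from the origin. The constant 2 is attained at a
  kink, for instance s = 1 and w = -1; summed over the coordinates it produces the radius in
  \<open>drift_dissipative\<close>.\<close>

lemma prox_subdiff_double_well_bounds:
  assumes "w \<in> prox_subdiff double_well s"
  shows "\<bar>w\<bar> \<le> 1" "\<bar>s\<bar> - 2 \<le> s * w"
proof -
  show "\<bar>w\<bar> \<le> 1" using assms by (auto simp: prox_subdiff_double_well split: if_splits)
  consider "s < -1" | "s = -1" | "-1 < s" "s < 1" | "s = 1" | "s > 1" by linarith
  then show "\<bar>s\<bar> - 2 \<le> s * w"
  proof cases
    case 3
    then have "\<bar>s\<bar> * \<bar>s\<bar> \<le> 1" by (intro mult_le_one) auto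
    then have "s * s \<le> 1" by simp
    then show ?thesis using 3 assms by (auto simp: prox_subdiff_double_well)
  qed (use assms in \<open>auto simp: prox_subdiff_double_well\<close>)
qed

lemma drift_1:
  assumes "\<epsilon> > 0" "j \<noteq> 0"
  shows "drift \<alpha> \<epsilon> X' d G j \<eta> =
    {- (1 / \<epsilon>) *\<^sub>R w | w. \<forall>k. w $ k \<in> prox_subdiff double_well (\<eta> $ k)}"
  using assms unfolding drift_def by (auto simp: prox_subdiff_Phi_w)

text \<open>The Hessian of \<open>Phi_l\<close>, whose minimal eigenvalue enters the
  theorem.\<close>

definition stiffness :: "real \<Rightarrow> real \<Rightarrow> (real^'n) set \<Rightarrow> real^'n^'m \<Rightarrow> real^'n^'n" where
  "stiffness \<alpha> \<epsilon> X' G = data_op \<alpha> X' - \<epsilon> *\<^sub>R laplacian G"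

lemma drift_0_affine:
  assumes "subspace X'"
  shows "drift \<alpha> \<epsilon> X' d G 0 \<eta> = {data_vec \<alpha> X' d - stiffness \<alpha> \<epsilon> X' G *v \<eta>}"
  by (simp add: drift_0[OF assms] stiffness_def matrix_vector_mult_diff_rdistrib
      scaleR_matrix_vector_assoc[symmetric])

lemma transpose_stiffness:
  assumes "symmetric_matrix (laplacian G)"
  shows "transpose (stiffness \<alpha> \<epsilon> X' G) = stiffness \<alpha> \<epsilon> X' G"
proof -
  have "transpose (A - c *\<^sub>R B) = transpose A - c *\<^sub>R transpose B" for A B :: "real^'n^'n" and c
    by (simp add: transpose_def vec_eq_iff)
  moreover have "transpose (data_op \<alpha> X') = data_op \<alpha> X'"
    by (simp add: data_op_def transpose_scalar matrix_transpose_mul)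
  ultimately show ?thesis using assms by (metis stiffness_def symmetric_matrix_def)
qed

text \<open>In state 0 the difference of drifts is linear and the quadratic form of the Hessian
  gives the rate. In state 1 the modulus 1 of weak convexity of the double well is divided by
  \<epsilon>, coordinate by coordinate.\<close>

lemma drift_one_sided_lipschitz:
  fixes x y :: "real^'n"
  assumes "\<epsilon> > 0" "subspace X'" "symmetric_matrix (laplacian G)"
    "is_min_eigenvalue (stiffness \<alpha> \<epsilon> X' G) \<mu>"
    "v \<in> drift \<alpha> \<epsilon> X' d G j x" "v' \<in> drift \<alpha> \<epsilon> X' d G j y"
  shows "(v - v') \<bullet> (x - y) \<le> (if j = 0 then - \<mu> else 1 / \<epsilon>) * (norm (x - y))\<^sup>2"
proof (cases "j = 0")
  case True
  let ?A = "stiffness \<alpha> \<epsilon> X' G"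
  have "v - v' = - (?A *v (x - y))"
    using assms(5,6) True by (simp add: drift_0_affine[OF assms(2)] matrix_vector_mult_diff_distrib)
  then have "(v - v') \<bullet> (x - y) = - ((x - y) \<bullet> (?A *v (x - y)))" by (simp add: inner_commute)
  also have "\<dots> \<le> - (\<mu> * (norm (x - y))\<^sup>2)"
    using min_eigenvalue_le_quadratic_form[OF transpose_stiffness[OF assms(3)] assms(4)] by simp
  finally show ?thesis using True by simp
next
  case False
  obtain w w' where w: "v = - (1 / \<epsilon>) *\<^sub>R w" "\<And>k. w $ k \<in> prox_subdiff double_well (x $ k)"
    "v' = - (1 / \<epsilon>) *\<^sub>R w'" "\<And>k. w' $ k \<in> prox_subdiff double_well (y $ k)"
    using assms(5,6) unfolding drift_1[OF assms(1) False] by blast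
  have "(w - w') \<bullet> (x - y) = (\<Sum>k\<in>UNIV. (w $ k - w' $ k) * (x $ k - y $ k))"
    by (simp add: inner_vec_def)
  also have "\<dots> \<ge> (\<Sum>k\<in>UNIV. - (x $ k - y $ k)\<^sup>2)"
    by (intro sum_mono prox_subdiff_double_well_monotone w)
  also have "(\<Sum>k\<in>UNIV. - (x $ k - y $ k)\<^sup>2) = - (norm (x - y))\<^sup>2"
    unfolding power2_norm_eq_inner inner_vec_def sum_negf by (simp add: power2_eq_square)
  finally have "- (1 / \<epsilon>) * ((w - w') \<bullet> (x - y)) \<le> (1 / \<epsilon>) * (norm (x - y))\<^sup>2"
    using assms(1) by (simp add: field_simps)
  moreover have "v - v' = - (1 / \<epsilon>) *\<^sub>R (w - w')" by (simp add: w scaleR_diff_right)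
  ultimately show ?thesis using False by (simp add: inner_scaleR_left)
qed

text \<open>Both drifts point inward outside a common ball, which bounds solutions
  deterministically. The first radius is where the quadratic form overtakes the data term; the
  second comes from summing \<open>\<bar>x $ k\<bar> - 2 \<le> x $ k * w $ k\<close> and comparing
  the 1-norm with the Euclidean norm.\<close>

lemma drift_dissipative:
  fixes x :: "real^'n"
  assumes "\<epsilon> > 0" "subspace X'" "symmetric_matrix (laplacian G)"
    "is_min_eigenvalue (stiffness \<alpha> \<epsilon> X' G) \<mu>" "\<mu> > 0"
    "v \<in> drift \<alpha> \<epsilon> X' d G j x" and R: "max (norm (data_vec \<alpha> X' d) / \<mu>) (2 * CARD('n)) \<le> norm x"
  shows "v \<bullet> x \<le> 0"
proof (cases "j = 0")
  case True
  let ?A = "stiffness \<alpha> \<epsilon> X' G"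
  have "v \<bullet> x = data_vec \<alpha> X' d \<bullet> x - x \<bullet> (?A *v x)"
    using assms(6) True by (simp add: drift_0_affine[OF assms(2)] inner_diff_left inner_commute[of x])
  also have "\<dots> \<le> norm (data_vec \<alpha> X' d) * norm x - \<mu> * (norm x)\<^sup>2"
    using min_eigenvalue_le_quadratic_form[OF transpose_stiffness[OF assms(3)] assms(4)]
    by (intro diff_mono norm_cauchy_schwarz)
  also have "\<dots> = (norm (data_vec \<alpha> X' d) - \<mu> * norm x) * norm x"
    by (simp add: algebra_simps power2_eq_square)
  also have "\<dots> \<le> 0"
    using R assms(5) by (intro mult_nonpos_nonneg) (auto simp: pos_divide_le_eq mult.commute)
  finally show ?thesis .
next
  case False
  obtain w where w: "v = - (1 / \<epsilon>) *\<^sub>R w" "\<And>k. w $ k \<in> prox_subdiff double_well (x $ k)"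
    using assms(6) unfolding drift_1[OF assms(1) False] by blast
  have "norm x - 2 * CARD('n) \<le> (\<Sum>k\<in>UNIV. \<bar>x $ k\<bar>) - 2 * CARD('n)"
    using norm_le_l1_cart[of x] by simp
  also have "\<dots> = (\<Sum>k\<in>UNIV. \<bar>x $ k\<bar> - 2)" by (simp add: sum_subtractf)
  also have "\<dots> \<le> (\<Sum>k\<in>UNIV. x $ k * w $ k)"
    by (intro sum_mono prox_subdiff_double_well_bounds w)
  also have "\<dots> = x \<bullet> w" by (simp add: inner_vec_def)
  finally have "0 \<le> w \<bullet> x" using R by (simp add: inner_commute)
  then show ?thesis using assms(1) by (simp add: w(1) inner_scaleR_left)
qed

lemma drift_locally_bounded:
  fixes \<rho> :: real and X' :: "(real^'n) set" and G :: "real^'n^'m"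
  assumes "\<epsilon> > 0" "subspace X'"
  obtains C where "C \<ge> 0"
    "\<And>j x v. norm x \<le> \<rho> \<Longrightarrow> v \<in> drift \<alpha> \<epsilon> X' d G j x \<Longrightarrow> norm v \<le> C"
proof -
  let ?A = "stiffness \<alpha> \<epsilon> X' G"
  obtain K where K: "K > 0" "\<And>x. norm (?A *v x) \<le> norm x * K"
    using bounded_linear.pos_bounded[OF matrix_vector_mul_bounded_linear[of ?A]] by auto
  show ?thesis
  proof (rule that[of "norm (data_vec \<alpha> X' d) + \<bar>\<rho>\<bar> * K + CARD('n) / \<epsilon>"])
    show "0 \<le> norm (data_vec \<alpha> X' d) + \<bar>\<rho>\<bar> * K + CARD('n) / \<epsilon>"
      using K assms by (intro add_nonneg_nonneg) auto
    fix j :: 2 and x v assume x: "norm x \<le> \<rho>" and v: "v \<in> drift \<alpha> \<epsilon> X' d G j x"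
    show "norm v \<le> norm (data_vec \<alpha> X' d) + \<bar>\<rho>\<bar> * K + CARD('n) / \<epsilon>"
    proof (cases "j = 0")
      case True
      then have "norm v \<le> norm (data_vec \<alpha> X' d) + norm (?A *v x)"
        using v by (simp add: drift_0_affine[OF assms(2)] norm_triangle_ineq4)
      also have "norm (?A *v x) \<le> \<bar>\<rho>\<bar> * K"
        using K(2)[of x] x K(1) by (intro order_trans[OF K(2)] mult_right_mono) auto
      finally show ?thesis using assms(1) by (simp add: add_increasing2)
    next
      case False
      obtain w where w: "v = - (1 / \<epsilon>) *\<^sub>R w" "\<And>k. w $ k \<in> prox_subdiff double_well (x $ k)"
        using v unfolding drift_1[OF assms(1) False] by blast
      have "norm w \<le> (\<Sum>k\<in>UNIV. \<bar>w $ k\<bar>)" by (rule norm_le_l1_cart)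
      also have "\<dots> \<le> (\<Sum>k\<in>(UNIV::'n set). 1)" by (intro sum_mono prox_subdiff_double_well_bounds(1)[OF w(2)])
      finally have "norm v \<le> CARD('n) / \<epsilon>" using assms(1) by (simp add: w(1) divide_simps)
      then show ?thesis using K(1) by (simp add: add_increasing)
    qed
  qed
qed

section \<open>Flows along switching paths\<close>

text \<open>Real induction. It lets an estimate pass over the jumps of a right-continuous path
  without enumerating them or showing that they do not accumulate.\<close>

lemma continuous_induct [consumes 1, case_names start limit step]:
  fixes a b :: real
  assumes "a \<le> b" and start: "Q a"
    and limit: "\<And>x. a < x \<Longrightarrow> x \<le> b \<Longrightarrow> (\<And>y. a \<le> y \<Longrightarrow> y < x \<Longrightarrow> Q y) \<Longrightarrow> Q x"
    and step: "\<And>x. a \<le> x \<Longrightarrow> x < b \<Longrightarrow> Q x \<Longrightarrow> \<exists>\<delta>>0. \<forall>y. x \<le> y \<longrightarrow> y < x + \<delta> \<longrightarrow> y \<le> b \<longrightarrow> Q y"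
  shows "Q b"
proof -
  define S where "S = {x \<in> {a..b}. \<forall>y\<in>{a..x}. Q y}"
  define s where "s = Sup S"
  have aS: "a \<in> S" using start assms(1) by (auto simp: S_def)
  have bdd: "bdd_above S" by (auto simp: S_def bdd_above_def)
  have s: "a \<le> s" "s \<le> b"
    unfolding s_def using aS bdd by (auto intro!: cSup_upper cSup_least simp: S_def)
  have below: "Q y" if "a \<le> y" "y < s" for y
  proof -
    obtain x where "x \<in> S" "y < x"
      using less_cSup_iff[of S y] \<open>y < s\<close> aS bdd unfolding s_def by blast
    then show ?thesis using that by (auto simp: S_def)
  qed
  have "Q s" using start limit[of s] below s by (cases "a = s") auto
  have "s = b"
  proof (rule ccontr)
    assume "s \<noteq> b"
    then have "s < b" using s by simp
    with step[of s] \<open>Q s\<close> s obtain \<delta> where \<delta>: "\<delta> > 0" "\<And>y. s \<le> y \<Longrightarrow> y < s + \<delta> \<Longrightarrow> y \<le> b \<Longrightarrow> Q y" by auto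
    define x where "x = min b (s + \<delta> / 2)"
    have "x \<in> S" unfolding S_def
    proof (intro CollectI conjI ballI)
      show "x \<in> {a..b}" using s \<delta>(1) by (auto simp: x_def)
      fix y assume y: "y \<in> {a..x}"
      show "Q y"
      proof (cases "y < s")
        case False
        then show ?thesis using y \<delta>(1) by (intro \<delta>(2)) (auto simp: x_def min_def split: if_splits)
      qed (use y below in auto)
    qed
    then have "x \<le> s" unfolding s_def using bdd by (rule cSup_upper)
    then show False using \<open>s < b\<close> \<delta>(1) by (auto simp: x_def)
  qed
  with \<open>Q s\<close> show ?thesis by simp
qed

lemma abs_cont_on_shift:
  assumes "abs_cont_on {a..b} f"
  shows "abs_cont_on {a - s..b - s} (\<lambda>t. f (s + t))"
  unfolding abs_cont_on_def
proof (intro allI impI)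
  fix e :: real assume e: "e > 0"
  obtain \<delta> where \<delta>: "\<delta> > 0" "\<And>D :: (real \<times> real) set.
       finite D \<Longrightarrow> \<forall>(u,v)\<in>D. u < v \<and> {u..v} \<subseteq> {a..b} \<Longrightarrow>
       pairwise (\<lambda>p q. disjnt {fst p<..<snd p} {fst q<..<snd q}) D \<Longrightarrow>
       (\<Sum>(u,v)\<in>D. v - u) < \<delta> \<Longrightarrow> (\<Sum>(u,v)\<in>D. norm (f v - f u)) < e"
    using abs_cont_onE[OF assms e] by blast
  show "\<exists>\<delta>>0. \<forall>D :: (real \<times> real) set.
       finite D \<longrightarrow> (\<forall>(u,v)\<in>D. u < v \<and> {u..v} \<subseteq> {a - s..b - s}) \<longrightarrow>
       pairwise (\<lambda>p q. disjnt {fst p<..<snd p} {fst q<..<snd q}) D \<longrightarrow>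
       (\<Sum>(u,v)\<in>D. v - u) < \<delta> \<longrightarrow> (\<Sum>(u,v)\<in>D. norm (f (s + v) - f (s + u))) < e"
  proof (intro exI[of _ \<delta>] conjI allI impI \<delta>(1))
    fix D :: "(real \<times> real) set"
    assume D: "finite D" "\<forall>(u,v)\<in>D. u < v \<and> {u..v} \<subseteq> {a - s..b - s}"
      "pairwise (\<lambda>p q. disjnt {fst p<..<snd p} {fst q<..<snd q}) D"
      "(\<Sum>(u,v)\<in>D. v - u) < \<delta>"
    define g where "g p = (s + fst p, s + snd p)" for p :: "real \<times> real"
    have inj: "inj_on g D" by (auto simp: inj_on_def g_def prod_eq_iff)
    have "(\<Sum>(u,v)\<in>g ` D. norm (f v - f u)) < e"
    proof (rule \<delta>(2))
      show "finite (g ` D)" using D(1) by simp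
      show "\<forall>(u,v)\<in>g ` D. u < v \<and> {u..v} \<subseteq> {a..b}" using D(2) by (force simp: g_def)
      show "pairwise (\<lambda>p q. disjnt {fst p<..<snd p} {fst q<..<snd q}) (g ` D)"
      proof (rule pairwise_imageI)
        fix p q assume "p \<in> D" "q \<in> D" "p \<noteq> q"
        then have d: "disjnt {fst p<..<snd p} {fst q<..<snd q}" using D(3) by (auto simp: pairwise_def)
        have "x - s \<in> {fst p<..<snd p} \<inter> {fst q<..<snd q}"
          if "x \<in> {fst (g p)<..<snd (g p)}" "x \<in> {fst (g q)<..<snd (g q)}" for x
          using that by (auto simp: g_def)
        with d show "disjnt {fst (g p)<..<snd (g p)} {fst (g q)<..<snd (g q)}"
          unfolding disjnt_def by blast
      qed
      have "(\<Sum>(u,v)\<in>g ` D. v - u) = (\<Sum>(u,v)\<in>D. v - u)"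
        unfolding sum.reindex[OF inj] by (simp add: g_def split_beta)
      with D(4) show "(\<Sum>(u,v)\<in>g ` D. v - u) < \<delta>" by simp
    qed
    then show "(\<Sum>(u,v)\<in>D. norm (f (s + v) - f (s + u))) < e"
      unfolding sum.reindex[OF inj] by (simp add: g_def split_beta)
  qed
qed

lemma AE_lborel_shift:
  assumes "AE t in lborel. P t"
  shows "AE t in lborel. P (s + t :: real)"
proof -
  obtain N where N: "N \<in> null_sets lborel" "{t. \<not> P t} \<subseteq> N"
    using assms by (auto elim!: AE_E simp: null_sets_def)
  have "AE t in lborel. s + 1 * t \<notin> N"
    by (rule AE_borel_affine) (use N(1) AE_not_in[OF N(1)] in auto)
  then show ?thesis using N(2) by (auto elim!: eventually_mono)
qed

lemma solves_inclusion_shift: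
  assumes "solves_inclusion F a b f"
  shows "solves_inclusion F (a - s) (b - s) (\<lambda>t. f (s + t))"
  unfolding solves_inclusion_def
proof
  show "abs_cont_on {a - s..b - s} (\<lambda>t. f (s + t))"
    using assms by (auto simp: solves_inclusion_def intro: abs_cont_on_shift)
  have "AE t in lborel. a < t \<and> t < b \<longrightarrow> (\<exists>v\<in>F (f t). (f has_vector_derivative v) (at t))"
    using assms by (simp add: solves_inclusion_def)
  from AE_lborel_shift[OF this, of s]
  show "AE t in lborel. a - s < t \<and> t < b - s \<longrightarrow>
      (\<exists>v\<in>F (f (s + t)). ((\<lambda>t. f (s + t)) has_vector_derivative v) (at t))"
  proof eventually_elim
    case (elim t)
    show ?case
    proof
      assume t: "a - s < t \<and> t < b - s"
      then obtain v where v: "v \<in> F (f (s + t))" "(f has_vector_derivative v) (at (s + t))"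
        using elim by (auto simp: algebra_simps)
      have "((\<lambda>t. s + t) has_vector_derivative 1) (at t)"
        by (auto intro!: derivative_eq_intros)
      from vector_diff_chain_at[OF this, of f v] v(2)
      have "((\<lambda>t. f (s + t)) has_vector_derivative v) (at t)" by (simp add: o_def)
      with v(1) show "\<exists>v\<in>F (f (s + t)). ((\<lambda>t. f (s + t)) has_vector_derivative v) (at t)" by blast
    qed
  qed
qed

lemma solves_inclusion_unshift:
  assumes "solves_inclusion F 0 h f"
  shows "solves_inclusion F s (s + h) (\<lambda>t. f (t - s))"
  using solves_inclusion_shift[OF assms, of "- s"] by (simp add: algebra_simps)

text \<open>The state used on a cell is the one at its right end point: grid points decreasing to s
  recover \<open>w s\<close> by right-continuity, whereas left end points need not.\<close>

primrec grid_flow :: "('s \<Rightarrow> real \<Rightarrow> 'a \<Rightarrow> 'a) \<Rightarrow> real \<Rightarrow> nat \<Rightarrow> 'a \<Rightarrow> (real \<Rightarrow> 's) \<Rightarrow> 'a" where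
  "grid_flow \<phi> h 0 x w = x"
| "grid_flow \<phi> h (Suc m) x w = \<phi> (w (real (Suc m) * h)) h (grid_flow \<phi> h m x w)"

text \<open>The properties of the Allen--Cahn drift that enter the pathwise analysis, with \<kappa>
  the minimal eigenvalue, b the reciprocal of \<epsilon> and R the radius of dissipativity.
  Uniqueness of solutions is a consequence of the one-sided bound.\<close>

locale switched_inclusion =
  fixes F :: "2 \<Rightarrow> 'a::euclidean_space \<Rightarrow> 'a set" and \<kappa> b R :: real
  assumes kb: "0 < b" "b < \<kappa>" and R: "0 \<le> R"
    and one_sided: "\<And>j x y v v'. v \<in> F j x \<Longrightarrow> v' \<in> F j y \<Longrightarrow>
      (v - v') \<bullet> (x - y) \<le> (if j = 0 then - \<kappa> else b) * (norm (x - y))\<^sup>2"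
    and dissipative: "\<And>j x v. v \<in> F j x \<Longrightarrow> R \<le> norm x \<Longrightarrow> v \<bullet> x \<le> 0"
    and locally_bounded: "\<And>\<rho>::real. \<exists>C\<ge>0. \<forall>j x v. norm x \<le> \<rho> \<longrightarrow> v \<in> F j x \<longrightarrow> norm v \<le> C"
    and solvable: "\<And>j x h. 0 \<le> h \<Longrightarrow> \<exists>f. f 0 = x \<and> solves_inclusion (F j) 0 h f"
begin

lemma solves_continuous: "solves_inclusion (F j) s t f \<Longrightarrow> continuous_on {s..t} f"
  by (auto simp: solves_inclusion_def intro: abs_cont_on_imp_continuous_on)

lemma solves_contract:
  assumes "s \<le> t" "solves_inclusion (F j) s t f" "solves_inclusion (F j) s t f'"
  shows "norm (f t - f' t) \<le> exp ((if j = 0 then - \<kappa> else b) * (t - s)) * norm (f s - f' s)"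
  using solves_inclusion_gronwall[OF assms one_sided] solves_continuous[OF assms(2)]
    solves_continuous[OF assms(3)] by simp

text \<open>If the curve ended outside the ball of radius \<open>max (norm (f s)) R\<close>, then
  after its last visit to that ball it would move where the drift points inward. The Gronwall
  estimate with c = 0 against the constant curve 0 then shows that its norm cannot grow
  there.\<close>

lemma solves_norm_le:
  assumes st: "s \<le> t" and f: "solves_inclusion (F j) s t f"
  shows "norm (f t) \<le> max (norm (f s)) R"
proof (rule ccontr)
  assume "\<not> ?thesis"
  then have gt: "norm (f t) > max (norm (f s)) R" by (simp only: not_le)
  define \<rho> where "\<rho> = max (norm (f s)) R"
  have cont: "continuous_on {s..t} (\<lambda>u. norm (f u))"
    by (intro continuous_intros solves_continuous[OF f])
  define S where "S = {u \<in> {s..t}. norm (f u) \<in> {..\<rho>}}"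
  have S_eq: "S = {s..t} \<inter> (\<lambda>u. norm (f u)) -` {..\<rho>}" by (auto simp: S_def)
  have "closed S"
    unfolding S_eq by (rule continuous_closed_preimage[OF cont closed_atLeastAtMost closed_atMost])
  moreover have "s \<in> S" using st by (auto simp: S_def \<rho>_def)
  moreover have bdd: "bdd_above S" by (auto simp: S_def bdd_above_def)
  ultimately have "Sup S \<in> S" using closed_contains_Sup[of S] by auto
  define u where "u = Sup S"
  have u: "s \<le> u" "u \<le> t" "norm (f u) \<le> \<rho>" using \<open>Sup S \<in> S\<close> by (auto simp: S_def u_def)
  have above: "norm (f v) > \<rho>" if "u < v" "v \<le> t" for v
  proof (rule ccontr)
    assume "\<not> ?thesis"
    then have "v \<in> S" using that u by (auto simp: S_def)
    then have "v \<le> u" unfolding u_def using bdd by (rule cSup_upper)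
    with that show False by simp
  qed
  have ac0: "solves_inclusion (\<lambda>_. {0}) u t (\<lambda>_. 0 :: 'a)"
    unfolding solves_inclusion_def abs_cont_on_def by (auto intro!: exI[of _ 1])
  have "norm (f t - 0) \<le> exp (0 * (t - u)) * norm (f u - 0)"
  proof (rule solves_inclusion_gronwall[OF u(2) solves_inclusion_subinterval[OF f u(1) order_refl] ac0])
    fix v w w' assume v: "u < v" "v < t" "w \<in> F j (f v)" "w' \<in> {0 :: 'a}"
    then have "R \<le> norm (f v)" using above[of v] by (simp add: \<rho>_def)
    with dissipative[OF v(3)] v(4) show "(w - w') \<bullet> (f v - 0) \<le> 0 * (norm (f v - 0))\<^sup>2" by simp
  qed (use solves_continuous[OF f] u in \<open>auto intro: continuous_on_subset\<close>)
  then have "norm (f t) \<le> \<rho>" using u(3) by simp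
  then show False using gt by (simp only: \<rho>_def)
qed

text \<open>A solution on [0, h] is chosen separately for every h; \<open>flow_eq\<close> removes
  the dependence on the choice, since solutions with the same initial value coincide.\<close>

definition flow :: "2 \<Rightarrow> real \<Rightarrow> 'a \<Rightarrow> 'a" where
  "flow j h x = (SOME f. f 0 = x \<and> solves_inclusion (F j) 0 h f) h"

lemma flow_eq:
  assumes "0 \<le> h" "solves_inclusion (F j) 0 h f"
  shows "flow j h (f 0) = f h"
proof -
  define g where "g = (SOME g. g 0 = f 0 \<and> solves_inclusion (F j) 0 h g)"
  have g: "g 0 = f 0" "solves_inclusion (F j) 0 h g"
    using someI_ex[OF solvable[OF assms(1), of "f 0" j]] unfolding g_def by auto
  have "norm (g h - f h) \<le> 0" using solves_contract[OF assms(1) g(2) assms(2)] g(1) by simp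
  then show ?thesis by (simp add: flow_def g_def)
qed

lemma flow_lipschitz:
  assumes "0 \<le> h"
  shows "norm (flow j h x - flow j h y) \<le> exp ((if j = 0 then - \<kappa> else b) * h) * norm (x - y)"
proof -
  obtain f where f: "f 0 = x" "solves_inclusion (F j) 0 h f" using solvable[OF assms] by blast
  obtain g where g: "g 0 = y" "solves_inclusion (F j) 0 h g" using solvable[OF assms] by blast
  show ?thesis
    using solves_contract[OF assms f(2) g(2)] flow_eq[OF assms f(2)] flow_eq[OF assms g(2)] f(1) g(1) by simp
qed

lemma flow_norm_le:
  assumes "0 \<le> h"
  shows "norm (flow j h x) \<le> max (norm x) R"
proof -
  obtain f where f: "f 0 = x" "solves_inclusion (F j) 0 h f" using solvable[OF assms] by blast
  show ?thesis using solves_norm_le[OF assms f(2)] flow_eq[OF assms f(2)] f(1) by simp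
qed

lemma grid_flow_norm_le: "0 \<le> h \<Longrightarrow> norm (grid_flow flow h m x w) \<le> max (norm x) R"
proof (induction m)
  case (Suc m)
  show ?case using flow_norm_le[OF Suc.prems, of "w (real (Suc m) * h)" "grid_flow flow h m x w"]
      Suc.IH[OF Suc.prems] by (simp add: max_def split: if_splits)
qed simp

text \<open>While w equals j, both curves solve the same inclusion and their distance grows at most
  at rate b. While w differs from j, both move with speed at most C, so the distance gains at most 2
  * C per unit of time. The function m stands for the accumulated time of mismatch.\<close>

lemma compare_with_constant_state:
  assumes pq: "p \<le> q"
    and rc: "\<And>t. p \<le> t \<Longrightarrow> t < q \<Longrightarrow> \<exists>\<delta>>0. \<forall>u\<in>{t..<t + \<delta>}. w u = w t"
    and cont: "continuous_on {p..q} \<eta>"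
    and sol: "\<And>t u. p \<le> t \<Longrightarrow> t < u \<Longrightarrow> u \<le> q \<Longrightarrow> (\<forall>v\<in>{t..<u}. w v = w t) \<Longrightarrow> solves_inclusion (F (w t)) t u \<eta>"
    and y: "solves_inclusion (F j) p q y"
    and bd: "\<And>t. p \<le> t \<Longrightarrow> t \<le> q \<Longrightarrow> norm (\<eta> t) \<le> \<rho>" "\<And>t. p \<le> t \<Longrightarrow> t \<le> q \<Longrightarrow> norm (y t) \<le> \<rho>"
    and C: "C \<ge> 0" "\<And>k x v. norm x \<le> \<rho> \<Longrightarrow> v \<in> F k x \<Longrightarrow> norm v \<le> C"
    and m: "\<And>t u. p \<le> t \<Longrightarrow> t \<le> u \<Longrightarrow> u \<le> q \<Longrightarrow> m t \<le> m u"
      "\<And>t u. p \<le> t \<Longrightarrow> t \<le> u \<Longrightarrow> u \<le> q \<Longrightarrow> (\<forall>v\<in>{t..<u}. w v \<noteq> j) \<Longrightarrow> u - t \<le> m u - m t"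
  shows "norm (\<eta> q - y q) \<le> exp (b * (q - p)) * (norm (\<eta> p - y p) + 2 * C * (m q - m p))"
proof -
  let ?B = "\<lambda>u. exp (b * (u - p)) * (norm (\<eta> p - y p) + 2 * C * (m u - m p))"
  have Bmono: "?B t \<le> ?B u" if "p \<le> t" "t \<le> u" "u \<le> q" for t u
    using m(1)[of t u] m(1)[of p t] that C(1) kb
    by (intro mult_mono add_mono mult_left_mono) (auto intro!: add_nonneg_nonneg mult_nonneg_nonneg)
  have conty: "continuous_on {p..q} y" by (rule solves_continuous[OF y])
  from pq show "norm (\<eta> q - y q) \<le> ?B q"
  proof (induction rule: continuous_induct)
    case start
    then show ?case by simp
  next
    case (limit x)
    have "continuous_on {p..q} (\<lambda>t. norm (\<eta> t - y t))" by (intro continuous_intros cont conty)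
    then have "continuous_on {p..x} (\<lambda>t. norm (\<eta> t - y t))"
      by (rule continuous_on_subset) (use limit(1,2) in auto)
    then have "((\<lambda>t. norm (\<eta> t - y t)) \<longlongrightarrow> norm (\<eta> x - y x)) (at x within {p..x})"
      using limit(1) unfolding continuous_on_def by (auto dest!: bspec[where x = x])
    then have "((\<lambda>t. norm (\<eta> t - y t)) \<longlongrightarrow> norm (\<eta> x - y x)) (at_left x)"
      using limit(1) by (simp add: at_within_Icc_at_left)
    moreover have "\<forall>\<^sub>F t in at_left x. norm (\<eta> t - y t) \<le> ?B x"
    proof (rule eventually_at_leftI[of p])
      fix t assume t: "t \<in> {p<..<x}"
      then have "norm (\<eta> t - y t) \<le> ?B t" by (intro limit(3)) auto
      also have "\<dots> \<le> ?B x" using t limit(1,2) by (intro Bmono) auto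
      finally show "norm (\<eta> t - y t) \<le> ?B x" .
    qed (use limit(1) in auto)
    ultimately show ?case by (rule tendsto_upperbound) simp
  next
    case (step t)
    obtain \<delta> where \<delta>: "\<delta> > 0" "\<And>u. u \<in> {t..<t + \<delta>} \<Longrightarrow> w u = w t" using rc[OF step(1,2)] by blast
    have "norm (\<eta> u - y u) \<le> ?B u" if u: "t < u" "u < t + \<delta>" "u \<le> q" for u
    proof -
      have wt: "w v = w t" if "v \<in> {t..<u}" for v using that u by (intro \<delta>(2)) auto
      then have s1: "solves_inclusion (F (w t)) t u \<eta>" using step(1) u by (intro sol ballI)
      have s2: "solves_inclusion (F j) t u y" using solves_inclusion_subinterval[OF y] step(1,2) u by auto
      have mtu: "m t \<le> m u" using step(1,2) u by (intro m(1)) auto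
      have mpt: "m p \<le> m t" using step(1,2) by (intro m(1)) auto
      have nn: "0 \<le> norm (\<eta> p - y p) + 2 * C * (m t - m p)" using C(1) mpt by simp
      show ?thesis
      proof (cases "w t = j")
        case True
        have "norm (\<eta> u - y u) \<le> exp ((if j = 0 then - \<kappa> else b) * (u - t)) * norm (\<eta> t - y t)"
          using s1 s2 True u by (intro solves_contract) simp_all
        \<comment> \<open>The decay in state 0 is given away: on a bounded time interval a crude
          growth factor is enough for the convergence of the grids.\<close>
        also have "\<dots> \<le> exp (b * (u - t)) * ?B t"
        proof (rule mult_mono[OF _ step(3)])
          have "(if j = 0 then - \<kappa> else b) * (u - t) \<le> b * (u - t)"
            using kb u by (intro mult_right_mono) (simp_all split: if_split)
          then show "exp ((if j = 0 then - \<kappa> else b) * (u - t)) \<le> exp (b * (u - t))" by (simp only: exp_le_cancel_iff)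
        qed simp_all
        also have "\<dots> = exp (b * (u - p)) * (norm (\<eta> p - y p) + 2 * C * (m t - m p))"
        proof -
          have "exp (b * (u - p)) = exp (b * (u - t)) * exp (b * (t - p))"
            by (simp add: exp_add[symmetric] algebra_simps)
          then show ?thesis by (simp only: mult.assoc)
        qed
        also have "\<dots> \<le> ?B u" using mtu C(1) by (intro mult_left_mono add_left_mono) auto
        finally show ?thesis .
      next
        case False
        have l1: "norm (\<eta> u - \<eta> t) \<le> C * (u - t)"
          using s1 u step(1,2) by (intro solves_inclusion_lipschitz[where F = "F (w t)"] C(2)[OF bd(1)]) auto
        have l2: "norm (y u - y t) \<le> C * (u - t)"
          using s2 u step(1,2) by (intro solves_inclusion_lipschitz[where F = "F j"] C(2)[OF bd(2)]) auto
        have "norm (\<eta> u - y u) \<le> norm (\<eta> t - y t) + (norm (\<eta> u - \<eta> t) + norm (y u - y t))" by norm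
        also have "\<dots> \<le> ?B t + 2 * C * (u - t)" using step(3) l1 l2 by linarith
        also have "\<dots> \<le> exp (b * (u - p)) * (norm (\<eta> p - y p) + 2 * C * (m t - m p)) + exp (b * (u - p)) * (2 * C * (m u - m t))"
        proof (intro add_mono)
          show "?B t \<le> exp (b * (u - p)) * (norm (\<eta> p - y p) + 2 * C * (m t - m p))"
            using nn u kb by (intro mult_right_mono) auto
          have "2 * C * (u - t) \<le> 2 * C * (m u - m t)"
          proof (intro mult_left_mono m(2) ballI)
            show "w v \<noteq> j" if "v \<in> {t..<u}" for v using wt[OF that] False by simp
          qed (use u step(1,2) C(1) in auto)
          also have "\<dots> \<le> exp (b * (u - p)) * (2 * C * (m u - m t))"
          proof -
            have "1 \<le> exp (b * (u - p))" using kb u step(1) by simp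
            then show ?thesis using mult_right_mono[of 1 "exp (b * (u - p))" "2 * C * (m u - m t)"] C(1) mtu by simp
          qed
          finally show "2 * C * (u - t) \<le> exp (b * (u - p)) * (2 * C * (m u - m t))" .
        qed
        also have "\<dots> = ?B u" by (simp add: algebra_simps)
        finally show ?thesis .
      qed
    qed
    then have "norm (\<eta> u - y u) \<le> ?B u" if "t \<le> u" "u < t + \<delta>" "u \<le> q" for u
      using that step(3) by (cases "t = u") auto
    then show ?case using \<delta>(1) by blast
  qed
qed

end

section \<open>Convergence of grid approximations along right-continuous paths\<close>

definition next_grid :: "real \<Rightarrow> real \<Rightarrow> real" where
  "next_grid h s = real_of_int \<lceil>s / h\<rceil> * h"

lemma next_grid_bounds:
  assumes "h > 0" shows "s \<le> next_grid h s" "next_grid h s < s + h"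
proof -
  have "s = s / h * h" using assms by simp
  also have "\<dots> \<le> real_of_int \<lceil>s / h\<rceil> * h" using assms by (intro mult_right_mono) auto
  finally show "s \<le> next_grid h s" by (simp add: next_grid_def)
  have "real_of_int \<lceil>s / h\<rceil> * h < (s / h + 1) * h"
    using assms ceiling_correct[of "s / h"] by (intro mult_strict_right_mono) linarith+
  also have "\<dots> = s + h" using assms by (simp add: distrib_right)
  finally show "next_grid h s < s + h" by (simp add: next_grid_def)
qed

lemma next_grid_cell:
  assumes "h > 0" "real k * h < s" "s \<le> real (Suc k) * h"
  shows "next_grid h s = real (Suc k) * h"
proof -
  have "\<lceil>s / h\<rceil> = int (Suc k)"
    using assms by (intro ceiling_unique) (auto simp: pos_less_divide_eq pos_divide_le_eq)
  then show ?thesis by (simp add: next_grid_def)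
qed

lemma next_grid_tendsto:
  "(\<lambda>n. next_grid (T / real (Suc n)) s) \<longlonglongrightarrow> s" if "T > 0"
proof (rule tendsto_sandwich[OF _ _ tendsto_const])
  show "\<forall>\<^sub>F n in sequentially. s \<le> next_grid (T / real (Suc n)) s"
    using that by (intro always_eventually allI next_grid_bounds) auto
  show "\<forall>\<^sub>F n in sequentially. next_grid (T / real (Suc n)) s \<le> s + T / real (Suc n)"
    using that by (intro always_eventually allI less_imp_le next_grid_bounds) auto
  have "(\<lambda>n. s + T * inverse (real (Suc n))) \<longlonglongrightarrow> s + T * 0"
    by (intro tendsto_intros LIMSEQ_inverse_real_of_nat)
  then show "(\<lambda>n. s + T / real (Suc n)) \<longlonglongrightarrow> s" by (simp add: divide_inverse)
qed

lemma right_continuous_next_grid: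
  assumes w: "right_continuous_path w" and "T > 0" "0 \<le> s"
  shows "\<forall>\<^sub>F n in sequentially. w (next_grid (T / real (Suc n)) s) = w s"
proof -
  have "\<forall>\<^sub>F u in at_right s. w u = w s" using w \<open>0 \<le> s\<close> by (auto simp: right_continuous_path_def)
  then obtain c where c: "s < c" "\<And>u. s < u \<Longrightarrow> u < c \<Longrightarrow> w u = w s"
    by (auto simp: eventually_at_right_field)
  have "\<forall>\<^sub>F n in sequentially. next_grid (T / real (Suc n)) s < c"
    using next_grid_tendsto[OF \<open>T > 0\<close>, of s] c(1) by (rule order_tendstoD)
  then show ?thesis
  proof eventually_elim
    case (elim n)
    have "s \<le> next_grid (T / real (Suc n)) s" using assms by (intro next_grid_bounds) auto
    with c(2)[of "next_grid (T / real (Suc n)) s"] elim show ?case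
      by (cases "next_grid (T / real (Suc n)) s = s") auto
  qed
qed

text \<open>The function factors through the integer-valued ceiling, and every function on a
  countable discrete space is measurable.\<close>

lemma measurable_next_grid_path [measurable]:
  "(\<lambda>s. w (next_grid h s)) \<in> measurable borel (count_space UNIV)"
proof -
  have "(\<lambda>s. \<lceil>s / h\<rceil>) \<in> measurable borel (count_space UNIV)" by measurable
  then have "(\<lambda>k. w (real_of_int k * h)) \<circ> (\<lambda>s. \<lceil>s / h\<rceil>) \<in> measurable borel (count_space UNIV)"
    by (rule measurable_comp) simp
  then show ?thesis by (simp add: o_def next_grid_def)
qed

text \<open>By right-continuity the path is a pointwise, eventually constant limit of step functions
  on grids, so its level sets are lower limits of measurable sets.\<close>

lemma right_continuous_path_sets:
  fixes w :: "real \<Rightarrow> 's"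
  assumes w: "right_continuous_path w"
  shows "{s. 0 < s \<and> w s = k} \<in> sets borel"
proof -
  have "{s. 0 < s \<and> w s = k} = {s \<in> space borel. 0 < s \<and> (\<exists>N. \<forall>n\<ge>N. w (next_grid (1 / real (Suc n)) s) = k)}"
  proof -
    have "w s = k \<longleftrightarrow> (\<exists>N. \<forall>n\<ge>N. w (next_grid (1 / real (Suc n)) s) = k)" if s: "0 < s" for s
    proof -
      obtain N where N: "\<And>n. n \<ge> N \<Longrightarrow> w (next_grid (1 / real (Suc n)) s) = w s"
        using right_continuous_next_grid[OF w, of 1 s] s by (auto simp: eventually_sequentially)
      show ?thesis
      proof
        assume "w s = k"
        then show "\<exists>N. \<forall>n\<ge>N. w (next_grid (1 / real (Suc n)) s) = k" using N by blast
      next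
        assume "\<exists>N. \<forall>n\<ge>N. w (next_grid (1 / real (Suc n)) s) = k"
        then obtain N' where "w (next_grid (1 / real (Suc (max N N'))) s) = k" by (meson max.cobounded2)
        then show "w s = k" using N[of "max N N'"] by simp
      qed
    qed
    then show ?thesis by auto
  qed
  also have "\<dots> \<in> sets borel" by measurable
  finally show ?thesis .
qed

text \<open>Each fixed s leaves the sets \<open>E n\<close> eventually, by right-continuity at s;
  dominated convergence turns this into vanishing measure.\<close>

lemma grid_mismatch_tendsto_0:
  fixes w :: "real \<Rightarrow> 's::finite"
  assumes w: "right_continuous_path w" and T: "T > 0"
  defines "E \<equiv> \<lambda>n. {s. 0 < s \<and> w s \<noteq> w (next_grid (T / real (Suc n)) s)}"
  shows "E n \<in> sets borel"
    and "(\<lambda>n. measure lborel ({0<..T} \<inter> E n)) \<longlonglongrightarrow> 0"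
proof -
  note [measurable] = right_continuous_path_sets[OF w]
  show E: "E n \<in> sets borel" for n
  proof -
    have "E n = (\<Union>k. {s. 0 < s \<and> w s = k} - {s \<in> space borel. w (next_grid (T / real (Suc n)) s) = k})"
      by (auto simp: E_def)
    also have "\<dots> \<in> sets borel" by measurable
    finally show ?thesis .
  qed
  have "(\<lambda>n. \<integral>s. indicator ({0<..T} \<inter> E n) s \<partial>lborel) \<longlonglongrightarrow> (\<integral>s. (0::real) \<partial>(lborel :: real measure))"
  proof (rule integral_dominated_convergence[where w = "indicator {0<..T}"])
    show "AE s in lborel. (\<lambda>n. indicator ({0<..T} \<inter> E n) s) \<longlonglongrightarrow> (0::real)"
    proof (rule AE_I2)
      fix s :: real
      show "(\<lambda>n. indicator ({0<..T} \<inter> E n) s) \<longlonglongrightarrow> (0::real)"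
      proof (cases "s > 0")
        case True
        have "\<forall>\<^sub>F n in sequentially. indicator ({0<..T} \<inter> E n) s = (0::real)"
          using right_continuous_next_grid[OF w T, of s] True
          by (auto elim!: eventually_mono simp: E_def indicator_def)
        then show ?thesis by (rule tendsto_eventually)
      qed (simp add: indicator_def)
    qed
  next
    show "integrable lborel (indicat_real {0<..T})" using T by (intro integrable_real_indicator) (auto simp: emeasure_lborel_Ioc)
  qed (use E in \<open>auto simp: indicator_def\<close>)
  then show "(\<lambda>n. measure lborel ({0<..T} \<inter> E n)) \<longlonglongrightarrow> 0" by simp
qed

context switched_inclusion begin

text \<open>On each cell the solution is compared with the flow of the state at the right end of the
  cell. The errors add up to the total time during which the path differs from the state used by the
  grid, amplified by at most \<open>exp (b * T)\<close>.\<close>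

lemma grid_flow_converges:
  assumes w: "right_continuous_path w"
    and cont: "continuous_on {0..} \<eta>"
    and sol: "\<And>t u. 0 \<le> t \<Longrightarrow> t < u \<Longrightarrow> (\<forall>v\<in>{t..<u}. w v = w t) \<Longrightarrow> solves_inclusion (F (w t)) t u \<eta>"
    and T: "0 \<le> T"
  shows "(\<lambda>n. grid_flow flow (T / real (Suc n)) (Suc n) (\<eta> 0) w) \<longlonglongrightarrow> \<eta> T"
proof (cases "T = 0")
  case True
  have flow0: "flow j 0 x = x" for j x
  proof -
    obtain f where "f 0 = x" "solves_inclusion (F j) 0 0 f" using solvable[of 0 x j] by auto
    then show ?thesis using flow_eq[of 0 j f] by simp
  qed
  have "grid_flow flow 0 m x w = x" for m x by (induction m) (simp_all add: flow0)
  then show ?thesis using True by (simp del: grid_flow.simps)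
next
  case False
  then have T: "T > 0" using T by simp
  have "compact ((\<lambda>t. norm (\<eta> t)) ` {0..T})"
    by (intro compact_continuous_image continuous_intros continuous_on_subset[OF cont]) auto
  then obtain \<rho>0 where \<rho>0: "\<And>t. t \<in> {0..T} \<Longrightarrow> norm (\<eta> t) \<le> \<rho>0"
    by (force dest: compact_imp_bounded simp: bounded_real)
  \<comment> \<open>Taking the maximum with R keeps the comparison curves in the same ball as the
    solution, by \<open>solves_norm_le\<close>.\<close>
  define \<rho> where "\<rho> = max \<rho>0 R"
  have \<rho>: "norm (\<eta> t) \<le> \<rho>" if "0 \<le> t" "t \<le> T" for t using \<rho>0[of t] that by (auto simp: \<rho>_def)
  obtain C where C: "C \<ge> 0" "\<And>k x v. norm x \<le> \<rho> \<Longrightarrow> v \<in> F k x \<Longrightarrow> norm v \<le> C"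
    using locally_bounded[of \<rho>] by blast
  define E where "E n = {s. 0 < s \<and> w s \<noteq> w (next_grid (T / real (Suc n)) s)}" for n
  have E: "E n \<in> sets borel" for n
    unfolding E_def using grid_mismatch_tendsto_0(1)[OF w T] .
  define m where "m n u = measure lborel ({0<..u} \<inter> E n)" for n u
  have fm0: "{t<..u} \<in> fmeasurable lborel" for t u :: real
    by (rule fmeasurableI2[OF fmeasurable_cbox[of t u]]) auto
  have fm: "{t<..u} \<inter> E n \<in> fmeasurable lborel" for t u n
    using E by (intro fmeasurable_Int_fmeasurable[OF fm0]) auto
  have m_diff: "m n u - m n t = measure lborel ({t<..u} \<inter> E n)" if "0 \<le> t" "t \<le> u" for n t u
  proof -
    have "{0<..u} \<inter> E n = ({0<..t} \<inter> E n) \<union> ({t<..u} \<inter> E n)" using that by auto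
    then have "m n u = measure lborel ({0<..t} \<inter> E n) + measure lborel ({t<..u} \<inter> E n)"
      unfolding m_def using fm[of 0 t n] fm[of t u n]
      by (auto simp: fmeasurable_def intro!: measure_Union)
    then show ?thesis by (simp add: m_def)
  qed
  have m_mono: "m n t \<le> m n u" if "0 \<le> t" "t \<le> u" for n t u
    using m_diff[OF that, of n] measure_nonneg[of lborel "{t<..u} \<inter> E n"] by linarith
  have main: "norm (\<eta> (real k * (T / real (Suc n))) - grid_flow flow (T / real (Suc n)) k (\<eta> 0) w)
      \<le> exp (b * (real k * (T / real (Suc n)))) * (2 * C * m n (real k * (T / real (Suc n))))"
    if "k \<le> Suc n" for k n
    using that
  proof (induction k)
    case 0
    then show ?case by (simp add: m_def)
  next
    case (Suc k)
    define h where "h = T / real (Suc n)"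
    have h: "h > 0" "real (Suc n) * h = T" using T by (auto simp: h_def)
    define p q where "p = real k * h" and "q = real (Suc k) * h"
    have pq: "0 \<le> p" "p \<le> q" "q - p = h" "q = p + h" using h by (auto simp: p_def q_def algebra_simps)
    have "q \<le> real (Suc n) * h" unfolding q_def using Suc.prems h by (intro mult_right_mono) auto
    then have qT: "q \<le> T" using h by simp
    let ?Y = "grid_flow flow h k (\<eta> 0) w"
    let ?j = "w q"
    obtain f where f: "f 0 = ?Y" "solves_inclusion (F ?j) 0 h f" using solvable[of h ?Y ?j] h by auto
    define y where "y t = f (t - p)" for t
    have y: "solves_inclusion (F ?j) p q y"
      using solves_inclusion_unshift[OF f(2), of p] by (simp add: y_def[abs_def] pq)
    have yp: "y p = ?Y" by (simp add: y_def f)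
    have yq: "y q = grid_flow flow h (Suc k) (\<eta> 0) w"
    proof -
      have "flow ?j h ?Y = f h" using flow_eq[OF _ f(2)] h f(1) by simp
      then show ?thesis unfolding y_def pq(3) by (simp add: q_def)
    qed
    have nY: "norm ?Y \<le> \<rho>"
      using grid_flow_norm_le[of h k "\<eta> 0" w] h \<rho>[of 0] T by (auto simp: \<rho>_def)
    have "norm (\<eta> q - y q) \<le> exp (b * (q - p)) * (norm (\<eta> p - y p) + 2 * C * (m n q - m n p))"
    proof (rule compare_with_constant_state[where w = w and j = ?j and \<rho> = \<rho>])
      show "\<exists>\<delta>>0. \<forall>u\<in>{t..<t + \<delta>}. w u = w t" if "p \<le> t" for t
      proof -
        have "\<forall>\<^sub>F u in at_right t. w u = w t" using w that pq by (auto simp: right_continuous_path_def)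
        then obtain c where c: "t < c" "\<And>u. t < u \<Longrightarrow> u < c \<Longrightarrow> w u = w t"
          by (auto simp: eventually_at_right_field)
        have "w u = w t" if "u \<in> {t..<t + (c - t)}" for u
          using c(2)[of u] that by (cases "u = t") auto
        moreover have "c - t > 0" using c(1) by simp
        ultimately show ?thesis by blast
      qed
      show "continuous_on {p..q} \<eta>" using pq by (intro continuous_on_subset[OF cont]) auto
      show "norm (y t) \<le> \<rho>" if "p \<le> t" "t \<le> q" for t
        using solves_norm_le[OF that(1) solves_inclusion_subinterval[OF y order_refl that(2)]] nY yp
        by (auto simp: \<rho>_def)
      show "norm (\<eta> t) \<le> \<rho>" if "p \<le> t" "t \<le> q" for t using that pq qT by (intro \<rho>) auto
      show "m n t \<le> m n u" if "p \<le> t" "t \<le> u" for t u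
        using that pq(1) by (intro m_mono) auto
      show "u - t \<le> m n u - m n t" if tu: "p \<le> t" "t \<le> u" "u \<le> q" and neq: "\<forall>v\<in>{t..<u}. w v \<noteq> ?j" for t u
      proof -
        have "{t<..<u} \<subseteq> {t<..u} \<inter> E n"
        proof
          fix v assume v: "v \<in> {t<..<u}"
          \<comment> \<open>All interior points of the cell are rounded up to its right end q, so
            differing from the state at q is precisely membership in \<open>E n\<close>.\<close>
          then have "next_grid h v = real (Suc k) * h" using tu h by (intro next_grid_cell) (auto simp: p_def q_def)
          then have "next_grid (T / real (Suc n)) v = q" by (simp only: h_def q_def)
          then show "v \<in> {t<..u} \<inter> E n" using v neq tu(1) pq(1) by (auto simp: E_def simp del: of_nat_Suc)
        qed
        then have "measure lborel {t<..<u} \<le> measure lborel ({t<..u} \<inter> E n)"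
          using E fm by (intro measure_mono_fmeasurable) auto
        then show ?thesis using m_diff[of t u n] tu pq by simp
      qed
      show "solves_inclusion (F (w t)) t u \<eta>"
        if "p \<le> t" "t < u" "u \<le> q" "\<forall>v\<in>{t..<u}. w v = w t" for t u
        by (rule sol[OF _ that(2) that(4)]) (use that(1) pq(1) in linarith)
      show "norm v \<le> C" if "norm x \<le> \<rho>" "v \<in> F k x" for k x v using C(2)[OF that] .
    qed (rule pq(2) y C(1))+
    also have "\<dots> \<le> exp (b * h) * (exp (b * p) * (2 * C * m n p) + exp (b * p) * (2 * C * (m n q - m n p)))"
    proof -
      have "norm (\<eta> p - y p) \<le> exp (b * p) * (2 * C * m n p)"
        using Suc.IH[folded h_def, folded p_def] Suc.prems yp by simp
      moreover have "2 * C * (m n q - m n p) \<le> exp (b * p) * (2 * C * (m n q - m n p))"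
      proof -
        have "0 \<le> m n q - m n p" using m_mono[OF pq(1,2), of n] by simp
        then show ?thesis
          using mult_right_mono[of 1 "exp (b * p)" "2 * C * (m n q - m n p)"] C(1) kb pq by simp
      qed
      ultimately show ?thesis unfolding pq(3) by (intro mult_left_mono add_mono) simp_all
    qed
    also have "\<dots> = exp (b * q) * (2 * C * m n q)"
      unfolding pq(4) by (simp add: distrib_left exp_add algebra_simps)
    finally show ?case unfolding yq unfolding q_def h_def .
  qed
  have "(\<lambda>n. exp (b * T) * (2 * C * m n T)) \<longlonglongrightarrow> exp (b * T) * (2 * C * 0)"
    unfolding m_def E_def by (intro tendsto_intros grid_mismatch_tendsto_0(2)[OF w T])
  then have lim0: "(\<lambda>n. exp (b * T) * (2 * C * m n T)) \<longlonglongrightarrow> 0" by simp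
  have "(\<lambda>n. grid_flow flow (T / real (Suc n)) (Suc n) (\<eta> 0) w - \<eta> T) \<longlonglongrightarrow> 0"
  proof (rule Lim_null_comparison[OF always_eventually lim0], rule allI)
    fix n
    have "real (Suc n) * (T / real (Suc n)) = T" by (simp del: of_nat_Suc)
    with main[of "Suc n" n]
    have "norm (\<eta> T - grid_flow flow (T / real (Suc n)) (Suc n) (\<eta> 0) w) \<le> exp (b * T) * (2 * C * m n T)"
      by (simp only: order_refl)
    then show "norm (grid_flow flow (T / real (Suc n)) (Suc n) (\<eta> 0) w - \<eta> T) \<le> exp (b * T) * (2 * C * m n T)"
      by (metis norm_minus_commute)
  qed
  then show ?thesis by (simp add: LIM_zero_iff)
qed

text \<open>Restarting at time s from the value reached there follows the same solution. On path
  space this becomes the cocycle property.\<close>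

lemma grid_flow_converges_shifted:
  assumes w: "right_continuous_path w"
    and cont: "continuous_on {0..} \<eta>"
    and sol: "\<And>t u. 0 \<le> t \<Longrightarrow> t < u \<Longrightarrow> (\<forall>v\<in>{t..<u}. w v = w t) \<Longrightarrow> solves_inclusion (F (w t)) t u \<eta>"
    and sT: "0 \<le> s" "0 \<le> T"
  shows "(\<lambda>n. grid_flow flow (T / real (Suc n)) (Suc n) (\<eta> s) (\<lambda>u. w (s + u))) \<longlonglongrightarrow> \<eta> (s + T)"
proof -
  have "(\<lambda>n. grid_flow flow (T / real (Suc n)) (Suc n) (\<eta> (s + 0)) (\<lambda>u. w (s + u))) \<longlonglongrightarrow> \<eta> (s + T)"
  proof (rule grid_flow_converges[OF _ _ _ sT(2)])
    show "right_continuous_path (\<lambda>u. w (s + u))"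
      unfolding right_continuous_path_def
    proof (intro allI impI)
      fix t :: real assume "0 \<le> t"
      then have "\<forall>\<^sub>F u in at_right (s + t). w u = w (s + t)" using w sT by (auto simp: right_continuous_path_def)
      then obtain c where c: "s + t < c" "\<And>u. s + t < u \<Longrightarrow> u < c \<Longrightarrow> w u = w (s + t)"
        by (auto simp: eventually_at_right_field)
      then show "\<forall>\<^sub>F u in at_right t. w (s + u) = w (s + t)"
        unfolding eventually_at_right_field by (intro exI[of _ "c - s"]) auto
    qed
    show "continuous_on {0..} (\<lambda>u. \<eta> (s + u))"
      by (rule continuous_on_compose2[OF cont]) (use sT in \<open>auto intro!: continuous_intros\<close>)
    fix t u assume tu: "0 \<le> t" "t < u" "\<forall>v\<in>{t..<u}. w (s + v) = w (s + t)"
    have "solves_inclusion (F (w (s + t))) (s + t) (s + u) \<eta>"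
    proof (rule sol)
      show "\<forall>v\<in>{s + t..<s + u}. w v = w (s + t)"
      proof
        fix v assume "v \<in> {s + t..<s + u}"
        then have "v - s \<in> {t..<u}" by auto
        from tu(3)[rule_format, OF this] show "w v = w (s + t)" by simp
      qed
    qed (use tu sT in auto)
    from solves_inclusion_shift[OF this, of s]
    show "solves_inclusion (F (w (s + t))) t u (\<lambda>u. \<eta> (s + u))" by simp
  qed
  then show ?thesis by simp
qed

end

section \<open>Finite-dimensional distributions of the switching process\<close>

text \<open>The entries of the matrix exponential found in
  \<open>mat_exp_switch_rates\<close>.\<close>

definition switch_prob :: "real \<Rightarrow> real \<Rightarrow> 2 \<Rightarrow> 2 \<Rightarrow> real" where
  "switch_prob r t j k = (if j = k then (1 + exp (- 2 * r * t)) / 2 else (1 - exp (- 2 * r * t)) / 2)"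

lemma switch_prob_0 [simp]: "switch_prob r 0 j k = (if j = k then 1 else 0)"
  by (simp add: switch_prob_def)

lemma switch_prob_commute: "switch_prob r t j k = switch_prob r t k j"
  by (simp add: switch_prob_def)

lemma UNIV_2_01: "(UNIV :: 2 set) = {0, 1}"
  using UNIV_2 by auto

lemma sum_UNIV_2: "sum f (UNIV :: 2 set) = f 0 + f (1::2)"
  by (simp add: UNIV_2_01)

lemma sum_switch_prob [simp]: "(\<Sum>k\<in>UNIV. switch_prob r t j k) = 1"
  using UNIV_2_01 by (cases "j = 0") (auto simp: sum_UNIV_2 switch_prob_def field_simps)

text \<open>The first sampling time may be positive; the sum transports the initial law from time 0
  to \<open>t 0\<close>.\<close>

definition fdd :: "real \<Rightarrow> 2 pmf \<Rightarrow> (nat \<Rightarrow> real) \<Rightarrow> (nat \<Rightarrow> 2) \<Rightarrow> nat \<Rightarrow> real" where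
  "fdd r \<mu> t y m = (\<Sum>j\<in>UNIV. pmf \<mu> j * switch_prob r (t 0) j (y 0)) *
     (\<Prod>k<m. switch_prob r (t (Suc k) - t k) (y k) (y (Suc k)))"

text \<open>Initial law and Markov property are merged into one family of formulas, which can be
  checked directly for shifted, refreshed and mixed processes. The paths themselves are left
  unrestricted, so that the coordinate process on path space qualifies too.\<close>

definition switching_process :: "real \<Rightarrow> 2 pmf \<Rightarrow> 'w measure \<Rightarrow> (real \<Rightarrow> 'w \<Rightarrow> 2) \<Rightarrow> bool" where
  "switching_process r \<mu> M W \<longleftrightarrow> prob_space M \<and>
    (\<forall>t\<ge>0. W t \<in> measurable M (count_space UNIV)) \<and>
    (\<forall>m t y. 0 \<le> t 0 \<longrightarrow> mono t \<longrightarrow>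
      measure M {\<omega>\<in>space M. \<forall>k\<le>m. W (t k) \<omega> = y k} = fdd r \<mu> t y m)"

lemma fdd_Suc: "fdd r \<mu> t y (Suc m) = fdd r \<mu> t y m * switch_prob r (t (Suc m) - t m) (y m) (y (Suc m))"
  by (simp add: fdd_def)

lemma fdd_cong:
  assumes "\<And>k. k \<le> m \<Longrightarrow> t k = t' k" "\<And>k. k \<le> m \<Longrightarrow> y k = y' k"
  shows "fdd r \<mu> t y m = fdd r \<mu> t' y' m"
  using assms by (auto simp: fdd_def intro!: arg_cong2[where f = "(*)"] sum.cong prod.cong)

lemma switching_processD:
  assumes "switching_process r \<mu> M W"
  shows "prob_space M" "\<And>t. 0 \<le> t \<Longrightarrow> W t \<in> measurable M (count_space UNIV)"
    "\<And>m t y. 0 \<le> t 0 \<Longrightarrow> mono t \<Longrightarrow>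
      measure M {\<omega>\<in>space M. \<forall>k\<le>m. W (t k) \<omega> = y k} = fdd r \<mu> t y m"
  using assms by (auto simp: switching_process_def)

lemma markov_chain_switching_process:
  assumes mc: "markov_chain (switch_rates r) M i"
    and init: "distr M (count_space UNIV) (i 0) = measure_pmf \<mu>"
  shows "switching_process r \<mu> M i"
proof -
  interpret prob_space M using mc by (simp add: markov_chain_def)
  have meas [measurable]: "i t \<in> measurable M (count_space UNIV)" if "0 \<le> t" for t
    using mc that by (simp add: markov_chain_def)
  have step: "prob {\<omega>\<in>space M. \<forall>k\<le>Suc m. i (t k) \<omega> = y k} =
      prob {\<omega>\<in>space M. \<forall>k\<le>m. i (t k) \<omega> = y k} * switch_prob r (t (Suc m) - t m) (y m) (y (Suc m))"
    if "0 \<le> t 0" "mono t" for m t y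
    using mc that unfolding markov_chain_def mat_exp_switch_rates switch_prob_def by blast
  have p0: "prob {\<omega>\<in>space M. i 0 \<omega> = j} = pmf \<mu> j" for j
  proof -
    have "pmf \<mu> j = measure (distr M (count_space UNIV) (i 0)) {j}" by (simp add: init measure_pmf_single)
    also have "\<dots> = prob (i 0 -` {j} \<inter> space M)" by (rule measure_distr) auto
    also have "i 0 -` {j} \<inter> space M = {\<omega>\<in>space M. i 0 \<omega> = j}" by auto
    finally show ?thesis by simp
  qed
  have "prob {\<omega>\<in>space M. \<forall>k\<le>m. i (t k) \<omega> = y k} = fdd r \<mu> t y m" if t: "0 \<le> t 0" "mono t" for m t y
  proof (induction m)
    case 0
    have "{\<omega>\<in>space M. i (t 0) \<omega> = y 0} = (\<Union>j\<in>UNIV. {\<omega>\<in>space M. i 0 \<omega> = j \<and> i (t 0) \<omega> = y 0})" by auto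
    also have "prob \<dots> = (\<Sum>j\<in>UNIV. prob {\<omega>\<in>space M. i 0 \<omega> = j \<and> i (t 0) \<omega> = y 0})"
    proof (rule finite_measure_finite_Union)
      show "(\<lambda>j. {\<omega> \<in> space M. i 0 \<omega> = j \<and> i (t 0) \<omega> = y 0}) ` UNIV \<subseteq> events"
        using t by auto
    qed (auto simp: disjoint_family_on_def)
    also have "\<dots> = (\<Sum>j\<in>UNIV. pmf \<mu> j * switch_prob r (t 0) j (y 0))"
    proof (rule sum.cong[OF refl])
      fix j :: 2
      \<comment> \<open>The Markov property links consecutive sampling times only, so time 0 is
        inserted before \<open>t 0\<close>.\<close>
      define t' where "t' k = (if k = 0 then 0 else t 0)" for k :: nat
      define y' where "y' k = (if k = 0 then j else y 0)" for k :: nat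
      have "mono t'" "0 \<le> t' 0" using t(1) by (auto simp: t'_def intro!: monoI)
      then have "prob {\<omega>\<in>space M. \<forall>k\<le>Suc 0. i (t' k) \<omega> = y' k} =
          prob {\<omega>\<in>space M. \<forall>k\<le>0. i (t' k) \<omega> = y' k} * switch_prob r (t' (Suc 0) - t' 0) (y' 0) (y' (Suc 0))"
        by (intro step)
      moreover have "(\<forall>k\<le>Suc 0. P k) \<longleftrightarrow> P 0 \<and> P 1" for P
        by (metis One_nat_def le0 le_SucE le_antisym order_refl)
      ultimately show "prob {\<omega> \<in> space M. i 0 \<omega> = j \<and> i (t 0) \<omega> = y 0} = pmf \<mu> j * switch_prob r (t 0) j (y 0)"
        by (simp add: t'_def y'_def p0)
    qed
    finally show ?case by (simp add: fdd_def)
  next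
    case (Suc m)
    then show ?case by (simp only: step[OF t] fdd_Suc)
  qed
  then show ?thesis using meas prob_space_axioms by (simp add: switching_process_def)
qed

section \<open>Path space, uniqueness of the law, and expectations of sampled states\<close>

abbreviation path_space :: "(real \<Rightarrow> 2) measure" where
  "path_space \<equiv> Pi\<^sub>M UNIV (\<lambda>_. count_space UNIV)"

lemma space_path_space [simp]: "space path_space = UNIV"
  by (simp add: space_PiM)

lemma measurable_path_spaceI:
  assumes "\<And>s. (\<lambda>\<omega>. f \<omega> s) \<in> measurable M (count_space UNIV)"
  shows "f \<in> measurable M path_space"
  by (rule measurable_PiM_single') (use assms in auto)

lemma measurable_path_eval [measurable]: "(\<lambda>w. w s) \<in> measurable path_space (count_space UNIV)"
  by (rule measurable_component_singleton) simp

lemma finite_times_enumeration: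
  fixes S :: "real set"
  assumes S: "finite S" "\<And>s. s \<in> S \<Longrightarrow> 0 \<le> s" "S \<noteq> {}"
  obtains t :: "nat \<Rightarrow> real" and m :: nat where "0 \<le> t 0" "mono t" "t ` {..m} = S"
proof -
  define l where "l = sorted_list_of_set S"
  have l: "sorted l" "set l = S" "l \<noteq> []" using S by (auto simp: l_def)
  define m where "m = length l - 1"
  \<comment> \<open>The enumeration stays at its last value beyond m, which keeps it monotone on all
    natural numbers.\<close>
  define t where "t k = l ! min k m" for k
  have len: "length l = Suc m" using l(3) by (cases l) (auto simp: m_def)
  show ?thesis
  proof (rule that[of t m])
    show "mono t" unfolding mono_def t_def
      by (intro allI impI sorted_nth_mono[OF l(1)]) (auto simp: len)
    have "t ` {..m} = (\<lambda>k. l ! k) ` {..m}" by (intro image_cong) (auto simp: t_def)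
    also have "\<dots> = set l" unfolding set_conv_nth by (auto simp: len less_Suc_eq_le)
    finally show "t ` {..m} = S" using l by simp
    then have "t 0 \<in> S" by auto
    then show "0 \<le> t 0" by (rule S(2))
  qed
qed

text \<open>Paths are indexed by all reals, but V is controlled at nonnegative times only; the even
  extension makes every coordinate measurable.\<close>

lemma measurable_path:
  assumes "\<And>t. 0 \<le> t \<Longrightarrow> V t \<in> measurable N (count_space UNIV)"
  shows "(\<lambda>\<omega> s. V \<bar>s\<bar> \<omega>) \<in> measurable N path_space"
  using assms by (intro measurable_path_spaceI) auto

lemma emeasure_law_cylinder:
  fixes A :: "real \<Rightarrow> 2 set"
  assumes N: "prob_space N" "\<And>t. 0 \<le> t \<Longrightarrow> V t \<in> measurable N (count_space UNIV)" and J: "finite J"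
  shows "emeasure (distr N path_space (\<lambda>\<omega> s. V \<bar>s\<bar> \<omega>)) (prod_emb UNIV (\<lambda>_. count_space UNIV) J (Pi\<^sub>E J A)) =
    ennreal (\<Sum>y\<in>Pi\<^sub>E J A. measure N {\<omega>\<in>space N. \<forall>s\<in>J. V \<bar>s\<bar> \<omega> = y s})"
proof -
  interpret prob_space N by (rule N)
  have mp: "(\<lambda>\<omega> s. V \<bar>s\<bar> \<omega>) \<in> measurable N path_space" by (rule measurable_path) (rule N(2))
  have fin: "finite (Pi\<^sub>E J A)" using J by (intro finite_PiE) auto
  have ev: "{\<omega>\<in>space N. \<forall>s\<in>J. V \<bar>s\<bar> \<omega> = y s} \<in> sets N" for y
    proof (rule sets.sets_Collect_finite_All[OF _ J])
        fix s
        have "V \<bar>s\<bar> -` {y s} \<inter> space N \<in> sets N"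
          by (rule measurable_sets[OF N(2)]) auto
        moreover have "V \<bar>s\<bar> -` {y s} \<inter> space N = {\<omega>\<in>space N. V \<bar>s\<bar> \<omega> = y s}" by auto
        ultimately show "{\<omega>\<in>space N. V \<bar>s\<bar> \<omega> = y s} \<in> sets N" by simp
      qed
  have "emeasure (distr N path_space (\<lambda>\<omega> s. V \<bar>s\<bar> \<omega>)) (prod_emb UNIV (\<lambda>_. count_space UNIV) J (Pi\<^sub>E J A)) =
      emeasure N ((\<lambda>\<omega> s. V \<bar>s\<bar> \<omega>) -` (prod_emb UNIV (\<lambda>_. count_space UNIV) J (Pi\<^sub>E J A)) \<inter> space N)"
    by (rule emeasure_distr[OF mp]) (intro sets_PiM_I, auto simp: J)
  also have "(\<lambda>\<omega> s. V \<bar>s\<bar> \<omega>) -` (prod_emb UNIV (\<lambda>_. count_space UNIV) J (Pi\<^sub>E J A)) \<inter> space N =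
      (\<Union>y\<in>Pi\<^sub>E J A. {\<omega>\<in>space N. \<forall>s\<in>J. V \<bar>s\<bar> \<omega> = y s})"
  proof (rule set_eqI)
    fix \<omega>
    have "(\<exists>y\<in>Pi\<^sub>E J A. \<forall>s\<in>J. V \<bar>s\<bar> \<omega> = y s) \<longleftrightarrow> (\<forall>s\<in>J. V \<bar>s\<bar> \<omega> \<in> A s)"
    proof
      assume "\<forall>s\<in>J. V \<bar>s\<bar> \<omega> \<in> A s"
      then show "\<exists>y\<in>Pi\<^sub>E J A. \<forall>s\<in>J. V \<bar>s\<bar> \<omega> = y s"
        by (intro bexI[of _ "\<lambda>s\<in>J. V \<bar>s\<bar> \<omega>"]) auto
    qed auto
    then show "\<omega> \<in> (\<lambda>\<omega> s. V \<bar>s\<bar> \<omega>) -` (prod_emb UNIV (\<lambda>_. count_space UNIV) J (Pi\<^sub>E J A)) \<inter> space N \<longleftrightarrow>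
      \<omega> \<in> (\<Union>y\<in>Pi\<^sub>E J A. {\<omega>\<in>space N. \<forall>s\<in>J. V \<bar>s\<bar> \<omega> = y s})"
      by (auto simp: prod_emb_def restrict_PiE_iff)
  qed
  also have "emeasure N \<dots> = ennreal (prob \<dots>)" by (rule emeasure_eq_measure)
  also have "prob (\<Union>y\<in>Pi\<^sub>E J A. {\<omega>\<in>space N. \<forall>s\<in>J. V \<bar>s\<bar> \<omega> = y s}) =
      (\<Sum>y\<in>Pi\<^sub>E J A. prob {\<omega>\<in>space N. \<forall>s\<in>J. V \<bar>s\<bar> \<omega> = y s})"
  proof (rule finite_measure_finite_Union[OF fin])
    show "disjoint_family_on (\<lambda>y. {\<omega>\<in>space N. \<forall>s\<in>J. V \<bar>s\<bar> \<omega> = y s}) (Pi\<^sub>E J A)"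
      unfolding disjoint_family_on_def
    proof (intro ballI impI)
      fix y z assume yz: "y \<in> Pi\<^sub>E J A" "z \<in> Pi\<^sub>E J A" "y \<noteq> z"
      then obtain s where "s \<in> J" "y s \<noteq> z s" by (metis PiE_ext)
      then show "{\<omega>\<in>space N. \<forall>s\<in>J. V \<bar>s\<bar> \<omega> = y s} \<inter> {\<omega>\<in>space N. \<forall>s\<in>J. V \<bar>s\<bar> \<omega> = z s} = {}" by auto
    qed
  qed (use ev in auto)
  finally show ?thesis .
qed
lemma law_eqI:
  assumes M: "prob_space M" "\<And>t. 0 \<le> t \<Longrightarrow> W t \<in> measurable M (count_space UNIV)"
    and M': "prob_space M'" "\<And>t. 0 \<le> t \<Longrightarrow> W' t \<in> measurable M' (count_space UNIV)"
    and eq: "\<And>(m::nat) t y. 0 \<le> t 0 \<Longrightarrow> mono t \<Longrightarrow>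
      measure M {\<omega>\<in>space M. \<forall>k\<le>m. W (t k) \<omega> = y k} = measure M' {\<omega>\<in>space M'. \<forall>k\<le>m. W' (t k) \<omega> = y k}"
  shows "distr M path_space (\<lambda>\<omega> s. W \<bar>s\<bar> \<omega>) = distr M' path_space (\<lambda>\<omega> s. W' \<bar>s\<bar> \<omega>)"
proof -
  have point: "measure M {\<omega>\<in>space M. \<forall>s\<in>J. W \<bar>s\<bar> \<omega> = y s} = measure M' {\<omega>\<in>space M'. \<forall>s\<in>J. W' \<bar>s\<bar> \<omega> = y s}"
    if J: "finite J" for J and y :: "real \<Rightarrow> 2"
  proof (cases "J = {} \<or> (\<exists>s s'. s \<in> J \<and> s' \<in> J \<and> \<bar>s\<bar> = \<bar>s'\<bar> \<and> y s \<noteq> y s')")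
    case True
    then show ?thesis
    proof
      assume "J = {}"
      then show ?thesis using prob_space.prob_space[OF M(1)]
          prob_space.prob_space[OF M'(1)] by simp
    next
      assume "\<exists>s s'. s \<in> J \<and> s' \<in> J \<and> \<bar>s\<bar> = \<bar>s'\<bar> \<and> y s \<noteq> y s'"
      then obtain s s' where "s \<in> J" "s' \<in> J" "\<bar>s\<bar> = \<bar>s'\<bar>" "y s \<noteq> y s'" by blast
      then have "{\<omega>\<in>space M. \<forall>s\<in>J. W \<bar>s\<bar> \<omega> = y s} = {}" "{\<omega>\<in>space M'. \<forall>s\<in>J. W' \<bar>s\<bar> \<omega> = y s} = {}"
        by (metis (mono_tags, lifting) empty_Collect_eq)+
      then show ?thesis by (simp only: measure_empty)
    qed
  next
    case False
    then have cons: "\<And>s s'. s \<in> J \<Longrightarrow> s' \<in> J \<Longrightarrow> \<bar>s\<bar> = \<bar>s'\<bar> \<Longrightarrow> y s = y s'" and "J \<noteq> {}" by blast+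
    have "finite (abs ` J)" "\<And>s. s \<in> abs ` J \<Longrightarrow> 0 \<le> s" "abs ` J \<noteq> {}" using J \<open>J \<noteq> {}\<close> by auto
    then obtain t :: "nat \<Rightarrow> real" and m where t: "0 \<le> t 0" "mono t" "t ` {..m} = abs ` J"
      by (rule finite_times_enumeration)
    have "\<forall>k. \<exists>s. k \<le> m \<longrightarrow> s \<in> J \<and> \<bar>s\<bar> = t k" using t(3) by (metis atMost_iff image_iff)
    then obtain \<sigma> where \<sigma>: "\<And>k. k \<le> m \<Longrightarrow> \<sigma> k \<in> J \<and> \<bar>\<sigma> k\<bar> = t k" by metis
    have evq: "(\<forall>s\<in>J. v \<bar>s\<bar> = y s) \<longleftrightarrow> (\<forall>k\<le>m. v (t k) = y (\<sigma> k))" for v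
    proof
      assume "\<forall>s\<in>J. v \<bar>s\<bar> = y s" then show "\<forall>k\<le>m. v (t k) = y (\<sigma> k)" using \<sigma> by metis
    next
      assume *: "\<forall>k\<le>m. v (t k) = y (\<sigma> k)"
      show "\<forall>s\<in>J. v \<bar>s\<bar> = y s"
      proof
        fix s assume "s \<in> J"
        then obtain k where "k \<le> m" "\<bar>s\<bar> = t k" using t(3) by (metis atMost_iff image_iff)
        then show "v \<bar>s\<bar> = y s" using * \<sigma>[of k] cons[OF \<open>s \<in> J\<close>, of "\<sigma> k"] by simp
      qed
    qed
    show ?thesis
      using evq[of "\<lambda>s. W s _"] evq[of "\<lambda>s. W' s _"]
        assms(5)[OF t(1,2), of m "\<lambda>k. y (\<sigma> k)"]
      by simp
  qed
  have mp: "(\<lambda>\<omega> s. W \<bar>s\<bar> \<omega>) \<in> measurable M path_space" by (rule measurable_path) (rule M(2))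
  show ?thesis
  proof (rule measure_eqI_PiM_infinite)
    show "finite_measure (distr M path_space (\<lambda>\<omega> s. W \<bar>s\<bar> \<omega>))"
      using prob_space.prob_space_distr[OF M(1) mp]
      by (simp add: prob_space_def)
    fix A :: "real \<Rightarrow> 2 set" and J :: "real set" assume J: "finite J"
    have c1: "emeasure (distr M path_space (\<lambda>\<omega> s. W \<bar>s\<bar> \<omega>)) (prod_emb UNIV (\<lambda>_. count_space UNIV) J (Pi\<^sub>E J A)) =
        ennreal (\<Sum>y\<in>Pi\<^sub>E J A. measure M {\<omega>\<in>space M. \<forall>s\<in>J. W \<bar>s\<bar> \<omega> = y s})"
      by (rule emeasure_law_cylinder[OF M(1) _ J]) (rule M(2))
    have c2: "emeasure (distr M' path_space (\<lambda>\<omega> s. W' \<bar>s\<bar> \<omega>)) (prod_emb UNIV (\<lambda>_. count_space UNIV) J (Pi\<^sub>E J A)) =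
        ennreal (\<Sum>y\<in>Pi\<^sub>E J A. measure M' {\<omega>\<in>space M'. \<forall>s\<in>J. W' \<bar>s\<bar> \<omega> = y s})"
      by (rule emeasure_law_cylinder[OF M'(1) _ J]) (rule M'(2))
    show "emeasure (distr M path_space (\<lambda>\<omega> s. W \<bar>s\<bar> \<omega>)) (prod_emb UNIV (\<lambda>_. count_space UNIV) J (Pi\<^sub>E J A)) =
        emeasure (distr M' path_space (\<lambda>\<omega> s. W' \<bar>s\<bar> \<omega>)) (prod_emb UNIV (\<lambda>_. count_space UNIV) J (Pi\<^sub>E J A))"
      unfolding c1 c2 by (simp only: point[OF J])
  qed simp_all
qed

lemma law_unique:
  assumes M: "switching_process r \<mu> M W" and M': "switching_process r \<mu> M' W'"
  shows "distr M path_space (\<lambda>\<omega> s. W \<bar>s\<bar> \<omega>) = distr M' path_space (\<lambda>\<omega> s. W' \<bar>s\<bar> \<omega>)"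
  by (rule law_eqI) (simp_all add: switching_processD[OF M] switching_processD[OF M'])

text \<open>With finitely many states, a function of finitely many samples is a finite combination
  of indicators. The assumption on H expresses that it only sees the coordinates up to m.\<close>

lemma finite_states_expectation:
  assumes W: "switching_process r \<mu> M W" and t: "0 \<le> t 0" "mono t"
    and H: "\<And>y y'. (\<And>k. k \<le> m \<Longrightarrow> y k = y' k) \<Longrightarrow> H y = H y'"
  shows "(\<integral>\<omega>. H (\<lambda>k. W (t k) \<omega>) \<partial>M) = (\<Sum>y\<in>{..m} \<rightarrow>\<^sub>E UNIV. H y * fdd r \<mu> t y m)"
    and "integrable M (\<lambda>\<omega>. H (\<lambda>k. W (t k) \<omega>) :: real)"
proof -
  interpret prob_space M by (rule switching_processD[OF W])
  let ?E = "\<lambda>y. {\<omega>\<in>space M. \<forall>k\<le>m. W (t k) \<omega> = y k}"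
  have t0: "0 \<le> t k" for k using t by (metis monoD le0 order_trans)
  have E: "?E y \<in> sets M" for y
  proof -
    have "{\<omega>\<in>space M. \<forall>k\<in>{..m}. W (t k) \<omega> = y k} \<in> sets M"
    proof (rule sets.sets_Collect_finite_All)
      fix k
      have "W (t k) -` {y k} \<inter> space M \<in> sets M"
        by (rule measurable_sets[OF switching_processD(2)[OF W t0]]) auto
      moreover have "W (t k) -` {y k} \<inter> space M = {\<omega>\<in>space M. W (t k) \<omega> = y k}" by auto
      ultimately show "{\<omega>\<in>space M. W (t k) \<omega> = y k} \<in> sets M" by simp
    qed simp
    then show ?thesis by (simp only: Ball_def atMost_iff)
  qed
  have fin: "finite ({..m} \<rightarrow>\<^sub>E (UNIV :: 2 set))" by (intro finite_PiE) auto
  have eq: "H (\<lambda>k. W (t k) \<omega>) = (\<Sum>y\<in>{..m} \<rightarrow>\<^sub>E UNIV. H y * indicator (?E y) \<omega>)" if "\<omega> \<in> space M" for \<omega>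
  proof -
    define z where "z = (\<lambda>k\<in>{..m}. W (t k) \<omega>)"
    have z: "z \<in> {..m} \<rightarrow>\<^sub>E UNIV" by (simp add: z_def)
    have "indicator (?E y) \<omega> = (if y = z then 1 else (0::real))" if "y \<in> {..m} \<rightarrow>\<^sub>E UNIV" for y
    proof -
      have "(\<forall>k\<le>m. W (t k) \<omega> = y k) \<longleftrightarrow> y = z"
        using that by (auto simp: z_def fun_eq_iff PiE_def extensional_def)
      then show ?thesis using \<open>\<omega> \<in> space M\<close> by (simp add: indicator_def)
    qed
    then have "(\<Sum>y\<in>{..m} \<rightarrow>\<^sub>E UNIV. H y * indicator (?E y) \<omega>) = (\<Sum>y\<in>{..m} \<rightarrow>\<^sub>E UNIV. if y = z then H y else 0)"
      by (intro sum.cong) auto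
    also have "\<dots> = H z" using z fin by simp
    also have "H z = H (\<lambda>k. W (t k) \<omega>)" by (rule H) (simp add: z_def)
    finally show ?thesis by simp
  qed
  have intE: "integrable M (\<lambda>\<omega>. indicator (?E y) \<omega> :: real)" for y
    by (rule integrable_real_indicator[OF E]) (simp only: emeasure_eq_measure infinity_ennreal_def ennreal_less_top)
  have int: "integrable M (\<lambda>\<omega>. \<Sum>y\<in>{..m} \<rightarrow>\<^sub>E UNIV. H y * indicator (?E y) \<omega>)"
    by (intro Bochner_Integration.integrable_sum integrable_mult_right intE)
  then show "integrable M (\<lambda>\<omega>. H (\<lambda>k. W (t k) \<omega>))"
    by (rule Bochner_Integration.integrable_cong[THEN iffD2, OF refl eq, rotated]) auto
  have "(\<integral>\<omega>. H (\<lambda>k. W (t k) \<omega>) \<partial>M) = (\<integral>\<omega>. (\<Sum>y\<in>{..m} \<rightarrow>\<^sub>E UNIV. H y * indicator (?E y) \<omega>) \<partial>M)"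
    by (intro Bochner_Integration.integral_cong refl eq)
  also have "\<dots> = (\<Sum>y\<in>{..m} \<rightarrow>\<^sub>E UNIV. H y * prob (?E y))"
  proof (subst Bochner_Integration.integral_sum)
    show "integrable M (\<lambda>\<omega>. H y * indicator (?E y) \<omega>)" for y by (rule integrable_mult_right[OF intE])
    have "(\<integral>\<omega>. H y * indicator (?E y) \<omega> \<partial>M) = H y * prob (?E y)" for y
      by (simp only: integral_mult_right_zero Bochner_Integration.integral_indicator sets.Int_space_eq2[OF E[of y]])
    then show "(\<Sum>y\<in>{..m} \<rightarrow>\<^sub>E UNIV. \<integral>\<omega>. H y * indicator (?E y) \<omega> \<partial>M) =
        (\<Sum>y\<in>{..m} \<rightarrow>\<^sub>E UNIV. H y * prob (?E y))" by (simp only:)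
  qed
  finally show "(\<integral>\<omega>. H (\<lambda>k. W (t k) \<omega>) \<partial>M) = (\<Sum>y\<in>{..m} \<rightarrow>\<^sub>E UNIV. H y * fdd r \<mu> t y m)"
    by (simp only: switching_processD(3)[OF W t])
qed

lemma sum_PiE_Suc:
  fixes f :: "(nat \<Rightarrow> 'b::finite) \<Rightarrow> real"
  shows "(\<Sum>y\<in>{..Suc m} \<rightarrow>\<^sub>E UNIV. f y) = (\<Sum>y\<in>{..m} \<rightarrow>\<^sub>E UNIV. \<Sum>l\<in>UNIV. f (y(Suc m := l)))"
proof -
  have "{..Suc m} \<rightarrow>\<^sub>E (UNIV :: 'b set) = (\<lambda>(l, y). y(Suc m := l)) ` (UNIV \<times> ({..m} \<rightarrow>\<^sub>E UNIV))"
    by (simp add: atMost_Suc PiE_insert_eq)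
  moreover have "inj_on (\<lambda>(l, y). y(Suc m := l)) (UNIV \<times> ({..m} \<rightarrow>\<^sub>E (UNIV :: 'b set)))"
    by (rule inj_combinator) simp
  ultimately have "(\<Sum>y\<in>{..Suc m} \<rightarrow>\<^sub>E UNIV. f y) = (\<Sum>(l, y)\<in>UNIV \<times> ({..m} \<rightarrow>\<^sub>E UNIV). f (y(Suc m := l)))"
    by (simp add: sum.reindex o_def case_prod_unfold)
  also have "\<dots> = (\<Sum>l\<in>UNIV. \<Sum>y\<in>{..m} \<rightarrow>\<^sub>E UNIV. f (y(Suc m := l)))"
    by (rule sum.cartesian_product[symmetric])
  also have "\<dots> = (\<Sum>y\<in>{..m} \<rightarrow>\<^sub>E UNIV. \<Sum>l\<in>UNIV. f (y(Suc m := l)))" by (rule sum.swap)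
  finally show ?thesis .
qed

text \<open>Summing out the last state in \<open>fdd\<close> isolates one factor
  \<open>switch_prob\<close>. This is the integrated form of conditioning on the past; H may collect
  any information from the first samples, such as a position or a product of growth factors.\<close>

lemma markov_step:
  fixes g :: "2 \<Rightarrow> 'b \<Rightarrow> real"
  assumes W: "switching_process r \<mu> M W" and t: "0 \<le> t 0" "mono t"
    and H: "\<And>y y'. (\<And>k. k \<le> m \<Longrightarrow> y k = y' k) \<Longrightarrow> H y = H y'"
  shows "(\<integral>\<omega>. g (W (t (Suc m)) \<omega>) (H (\<lambda>k. W (t k) \<omega>)) \<partial>M) =
    (\<integral>\<omega>. (\<Sum>l\<in>UNIV. switch_prob r (t (Suc m) - t m) (W (t m) \<omega>) l * g l (H (\<lambda>k. W (t k) \<omega>))) \<partial>M)"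
proof -
  have 1: "(\<integral>\<omega>. (\<lambda>y. g (y (Suc m)) (H y)) (\<lambda>k. W (t k) \<omega>) \<partial>M) =
      (\<Sum>y\<in>{..Suc m} \<rightarrow>\<^sub>E UNIV. g (y (Suc m)) (H y) * fdd r \<mu> t y (Suc m))"
    using H by (intro finite_states_expectation(1)[OF W t]) (metis le_SucI order_refl)
  have 2: "(\<integral>\<omega>. (\<lambda>y. \<Sum>l\<in>UNIV. switch_prob r (t (Suc m) - t m) (y m) l * g l (H y)) (\<lambda>k. W (t k) \<omega>) \<partial>M) =
      (\<Sum>y\<in>{..m} \<rightarrow>\<^sub>E UNIV. (\<Sum>l\<in>UNIV. switch_prob r (t (Suc m) - t m) (y m) l * g l (H y)) * fdd r \<mu> t y m)"
    using H by (intro finite_states_expectation(1)[OF W t]) (metis order_refl)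
  have "g ((y(Suc m := l)) (Suc m)) (H (y(Suc m := l))) * fdd r \<mu> t (y(Suc m := l)) (Suc m) =
      switch_prob r (t (Suc m) - t m) (y m) l * g l (H y) * fdd r \<mu> t y m" for y l
  proof -
    have "H (y(Suc m := l)) = H y" by (rule H) auto
    moreover have "fdd r \<mu> t (y(Suc m := l)) m = fdd r \<mu> t y m" by (rule fdd_cong) auto
    ultimately show ?thesis by (simp add: fdd_Suc)
  qed
  then show ?thesis using 1 2 by (simp add: sum_PiE_Suc sum_distrib_right del: fun_upd_apply)
qed

section \<open>Reversal and refreshment of the switching process\<close>

abbreviation uniform2 :: "2 pmf" where "uniform2 \<equiv> pmf_of_set UNIV"

lemma pmf_uniform2: "pmf uniform2 j = 1 / 2"
  by (simp add: pmf_of_set)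

text \<open>Symmetry turns column sums of the transition matrix into row sums, which are 1. So the
  uniform law is stationary and only time differences remain.\<close>

lemma fdd_uniform2:
  "fdd r uniform2 t y m = 1 / 2 * (\<Prod>k<m. switch_prob r (t (Suc k) - t k) (y k) (y (Suc k)))"
proof -
  have "(\<Sum>j\<in>UNIV. pmf uniform2 j * switch_prob r (t 0) j (y 0)) = 1 / 2 * (\<Sum>j\<in>UNIV. switch_prob r (t 0) (y 0) j)"
    unfolding sum_distrib_left by (intro sum.cong) (simp_all add: pmf_uniform2 switch_prob_commute)
  then show ?thesis by (simp add: fdd_def)
qed

lemma fdd_return_pmf:
  "fdd r (return_pmf j) t y m = switch_prob r (t 0) j (y 0) * (\<Prod>k<m. switch_prob r (t (Suc k) - t k) (y k) (y (Suc k)))"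
proof -
  have "(\<Sum>k\<in>UNIV. pmf (return_pmf j) k * switch_prob r (t 0) k (y 0)) =
      (\<Sum>k\<in>UNIV. if k = j then switch_prob r (t 0) k (y 0) else 0)"
    by (intro sum.cong) (auto simp: pmf_return indicator_def)
  then show ?thesis by (simp add: fdd_def)
qed

lemma fdd_mixture: "fdd r \<mu> t y m = (\<Sum>j\<in>UNIV. pmf \<mu> j * fdd r (return_pmf j) t y m)"
  unfolding fdd_return_pmf by (simp add: fdd_def sum_distrib_right mult.assoc)

lemma switching_process_shift:
  assumes W: "switching_process r uniform2 M W" and s: "0 \<le> s"
  shows "switching_process r uniform2 M (\<lambda>t. W (s + t))"
  unfolding switching_process_def
proof (intro conjI allI impI)
  show "prob_space M" by (rule switching_processD[OF W])
  show "W (s + t) \<in> measurable M (count_space UNIV)" if "0 \<le> t" for t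
    using that s by (intro switching_processD(2)[OF W]) simp
  fix m and t :: "nat \<Rightarrow> real" and y assume t: "0 \<le> t 0" "mono t"
  have "measure M {\<omega>\<in>space M. \<forall>k\<le>m. W (s + t k) \<omega> = y k} = fdd r uniform2 (\<lambda>k. s + t k) y m"
    using t s by (intro switching_processD(3)[OF W]) (auto simp: mono_def)
  then show "measure M {\<omega>\<in>space M. \<forall>k\<le>m. W (s + t k) \<omega> = y k} = fdd r uniform2 t y m"
    by (simp add: fdd_uniform2)
qed

text \<open>Symmetric rates make the stationary switching process reversible.\<close>

lemma reversed_law:
  assumes W: "switching_process r uniform2 M W" and T: "0 \<le> T"
  shows "distr M path_space (\<lambda>\<omega> s. W (T - min \<bar>s\<bar> T) \<omega>) = distr M path_space (\<lambda>\<omega> s. W (min \<bar>s\<bar> T) \<omega>)"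
proof (rule law_eqI[of M "\<lambda>s. W (T - min s T)" M "\<lambda>s. W (min s T)"])
  show "prob_space M" by (rule switching_processD[OF W])
  show "prob_space M" by (rule switching_processD[OF W])
  show "W (T - min t T) \<in> measurable M (count_space UNIV)" if "0 \<le> t" for t
    by (rule switching_processD(2)[OF W]) simp
  show "W (min t T) \<in> measurable M (count_space UNIV)" if "0 \<le> t" for t
    using that T by (intro switching_processD(2)[OF W]) simp
  fix m :: nat and t :: "nat \<Rightarrow> real" and y :: "nat \<Rightarrow> 2" assume t: "0 \<le> t 0" "mono t"
  \<comment> \<open>Both paths are frozen from time T on, so sampling times beyond T collapse to T.
    Reversal then reads the sampled states in opposite order at the times \<open>t2\<close>.\<close>
  define t1 where "t1 k = min (t k) T" for k
  define t2 where "t2 k = T - t1 (m - k)" for k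
  have t1: "0 \<le> t1 0" using t T by (simp add: t1_def)
  have "mono t1" unfolding t1_def by (intro monoI min.mono monoD[OF t(2)]) auto
  note t1 = t1 this
  have t2: "0 \<le> t2 0" "mono t2"
    using t1(2) unfolding t2_def mono_def by (auto simp: t1_def intro: diff_le_mono2)
  have "measure M {\<omega>\<in>space M. \<forall>k\<le>m. W (T - t1 k) \<omega> = y k} =
      measure M {\<omega>\<in>space M. \<forall>k\<le>m. W (t2 k) \<omega> = y (m - k)}"
  proof -
    have "(\<forall>k\<le>m. P k (T - t1 k)) \<longleftrightarrow> (\<forall>k\<le>m. P (m - k) (t2 k))" for P
    proof
      assume "\<forall>k\<le>m. P k (T - t1 k)" then show "\<forall>k\<le>m. P (m - k) (t2 k)" by (simp add: t2_def)
    next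
      assume *: "\<forall>k\<le>m. P (m - k) (t2 k)"
      show "\<forall>k\<le>m. P k (T - t1 k)"
      proof (intro allI impI)
        fix k assume "k \<le> m"
        with *[rule_format, of "m - k"] show "P k (T - t1 k)" by (simp add: t2_def)
      qed
    qed
    from this[of "\<lambda>k s. W s _ = y k"] show ?thesis by simp
  qed
  also have "\<dots> = fdd r uniform2 t2 (\<lambda>k. y (m - k)) m"
    by (rule switching_processD(3)[OF W t2])
  also have "\<dots> = fdd r uniform2 t1 y m"
  proof -
    have "(\<Prod>k<m. switch_prob r (t2 (Suc k) - t2 k) (y (m - k)) (y (m - Suc k))) =
        (\<Prod>k<m. (\<lambda>k. switch_prob r (t1 (Suc k) - t1 k) (y k) (y (Suc k))) (m - Suc k))"
    proof (rule prod.cong[OF refl])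
      fix k assume "k \<in> {..<m}"
      then have "Suc (m - Suc k) = m - k" by auto
      then show "switch_prob r (t2 (Suc k) - t2 k) (y (m - k)) (y (m - Suc k)) =
          (\<lambda>k. switch_prob r (t1 (Suc k) - t1 k) (y k) (y (Suc k))) (m - Suc k)"
        by (simp add: t2_def switch_prob_commute)
    qed
    then show ?thesis
      using prod.nat_diff_reindex[of "\<lambda>k. switch_prob r (t1 (Suc k) - t1 k) (y k) (y (Suc k))" m]
      by (simp add: fdd_uniform2)
  qed
  also have "\<dots> = measure M {\<omega>\<in>space M. \<forall>k\<le>m. W (t1 k) \<omega> = y k}"
    by (rule switching_processD(3)[OF W t1, symmetric])
  finally show "measure M {\<omega>\<in>space M. \<forall>k\<le>m. W (T - min (t k) T) \<omega> = y k} =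
      measure M {\<omega>\<in>space M. \<forall>k\<le>m. W (min (t k) T) \<omega> = y k}"
    unfolding t1_def .
qed

text \<open>The rate is read off from \<open>switch_prob\<close>: a row at time t is the mixture of
  staying, with weight \<open>exp (- 2 * r * t)\<close>, and of the uniform law, with the
  complementary weight.\<close>

definition refresh_time :: "real \<Rightarrow> real measure" where
  "refresh_time r = density lborel (exponential_density (2 * r))"

lemma refresh_time:
  assumes "r > 0"
  shows "prob_space (refresh_time r)" "sets (refresh_time r) = sets borel" "space (refresh_time r) = UNIV"
    "0 \<le> a \<Longrightarrow> measure (refresh_time r) {a<..} = exp (- 2 * r * a)"
proof -
  interpret prob_space "refresh_time r"
    unfolding refresh_time_def using assms by (intro prob_space_exponential_density) simp
  show "prob_space (refresh_time r)" by (rule prob_space_axioms)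
  show s: "sets (refresh_time r) = sets borel" "space (refresh_time r) = UNIV"
    by (simp_all add: refresh_time_def)
  have D: "distributed (refresh_time r) lborel (\<lambda>x. x) (exponential_density (2 * r))"
  proof -
    have "distr (refresh_time r) lborel (\<lambda>x. x) = refresh_time r"
      by (rule distr_id2) (simp add: refresh_time_def)
    then show ?thesis using assms
      by (auto simp: distributed_def refresh_time_def exponential_density_def)
  qed
  show "measure (refresh_time r) {a<..} = exp (- 2 * r * a)" if "0 \<le> a"
    using exponential_distributedD_gt[OF D that] s assms by (simp add: greaterThan_def algebra_simps)
qed

lemma integral_refresh_time_gt:
  assumes "r > 0" "0 \<le> a"
  shows "(\<integral>\<tau>. c * indicator {a<..} \<tau> \<partial>refresh_time r) = c * exp (- 2 * r * a)"
    and "integrable (refresh_time r) (\<lambda>\<tau>. c * indicator {a<..} \<tau> :: real)"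
proof -
  interpret prob_space "refresh_time r" by (rule refresh_time[OF assms(1)])
  show "(\<integral>\<tau>. c * indicator {a<..} \<tau> \<partial>refresh_time r) = c * exp (- 2 * r * a)"
    using refresh_time(4)[OF assms] refresh_time(3)[OF assms(1)] by simp
  show "integrable (refresh_time r) (\<lambda>\<tau>. c * indicator {a<..} \<tau> :: real)"
    using refresh_time(2)[OF assms(1)]
    by (intro integrable_mult_right integrable_real_indicator) (auto simp: emeasure_eq_measure)
qed

definition refreshed :: "2 \<Rightarrow> (real \<Rightarrow> 'w \<Rightarrow> 2) \<Rightarrow> real \<Rightarrow> 'w \<times> real \<Rightarrow> 2" where
  "refreshed j W t z = (if t < snd z then j else W t (fst z))"

text \<open>
  A symmetric switching process can be read as one that forgets its state at rate \<open>2 * r\<close>: before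
  the first refresh it sits in its initial state, afterwards it follows a stationary copy that does
  not depend on that initial state.
\<close>

lemma switching_process_refreshed:
  assumes r: "r > 0" and W: "switching_process r uniform2 M W"
  shows "switching_process r (return_pmf j) (M \<Otimes>\<^sub>M refresh_time r) (refreshed j W)"
proof -
  let ?D = "refresh_time r" and ?N = "M \<Otimes>\<^sub>M refresh_time r"
  interpret M: prob_space M by (rule switching_processD[OF W])
  interpret D: prob_space ?D by (rule refresh_time[OF r])
  interpret pair_prob_space M ?D ..
  have sD [measurable_cong]: "sets ?D = sets borel" by (rule refresh_time[OF r])
  have WM [measurable]: "W t \<in> measurable M (count_space UNIV)" if "0 \<le> t" for t
    using switching_processD(2)[OF W that] .
  have mR: "refreshed j W t \<in> measurable ?N (count_space UNIV)" if [arith]: "0 \<le> t" for t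
    unfolding refreshed_def using WM[OF that] by measurable
  \<comment> \<open>The probability of the sampled states given that the refresh happens at \<tau>;
    integrating over \<tau> has to reproduce \<open>fdd\<close>.\<close>
  define p where "p t y m \<tau> = (\<integral>\<omega>. (if \<forall>k\<le>m. refreshed j W (t k) (\<omega>, \<tau>) = y k then 1 else (0::real)) \<partial>M)"
    for t :: "nat \<Rightarrow> real" and y :: "nat \<Rightarrow> 2" and m :: nat and \<tau> :: real
  have slice: "measure ?N {z\<in>space ?N. \<forall>k\<le>m. refreshed j W (t k) z = y k} = (\<integral>\<tau>. p t y m \<tau> \<partial>?D)"
    "integrable ?D (p t y m)" if t: "0 \<le> t 0" "mono t" for t :: "nat \<Rightarrow> real" and y m
  proof -
    have t0: "0 \<le> t k" for k using t by (metis monoD le0 order_trans)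
    define f :: "'a \<times> real \<Rightarrow> real" where "f z = (if \<forall>k\<le>m. refreshed j W (t k) z = y k then 1 else 0)" for z
    have "Measurable.pred ?N (\<lambda>z. \<forall>k\<in>{..m}. refreshed j W (t k) z = y k)"
    proof (rule pred_intros_finite(3))
      fix k show "Measurable.pred ?N (\<lambda>z. refreshed j W (t k) z = y k)"
        using mR[OF t0[of k]] by measurable
    qed simp
    then have A: "{z\<in>space ?N. \<forall>k\<in>{..m}. refreshed j W (t k) z = y k} \<in> sets ?N" by (simp add: pred_def)
    let ?A = "{z\<in>space ?N. \<forall>k\<le>m. refreshed j W (t k) z = y k}"
    have A': "?A \<in> sets ?N" using A by (simp only: Ball_def atMost_iff)
    have f: "f z = indicator ?A z" if "z \<in> space ?N" for z using that by (simp add: f_def indicator_def)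
    have intf: "integrable ?N f"
    proof (rule Bochner_Integration.integrable_cong[THEN iffD2, OF refl f])
      show "integrable ?N (indicator ?A :: _ \<Rightarrow> real)"
        by (rule integrable_real_indicator[OF A'])
          (simp only: P.emeasure_eq_measure infinity_ennreal_def ennreal_less_top)
    qed
    have "measure ?N ?A = (\<integral>z. f z \<partial>?N)"
    proof -
      have "(\<integral>z. f z \<partial>?N) = (\<integral>z. indicator ?A z \<partial>?N)" by (rule Bochner_Integration.integral_cong[OF refl f])
      then show ?thesis by (simp only: Bochner_Integration.integral_indicator sets.Int_space_eq2[OF A'])
    qed
    also have "\<dots> = (\<integral>\<tau>. \<integral>\<omega>. f (\<omega>, \<tau>) \<partial>M \<partial>?D)"
      by (rule integral_snd[symmetric, of "\<lambda>\<omega> \<tau>. f (\<omega>, \<tau>)", unfolded case_prod_eta, OF intf])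
    finally show "measure ?N ?A = (\<integral>\<tau>. p t y m \<tau> \<partial>?D)" unfolding p_def f_def .
    show "integrable ?D (p t y m)"
      unfolding p_def[abs_def] f_def[symmetric]
      by (rule integrable_snd[of "\<lambda>\<omega> \<tau>. f (\<omega>, \<tau>)", unfolded case_prod_eta, OF intf])
  qed
  have unif: "(\<integral>\<omega>. (if W s \<omega> = l then 1 else 0) \<partial>M) = (1 / 2 :: real)" if "0 \<le> s" for s l
  proof -
    have "(\<integral>\<omega>. (if W s \<omega> = l then 1 else (0::real)) \<partial>M) = (\<integral>\<omega>. indicator {\<omega>\<in>space M. W s \<omega> = l} \<omega> \<partial>M)"
      by (rule Bochner_Integration.integral_cong) (auto simp: indicator_def)
    also have "\<dots> = M.prob {\<omega>\<in>space M. W s \<omega> = l}" by (auto intro!: arg_cong[where f = M.prob])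
    also have "\<dots> = 1 / 2"
      using switching_processD(3)[OF W, of "\<lambda>_. s" 0 "\<lambda>_. l"] that by (simp add: mono_def fdd_uniform2)
    finally show ?thesis .
  qed
  have one: "(\<integral>\<omega>. (if refreshed j W s (\<omega>, \<tau>) = l then 1 else 0) \<partial>M) =
      (if s < \<tau> then (if j = l then 1 else 0) else 1 / 2 :: real)" if "0 \<le> s" for s l \<tau>
  proof (cases "s < \<tau>")
    case True
    then show ?thesis by (cases "j = l") (simp_all add: refreshed_def M.prob_space)
  next
    case False
    then show ?thesis using unif[OF that, of l] by (simp add: refreshed_def)
  qed
  have base: "p t y 0 \<tau> = 1 / 2 + ((if j = y 0 then 1 else 0) - 1 / 2) * indicator {t 0<..} \<tau>"
    if "0 \<le> t 0" for t y \<tau>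
    using one[OF that, of \<tau> "y 0"] by (simp add: p_def indicator_def)
  \<comment> \<open>For a fixed refresh time the Markov factorization fails when no refresh has
    occurred by \<open>t m\<close>. The second summand corrects this on \<open>t m < \<tau>\<close>
    and cancels once it is integrated over the exponential law.\<close>
  have step: "p t y (Suc m) \<tau> = p t y m \<tau> * switch_prob r (t (Suc m) - t m) (y m) (y (Suc m)) +
      (if \<forall>k\<le>m. y k = j then 1 else 0) * (((if j = y (Suc m) then 1 else 0) - 1 / 2) * indicator {t (Suc m)<..} \<tau> +
        (1 / 2 - switch_prob r (t (Suc m) - t m) (y m) (y (Suc m))) * indicator {t m<..} \<tau>)"
    if t: "0 \<le> t 0" "mono t" for t y m \<tau>
  proof -
    let ?P = "switch_prob r (t (Suc m) - t m)"
    have tS: "t m \<le> t (Suc m)" "0 \<le> t (Suc m)" using t by (auto simp: mono_def intro: order_trans[of _ "t 0"])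
    show ?thesis
    proof (cases "\<tau> \<le> t m")
      case True
      \<comment> \<open>The refresh has occurred by \<open>t m\<close>, so the last two samples come
        from W and its Markov property applies; samples before \<tau> are replaced by j.\<close>
      define H where "H v = (if \<forall>k\<le>m. (if t k < \<tau> then j else v k) = y k then 1 else (0::real))" for v
      have Hc: "H v = H v'" if "\<And>k. k \<le> m \<Longrightarrow> v k = v' k" for v v' :: "nat \<Rightarrow> 2"
        using that by (auto simp: H_def)
      have "p t y (Suc m) \<tau> = (\<integral>\<omega>. (\<lambda>l h. h * (if l = y (Suc m) then 1 else 0)) (W (t (Suc m)) \<omega>) (H (\<lambda>k. W (t k) \<omega>)) \<partial>M)"
        unfolding p_def
        by (rule Bochner_Integration.integral_cong) (use True tS in \<open>auto simp: H_def refreshed_def le_Suc_eq\<close>)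
      also have "\<dots> = (\<integral>\<omega>. (\<Sum>l\<in>UNIV. ?P (W (t m) \<omega>) l * (H (\<lambda>k. W (t k) \<omega>) * (if l = y (Suc m) then 1 else 0))) \<partial>M)"
        by (rule markov_step[OF W t Hc])
      also have "\<dots> = (\<integral>\<omega>. ?P (y m) (y (Suc m)) * H (\<lambda>k. W (t k) \<omega>) \<partial>M)"
      proof (rule Bochner_Integration.integral_cong[OF refl])
        fix \<omega>
        have "(\<Sum>l\<in>UNIV. ?P (W (t m) \<omega>) l * (H (\<lambda>k. W (t k) \<omega>) * (if l = y (Suc m) then 1 else 0))) =
            ?P (W (t m) \<omega>) (y (Suc m)) * H (\<lambda>k. W (t k) \<omega>)"
          by (simp add: if_distrib cong: if_cong)
        also have "\<dots> = ?P (y m) (y (Suc m)) * H (\<lambda>k. W (t k) \<omega>)"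
          using True by (auto simp: H_def dest: spec[where x = m])
        finally show "(\<Sum>l\<in>UNIV. ?P (W (t m) \<omega>) l * (H (\<lambda>k. W (t k) \<omega>) * (if l = y (Suc m) then 1 else 0))) =
            ?P (y m) (y (Suc m)) * H (\<lambda>k. W (t k) \<omega>)" .
      qed
      also have "\<dots> = ?P (y m) (y (Suc m)) * p t y m \<tau>"
        by (simp add: p_def H_def refreshed_def)
      finally show ?thesis using True tS by simp
    next
      case False
      then have less: "t k < \<tau>" if "k \<le> m" for k using monoD[OF t(2) that] by simp
      have pm: "p t y m \<tau> = (if \<forall>k\<le>m. y k = j then 1 else 0)"
        using less by (auto simp: p_def refreshed_def M.prob_space)
      have "p t y (Suc m) \<tau> = (\<integral>\<omega>. (if \<forall>k\<le>m. y k = j then 1 else 0) *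
          (if refreshed j W (t (Suc m)) (\<omega>, \<tau>) = y (Suc m) then 1 else 0) \<partial>M)"
        unfolding p_def
        by (rule Bochner_Integration.integral_cong) (use less in \<open>auto simp: refreshed_def le_Suc_eq\<close>)
      also have "\<dots> = (if \<forall>k\<le>m. y k = j then 1 else 0) * (if t (Suc m) < \<tau> then (if j = y (Suc m) then 1 else 0) else 1 / 2)"
        by (simp only: Bochner_Integration.integral_mult_right_zero one[OF tS(2)])
      finally show ?thesis using False pm by (auto simp: algebra_simps)
    qed
  qed
  have "(\<integral>\<tau>. p t y m \<tau> \<partial>?D) = fdd r (return_pmf j) t y m" if t: "0 \<le> t 0" "mono t" for t :: "nat \<Rightarrow> real" and y m
  proof (induction m)
    case 0
    have "(\<integral>\<tau>. p t y 0 \<tau> \<partial>?D) = 1 / 2 + ((if j = y 0 then 1 else 0) - 1 / 2) * exp (- 2 * r * t 0)"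
      unfolding base[of t, OF t(1)]
      by (subst Bochner_Integration.integral_add)
        (simp_all only: integral_refresh_time_gt[OF r t(1)] D.integrable_const D.prob_space lebesgue_integral_const, simp)
    also have "\<dots> = switch_prob r (t 0) j (y 0)" by (simp add: switch_prob_def field_simps)
    finally show ?case by (simp add: fdd_return_pmf)
  next
    case (Suc m)
    let ?P = "switch_prob r (t (Suc m) - t m) (y m) (y (Suc m))"
    let ?c = "(if \<forall>k\<le>m. y k = j then 1 else 0) :: real"
    have tS: "0 \<le> t m" "0 \<le> t (Suc m)" using t by (auto simp: mono_def intro: order_trans[of _ "t 0"])
    have "(\<integral>\<tau>. p t y (Suc m) \<tau> \<partial>?D) = (\<integral>\<tau>. p t y m \<tau> \<partial>?D) * ?P +
        ?c * (((if j = y (Suc m) then 1 else 0) - 1 / 2) * exp (- 2 * r * t (Suc m)) + (1 / 2 - ?P) * exp (- 2 * r * t m))"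
      unfolding step[of t, OF t]
      using refresh_time(4)[OF r tS(1)] refresh_time(4)[OF r tS(2)] slice(2)[of t, OF t]
        integral_refresh_time_gt(2)[OF r tS(1), of 1] integral_refresh_time_gt(2)[OF r tS(2), of 1]
      by simp
    \<comment> \<open>Memorylessness: the deviation of \<open>switch_prob\<close> from 1 / 2 carries
      exactly the factor that turns the tail at \<open>t m\<close> into the tail at the next
      time.\<close>
    also have "?c * (((if j = y (Suc m) then 1 else 0) - 1 / 2) * exp (- 2 * r * t (Suc m)) + (1 / 2 - ?P) * exp (- 2 * r * t m)) = 0"
    proof (cases "\<forall>k\<le>m. y k = j")
      case True
      then have "y m = j" by simp
      have "exp (- 2 * r * (t (Suc m) - t m)) * exp (- 2 * r * t m) = exp (- 2 * r * t (Suc m))"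
        by (simp add: exp_add[symmetric] algebra_simps)
      then show ?thesis using \<open>y m = j\<close> by (auto simp: switch_prob_def field_simps)
    next
      case False
      then show ?thesis by (subst if_not_P) (assumption, rule mult_zero_left)
    qed
    finally show ?case using Suc.IH by (simp add: fdd_Suc)
  qed
  note fdd_eq = this
  show ?thesis
    unfolding switching_process_def
  proof (intro conjI allI impI)
    show "prob_space ?N" by (rule prob_space_axioms)
    show "refreshed j W t \<in> measurable ?N (count_space UNIV)" if "0 \<le> t" for t by (rule mR[OF that])
    fix m :: nat and t y assume t: "0 \<le> t 0" "mono (t :: nat \<Rightarrow> real)"
    show "measure ?N {z\<in>space ?N. \<forall>k\<le>m. refreshed j W (t k) z = y k} = fdd r (return_pmf j) t y m"
      unfolding slice(1)[of t, OF t] by (rule fdd_eq[of t, OF t])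
  qed
qed

text \<open>The initial state is drawn independently of N and selects a member of a family driven by
  one common space; every initial law is thus reached from the deterministic ones.\<close>

lemma switching_process_mixture:
  assumes W: "\<And>j. switching_process r (return_pmf j) N (W j)"
  shows "switching_process r \<mu> (measure_pmf \<mu> \<Otimes>\<^sub>M N) (\<lambda>t z. W (fst z) t (snd z))"
proof -
  interpret N: prob_space N by (rule switching_processD[OF W])
  interpret pair_prob_space "measure_pmf \<mu>" N ..
  let ?Z = "measure_pmf \<mu> \<Otimes>\<^sub>M N"
  have meas: "(\<lambda>z. W (fst z) t (snd z)) \<in> measurable ?Z (count_space UNIV)" if "0 \<le> t" for t
  proof (rule measurable_compose_countable'[where I = UNIV and g = fst])
    show "(\<lambda>z. W j t (snd z)) \<in> measurable ?Z (count_space UNIV)" for j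
      using switching_processD(2)[OF W that] by measurable
    show "fst \<in> measurable ?Z (count_space UNIV)"
      using measurable_fst[of "measure_pmf \<mu>" N] by (simp cong: measurable_cong_sets)
  qed auto
  have "measure ?Z {z\<in>space ?Z. \<forall>k\<le>m. W (fst z) (t k) (snd z) = y k} = fdd r \<mu> t y m"
    if t: "0 \<le> t 0" "mono t" for t :: "nat \<Rightarrow> real" and y m
  proof -
    let ?A = "{z\<in>space ?Z. \<forall>k\<le>m. W (fst z) (t k) (snd z) = y k}"
    have t0: "0 \<le> t k" for k using t by (metis monoD le0 order_trans)
    have "Measurable.pred ?Z (\<lambda>z. \<forall>k\<in>{..m}. W (fst z) (t k) (snd z) = y k)"
    proof (rule pred_intros_finite(3))
      fix k show "Measurable.pred ?Z (\<lambda>z. W (fst z) (t k) (snd z) = y k)"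
        using meas[OF t0[of k]] by measurable
    qed simp
    then have "{z\<in>space ?Z. \<forall>k\<in>{..m}. W (fst z) (t k) (snd z) = y k} \<in> sets ?Z" by (simp add: pred_def)
    then have A: "?A \<in> sets ?Z" by (simp only: Ball_def atMost_iff)
    have "emeasure ?Z ?A = (\<integral>\<^sup>+j. emeasure N (Pair j -` ?A) \<partial>measure_pmf \<mu>)"
      by (rule N.emeasure_pair_measure_alt[OF A])
    also have "\<dots> = (\<integral>\<^sup>+j. ennreal (fdd r (return_pmf j) t y m) \<partial>measure_pmf \<mu>)"
    proof (rule nn_integral_cong)
      fix j :: 2
      have "Pair j -` ?A = {\<omega>\<in>space N. \<forall>k\<le>m. W j (t k) \<omega> = y k}" by (auto simp: space_pair_measure)
      then show "emeasure N (Pair j -` ?A) = ennreal (fdd r (return_pmf j) t y m)"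
        by (simp add: N.emeasure_eq_measure switching_processD(3)[OF W t])
    qed
    also have "\<dots> = (\<Sum>j\<in>UNIV. ennreal (pmf \<mu> j) * ennreal (fdd r (return_pmf j) t y m))"
      by (simp add: nn_integral_measure_pmf nn_integral_count_space_finite)
    also have "\<dots> = ennreal (fdd r \<mu> t y m)"
    proof -
      have nn: "0 \<le> fdd r (return_pmf j) t y m" for j
        unfolding switching_processD(3)[OF W t, symmetric] by simp
      then show ?thesis
        by (subst fdd_mixture) (simp add: ennreal_mult'[symmetric] sum_ennreal)
    qed
    finally have "ennreal (measure ?Z ?A) = ennreal (fdd r \<mu> t y m)" by (simp add: P.emeasure_eq_measure)
    moreover have "0 \<le> fdd r \<mu> t y m"
      by (subst fdd_mixture) (auto intro!: sum_nonneg mult_nonneg_nonneg simp: switching_processD(3)[OF W t, symmetric])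
    ultimately show ?thesis by simp
  qed
  then show ?thesis using meas prob_space_axioms unfolding switching_process_def by blast
qed

section \<open>Moments of the growth along a switching path\<close>

definition rate :: "real \<Rightarrow> real \<Rightarrow> 2 \<Rightarrow> real" where
  "rate \<kappa> b j = (if j = 0 then - \<kappa> else b)"

text \<open>The Lipschitz constant of \<open>grid_flow\<close> along w, multiplied up from its
  single steps.\<close>

definition gain :: "real \<Rightarrow> real \<Rightarrow> real \<Rightarrow> nat \<Rightarrow> (real \<Rightarrow> 2) \<Rightarrow> real" where
  "gain \<kappa> b h m w = (\<Prod>k<m. exp (rate \<kappa> b (w (real (Suc k) * h)) * h))"

lemma gain_0 [simp]: "gain \<kappa> b h 0 w = 1"
  by (simp add: gain_def)

lemma gain_Suc [simp]:
  "gain \<kappa> b h (Suc m) w = exp (rate \<kappa> b (w (real (Suc m) * h)) * h) * gain \<kappa> b h m w"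
  by (simp add: gain_def mult.commute)

lemma gain_pos: "0 < gain \<kappa> b h m w"
  by (simp add: gain_def prod_pos)

lemma gain_bounds:
  assumes "0 \<le> h" "0 < b" "b < \<kappa>"
  shows "gain \<kappa> b h m w \<le> exp (b * (real m * h))" "exp (- \<kappa> * (real m * h)) \<le> gain \<kappa> b h m w"
proof -
  have "rate \<kappa> b j \<le> b" "- \<kappa> \<le> rate \<kappa> b j" for j
    using assms by (auto simp: rate_def)
  from this[THEN mult_right_mono, OF assms(1)]
  have r: "rate \<kappa> b j * h \<le> b * h" "- \<kappa> * h \<le> rate \<kappa> b j * h" for j .
  have "gain \<kappa> b h m w \<le> (\<Prod>k<m. exp (b * h))"
    unfolding gain_def by (intro prod_mono) (use r in auto)
  then show "gain \<kappa> b h m w \<le> exp (b * (real m * h))"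
    by (simp add: exp_of_nat_mult[symmetric] algebra_simps)
  have "(\<Prod>k<m. exp (- \<kappa> * h)) \<le> gain \<kappa> b h m w"
    unfolding gain_def by (intro prod_mono) (use r in auto)
  then show "exp (- \<kappa> * (real m * h)) \<le> gain \<kappa> b h m w"
    by (simp add: exp_of_nat_mult[symmetric] algebra_simps)
qed

text \<open>
  The vector \<open>(1, 1 + \<delta>)\<close> is a strict supersolution of the generator of the switching process
  tilted by \<open>q\<close> times the growth rates; \<open>\<delta> = q * s / r\<close> works for small \<open>q\<close> and
  \<open>s\<close> halfway between \<open>b\<close> and \<open>\<kappa>\<close>.
\<close>

lemma tilted_supersolution:
  assumes r: "r > 0" and kb: "0 < b" "b < \<kappa>"
  obtains q0 where "q0 > 0" "\<And>q. 0 < q \<Longrightarrow> q \<le> q0 \<Longrightarrow> \<exists>\<delta> c h0. \<delta> > 0 \<and> c > 0 \<and> h0 > 0 \<and>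
    (\<forall>h j. 0 < h \<longrightarrow> h < h0 \<longrightarrow>
      (\<Sum>l\<in>UNIV. switch_prob r h j l * (exp (q * rate \<kappa> b l * h) * (if l = 0 then 1 else 1 + \<delta>))) \<le>
        exp (- c * h) * (if j = 0 then 1 else 1 + \<delta>))"
proof -
  \<comment> \<open>With \<open>r * \<delta> = q * s\<close> the two rows have margins
    \<open>q * (\<kappa> - s)\<close> and, up to second order in q, \<open>q * (s - b)\<close>; any
    s strictly between b and \<kappa> makes both positive.\<close>
  define s where "s = (\<kappa> + b) / 2"
  have s: "b < s" "s < \<kappa>" "0 < s" using kb by (auto simp: s_def)
  \<comment> \<open>At this q the second-order term \<open>q * b * \<delta>\<close> uses up half of
    the margin \<open>q * (s - b)\<close>.\<close>
  define q0 where "q0 = (s - b) * r / (2 * s * b)"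
  have q0: "q0 > 0" using s kb r by (simp add: q0_def)
  show ?thesis
  proof (rule that[OF q0])
    fix q assume q: "0 < q" "q \<le> q0"
    define \<delta> where "\<delta> = q * s / r"
    have \<delta>: "\<delta> > 0" using q s r by (simp add: \<delta>_def)
    have sd: "r * \<delta> = q * s" using r by (simp add: \<delta>_def)
    have bd: "\<delta> * b \<le> (s - b) / 2"
    proof -
      have "\<delta> * b \<le> q0 * s / r * b"
        unfolding \<delta>_def using q s r kb by (intro mult_right_mono divide_right_mono) auto
      also have "\<dots> = (s - b) / 2" using s kb r by (simp add: q0_def field_simps)
      finally show ?thesis .
    qed
    define A B where "A = q * (\<kappa> - s)" and "B = q * (s - b) / 2 / (1 + \<delta>)"
    define c where "c = min A B / 2"
    have p: "0 < A" "0 < B" using q s \<delta> by (auto simp: A_def B_def add_pos_pos)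
    then have c: "c > 0" by (simp add: c_def)
    have c1: "c < q * (\<kappa> - s)" and c2: "c * (1 + \<delta>) < q * (s - b) / 2"
    proof -
      have "c < A" "c < B" using p unfolding c_def by linarith+
      then show "c < q * (\<kappa> - s)" "c * (1 + \<delta>) < q * (s - b) / 2"
        using \<delta> pos_less_divide_eq[of "1 + \<delta>" c "q * (s - b) / 2"] unfolding A_def B_def by simp_all
    qed
    \<comment> \<open>The defects in the two rows of the inequality. Both vanish at h = 0 with
      negative derivative, so they are negative for small positive h.\<close>
    define f0 where "f0 h = (1 + exp (- 2 * r * h)) / 2 * exp (- q * \<kappa> * h) +
      (1 - exp (- 2 * r * h)) / 2 * (exp (q * b * h) * (1 + \<delta>)) - exp (- c * h)" for h
    define f1 where "f1 h = (1 - exp (- 2 * r * h)) / 2 * exp (- q * \<kappa> * h) +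
      (1 + exp (- 2 * r * h)) / 2 * (exp (q * b * h) * (1 + \<delta>)) - exp (- c * h) * (1 + \<delta>)" for h
    have d0: "(f0 has_real_derivative (r * \<delta> - q * \<kappa> + c)) (at 0)"
      unfolding f0_def by (auto intro!: derivative_eq_intros simp: field_simps)
    have d1: "(f1 has_real_derivative (q * b * (1 + \<delta>) - r * \<delta> + c * (1 + \<delta>))) (at 0)"
      unfolding f1_def by (auto intro!: derivative_eq_intros simp: field_simps)
    have n0: "r * \<delta> - q * \<kappa> + c < 0" using c1 sd by (simp add: algebra_simps)
    have n1: "q * b * (1 + \<delta>) - r * \<delta> + c * (1 + \<delta>) < 0"
    proof -
      have "q * (\<delta> * b) \<le> q * ((s - b) / 2)" using bd q by (intro mult_left_mono) auto
      then show ?thesis using c2 sd by (simp add: algebra_simps)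
    qed
    obtain h1 where h1: "h1 > 0" "\<And>h. 0 < h \<Longrightarrow> h < h1 \<Longrightarrow> f0 h < f0 0"
      using DERIV_neg_dec_right[OF d0 n0] by auto
    obtain h2 where h2: "h2 > 0" "\<And>h. 0 < h \<Longrightarrow> h < h2 \<Longrightarrow> f1 h < f1 0"
      using DERIV_neg_dec_right[OF d1 n1] by auto
    have z: "f0 0 = 0" "f1 0 = 0" by (simp_all add: f0_def f1_def)
    show "\<exists>\<delta> c h0. \<delta> > 0 \<and> c > 0 \<and> h0 > 0 \<and>
      (\<forall>h j. 0 < h \<longrightarrow> h < h0 \<longrightarrow>
        (\<Sum>l\<in>UNIV. switch_prob r h j l * (exp (q * rate \<kappa> b l * h) * (if l = 0 then 1 else 1 + \<delta>))) \<le>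
          exp (- c * h) * (if j = 0 then 1 else 1 + \<delta>))"
    proof (rule exI[of _ \<delta>], rule exI[of _ c], rule exI[of _ "min h1 h2"], intro conjI allI impI)
      fix h and j :: 2 assume h: "0 < h" "h < min h1 h2"
      have "f0 h \<le> 0" "f1 h \<le> 0" using h1(2)[of h] h2(2)[of h] h z by auto
      then show "(\<Sum>l\<in>UNIV. switch_prob r h j l * (exp (q * rate \<kappa> b l * h) * (if l = 0 then 1 else 1 + \<delta>))) \<le>
          exp (- c * h) * (if j = 0 then 1 else 1 + \<delta>)"
        using UNIV_2_01 by (cases "j = 0") (auto simp: sum_UNIV_2 switch_prob_def rate_def f0_def f1_def)
    qed (use \<delta> c h1 h2 in auto)
  qed
qed

text \<open>The supersolution v makes the q-th power of the gain, times v at the current state,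
  decrease in mean by \<open>exp (- c * h)\<close> per step; as v lies between 1 and 1 + \<delta>,
  it costs only the constant. C, c and h0 depend neither on the mesh nor on the process, so the grid
  can be refined.\<close>

lemma gain_moment_bound:
  assumes r: "r > 0" and kb: "0 < b" "b < \<kappa>"
  obtains q0 where "q0 > 0" "\<And>q. 0 < q \<Longrightarrow> q \<le> q0 \<Longrightarrow> \<exists>C c h0. C > 0 \<and> c > 0 \<and> h0 > 0 \<and>
    (\<forall>h m (M :: 'w measure) W \<mu>. 0 < h \<longrightarrow> h < h0 \<longrightarrow> switching_process r \<mu> M W \<longrightarrow>
      integrable M (\<lambda>\<omega>. gain \<kappa> b h m (\<lambda>s. W s \<omega>) powr q) \<and>
      (\<integral>\<omega>. gain \<kappa> b h m (\<lambda>s. W s \<omega>) powr q \<partial>M) \<le> C * exp (- c * (real m * h)))"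
proof -
  obtain q0 where q0: "q0 > 0" "\<And>q. 0 < q \<Longrightarrow> q \<le> q0 \<Longrightarrow> \<exists>\<delta> c h0. \<delta> > 0 \<and> c > 0 \<and> h0 > 0 \<and>
    (\<forall>h j. 0 < h \<longrightarrow> h < h0 \<longrightarrow>
      (\<Sum>l\<in>UNIV. switch_prob r h j l * (exp (q * rate \<kappa> b l * h) * (if l = 0 then 1 else 1 + \<delta>))) \<le>
        exp (- c * h) * (if j = 0 then 1 else 1 + \<delta>))"
    using tilted_supersolution[OF r kb] by blast
  show ?thesis
  proof (rule that[OF q0(1)])
    fix q assume q: "0 < q" "q \<le> q0"
    obtain \<delta> c h0 where d: "\<delta> > 0" "c > 0" "h0 > 0" and
      key: "\<And>h j. 0 < h \<Longrightarrow> h < h0 \<Longrightarrow>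
        (\<Sum>l\<in>UNIV. switch_prob r h j l * (exp (q * rate \<kappa> b l * h) * (if l = 0 then 1 else 1 + \<delta>))) \<le>
          exp (- c * h) * (if j = 0 then 1 else 1 + \<delta>)"
      using q0(2)[OF q] by blast
    define v where "v j = (if j = 0 then 1 else 1 + \<delta>)" for j :: 2
    have v: "1 \<le> v j" "v j \<le> 1 + \<delta>" for j using d by (auto simp: v_def)
    show "\<exists>C c h0. C > 0 \<and> c > 0 \<and> h0 > 0 \<and>
      (\<forall>h m (M :: 'w measure) W \<mu>. 0 < h \<longrightarrow> h < h0 \<longrightarrow> switching_process r \<mu> M W \<longrightarrow>
        integrable M (\<lambda>\<omega>. gain \<kappa> b h m (\<lambda>s. W s \<omega>) powr q) \<and>
        (\<integral>\<omega>. gain \<kappa> b h m (\<lambda>s. W s \<omega>) powr q \<partial>M) \<le> C * exp (- c * (real m * h)))"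
    proof (rule exI[of _ "1 + \<delta>"], rule exI[of _ c], rule exI[of _ h0], intro conjI allI impI)
      fix h m and M :: "'w measure" and W \<mu>
      assume h: "0 < h" "h < h0" and W: "switching_process r \<mu> M W"
      interpret prob_space M by (rule switching_processD[OF W])
      define t where "t k = real k * h" for k :: nat
      have t: "0 \<le> t 0" "mono t" using h by (auto simp: t_def mono_def intro!: mult_right_mono)
      define Gq where "Gq m y = (\<Prod>k<m. exp (q * rate \<kappa> b (y (Suc k)) * h))" for m and y :: "nat \<Rightarrow> 2"
      have Gq_cong: "Gq m y = Gq m y'" if "\<And>k. k \<le> m \<Longrightarrow> y k = y' k" for m y y'
        unfolding Gq_def using that by (intro prod.cong) auto
      have Gq_pos: "0 \<le> Gq m y" for m y by (simp add: Gq_def prod_nonneg)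
      have gain_Gq: "gain \<kappa> b h m (\<lambda>s. W s \<omega>) powr q = Gq m (\<lambda>k. W (t k) \<omega>)" for m \<omega>
      proof -
        have "gain \<kappa> b h m (\<lambda>s. W s \<omega>) powr q = (\<Prod>k<m. exp (rate \<kappa> b (W (real (Suc k) * h) \<omega>) * h) powr q)"
          unfolding gain_def by (rule prod_powr_distrib)
        then show ?thesis by (simp add: Gq_def t_def exp_powr_real algebra_simps)
      qed
      have int: "integrable M (\<lambda>\<omega>. Gq m (\<lambda>k. W (t k) \<omega>) * v (W (t m) \<omega>))" for m
      proof (rule finite_states_expectation(2)[OF W t, of m "\<lambda>y. Gq m y * v (y m)"])
        fix y y' :: "nat \<Rightarrow> 2" assume eq: "\<And>k. k \<le> m \<Longrightarrow> y k = y' k"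
        show "Gq m y * v (y m) = Gq m y' * v (y' m)" using Gq_cong[of m y y', OF eq] eq[of m] by simp
      qed
      have int': "integrable M (\<lambda>\<omega>. Gq m (\<lambda>k. W (t k) \<omega>))" for m
        by (rule finite_states_expectation(2)[OF W t, of m "Gq m"]) (rule Gq_cong)
      have E: "(\<integral>\<omega>. Gq m (\<lambda>k. W (t k) \<omega>) * v (W (t m) \<omega>) \<partial>M) \<le> (1 + \<delta>) * exp (- c * (real m * h))" for m
      proof (induction m)
        case 0
        have "(\<integral>\<omega>. Gq 0 (\<lambda>k. W (t k) \<omega>) * v (W (t 0) \<omega>) \<partial>M) \<le> (\<integral>\<omega>. 1 + \<delta> \<partial>M)"
          by (rule integral_mono[OF int]) (use v in \<open>auto simp: Gq_def\<close>)
        then show ?case by (simp add: prob_space)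
      next
        case (Suc m)
        have tm: "t (Suc m) - t m = h" by (simp add: t_def algebra_simps)
        have "(\<integral>\<omega>. Gq (Suc m) (\<lambda>k. W (t k) \<omega>) * v (W (t (Suc m)) \<omega>) \<partial>M) =
            (\<integral>\<omega>. (\<lambda>l g. g * (exp (q * rate \<kappa> b l * h) * v l)) (W (t (Suc m)) \<omega>) (Gq m (\<lambda>k. W (t k) \<omega>)) \<partial>M)"
          by (simp add: Gq_def algebra_simps)
        also have "\<dots> = (\<integral>\<omega>. (\<Sum>l\<in>UNIV. switch_prob r (t (Suc m) - t m) (W (t m) \<omega>) l *
            (Gq m (\<lambda>k. W (t k) \<omega>) * (exp (q * rate \<kappa> b l * h) * v l))) \<partial>M)"
          by (rule markov_step[OF W t Gq_cong])
        also have "\<dots> \<le> (\<integral>\<omega>. exp (- c * h) * (Gq m (\<lambda>k. W (t k) \<omega>) * v (W (t m) \<omega>)) \<partial>M)"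
        proof (rule integral_mono)
          show "integrable M (\<lambda>\<omega>. \<Sum>l\<in>UNIV. switch_prob r (t (Suc m) - t m) (W (t m) \<omega>) l *
              (Gq m (\<lambda>k. W (t k) \<omega>) * (exp (q * rate \<kappa> b l * h) * v l)))"
          proof (rule finite_states_expectation(2)[OF W t, of m "\<lambda>y. \<Sum>l\<in>UNIV. switch_prob r (t (Suc m) - t m) (y m) l *
              (Gq m y * (exp (q * rate \<kappa> b l * h) * v l))"])
            fix y y' :: "nat \<Rightarrow> 2" assume eq: "\<And>k. k \<le> m \<Longrightarrow> y k = y' k"
            show "(\<Sum>l\<in>UNIV. switch_prob r (t (Suc m) - t m) (y m) l * (Gq m y * (exp (q * rate \<kappa> b l * h) * v l))) =
              (\<Sum>l\<in>UNIV. switch_prob r (t (Suc m) - t m) (y' m) l * (Gq m y' * (exp (q * rate \<kappa> b l * h) * v l)))"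
              using Gq_cong[of m y y', OF eq] eq[of m] by simp
          qed
          fix \<omega>
          have "(\<Sum>l\<in>UNIV. switch_prob r h (W (t m) \<omega>) l * (Gq m (\<lambda>k. W (t k) \<omega>) * (exp (q * rate \<kappa> b l * h) * v l))) =
              Gq m (\<lambda>k. W (t k) \<omega>) * (\<Sum>l\<in>UNIV. switch_prob r h (W (t m) \<omega>) l * (exp (q * rate \<kappa> b l * h) * v l))"
            by (simp add: sum_distrib_left algebra_simps)
          also have "\<dots> \<le> Gq m (\<lambda>k. W (t k) \<omega>) * (exp (- c * h) * v (W (t m) \<omega>))"
            using key[OF h, of "W (t m) \<omega>"] Gq_pos unfolding v_def by (intro mult_left_mono)
          finally show "(\<Sum>l\<in>UNIV. switch_prob r (t (Suc m) - t m) (W (t m) \<omega>) l *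
              (Gq m (\<lambda>k. W (t k) \<omega>) * (exp (q * rate \<kappa> b l * h) * v l))) \<le>
              exp (- c * h) * (Gq m (\<lambda>k. W (t k) \<omega>) * v (W (t m) \<omega>))"
            by (simp add: tm algebra_simps)
        qed (intro integrable_mult_right int)
        also have "\<dots> = exp (- c * h) * (\<integral>\<omega>. Gq m (\<lambda>k. W (t k) \<omega>) * v (W (t m) \<omega>) \<partial>M)" by simp
        also have "\<dots> \<le> exp (- c * h) * ((1 + \<delta>) * exp (- c * (real m * h)))"
          by (intro mult_left_mono Suc.IH) simp
        also have "\<dots> = (1 + \<delta>) * exp (- c * (real (Suc m) * h))"
          by (simp add: exp_add[symmetric] algebra_simps)
        finally show ?case .
      qed
      show "integrable M (\<lambda>\<omega>. gain \<kappa> b h m (\<lambda>s. W s \<omega>) powr q)" unfolding gain_Gq by (rule int')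
      have "(\<integral>\<omega>. Gq m (\<lambda>k. W (t k) \<omega>) \<partial>M) \<le> (\<integral>\<omega>. Gq m (\<lambda>k. W (t k) \<omega>) * v (W (t m) \<omega>) \<partial>M)"
      proof (rule integral_mono)
        fix \<omega>
        show "Gq m (\<lambda>k. W (t k) \<omega>) \<le> Gq m (\<lambda>k. W (t k) \<omega>) * v (W (t m) \<omega>)"
          using mult_left_mono[OF v(1)[of "W (t m) \<omega>"] Gq_pos[of m "\<lambda>k. W (t k) \<omega>"]] by simp
      qed (rule int' int)+
      also note E
      finally show "(\<integral>\<omega>. gain \<kappa> b h m (\<lambda>s. W s \<omega>) powr q \<partial>M) \<le> (1 + \<delta>) * exp (- c * (real m * h))"
        unfolding gain_Gq .
    qed (use d in auto)
  qed
qed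

section \<open>Exponential moments of the refresh time and images of product measures\<close>

lemma nn_integral_exp_refresh_time:
  assumes "r > 0" "a < 2 * r"
  shows "(\<integral>\<^sup>+\<tau>. ennreal (exp (a * \<tau>)) \<partial>refresh_time r) = ennreal (2 * r / (2 * r - a))"
proof -
  \<comment> \<open>Tilting an exponential density by \<open>exp (a * \<tau>)\<close> gives a
    multiple of the exponential density of rate \<open>2 * r - a\<close>.\<close>
  have eq: "ennreal (exponential_density (2 * r) \<tau>) * ennreal (exp (a * \<tau>)) =
      ennreal (2 * r / (2 * r - a)) * ennreal (exponential_density (2 * r - a) \<tau>)" for \<tau>
  proof (cases "\<tau> < 0")
    case False
    have "exp (- \<tau> * (2 * r)) * exp (a * \<tau>) = exp (- \<tau> * (2 * r - a))"
      by (simp add: exp_add[symmetric] algebra_simps)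
    then show ?thesis using assms False
      by (simp add: exponential_density_def ennreal_mult'[symmetric])
  qed (simp add: exponential_density_def)
  interpret prob_space "density lborel (exponential_density (2 * r - a))"
    using assms by (intro prob_space_exponential_density) simp
  have "(\<integral>\<^sup>+\<tau>. ennreal (exponential_density (2 * r - a) \<tau>) \<partial>lborel) = 1"
    using emeasure_space_1 by (simp add: emeasure_density)
  then show ?thesis
    unfolding refresh_time_def by (subst nn_integral_density) (simp_all add: eq nn_integral_cmult)
qed

lemma AE_refresh_time_nonneg: "r > 0 \<Longrightarrow> AE \<tau> in refresh_time r. 0 \<le> \<tau>"
  unfolding refresh_time_def by (subst AE_density) (auto simp: exponential_density_def)

lemma nn_integral_pair_forget:
  assumes "prob_space A" "prob_space B" "prob_space N"
    and f: "f \<in> borel_measurable (A \<Otimes>\<^sub>M N)"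
  shows "(\<integral>\<^sup>+z. f (fst (fst z), snd z) \<partial>((A \<Otimes>\<^sub>M B) \<Otimes>\<^sub>M N)) = (\<integral>\<^sup>+z. f z \<partial>(A \<Otimes>\<^sub>M N))"
    and "(\<integral>\<^sup>+z. f (snd (fst z), snd z) \<partial>((B \<Otimes>\<^sub>M A) \<Otimes>\<^sub>M N)) = (\<integral>\<^sup>+z. f z \<partial>(A \<Otimes>\<^sub>M N))"
proof -
  interpret A: prob_space A by fact
  interpret B: prob_space B by fact
  interpret N: prob_space N by fact
  have f1 [measurable]: "(\<lambda>a. \<integral>\<^sup>+\<omega>. f (a, \<omega>) \<partial>N) \<in> borel_measurable A"
    using N.borel_measurable_nn_integral_fst[OF f] .
  have "(\<integral>\<^sup>+z. f (fst (fst z), snd z) \<partial>((A \<Otimes>\<^sub>M B) \<Otimes>\<^sub>M N)) =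
      (\<integral>\<^sup>+x. \<integral>\<^sup>+\<omega>. f (fst x, \<omega>) \<partial>N \<partial>(A \<Otimes>\<^sub>M B))"
    by (subst N.nn_integral_fst[symmetric]) (simp_all add: measurable_compose[OF _ f])
  also have "\<dots> = (\<integral>\<^sup>+a. \<integral>\<^sup>+b. \<integral>\<^sup>+\<omega>. f (a, \<omega>) \<partial>N \<partial>B \<partial>A)"
    by (subst B.nn_integral_fst[symmetric]) (simp_all add: measurable_compose[OF _ f1])
  also have "\<dots> = (\<integral>\<^sup>+a. \<integral>\<^sup>+\<omega>. f (a, \<omega>) \<partial>N \<partial>A)" by (simp add: B.emeasure_space_1)
  also have "\<dots> = (\<integral>\<^sup>+z. f z \<partial>(A \<Otimes>\<^sub>M N))" by (rule N.nn_integral_fst[OF f])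
  finally show "(\<integral>\<^sup>+z. f (fst (fst z), snd z) \<partial>((A \<Otimes>\<^sub>M B) \<Otimes>\<^sub>M N)) = (\<integral>\<^sup>+z. f z \<partial>(A \<Otimes>\<^sub>M N))" .
  have "(\<integral>\<^sup>+z. f (snd (fst z), snd z) \<partial>((B \<Otimes>\<^sub>M A) \<Otimes>\<^sub>M N)) =
      (\<integral>\<^sup>+x. \<integral>\<^sup>+\<omega>. f (snd x, \<omega>) \<partial>N \<partial>(B \<Otimes>\<^sub>M A))"
    by (subst N.nn_integral_fst[symmetric]) (simp_all add: measurable_compose[OF _ f])
  also have "\<dots> = (\<integral>\<^sup>+b. \<integral>\<^sup>+a. \<integral>\<^sup>+\<omega>. f (a, \<omega>) \<partial>N \<partial>A \<partial>B)"
    by (subst A.nn_integral_fst[symmetric]) (simp_all add: measurable_compose[OF _ f1])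
  also have "\<dots> = (\<integral>\<^sup>+a. \<integral>\<^sup>+\<omega>. f (a, \<omega>) \<partial>N \<partial>A)" by (simp add: B.emeasure_space_1)
  also have "\<dots> = (\<integral>\<^sup>+z. f z \<partial>(A \<Otimes>\<^sub>M N))" by (rule N.nn_integral_fst[OF f])
  finally show "(\<integral>\<^sup>+z. f (snd (fst z), snd z) \<partial>((B \<Otimes>\<^sub>M A) \<Otimes>\<^sub>M N)) = (\<integral>\<^sup>+z. f z \<partial>(A \<Otimes>\<^sub>M N))" .
qed

lemma emeasure_distr_nn_integral:
  assumes "h \<in> measurable Z S" "X \<in> sets S"
  shows "emeasure (distr Z S h) X = (\<integral>\<^sup>+z. indicator X (h z) \<partial>Z)"
  using assms nn_integral_distr[OF assms(1), of "indicator X"] by simp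

text \<open>For the marginals of the coupling in \<open>wasserstein_bound\<close>: each of the two
  solutions ignores one independent factor of the common probability space.\<close>

lemma distr_pair_forget:
  assumes P: "prob_space A" "prob_space B" "prob_space N"
    and g [measurable]: "g \<in> measurable (A \<Otimes>\<^sub>M N) S"
  shows "distr ((A \<Otimes>\<^sub>M B) \<Otimes>\<^sub>M N) S (\<lambda>z. g (fst (fst z), snd z)) = distr (A \<Otimes>\<^sub>M N) S g"
    and "distr ((B \<Otimes>\<^sub>M A) \<Otimes>\<^sub>M N) S (\<lambda>z. g (snd (fst z), snd z)) = distr (A \<Otimes>\<^sub>M N) S g"
proof -
  have m1: "(\<lambda>z. g (fst (fst z), snd z)) \<in> measurable ((A \<Otimes>\<^sub>M B) \<Otimes>\<^sub>M N) S"
    and m2: "(\<lambda>z. g (snd (fst z), snd z)) \<in> measurable ((B \<Otimes>\<^sub>M A) \<Otimes>\<^sub>M N) S"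
    by (auto intro!: measurable_compose[OF _ g])
  show "distr ((A \<Otimes>\<^sub>M B) \<Otimes>\<^sub>M N) S (\<lambda>z. g (fst (fst z), snd z)) = distr (A \<Otimes>\<^sub>M N) S g"
  proof (rule measure_eqI)
    fix X assume "X \<in> sets (distr ((A \<Otimes>\<^sub>M B) \<Otimes>\<^sub>M N) S (\<lambda>z. g (fst (fst z), snd z)))"
    then have X [measurable]: "X \<in> sets S" by simp
    show "emeasure (distr ((A \<Otimes>\<^sub>M B) \<Otimes>\<^sub>M N) S (\<lambda>z. g (fst (fst z), snd z))) X = emeasure (distr (A \<Otimes>\<^sub>M N) S g) X"
      unfolding emeasure_distr_nn_integral[OF m1 X] emeasure_distr_nn_integral[OF g X]
      by (rule nn_integral_pair_forget(1)[OF P]) measurable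
  qed simp
  show "distr ((B \<Otimes>\<^sub>M A) \<Otimes>\<^sub>M N) S (\<lambda>z. g (snd (fst z), snd z)) = distr (A \<Otimes>\<^sub>M N) S g"
  proof (rule measure_eqI)
    fix X assume "X \<in> sets (distr ((B \<Otimes>\<^sub>M A) \<Otimes>\<^sub>M N) S (\<lambda>z. g (snd (fst z), snd z)))"
    then have X [measurable]: "X \<in> sets S" by simp
    show "emeasure (distr ((B \<Otimes>\<^sub>M A) \<Otimes>\<^sub>M N) S (\<lambda>z. g (snd (fst z), snd z))) X = emeasure (distr (A \<Otimes>\<^sub>M N) S g) X"
      unfolding emeasure_distr_nn_integral[OF m2 X] emeasure_distr_nn_integral[OF g X]
      by (rule nn_integral_pair_forget(2)[OF P]) measurable
  qed simp
qed

section \<open>The solution as a function of the switching path\<close>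

abbreviation state_space :: "(2 \<times> 'a::topological_space) measure" where
  "state_space \<equiv> count_space UNIV \<Otimes>\<^sub>M borel"

lemma grid_flow_cong:
  assumes "\<And>k. k < m \<Longrightarrow> w (real (Suc k) * h) = w' (real (Suc k) * h)"
  shows "grid_flow \<phi> h m x w = grid_flow \<phi> h m x w'"
  using assms by (induction m) simp_all

text \<open>The inclusions have disappeared: only Lipschitz and norm bounds of the two flows and the
  convergence of the grids remain. The exceptional set in \<open>grid_converges\<close> is common to
  all restart times s and durations t.\<close>

locale switched_flow =
  fixes r \<kappa> b R :: real and \<phi> :: "2 \<Rightarrow> real \<Rightarrow> 'a::euclidean_space \<Rightarrow> 'a"
    and M :: "2 pmf \<Rightarrow> 'a \<Rightarrow> 'w measure"
    and i :: "2 pmf \<Rightarrow> 'a \<Rightarrow> real \<Rightarrow> 'w \<Rightarrow> 2"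
    and \<eta> :: "2 pmf \<Rightarrow> 'a \<Rightarrow> real \<Rightarrow> 'w \<Rightarrow> 'a"
  assumes r: "0 < r" and kb: "0 < b" "b < \<kappa>" and R: "0 \<le> R"
    and flow_lipschitz: "\<And>h j x y. 0 \<le> h \<Longrightarrow>
      norm (\<phi> j h x - \<phi> j h y) \<le> exp (rate \<kappa> b j * h) * norm (x - y)"
    and flow_bound: "\<And>h j x. 0 \<le> h \<Longrightarrow> norm (\<phi> j h x) \<le> max (norm x) R"
    and process: "\<And>\<mu> x. switching_process r \<mu> (M \<mu> x) (i \<mu> x)"
    and measurable_eta: "\<And>\<mu> x t. 0 \<le> t \<Longrightarrow> \<eta> \<mu> x t \<in> borel_measurable (M \<mu> x)"
    and grid_converges: "\<And>\<mu> x. AE \<omega> in M \<mu> x. \<eta> \<mu> x 0 \<omega> = x \<and>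
      (\<forall>s t. 0 \<le> s \<longrightarrow> 0 \<le> t \<longrightarrow>
        (\<lambda>n. grid_flow \<phi> (t / real (Suc n)) (Suc n) (\<eta> \<mu> x s \<omega>) (\<lambda>u. i \<mu> x (s + u) \<omega>))
          \<longlonglongrightarrow> \<eta> \<mu> x (s + t) \<omega>)"
begin

lemma grid_flow_lipschitz:
  assumes "0 \<le> h"
  shows "norm (grid_flow \<phi> h m x w - grid_flow \<phi> h m y w) \<le> gain \<kappa> b h m w * norm (x - y)"
proof (induction m)
  case (Suc m)
  let ?j = "w (real (Suc m) * h)"
  have "norm (grid_flow \<phi> h (Suc m) x w - grid_flow \<phi> h (Suc m) y w) \<le>
      exp (rate \<kappa> b ?j * h) * norm (grid_flow \<phi> h m x w - grid_flow \<phi> h m y w)"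
    using flow_lipschitz[OF assms, of ?j "grid_flow \<phi> h m x w" "grid_flow \<phi> h m y w"] by simp
  also have "\<dots> \<le> exp (rate \<kappa> b ?j * h) * (gain \<kappa> b h m w * norm (x - y))"
    by (intro mult_left_mono Suc.IH) simp
  finally show ?case by (simp add: algebra_simps)
qed simp

lemma grid_flow_bound:
  assumes "0 \<le> h" shows "norm (grid_flow \<phi> h m x w) \<le> max (norm x) R"
proof (induction m)
  case (Suc m)
  have "norm (\<phi> (w (real (Suc m) * h)) h (grid_flow \<phi> h m x w)) \<le> max (norm (grid_flow \<phi> h m x w)) R"
    by (rule flow_bound[OF assms])
  also have "\<dots> \<le> max (norm x) R" using Suc by simp
  finally show ?case by simp
qed simp

lemma measurable_flow [measurable]:
  assumes "0 \<le> h" shows "\<phi> j h \<in> borel_measurable borel"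
proof (rule borel_measurable_continuous_onI)
  have "(exp (rate \<kappa> b j * h))-lipschitz_on UNIV (\<phi> j h)"
    using flow_lipschitz[OF assms] by (intro lipschitz_onI) (auto simp: dist_norm)
  then show "continuous_on UNIV (\<phi> j h)" by (rule lipschitz_on_continuous_on)
qed

lemma measurable_grid_flow:
  assumes h: "0 \<le> h" and f: "f \<in> borel_measurable N" and g: "g \<in> measurable N path_space"
  shows "(\<lambda>z. grid_flow \<phi> h m (f z) (g z)) \<in> borel_measurable N"
proof (induction m)
  case 0
  then show ?case using f by simp
next
  case (Suc m)
  have "(\<lambda>z. \<phi> (g z (real (Suc m) * h)) h (grid_flow \<phi> h m (f z) (g z))) \<in> borel_measurable N"
  proof (rule measurable_compose_countable'[where I = UNIV and g = "\<lambda>z. g z (real (Suc m) * h)"])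
    show "(\<lambda>z. \<phi> j h (grid_flow \<phi> h m (f z) (g z))) \<in> borel_measurable N" for j
      by (rule measurable_compose[OF Suc measurable_flow[OF h]])
    show "(\<lambda>z. g z (real (Suc m) * h)) \<in> measurable N (count_space UNIV)"
      by (rule measurable_compose[OF g measurable_path_eval])
  qed auto
  then show ?case by simp
qed

definition grid :: "real \<Rightarrow> nat \<Rightarrow> 'a \<Rightarrow> (real \<Rightarrow> 2) \<Rightarrow> 'a" where
  "grid t n x w = grid_flow \<phi> (t / real (Suc n)) (Suc n) x w"

lemma grid_mult: "real (Suc n) * (t / real (Suc n)) = t"
  by simp

lemma grid_lipschitz:
  assumes "0 \<le> t" shows "norm (grid t n x w - grid t n y w) \<le> exp (b * t) * norm (x - y)"
proof -
  have "norm (grid t n x w - grid t n y w) \<le> gain \<kappa> b (t / real (Suc n)) (Suc n) w * norm (x - y)"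
    unfolding grid_def by (rule grid_flow_lipschitz) (use assms in simp)
  also have "\<dots> \<le> exp (b * (real (Suc n) * (t / real (Suc n)))) * norm (x - y)"
    by (intro mult_right_mono gain_bounds kb) (use assms in simp_all)
  finally show ?thesis unfolding grid_mult .
qed

lemma grid_bound: "0 \<le> t \<Longrightarrow> norm (grid t n x w) \<le> max (norm x) R"
  unfolding grid_def by (rule grid_flow_bound) simp

lemma grid_cong:
  assumes "0 \<le> t" "\<And>s. 0 \<le> s \<Longrightarrow> s \<le> t \<Longrightarrow> w s = w' s"
  shows "grid t n x w = grid t n x w'"
  unfolding grid_def
proof (rule grid_flow_cong, rule assms(2))
  fix k assume "k < Suc n"
  then have "real (Suc k) * (t / real (Suc n)) \<le> real (Suc n) * (t / real (Suc n))"
    using assms(1) by (intro mult_right_mono) auto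
  then show "real (Suc k) * (t / real (Suc n)) \<le> t" unfolding grid_mult .
qed (use assms(1) in simp)

lemma measurable_grid:
  assumes "0 \<le> t" "f \<in> borel_measurable N" "g \<in> measurable N path_space"
  shows "(\<lambda>z. grid t n (f z) (g z)) \<in> borel_measurable N"
  unfolding grid_def using assms by (intro measurable_grid_flow) auto

text \<open>The solution as a function of the path. Being a limit along grids, it uses countably
  many evaluations and is therefore measurable on path space; the default 0 is taken on paths where
  the grids do not converge.\<close>

definition F :: "real \<Rightarrow> 'a \<Rightarrow> (real \<Rightarrow> 2) \<Rightarrow> 'a" where
  "F t x w = (if Cauchy (\<lambda>n. grid t n x w) then lim (\<lambda>n. grid t n x w) else 0)"

lemma F_eqI: "(\<lambda>n. grid t n x w) \<longlonglongrightarrow> l \<Longrightarrow> F t x w = l"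
  by (simp add: F_def LIMSEQ_imp_Cauchy limI)

lemma F_lim: "Cauchy (\<lambda>n. grid t n x w) \<Longrightarrow> (\<lambda>n. grid t n x w) \<longlonglongrightarrow> F t x w"
  by (simp add: F_def Cauchy_convergent_iff convergent_LIMSEQ_iff)

lemma F_bound:
  assumes "0 \<le> t" shows "norm (F t x w) \<le> max (norm x) R"
proof (cases "Cauchy (\<lambda>n. grid t n x w)")
  case True
  show ?thesis
    by (rule tendsto_upperbound[OF tendsto_norm[OF F_lim[OF True]]])
      (auto intro!: always_eventually grid_bound[OF assms])
next
  case False
  then show ?thesis using R by (simp add: F_def)
qed

lemma F_cong:
  assumes "0 \<le> t" "\<And>s. 0 \<le> s \<Longrightarrow> s \<le> t \<Longrightarrow> w s = w' s"
  shows "F t x w = F t x w'"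
proof -
  have "grid t n x w = grid t n x w'" for n using assms by (rule grid_cong)
  then show ?thesis by (simp add: F_def)
qed

lemma measurable_F:
  assumes t: "0 \<le> t" and [measurable]: "f \<in> borel_measurable N" "g \<in> measurable N path_space"
  shows "(\<lambda>z. F t (f z) (g z)) \<in> borel_measurable N"
proof -
  have [measurable]: "(\<lambda>z. grid t n (f z) (g z)) \<in> borel_measurable N" for n
    by (rule measurable_grid[OF t]) measurable
  show ?thesis unfolding F_def by measurable
qed

text \<open>The initial value 0 of the position is an arbitrary choice: by \<open>L_eq\<close>,
  every process with the initial law \<mu> induces the same measure.\<close>

definition L :: "2 pmf \<Rightarrow> (real \<Rightarrow> 2) measure" where
  "L \<mu> = distr (M \<mu> 0) path_space (\<lambda>\<omega> s. i \<mu> 0 \<bar>s\<bar> \<omega>)"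

lemma L_eq: "switching_process r \<mu> N W \<Longrightarrow> distr N path_space (\<lambda>\<omega> s. W \<bar>s\<bar> \<omega>) = L \<mu>"
  unfolding L_def by (rule law_unique[OF _ process])

lemma sets_L [measurable_cong, simp]: "sets (L \<mu>) = sets path_space"
  by (simp add: L_def)

lemma space_L [simp]: "space (L \<mu>) = UNIV"
  by (simp add: L_def)

lemma prob_space_L: "prob_space (L \<mu>)"
proof -
  interpret prob_space "M \<mu> 0" by (rule switching_processD[OF process])
  show ?thesis unfolding L_def
    by (rule prob_space_distr) (rule measurable_path, rule switching_processD(2)[OF process])
qed

lemma process_path_measurable: "(\<lambda>\<omega> s. i \<mu> x \<bar>s\<bar> \<omega>) \<in> measurable (M \<mu> x) path_space"
  by (rule measurable_path, rule switching_processD(2)[OF process])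

lemma canonical_process: "switching_process r \<mu> (L \<mu>) (\<lambda>t w. w t)"
  unfolding switching_process_def
proof (intro conjI allI impI)
  show "prob_space (L \<mu>)" by (rule prob_space_L)
  show "(\<lambda>w. w t) \<in> measurable (L \<mu>) (count_space UNIV)" for t by measurable
  fix m :: nat and t y assume t: "0 \<le> t 0" "mono (t :: nat \<Rightarrow> real)"
  have t0: "0 \<le> t k" for k using t by (metis monoD le0 order_trans)
  have A: "{w \<in> space path_space. \<forall>k\<in>{..m}. w (t k) = y k} \<in> sets path_space"
  proof (rule sets.sets_Collect_finite_All)
    fix k
    have "(\<lambda>w. w (t k)) -` {y k} \<inter> space path_space \<in> sets path_space"
      by (rule measurable_sets[OF measurable_path_eval]) simp
    then show "{w \<in> space path_space. w (t k) = y k} \<in> sets path_space" by (simp add: vimage_def)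
  qed simp
  have "measure (L \<mu>) {w \<in> space path_space. \<forall>k\<in>{..m}. w (t k) = y k} =
      measure (M \<mu> 0) ((\<lambda>\<omega> s. i \<mu> 0 \<bar>s\<bar> \<omega>) -` {w \<in> space path_space. \<forall>k\<in>{..m}. w (t k) = y k} \<inter> space (M \<mu> 0))"
    unfolding L_def by (rule measure_distr[OF process_path_measurable A])
  also have "(\<lambda>\<omega> s. i \<mu> 0 \<bar>s\<bar> \<omega>) -` {w \<in> space path_space. \<forall>k\<in>{..m}. w (t k) = y k} \<inter> space (M \<mu> 0) =
      {\<omega>\<in>space (M \<mu> 0). \<forall>k\<le>m. i \<mu> 0 (t k) \<omega> = y k}"
    using t0 by auto
  also have "measure (M \<mu> 0) \<dots> = fdd r \<mu> t y m" by (rule switching_processD(3)[OF process t])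
  finally show "measure (L \<mu>) {w \<in> space (L \<mu>). \<forall>k\<le>m. w (t k) = y k} = fdd r \<mu> t y m"
    by (simp add: Ball_def)
qed

lemma AE_process_F:
  "AE \<omega> in M \<mu> x. \<forall>t\<ge>0. (\<lambda>n. grid t n x (\<lambda>s. i \<mu> x \<bar>s\<bar> \<omega>)) \<longlonglongrightarrow> \<eta> \<mu> x t \<omega>"
  using grid_converges[of \<mu> x]
proof eventually_elim
  case (elim \<omega>)
  show ?case
  proof (intro allI impI)
    fix t :: real assume t: "0 \<le> t"
    have "(\<lambda>n. grid t n (\<eta> \<mu> x 0 \<omega>) (\<lambda>u. i \<mu> x (0 + u) \<omega>)) \<longlonglongrightarrow> \<eta> \<mu> x (0 + t) \<omega>"
      unfolding grid_def using elim t by blast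
    moreover have "grid t n x (\<lambda>u. i \<mu> x u \<omega>) = grid t n x (\<lambda>s. i \<mu> x \<bar>s\<bar> \<omega>)" for n
      using t by (rule grid_cong) simp
    ultimately show "(\<lambda>n. grid t n x (\<lambda>s. i \<mu> x \<bar>s\<bar> \<omega>)) \<longlonglongrightarrow> \<eta> \<mu> x t \<omega>"
      using elim by simp
  qed
qed

text \<open>A property passes from the given spaces to path space only if it is an event there. This
  is why the following lemmas speak of Cauchy sequences and of equations between measurable
  functions.\<close>

lemma AE_L:
  assumes "{w \<in> space path_space. P w} \<in> sets path_space"
    and "AE \<omega> in M \<mu> x. P (\<lambda>s. i \<mu> x \<bar>s\<bar> \<omega>)"
  shows "AE w in L \<mu>. P w"
  using AE_distr_iff[OF process_path_measurable[of \<mu> x] assms(1)] assms(2)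
  unfolding L_eq[OF process[of \<mu> x]] by simp

lemma AE_L_F:
  assumes t: "0 \<le> t"
  shows "AE w in L \<mu>. (\<lambda>n. grid t n x w) \<longlonglongrightarrow> F t x w"
proof -
  have [measurable]: "(\<lambda>w. grid t n x w) \<in> borel_measurable path_space" for n
    by (rule measurable_grid[OF t]) measurable
  have "AE w in L \<mu>. Cauchy (\<lambda>n. grid t n x w)"
  proof (rule AE_L[where x = x])
    show "{w \<in> space path_space. Cauchy (\<lambda>n. grid t n x w)} \<in> sets path_space" by measurable
    show "AE \<omega> in M \<mu> x. Cauchy (\<lambda>n. grid t n x (\<lambda>s. i \<mu> x \<bar>s\<bar> \<omega>))"
      using AE_process_F by eventually_elim (use t LIMSEQ_imp_Cauchy in blast)
  qed
  then show ?thesis by eventually_elim (rule F_lim)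
qed

text \<open>\<open>AE_L_F\<close> has an exceptional set depending on the initial value, so it
  cannot be applied at the random point \<open>F s x w\<close>. The restart property in
  \<open>grid_converges\<close> provides the convergence from that point.\<close>

lemma AE_L_cocycle:
  assumes s: "0 \<le> s" and t: "0 \<le> t"
  shows "AE w in L \<mu>. (\<lambda>n. grid t n (F s x w) (\<lambda>u. w (s + u))) \<longlonglongrightarrow> F (s + t) x w"
proof -
  have [measurable]: "(\<lambda>w u. w (s + u)) \<in> measurable path_space path_space"
    by (rule measurable_path_spaceI) measurable
  have [measurable]: "(\<lambda>w. F s x w) \<in> borel_measurable path_space"
    by (rule measurable_F[OF s]) measurable
  have gm: "(\<lambda>w. grid t n (F s x w) (\<lambda>u. w (s + u))) \<in> borel_measurable path_space" for n
    by (rule measurable_grid[OF t]) measurable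
  have Fm: "(\<lambda>w. F t (F s x w) (\<lambda>u. w (s + u))) \<in> borel_measurable path_space"
    by (rule measurable_F[OF t]) measurable
  have Fm': "(\<lambda>w. F (s + t) x w) \<in> borel_measurable path_space"
    by (rule measurable_F) (use s t in \<open>simp_all add: measurable_ident\<close>)
  have eqm: "{w \<in> space path_space. f w = g w} \<in> sets path_space"
    if [measurable]: "f \<in> borel_measurable path_space" "g \<in> borel_measurable path_space" for f g :: "_ \<Rightarrow> 'a"
    by measurable
  \<comment> \<open>The Cauchy property together with the equation for the limit is the convergence
    claim in a measurable form.\<close>
  have "AE w in L \<mu>. Cauchy (\<lambda>n. grid t n (F s x w) (\<lambda>u. w (s + u))) \<and>
      F t (F s x w) (\<lambda>u. w (s + u)) = F (s + t) x w"
  proof (rule AE_L[where x = x])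
    show "{w \<in> space path_space. Cauchy (\<lambda>n. grid t n (F s x w) (\<lambda>u. w (s + u))) \<and>
      F t (F s x w) (\<lambda>u. w (s + u)) = F (s + t) x w} \<in> sets path_space"
      by (intro sets.sets_Collect_conj sets_Collect_Cauchy gm) (rule eqm[OF Fm Fm'])
    show "AE \<omega> in M \<mu> x. Cauchy (\<lambda>n. grid t n (F s x (\<lambda>s. i \<mu> x \<bar>s\<bar> \<omega>)) (\<lambda>u. i \<mu> x \<bar>s + u\<bar> \<omega>)) \<and>
      F t (F s x (\<lambda>s. i \<mu> x \<bar>s\<bar> \<omega>)) (\<lambda>u. i \<mu> x \<bar>s + u\<bar> \<omega>) = F (s + t) x (\<lambda>s. i \<mu> x \<bar>s\<bar> \<omega>)"
      using grid_converges[of \<mu> x] AE_process_F[where \<mu> = \<mu> and x = x]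
    proof eventually_elim
      case (elim \<omega>)
      have e: "F s x (\<lambda>s. i \<mu> x \<bar>s\<bar> \<omega>) = \<eta> \<mu> x s \<omega>" "F (s + t) x (\<lambda>s. i \<mu> x \<bar>s\<bar> \<omega>) = \<eta> \<mu> x (s + t) \<omega>"
        using elim(2) s t by (auto intro!: F_eqI)
      have "grid t n y (\<lambda>u. i \<mu> x (s + u) \<omega>) = grid t n y (\<lambda>u. i \<mu> x \<bar>s + u\<bar> \<omega>)" for n y
        using t by (rule grid_cong) (use s in simp)
      moreover have "(\<lambda>n. grid t n (\<eta> \<mu> x s \<omega>) (\<lambda>u. i \<mu> x (s + u) \<omega>)) \<longlonglongrightarrow> \<eta> \<mu> x (s + t) \<omega>"
        unfolding grid_def using elim(1) s t by blast
      ultimately have lim: "(\<lambda>n. grid t n (\<eta> \<mu> x s \<omega>) (\<lambda>u. i \<mu> x \<bar>s + u\<bar> \<omega>)) \<longlonglongrightarrow> \<eta> \<mu> x (s + t) \<omega>"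
        by simp
      then show ?case unfolding e using LIMSEQ_imp_Cauchy[OF lim] F_eqI[OF lim] by blast
    qed
  qed
  then show ?thesis
  proof eventually_elim
    case (elim w)
    then show ?case using F_lim[of t "F s x w" "\<lambda>u. w (s + u)"] by simp
  qed
qed

lemma measurable_state:
  assumes "0 \<le> t"
  shows "(\<lambda>w. (w t, F t x w)) \<in> measurable path_space state_space"
proof -
  have [measurable]: "(\<lambda>w. F t x w) \<in> borel_measurable path_space"
    by (rule measurable_F[OF assms]) measurable
  show ?thesis by measurable
qed

lemma law_eq:
  assumes t: "0 \<le> t"
  shows "distr (M \<mu> x) state_space (\<lambda>\<omega>. (i \<mu> x t \<omega>, \<eta> \<mu> x t \<omega>)) = distr (L \<mu>) state_space (\<lambda>w. (w t, F t x w))"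
proof -
  have [measurable]: "i \<mu> x t \<in> measurable (M \<mu> x) (count_space UNIV)" "\<eta> \<mu> x t \<in> borel_measurable (M \<mu> x)"
    using switching_processD(2)[OF process t] measurable_eta[OF t] by auto
  note [measurable] = measurable_state[OF t] process_path_measurable
  have "distr (L \<mu>) state_space (\<lambda>w. (w t, F t x w)) =
      distr (distr (M \<mu> x) path_space (\<lambda>\<omega> s. i \<mu> x \<bar>s\<bar> \<omega>)) state_space (\<lambda>w. (w t, F t x w))"
    by (simp only: L_eq[OF process])
  also have "\<dots> = distr (M \<mu> x) state_space ((\<lambda>w. (w t, F t x w)) \<circ> (\<lambda>\<omega> s. i \<mu> x \<bar>s\<bar> \<omega>))"
    by (rule distr_distr) measurable
  also have "\<dots> = distr (M \<mu> x) state_space (\<lambda>\<omega>. (i \<mu> x t \<omega>, \<eta> \<mu> x t \<omega>))"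
  proof (rule distr_cong_AE)
    show "AE \<omega> in M \<mu> x. ((\<lambda>w. (w t, F t x w)) \<circ> (\<lambda>\<omega> s. i \<mu> x \<bar>s\<bar> \<omega>)) \<omega> = (i \<mu> x t \<omega>, \<eta> \<mu> x t \<omega>)"
      using AE_process_F by eventually_elim (use t in \<open>auto intro!: F_eqI\<close>)
  qed (use t in \<open>auto simp: o_def intro!: measurable_compose[OF process_path_measurable measurable_state[OF t]]\<close>)
  finally show ?thesis ..
qed

definition K :: "real \<Rightarrow> 2 \<times> 'a \<Rightarrow> (2 \<times> 'a) measure" where
  "K t z = distr (L (return_pmf (fst z))) state_space (\<lambda>w. (w t, F t (snd z) w))"

lemma transition_kernel_eq: "0 \<le> t \<Longrightarrow> transition_kernel M i \<eta> t z = K t z"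
  unfolding transition_kernel_def K_def Let_def by (rule law_eq)

end

text \<open>Bounded Lipschitz functions determine a probability measure, and the transition
  operators map this class into itself. One constant bounds both the values and the slopes; slopes
  are compared only within one state.\<close>

definition test_function :: "real \<Rightarrow> (2 \<times> 'a::real_normed_vector \<Rightarrow> real) \<Rightarrow> bool" where
  "test_function B f \<longleftrightarrow> (\<forall>z. \<bar>f z\<bar> \<le> B) \<and> (\<forall>k x y. \<bar>f (k, x) - f (k, y)\<bar> \<le> B * norm (x - y))"

lemma test_functionD:
  assumes "test_function B f"
  shows "\<bar>f z\<bar> \<le> B" "\<bar>f (k, x) - f (k, y)\<bar> \<le> B * norm (x - y)" "0 \<le> B"
proof -
  have 1: "\<bar>f z\<bar> \<le> B" for z using assms unfolding test_function_def by blast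
  then show "\<bar>f z\<bar> \<le> B" .
  show "0 \<le> B" using 1[of "(0, 0)"] by linarith
  show "\<bar>f (k, x) - f (k, y)\<bar> \<le> B * norm (x - y)" using assms unfolding test_function_def by blast
qed

lemma measurable_test_function:
  fixes f :: "2 \<times> 'a::euclidean_space \<Rightarrow> real"
  assumes f: "test_function B f"
  shows "f \<in> borel_measurable state_space"
proof -
  have "(\<lambda>z. f (fst z, snd z)) \<in> borel_measurable state_space"
  proof (rule measurable_compose_countable'[where I = UNIV and g = fst])
    fix k
    have "B-lipschitz_on UNIV (\<lambda>x. f (k, x))"
      using test_functionD[OF f] by (intro lipschitz_onI) (auto simp: dist_norm)
    then have "(\<lambda>x. f (k, x)) \<in> borel_measurable borel"
      by (intro borel_measurable_continuous_onI lipschitz_on_continuous_on)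
    then show "(\<lambda>z. f (k, snd z)) \<in> borel_measurable state_space" by measurable
  qed auto
  then show ?thesis by simp
qed

lemma test_function_tendsto:
  fixes f :: "2 \<times> 'a::real_normed_vector \<Rightarrow> real"
  assumes "test_function B f" "x \<longlonglongrightarrow> l"
  shows "(\<lambda>n. f (k, x n)) \<longlonglongrightarrow> f (k, l)"
proof -
  have "(\<lambda>n. f (k, x n) - f (k, l)) \<longlonglongrightarrow> 0"
  proof (rule Lim_null_comparison[OF always_eventually])
    show "\<forall>n. norm (f (k, x n) - f (k, l)) \<le> B * norm (x n - l)"
      using test_functionD(2)[OF assms(1)] by simp
    have "(\<lambda>n. B * norm (x n - l)) \<longlonglongrightarrow> B * norm (l - l)" by (intro tendsto_intros assms)
    then show "(\<lambda>n. B * norm (x n - l)) \<longlonglongrightarrow> 0" by simp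
  qed
  then show ?thesis by (simp add: LIM_zero_iff)
qed

section \<open>The transition operators and their semigroup property\<close>

context switched_flow begin

text \<open>The new state is drawn first and its flow is applied over the step just completed,
  matching the right end points used by \<open>grid_flow\<close>.\<close>

definition step_op :: "real \<Rightarrow> (2 \<times> 'a \<Rightarrow> real) \<Rightarrow> 2 \<times> 'a \<Rightarrow> real" where
  "step_op h f z = (\<Sum>l\<in>UNIV. switch_prob r h (fst z) l * f (l, \<phi> l h (snd z)))"

text \<open>Unlike \<open>grid_flow\<close>, the steps may vary in length; the semigroup property
  concatenates two grids of different mesh.\<close>

primrec chain_flow :: "(nat \<Rightarrow> real) \<Rightarrow> 'a \<Rightarrow> (nat \<Rightarrow> 2) \<Rightarrow> nat \<Rightarrow> 'a" where
  "chain_flow t x y 0 = x"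
| "chain_flow t x y (Suc m) = \<phi> (y (Suc m)) (t (Suc m) - t m) (chain_flow t x y m)"

lemma chain_flow_cong: "(\<And>k. k \<le> m \<Longrightarrow> y k = y' k) \<Longrightarrow> chain_flow t x y m = chain_flow t x y' m"
  by (induction m) auto

lemma chain_flow_step:
  assumes W: "switching_process r \<mu> N W" and t: "0 \<le> t 0" "mono t"
  shows "(\<integral>\<omega>. f (W (t (Suc m)) \<omega>, chain_flow t x (\<lambda>k. W (t k) \<omega>) (Suc m)) \<partial>N) =
    (\<integral>\<omega>. step_op (t (Suc m) - t m) f (W (t m) \<omega>, chain_flow t x (\<lambda>k. W (t k) \<omega>) m) \<partial>N)"
proof -
  have "(\<integral>\<omega>. (\<lambda>l y. f (l, \<phi> l (t (Suc m) - t m) y)) (W (t (Suc m)) \<omega>) ((\<lambda>y. chain_flow t x y m) (\<lambda>k. W (t k) \<omega>)) \<partial>N) =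
      (\<integral>\<omega>. (\<Sum>l\<in>UNIV. switch_prob r (t (Suc m) - t m) (W (t m) \<omega>) l *
        (\<lambda>l y. f (l, \<phi> l (t (Suc m) - t m) y)) l ((\<lambda>y. chain_flow t x y m) (\<lambda>k. W (t k) \<omega>))) \<partial>N)"
    by (rule markov_step[OF W t]) (rule chain_flow_cong, blast)
  then show ?thesis by (simp add: step_op_def)
qed

lemma chain_flow_iterate:
  assumes W: "switching_process r \<mu> N W" and t: "0 \<le> t 0" "mono t"
    and h: "\<And>k. k < m \<Longrightarrow> t (Suc (n + k)) - t (n + k) = h"
  shows "(\<integral>\<omega>. f (W (t (n + m)) \<omega>, chain_flow t x (\<lambda>k. W (t k) \<omega>) (n + m)) \<partial>N) =
    (\<integral>\<omega>. (step_op h ^^ m) f (W (t n) \<omega>, chain_flow t x (\<lambda>k. W (t k) \<omega>) n) \<partial>N)"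
  using h
proof (induction m arbitrary: f)
  case (Suc m)
  have "(\<integral>\<omega>. f (W (t (n + Suc m)) \<omega>, chain_flow t x (\<lambda>k. W (t k) \<omega>) (n + Suc m)) \<partial>N) =
      (\<integral>\<omega>. step_op h f (W (t (n + m)) \<omega>, chain_flow t x (\<lambda>k. W (t k) \<omega>) (n + m)) \<partial>N)"
    using chain_flow_step[OF W t, of f "n + m" x] Suc.prems[of m] by simp
  also have "\<dots> = (\<integral>\<omega>. (step_op h ^^ m) (step_op h f) (W (t n) \<omega>, chain_flow t x (\<lambda>k. W (t k) \<omega>) n) \<partial>N)"
    by (rule Suc.IH) (use Suc.prems in simp)
  finally show ?case by (simp only: funpow_Suc_right o_apply)
next
  case 0
  show ?case by (simp only: funpow_0 add_0_right)
qed

lemma chain_flow_grid_flow: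
  assumes "\<And>k. k \<le> m \<Longrightarrow> t (n + k) = s + real k * h"
  shows "chain_flow t x (\<lambda>k. w (t k)) (n + m) = grid_flow \<phi> h m (chain_flow t x (\<lambda>k. w (t k)) n) (\<lambda>u. w (s + u))"
  using assms
proof (induction m)
  case (Suc m)
  have "t (Suc (n + m)) - t (n + m) = h" "t (Suc (n + m)) = s + real (Suc m) * h"
    using Suc.prems[of "Suc m"] Suc.prems[of m] by (simp_all add: algebra_simps)
  moreover have "chain_flow t x (\<lambda>k. w (t k)) (n + m) = grid_flow \<phi> h m (chain_flow t x (\<lambda>k. w (t k)) n) (\<lambda>u. w (s + u))"
    by (rule Suc.IH) (use Suc.prems in simp)
  ultimately show ?case by simp
next
  case 0
  show ?case by (simp only: grid_flow.simps add_0_right)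
qed

definition grid_op :: "real \<Rightarrow> nat \<Rightarrow> (2 \<times> 'a \<Rightarrow> real) \<Rightarrow> 2 \<times> 'a \<Rightarrow> real" where
  "grid_op t n = step_op (t / real (Suc n)) ^^ Suc n"

text \<open>The integral of f against \<open>K t z\<close>, written on path space.\<close>

definition KI :: "real \<Rightarrow> (2 \<times> 'a \<Rightarrow> real) \<Rightarrow> 2 \<times> 'a \<Rightarrow> real" where
  "KI t f z = (\<integral>w. f (w t, F t (snd z) w) \<partial>L (return_pmf (fst z)))"

lemma AE_initial_state: "AE w in L (return_pmf k). w 0 = k"
proof -
  interpret prob_space "L (return_pmf k)" by (rule prob_space_L)
  have "prob {w \<in> space (L (return_pmf k)). \<forall>l\<le>(0::nat). w 0 = k} = fdd r (return_pmf k) (\<lambda>_. 0) (\<lambda>_. k) 0"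
    using switching_processD(3)[OF canonical_process[of "return_pmf k"], of "\<lambda>_. 0" 0 "\<lambda>_. k"]
    by (simp add: mono_def)
  also have "\<dots> = 1" by (simp add: fdd_return_pmf)
  finally have "prob {w. w 0 = k} = 1" by simp
  moreover have "{w. w 0 = k} \<in> events"
  proof -
    have "(\<lambda>w. w 0) -` {k} \<inter> space path_space \<in> sets path_space"
      by (rule measurable_sets[OF measurable_path_eval]) simp
    then show ?thesis by (simp add: vimage_def)
  qed
  ultimately show ?thesis using AE_prob_1 by fastforce
qed

lemma measurable_grid_state:
  assumes t: "0 \<le> t" and f: "test_function B f"
  shows "(\<lambda>w. f (w s, grid t n x w)) \<in> borel_measurable path_space"
proof -
  have "(\<lambda>w. (w s, grid t n x w)) \<in> measurable path_space state_space"
    by (intro measurable_Pair measurable_path_eval measurable_grid[OF t]) auto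
  from measurable_compose[OF this measurable_test_function[OF f]] show ?thesis .
qed

lemma measurable_F_state:
  assumes t: "0 \<le> t" and f: "test_function B f"
  shows "(\<lambda>w. f (w s, F t x w)) \<in> borel_measurable path_space"
proof -
  have "(\<lambda>w. (w s, F t x w)) \<in> measurable path_space state_space"
    by (intro measurable_Pair measurable_path_eval measurable_F[OF t]) auto
  from measurable_compose[OF this measurable_test_function[OF f]] show ?thesis .
qed

lemma bounded_integrable_L:
  assumes "g \<in> borel_measurable path_space" "\<And>w. \<bar>g w\<bar> \<le> (B::real)"
  shows "integrable (L \<mu>) g"
proof -
  interpret prob_space "L \<mu>" by (rule prob_space_L)
  show ?thesis using assms by (intro integrable_const_bound[of _ B]) auto
qed

lemma grid_op_eq:
  assumes t: "0 \<le> t" and f: "test_function B f"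
  shows "grid_op t n f (k, x) = (\<integral>w. f (w t, grid t n x w) \<partial>L (return_pmf k))"
proof -
  interpret prob_space "L (return_pmf k)" by (rule prob_space_L)
  define h where "h = t / real (Suc n)"
  define u where "u k = real k * h" for k :: nat
  have "0 \<le> h" using t by (simp add: h_def)
  then have u: "0 \<le> u 0" "mono u" unfolding u_def by (auto intro!: monoI mult_right_mono)
  have uS: "u (0 + Suc n) = t" by (simp add: u_def h_def)
  have "(\<integral>w. f (w (u (0 + Suc n)), chain_flow u x (\<lambda>k. w (u k)) (0 + Suc n)) \<partial>L (return_pmf k)) =
      (\<integral>w. (step_op h ^^ Suc n) f (w (u 0), chain_flow u x (\<lambda>k. w (u k)) 0) \<partial>L (return_pmf k))"
    by (rule chain_flow_iterate[OF canonical_process u]) (simp add: u_def algebra_simps)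
  moreover have "chain_flow u x (\<lambda>k. w (u k)) (0 + Suc n) = grid t n x w" for w
    using chain_flow_grid_flow[of "Suc n" u 0 0 h x w] by (simp add: u_def grid_def h_def del: grid_flow.simps chain_flow.simps(2))
  ultimately have "(\<integral>w. f (w t, grid t n x w) \<partial>L (return_pmf k)) =
      (\<integral>w. (step_op h ^^ Suc n) f (w (u 0), chain_flow u x (\<lambda>k. w (u k)) 0) \<partial>L (return_pmf k))"
    by (simp only: uS)
  also have "\<dots> = (\<integral>w. (step_op h ^^ Suc n) f (k, x) \<partial>L (return_pmf k))"
  proof (rule integral_cong_AE)
    have "(\<lambda>w. (\<lambda>l. (step_op h ^^ Suc n) f (l, x)) (w 0)) \<in> borel_measurable path_space"
      by (rule measurable_compose[OF measurable_path_eval]) simp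
    then show "(\<lambda>w. (step_op h ^^ Suc n) f (w (u 0), chain_flow u x (\<lambda>k. w (u k)) 0)) \<in> borel_measurable (L (return_pmf k))"
      by (simp add: u_def)
    show "AE w in L (return_pmf k). (step_op h ^^ Suc n) f (w (u 0), chain_flow u x (\<lambda>k. w (u k)) 0) = (step_op h ^^ Suc n) f (k, x)"
      using AE_initial_state by eventually_elim (simp add: u_def del: funpow.simps)
  qed simp
  also have "\<dots> = (step_op h ^^ Suc n) f (k, x)"
    by (simp only: lebesgue_integral_const prob_space scaleR_one)
  finally show ?thesis by (simp only: grid_op_def h_def)
qed

lemma grid_op_tendsto:
  assumes t: "0 \<le> t" and f: "test_function B f"
  shows "(\<lambda>n. grid_op t n f z) \<longlonglongrightarrow> KI t f z"
proof -
  interpret prob_space "L (return_pmf (fst z))" by (rule prob_space_L)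
  have "(\<lambda>n. \<integral>w. f (w t, grid t n (snd z) w) \<partial>L (return_pmf (fst z))) \<longlonglongrightarrow> KI t f z"
    unfolding KI_def
  proof (rule integral_dominated_convergence[where w = "\<lambda>_. B"])
    show "AE w in L (return_pmf (fst z)). (\<lambda>n. f (w t, grid t n (snd z) w)) \<longlonglongrightarrow> f (w t, F t (snd z) w)"
      using AE_L_F[OF t, where x = "snd z"] by eventually_elim (rule test_function_tendsto[OF f])
    show "(\<lambda>w. f (w t, F t (snd z) w)) \<in> borel_measurable (L (return_pmf (fst z)))"
      using measurable_F_state[OF t f] by simp
    show "(\<lambda>w. f (w t, grid t n (snd z) w)) \<in> borel_measurable (L (return_pmf (fst z)))" for n
      using measurable_grid_state[OF t f] by simp
    show "AE w in L (return_pmf (fst z)). norm (f (w t, grid t n (snd z) w)) \<le> B" for n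
      using test_functionD(1)[OF f] by simp
  qed simp
  moreover have "grid_op t n f z = (\<integral>w. f (w t, grid t n (snd z) w) \<partial>L (return_pmf (fst z)))" for n
    using grid_op_eq[OF t f, of n "fst z" "snd z"] by (simp only: prod.collapse)
  ultimately show ?thesis by (simp only:)
qed

text \<open>The factor is the worst growth allowed by \<open>grid_lipschitz\<close>. What counts is
  that it does not depend on n, so that it survives the limit and controls errors in the initial
  point uniformly.\<close>

lemma test_function_grid_op:
  assumes t: "0 \<le> t" and f: "test_function B f"
  shows "test_function (B * exp (b * t)) (grid_op t n f)"
  unfolding test_function_def
proof (intro conjI allI)
  have B: "0 \<le> B" by (rule test_functionD(3)[OF f])
  have e: "1 \<le> exp (b * t)" using t kb by simp
  fix z :: "2 \<times> 'a"
  obtain k x where z: "z = (k, x)" by (cases z)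
  interpret prob_space "L (return_pmf k)" by (rule prob_space_L)
  have "\<bar>grid_op t n f z\<bar> \<le> (\<integral>w. \<bar>f (w t, grid t n x w)\<bar> \<partial>L (return_pmf k))"
    unfolding z grid_op_eq[OF t f] by (rule integral_abs_bound)
  also have "\<dots> \<le> (\<integral>w. B \<partial>L (return_pmf k))"
    by (intro integral_mono integrable_abs bounded_integrable_L[OF measurable_grid_state[OF t f]])
      (auto intro: test_functionD[OF f])
  also have "\<dots> \<le> B * exp (b * t)" using B e mult_left_mono[OF e B] by (simp add: prob_space[simplified])
  finally show "\<bar>grid_op t n f z\<bar> \<le> B * exp (b * t)" .
next
  have B: "0 \<le> B" by (rule test_functionD(3)[OF f])
  fix k :: 2 and x y
  interpret prob_space "L (return_pmf k)" by (rule prob_space_L)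
  have int: "integrable (L (return_pmf k)) (\<lambda>w. f (w t, grid t n x w))" for x
    by (rule bounded_integrable_L[OF measurable_grid_state[OF t f]]) (rule test_functionD[OF f])
  have "\<bar>grid_op t n f (k, x) - grid_op t n f (k, y)\<bar> =
      \<bar>\<integral>w. f (w t, grid t n x w) - f (w t, grid t n y w) \<partial>L (return_pmf k)\<bar>"
    unfolding grid_op_eq[OF t f] using int by simp
  also have "\<dots> \<le> (\<integral>w. \<bar>f (w t, grid t n x w) - f (w t, grid t n y w)\<bar> \<partial>L (return_pmf k))"
    by (rule integral_abs_bound)
  also have "\<dots> \<le> (\<integral>w. B * exp (b * t) * norm (x - y) \<partial>L (return_pmf k))"
  proof (rule integral_mono)
    fix w
    have "\<bar>f (w t, grid t n x w) - f (w t, grid t n y w)\<bar> \<le> B * norm (grid t n x w - grid t n y w)"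
      by (rule test_functionD[OF f])
    also have "\<dots> \<le> B * (exp (b * t) * norm (x - y))" by (intro mult_left_mono grid_lipschitz t B)
    finally show "\<bar>f (w t, grid t n x w) - f (w t, grid t n y w)\<bar> \<le> B * exp (b * t) * norm (x - y)" by simp
  qed (use int in auto)
  also have "\<dots> = B * exp (b * t) * norm (x - y)" by (simp add: prob_space[simplified])
  finally show "\<bar>grid_op t n f (k, x) - grid_op t n f (k, y)\<bar> \<le> B * exp (b * t) * norm (x - y)" .
qed

lemma test_function_KI:
  assumes t: "0 \<le> t" and f: "test_function B f"
  shows "test_function (B * exp (b * t)) (KI t f)"
  unfolding test_function_def
proof (intro conjI allI)
  fix z show "\<bar>KI t f z\<bar> \<le> B * exp (b * t)"
    by (rule tendsto_upperbound[OF tendsto_rabs[OF grid_op_tendsto[OF t f]]])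
      (auto intro!: always_eventually test_functionD(1)[OF test_function_grid_op[OF t f]])
next
  fix k x y show "\<bar>KI t f (k, x) - KI t f (k, y)\<bar> \<le> B * exp (b * t) * norm (x - y)"
    by (rule tendsto_upperbound[OF tendsto_rabs[OF tendsto_diff[OF grid_op_tendsto[OF t f] grid_op_tendsto[OF t f]]]])
      (auto intro!: always_eventually test_functionD(2)[OF test_function_grid_op[OF t f]])
qed

lemma KI_bound:
  assumes t: "0 \<le> t" and f: "test_function B f"
  shows "\<bar>KI t f z\<bar> \<le> B"
proof -
  interpret prob_space "L (return_pmf (fst z))" by (rule prob_space_L)
  have "\<bar>KI t f z\<bar> \<le> (\<integral>w. \<bar>f (w t, F t (snd z) w)\<bar> \<partial>L (return_pmf (fst z)))"
    unfolding KI_def by (rule integral_abs_bound)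
  also have "\<dots> \<le> (\<integral>w. B \<partial>L (return_pmf (fst z)))"
    by (intro integral_mono integrable_abs bounded_integrable_L[OF measurable_F_state[OF t f]])
      (auto intro: test_functionD[OF f])
  finally show ?thesis by (simp add: prob_space[simplified])
qed

text \<open>On a grid over [0, s] followed by a grid over [s, s + t] the identity is the Markov
  property of the sampled chain. Refining both grids, one side converges by the cocycle property,
  the other by the Lipschitz bound on \<open>grid_op\<close> that is uniform in n.\<close>

lemma KI_semigroup:
  assumes s: "0 \<le> s" and t: "0 \<le> t" and f: "test_function B f"
  shows "KI (s + t) f z = KI s (KI t f) z"
proof -
  obtain j x where z: "z = (j, x)" by (cases z)
  interpret prob_space "L (return_pmf j)" by (rule prob_space_L)
  define Z where "Z n w = grid t n (grid s n x w) (\<lambda>u. w (s + u))" for n and w :: "real \<Rightarrow> 2"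
  have sh: "(\<lambda>w u. w (s + u)) \<in> measurable path_space path_space"
    by (rule measurable_path_spaceI) (rule measurable_path_eval)
  have Zm: "Z n \<in> borel_measurable path_space" for n
    unfolding Z_def[abs_def] by (intro measurable_grid[OF t] measurable_grid[OF s] sh) auto
  have fZm: "(\<lambda>w. f (w (s + t), Z n w)) \<in> borel_measurable path_space" for n
  proof -
    have "(\<lambda>w. (w (s + t), Z n w)) \<in> measurable path_space state_space"
      by (intro measurable_Pair measurable_path_eval Zm)
    from measurable_compose[OF this measurable_test_function[OF f]] show ?thesis .
  qed
  have eq: "(\<integral>w. f (w (s + t), Z n w) \<partial>L (return_pmf j)) = (\<integral>w. grid_op t n f (w s, grid s n x w) \<partial>L (return_pmf j))" for n
  proof -
    define N where "N = Suc n"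
    define h h' where "h = t / real N" and "h' = s / real N"
    have hN: "0 \<le> h" "0 \<le> h'" "real N * h = t" "real N * h' = s" using s t by (auto simp: h_def h'_def N_def)
    \<comment> \<open>N cells of length \<open>h'\<close> up to time s, then cells of length h;
      chosen so that index N is time s and index N + N is time s + t.\<close>
    define u where "u k = (if k \<le> N then real k * h' else s + real (k - N) * h)" for k
    have u0: "0 \<le> u 0" by (simp add: u_def)
    have uN: "u (N + k) = s + real k * h" for k using hN by (cases "k = 0") (auto simp: u_def)
    have uk: "u k = real k * h'" if "k \<le> N" for k using that by (simp add: u_def)
    have um: "mono u"
    proof (rule mono_iff_le_Suc[THEN iffD2], rule allI)
      fix k show "u k \<le> u (Suc k)"
      proof (cases "Suc k \<le> N")
        case True
        then show ?thesis using hN by (simp add: uk algebra_simps)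
      next
        case False
        then obtain l where "k = N + l" by (metis le_Suc_ex not_less_eq_eq)
        then show ?thesis using uN[of l] uN[of "Suc l"] hN by (simp add: algebra_simps)
      qed
    qed
    have "(\<integral>w. f (w (u (N + N)), chain_flow u x (\<lambda>k. w (u k)) (N + N)) \<partial>L (return_pmf j)) =
        (\<integral>w. (step_op h ^^ N) f (w (u N), chain_flow u x (\<lambda>k. w (u k)) N) \<partial>L (return_pmf j))"
    proof (rule chain_flow_iterate[OF canonical_process u0 um])
      fix k show "u (Suc (N + k)) - u (N + k) = h"
        using uN[of k] uN[of "Suc k"] by (simp add: algebra_simps)
    qed
    moreover have "u (N + N) = s + t" using uN[of N] hN by simp
    moreover have "u N = s" using uN[of 0] by simp
    moreover have c1: "chain_flow u x (\<lambda>k. w (u k)) N = grid s n x w" for w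
    proof -
      have "chain_flow u x (\<lambda>k. w (u k)) (0 + N) = grid_flow \<phi> h' N (chain_flow u x (\<lambda>k. w (u k)) 0) (\<lambda>u. w (0 + u))"
        by (rule chain_flow_grid_flow) (simp add: uk)
      then show ?thesis by (simp add: grid_def h'_def N_def del: grid_flow.simps chain_flow.simps(2))
    qed
    moreover have "chain_flow u x (\<lambda>k. w (u k)) (N + N) = Z n w" for w
    proof -
      have "chain_flow u x (\<lambda>k. w (u k)) (N + N) = grid_flow \<phi> h N (chain_flow u x (\<lambda>k. w (u k)) N) (\<lambda>u. w (s + u))"
        by (rule chain_flow_grid_flow) (rule uN)
      then show ?thesis unfolding c1 by (simp add: Z_def grid_def[of t] h_def N_def del: grid_flow.simps)
    qed
    moreover have "step_op h ^^ N = grid_op t n" by (simp only: grid_op_def h_def N_def)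
    ultimately show ?thesis by simp
  qed
  have "(\<lambda>n. \<integral>w. f (w (s + t), Z n w) \<partial>L (return_pmf j)) \<longlonglongrightarrow> KI (s + t) f z"
    unfolding KI_def z fst_conv snd_conv
  proof (rule integral_dominated_convergence[where w = "\<lambda>_. B"])
    show "AE w in L (return_pmf j). (\<lambda>n. f (w (s + t), Z n w)) \<longlonglongrightarrow> f (w (s + t), F (s + t) x w)"
      using AE_L_F[OF s, where x = x] AE_L_cocycle[OF s t, where x = x]
    proof eventually_elim
      case (elim w)
      \<comment> \<open>Z starts its second stage from the approximate point
        \<open>grid s n x w\<close> instead of \<open>F s x w\<close>; the Lipschitz bound makes the
        difference vanish.\<close>
      have "(\<lambda>n. Z n w - grid t n (F s x w) (\<lambda>u. w (s + u))) \<longlonglongrightarrow> 0"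
      proof (rule Lim_null_comparison[OF always_eventually])
        show "\<forall>n. norm (Z n w - grid t n (F s x w) (\<lambda>u. w (s + u))) \<le> exp (b * t) * norm (grid s n x w - F s x w)"
          unfolding Z_def by (intro allI grid_lipschitz t)
        have "(\<lambda>n. exp (b * t) * norm (grid s n x w - F s x w)) \<longlonglongrightarrow> exp (b * t) * norm (F s x w - F s x w)"
          by (intro tendsto_intros elim(1))
        then show "(\<lambda>n. exp (b * t) * norm (grid s n x w - F s x w)) \<longlonglongrightarrow> 0" by simp
      qed
      from tendsto_add[OF this elim(2)] have "(\<lambda>n. Z n w) \<longlonglongrightarrow> F (s + t) x w" by simp
      then show ?case by (rule test_function_tendsto[OF f])
    qed
    show "(\<lambda>w. f (w (s + t), F (s + t) x w)) \<in> borel_measurable (L (return_pmf j))"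
      using measurable_F_state[OF _ f, of "s + t" "s + t" x] s t by simp
    show "(\<lambda>w. f (w (s + t), Z n w)) \<in> borel_measurable (L (return_pmf j))" for n using fZm by simp
    show "AE w in L (return_pmf j). norm (f (w (s + t), Z n w)) \<le> B" for n
      using test_functionD(1)[OF f] by simp
  qed simp
  moreover have "(\<lambda>n. \<integral>w. grid_op t n f (w s, grid s n x w) \<partial>L (return_pmf j)) \<longlonglongrightarrow> KI s (KI t f) z"
    unfolding KI_def[of s] z fst_conv snd_conv
  proof (rule integral_dominated_convergence[where w = "\<lambda>_. B * exp (b * t)"])
    show "AE w in L (return_pmf j). (\<lambda>n. grid_op t n f (w s, grid s n x w)) \<longlonglongrightarrow> KI t f (w s, F s x w)"
      using AE_L_F[OF s, where x = x]
    proof eventually_elim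
      case (elim w)
      have "(\<lambda>n. grid_op t n f (w s, grid s n x w) - grid_op t n f (w s, F s x w)) \<longlonglongrightarrow> 0"
      proof (rule Lim_null_comparison[OF always_eventually])
        show "\<forall>n. norm (grid_op t n f (w s, grid s n x w) - grid_op t n f (w s, F s x w)) \<le>
            B * exp (b * t) * norm (grid s n x w - F s x w)"
          using test_functionD(2)[OF test_function_grid_op[OF t f]] by simp
        have "(\<lambda>n. B * exp (b * t) * norm (grid s n x w - F s x w)) \<longlonglongrightarrow> B * exp (b * t) * norm (F s x w - F s x w)"
          by (intro tendsto_intros elim(1))
        then show "(\<lambda>n. B * exp (b * t) * norm (grid s n x w - F s x w)) \<longlonglongrightarrow> 0" by simp
      qed
      from tendsto_add[OF this grid_op_tendsto[OF t f, of "(w s, F s x w)"]]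
      show ?case by simp
    qed
    show "(\<lambda>w. KI t f (w s, F s x w)) \<in> borel_measurable (L (return_pmf j))"
      using measurable_F_state[OF s test_function_KI[OF t f]] by simp
    show "(\<lambda>w. grid_op t n f (w s, grid s n x w)) \<in> borel_measurable (L (return_pmf j))" for n
      using measurable_grid_state[OF s test_function_grid_op[OF t f]] by simp
    show "AE w in L (return_pmf j). norm (grid_op t n f (w s, grid s n x w)) \<le> B * exp (b * t)" for n
      using test_functionD(1)[OF test_function_grid_op[OF t f]] by simp
  qed simp
  ultimately show ?thesis unfolding eq by (rule LIMSEQ_unique)
qed

end

section \<open>Coupling\<close>

text \<open>The truncation allows the exponent p to be lowered to a q for which the moments of the
  gain decay: below 1 the smaller exponent gives the larger value, above 1 the truncation takes
  over.\<close>

lemma min_one_powr_le: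
  fixes \<delta> p q :: real
  assumes "0 \<le> \<delta>" "0 < q" "q \<le> p"
  shows "min 1 (\<delta> powr p) \<le> \<delta> powr q"
proof (cases "\<delta> \<le> 1")
  case True
  then have "\<delta> powr p \<le> \<delta> powr q" using assms by (cases "\<delta> = 0") (auto intro: powr_mono')
  then show ?thesis by simp
next
  case False
  then have "1 \<le> \<delta> powr q" using assms by (intro ge_one_powr_ge_zero) auto
  then show ?thesis by simp
qed

lemma powr_le_one_plus:
  fixes D q :: real
  assumes "0 \<le> D" "0 < q" "q \<le> 1"
  shows "D powr q \<le> 1 + D"
proof (cases "D \<le> 1")
  case True
  then have "D powr q \<le> 1" using assms by (intro powr_le1) auto
  then show ?thesis using assms by simp
next
  case False
  then have "D powr q \<le> D powr 1" using assms by (intro powr_mono) auto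
  then show ?thesis using False by simp
qed

lemma nn_integral_pair_product:
  assumes "sigma_finite_measure B" "g \<in> borel_measurable A" "k \<in> borel_measurable B"
  shows "(\<integral>\<^sup>+z. g (fst z) * k (snd z) \<partial>(A \<Otimes>\<^sub>M B)) = (\<integral>\<^sup>+a. g a \<partial>A) * (\<integral>\<^sup>+c. k c \<partial>B)"
proof -
  interpret B: sigma_finite_measure B by fact
  note [measurable] = assms(2,3)
  have "(\<integral>\<^sup>+z. g (fst z) * k (snd z) \<partial>(A \<Otimes>\<^sub>M B)) = (\<integral>\<^sup>+a. \<integral>\<^sup>+c. g a * k c \<partial>B \<partial>A)"
    by (subst B.nn_integral_fst[symmetric]) simp_all
  also have "\<dots> = (\<integral>\<^sup>+a. g a * (\<integral>\<^sup>+c. k c \<partial>B) \<partial>A)"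
    by (intro nn_integral_cong nn_integral_cmult) measurable
  also have "\<dots> = (\<integral>\<^sup>+a. g a \<partial>A) * (\<integral>\<^sup>+c. k c \<partial>B)" by (rule nn_integral_multc) measurable
  finally show ?thesis .
qed

context switched_flow begin

text \<open>One space for all initial states: a stationary path and an independent refresh time. The
  paths built by \<open>path_from\<close> from two initial states agree from the refresh time
  on.\<close>

definition N :: "((real \<Rightarrow> 2) \<times> real) measure" where
  "N = L uniform2 \<Otimes>\<^sub>M refresh_time r"

definition path_from :: "2 \<Rightarrow> (real \<Rightarrow> 2) \<times> real \<Rightarrow> real \<Rightarrow> 2" where
  "path_from j z s = (if \<bar>s\<bar> < snd z then j else fst z \<bar>s\<bar>)"

lemma sets_N [measurable_cong]: "sets N = sets (path_space \<Otimes>\<^sub>M borel)"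
  unfolding N_def by (intro sets_pair_measure_cong) (simp_all add: refresh_time(2)[OF r])

lemma prob_space_N: "prob_space N"
proof -
  interpret A: prob_space "L uniform2" by (rule prob_space_L)
  interpret B: prob_space "refresh_time r" by (rule refresh_time(1)[OF r])
  interpret pair_prob_space "L uniform2" "refresh_time r" ..
  show ?thesis unfolding N_def by (rule prob_space_axioms)
qed

lemma measurable_path_from: "path_from j \<in> measurable N path_space"
proof (rule measurable_path_spaceI)
  fix s
  have [measurable]: "(\<lambda>z. fst z \<bar>s\<bar>) \<in> measurable N (count_space UNIV)"
    by (rule measurable_compose[OF _ measurable_path_eval]) measurable
  show "(\<lambda>z. path_from j z s) \<in> measurable N (count_space UNIV)"
    unfolding path_from_def by measurable
qed

lemma refreshed_process: "switching_process r (return_pmf j) N (refreshed j (\<lambda>t w. w t))"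
  unfolding N_def by (rule switching_process_refreshed[OF r canonical_process])

lemma path_from_refreshed: "path_from j = (\<lambda>z s. refreshed j (\<lambda>t w. w t) \<bar>s\<bar> z)"
  by (simp add: fun_eq_iff path_from_def refreshed_def)

lemma distr_path_from: "distr N path_space (path_from j) = L (return_pmf j)"
  unfolding path_from_refreshed by (rule L_eq[OF refreshed_process])

lemma AE_path_from: "AE w in L (return_pmf j). Q w \<Longrightarrow> AE z in N. Q (path_from j z)"
  unfolding distr_path_from[symmetric] by (rule AE_distrD[OF measurable_path_from])

lemma AE_N_nonneg: "AE z in N. 0 \<le> snd z"
proof -
  interpret A: prob_space "L uniform2" by (rule prob_space_L)
  interpret B: prob_space "refresh_time r" by (rule refresh_time(1)[OF r])
  interpret pair_prob_space "L uniform2" "refresh_time r" ..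
  show ?thesis unfolding N_def
  proof (rule AE_pair_measure)
    have "{x \<in> space N. 0 \<le> snd x} \<in> sets N" by measurable
    then show "{x \<in> space (L uniform2 \<Otimes>\<^sub>M refresh_time r). 0 \<le> snd x} \<in> sets (L uniform2 \<Otimes>\<^sub>M refresh_time r)"
      by (simp only: N_def)
    show "AE x in L uniform2. AE y in refresh_time r. 0 \<le> snd (x, y)"
      using AE_refresh_time_nonneg[OF r] by simp
  qed
qed

text \<open>Before the refresh only the norm bounds are available; afterwards both solutions follow
  the stationary path and contract together. The factor \<open>exp (\<kappa> * snd z)\<close> pays
  for the gain of the stationary path before the refresh, so that the bound splits into independent
  functions of path and refresh time.\<close>

lemma coupled_grid_flow:
  assumes h: "0 \<le> h" and \<tau>: "0 \<le> snd z"
  shows "norm (grid_flow \<phi> h m x (path_from j z) - grid_flow \<phi> h m y (path_from k z)) \<le>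
    (max (norm x) R + max (norm y) R) * exp (\<kappa> * snd z) * gain \<kappa> b h m (fst z)"
proof (induction m)
  case 0
  have "norm (x - y) \<le> max (norm x) R + max (norm y) R"
    by (rule order_trans[OF norm_triangle_ineq4]) (simp add: add_mono)
  also have "\<dots> \<le> (max (norm x) R + max (norm y) R) * exp (\<kappa> * snd z)"
    using \<tau> kb R mult_left_mono[of 1 "exp (\<kappa> * snd z)" "max (norm x) R + max (norm y) R"] by simp
  finally show ?case by simp
next
  case (Suc m)
  let ?D = "max (norm x) R + max (norm y) R" and ?s = "real (Suc m) * h"
  have s: "0 \<le> ?s" using h by simp
  have D: "0 \<le> ?D" using R by simp
  let ?gx = "grid_flow \<phi> h m x (path_from j z)" and ?gy = "grid_flow \<phi> h m y (path_from k z)"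
  show ?case
  proof (cases "?s < snd z")
    case True
    have "norm (grid_flow \<phi> h (Suc m) x (path_from j z) - grid_flow \<phi> h (Suc m) y (path_from k z)) \<le> ?D"
      by (rule order_trans[OF norm_triangle_ineq4]) (intro add_mono grid_flow_bound[OF h])
    also have "\<dots> \<le> ?D * (exp (\<kappa> * snd z) * gain \<kappa> b h (Suc m) (fst z))"
    proof -
      have "1 \<le> exp (\<kappa> * snd z) * exp (- \<kappa> * ?s)"
        \<comment> \<open>The gain up to a time before the refresh is at least
          \<open>exp (- \<kappa> * snd z)\<close>, so the right-hand side still exceeds the norm
          bound.\<close>
        using True kb by (simp add: exp_add[symmetric] mult_left_mono del: of_nat_Suc)
      also have "\<dots> \<le> exp (\<kappa> * snd z) * gain \<kappa> b h (Suc m) (fst z)"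
        using gain_bounds(2)[OF h kb, of "Suc m" "fst z"] by (intro mult_left_mono) auto
      finally show ?thesis using mult_left_mono[OF _ D] by fastforce
    qed
    finally show ?thesis by (simp only: mult.assoc)
  next
    case False
    have e: "path_from j z ?s = fst z ?s" "path_from k z ?s = fst z ?s"
      using False s unfolding path_from_def by simp_all
    have "norm (grid_flow \<phi> h (Suc m) x (path_from j z) - grid_flow \<phi> h (Suc m) y (path_from k z)) \<le>
        exp (rate \<kappa> b (fst z ?s) * h) * norm (?gx - ?gy)"
      unfolding grid_flow.simps e by (rule flow_lipschitz[OF h])
    also have "\<dots> \<le> exp (rate \<kappa> b (fst z ?s) * h) * (?D * exp (\<kappa> * snd z) * gain \<kappa> b h m (fst z))"
      by (intro mult_left_mono Suc.IH) simp
    also have "\<dots> = ?D * exp (\<kappa> * snd z) * gain \<kappa> b h (Suc m) (fst z)" by (simp add: algebra_simps)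
    finally show ?thesis .
  qed
qed

lemma measurable_F_path_from:
  assumes "0 \<le> t" shows "(\<lambda>z. F t x (path_from j z)) \<in> borel_measurable N"
  by (rule measurable_F[OF assms _ measurable_path_from]) simp

lemma measurable_grid_path_from:
  assumes "0 \<le> t" shows "(\<lambda>z. grid t n x (path_from j z)) \<in> borel_measurable N"
  by (rule measurable_grid[OF assms _ measurable_path_from]) simp

text \<open>On grids, \<open>coupled_grid_flow\<close> raised to the power q factorizes by
  independence into a moment of the gain and an exponential moment of the refresh time. Fatou's
  lemma carries the bound over to the solutions.\<close>

lemma coupling_estimate:
  assumes p: "0 < p" "p \<le> 1"
  obtains C c where "C > 0" "c > 0" "\<And>t j k x y. 0 \<le> t \<Longrightarrow>
    (\<integral>\<^sup>+z. ennreal (min 1 (norm (F t x (path_from j z) - F t y (path_from k z)) powr p)) \<partial>N) \<le>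
      ennreal (C * (1 + norm x + norm y) * exp (- c * t))"
proof -
  interpret N: prob_space N by (rule prob_space_N)
  interpret Lu: prob_space "L uniform2" by (rule prob_space_L)
  interpret D: prob_space "refresh_time r" by (rule refresh_time(1)[OF r])
  obtain q0 where q0: "q0 > 0" "\<And>q. 0 < q \<Longrightarrow> q \<le> q0 \<Longrightarrow> \<exists>C c h0. C > 0 \<and> c > 0 \<and> h0 > 0 \<and>
    (\<forall>h m (M :: (real \<Rightarrow> 2) measure) W \<mu>. 0 < h \<longrightarrow> h < h0 \<longrightarrow> switching_process r \<mu> M W \<longrightarrow>
      integrable M (\<lambda>\<omega>. gain \<kappa> b h m (\<lambda>s. W s \<omega>) powr q) \<and>
      (\<integral>\<omega>. gain \<kappa> b h m (\<lambda>s. W s \<omega>) powr q \<partial>M) \<le> C * exp (- c * (real m * h)))"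
    using gain_moment_bound[OF r kb] by blast
  \<comment> \<open>The three bounds serve the decay of the gain, the passage from p to q, and the
    finiteness of the exponential moment of the refresh time, as q * \<kappa> stays below 2 *
    r.\<close>
  define q where "q = min q0 (min p (r / \<kappa>))"
  have k0: "0 < \<kappa>" using kb by simp
  have q: "0 < q" "q \<le> q0" "q \<le> p" "q \<le> 1" using q0 p r k0 by (auto simp: q_def)
  have qk: "q * \<kappa> < 2 * r"
  proof -
    have "q * \<kappa> \<le> r / \<kappa> * \<kappa>" using k0 by (intro mult_right_mono) (auto simp: q_def)
    then show ?thesis using k0 r by simp
  qed
  obtain C c h0 where C: "C > 0" "c > 0" "h0 > 0" and
    mom: "\<And>h m. 0 < h \<Longrightarrow> h < h0 \<Longrightarrow> integrable (L uniform2) (\<lambda>w. gain \<kappa> b h m w powr q) \<and>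
      (\<integral>w. gain \<kappa> b h m w powr q \<partial>L uniform2) \<le> C * exp (- c * (real m * h))"
  proof -
    obtain C c h0 where *: "C > 0" "c > 0" "h0 > 0"
      "\<forall>h m (M :: (real \<Rightarrow> 2) measure) W \<mu>. 0 < h \<longrightarrow> h < h0 \<longrightarrow> switching_process r \<mu> M W \<longrightarrow>
      integrable M (\<lambda>\<omega>. gain \<kappa> b h m (\<lambda>s. W s \<omega>) powr q) \<and>
      (\<integral>\<omega>. gain \<kappa> b h m (\<lambda>s. W s \<omega>) powr q \<partial>M) \<le> C * exp (- c * (real m * h))"
      using q0(2)[OF q(1,2)] by blast
    show thesis by (rule that[OF *(1-3)]) (use *(4) canonical_process[of uniform2] in blast)
  qed
  define A where "A = 2 * r / (2 * r - q * \<kappa>)"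
  have A: "0 < A" using qk r by (simp add: A_def)
  \<comment> \<open>The summand 1 covers t = 0, where the mesh vanishes and the moment bound does
    not apply; there the truncated cost is at most 1.\<close>
  define C' where "C' = 1 + (1 + 2 * R) * A * C"
  have C': "C' > 0" using A C(1) R by (simp add: C'_def add_pos_nonneg)
  show ?thesis
  proof (rule that[OF C' C(2)])
    fix t j k x y assume t: "0 \<le> (t::real)"
    define G where "G u v = ennreal (min 1 (norm (u - v) powr p))" for u v :: 'a
    have G1: "G u v \<le> 1" for u v by (simp add: G_def)
    show "(\<integral>\<^sup>+z. ennreal (min 1 (norm (F t x (path_from j z) - F t y (path_from k z)) powr p)) \<partial>N) \<le>
      ennreal (C' * (1 + norm x + norm y) * exp (- c * t))"
      unfolding G_def[symmetric]
    proof (cases "t = 0")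
      case True
      have "(\<integral>\<^sup>+z. G (F t x (path_from j z)) (F t y (path_from k z)) \<partial>N) \<le> (\<integral>\<^sup>+z. 1 \<partial>N)"
        by (intro nn_integral_mono G1)
      also have "\<dots> = 1" by (simp add: N.emeasure_space_1)
      also have "\<dots> \<le> ennreal (C' * (1 + norm x + norm y) * exp (- c * t))"
      proof -
        have "1 * 1 \<le> C' * (1 + norm x + norm y)"
          using A C(1) R by (intro mult_mono) (auto simp: C'_def)
        then show ?thesis using True by simp
      qed
      finally show "(\<integral>\<^sup>+z. G (F t x (path_from j z)) (F t y (path_from k z)) \<partial>N) \<le>
        ennreal (C' * (1 + norm x + norm y) * exp (- c * t))" .
    next
      case False
      then have t0: "0 < t" using t by simp
      define D where "D = max (norm x) R + max (norm y) R"
      have D: "0 \<le> D" "D powr q \<le> (1 + 2 * R) * (1 + norm x + norm y)"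
      proof -
        show "0 \<le> D" using R by (simp add: D_def)
        then have "D powr q \<le> 1 + D" using q by (intro powr_le_one_plus) auto
        also have "\<dots> \<le> 1 + (norm x + R) + (norm y + R)" using R by (simp add: D_def max_def)
        also have "\<dots> \<le> (1 + 2 * R) * (1 + norm x + norm y)" using R by (simp add: algebra_simps)
        finally show "D powr q \<le> (1 + 2 * R) * (1 + norm x + norm y)" .
      qed
      define Gn where "Gn n z = G (grid t n x (path_from j z)) (grid t n y (path_from k z))" for n z
      have Gm: "(\<lambda>z. G (f z) (g z)) \<in> borel_measurable N" if [measurable]: "f \<in> borel_measurable N" "g \<in> borel_measurable N" for f g
        unfolding G_def by measurable
      have Gnm: "Gn n \<in> borel_measurable N" for n
        unfolding Gn_def[abs_def] by (intro Gm measurable_grid_path_from[OF t])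
      have Gn_bound: "(\<integral>\<^sup>+z. Gn n z \<partial>N) \<le> ennreal (C' * (1 + norm x + norm y) * exp (- c * t))" if n: "t / real (Suc n) < h0" for n
      proof -
        define h where "h = t / real (Suc n)"
        have h: "0 < h" "h < h0" "real (Suc n) * h = t" using t0 n by (auto simp: h_def simp del: of_nat_Suc)
        let ?g = "\<lambda>w. gain \<kappa> b h (Suc n) w powr q"
        have gm: "?g \<in> borel_measurable (L uniform2)" using mom[OF h(1,2), of "Suc n"] by blast
        have "(\<integral>\<^sup>+z. Gn n z \<partial>N) \<le> (\<integral>\<^sup>+z. (ennreal (D powr q) * ennreal (?g (fst z))) * ennreal (exp (q * \<kappa> * snd z)) \<partial>N)"
        proof (rule nn_integral_mono_AE)
          show "AE z in N. Gn n z \<le> (ennreal (D powr q) * ennreal (?g (fst z))) * ennreal (exp (q * \<kappa> * snd z))"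
            using AE_N_nonneg
          proof eventually_elim
            case (elim z)
            let ?\<delta> = "norm (grid t n x (path_from j z) - grid t n y (path_from k z))"
            have "min 1 (?\<delta> powr p) \<le> ?\<delta> powr q" by (rule min_one_powr_le) (use q in auto)
            also have "\<dots> \<le> (D * exp (\<kappa> * snd z) * gain \<kappa> b h (Suc n) (fst z)) powr q"
            proof (rule powr_mono2)
              show "?\<delta> \<le> D * exp (\<kappa> * snd z) * gain \<kappa> b h (Suc n) (fst z)"
                unfolding grid_def D_def h_def by (rule coupled_grid_flow) (use t elim in auto)
            qed (use q in auto)
            also have "\<dots> = (D powr q * ?g (fst z)) * exp (q * \<kappa> * snd z)"
              using D(1) less_imp_le[OF gain_pos[of \<kappa> b h "Suc n" "fst z"]]
              by (simp add: powr_mult exp_powr_real mult.commute mult.left_commute del: gain_Suc)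
            finally show ?case
              unfolding Gn_def G_def by (simp only: ennreal_mult'[symmetric] ennreal_leI powr_ge_zero exp_ge_zero mult_nonneg_nonneg ennreal_mult''[symmetric])
          qed
        qed
        also have "\<dots> = (\<integral>\<^sup>+w. ennreal (D powr q) * ennreal (?g w) \<partial>L uniform2) * (\<integral>\<^sup>+\<tau>. ennreal (exp (q * \<kappa> * \<tau>)) \<partial>refresh_time r)"
          unfolding N_def
        proof (rule nn_integral_pair_product)
          show "sigma_finite_measure (refresh_time r)" by unfold_locales
          show "(\<lambda>w. ennreal (D powr q) * ennreal (?g w)) \<in> borel_measurable (L uniform2)"
            by (intro borel_measurable_times_ennreal borel_measurable_const measurable_compose[OF gm measurable_ennreal])
          show "(\<lambda>\<tau>. ennreal (exp (q * \<kappa> * \<tau>))) \<in> borel_measurable (refresh_time r)"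
            unfolding refresh_time_def by measurable
        qed
        also have "(\<integral>\<^sup>+\<tau>. ennreal (exp (q * \<kappa> * \<tau>)) \<partial>refresh_time r) = ennreal A"
          unfolding A_def by (rule nn_integral_exp_refresh_time[OF r qk])
        also have "(\<integral>\<^sup>+w. ennreal (D powr q) * ennreal (?g w) \<partial>L uniform2) = ennreal (D powr q) * (\<integral>\<^sup>+w. ennreal (?g w) \<partial>L uniform2)"
          by (rule nn_integral_cmult) (rule measurable_compose[OF gm measurable_ennreal])
        also have "(\<integral>\<^sup>+w. ennreal (?g w) \<partial>L uniform2) = ennreal (\<integral>w. ?g w \<partial>L uniform2)"
          by (rule nn_integral_eq_integral) (use mom[OF h(1,2), of "Suc n"] in auto)
        also have "ennreal (D powr q) * ennreal (\<integral>w. ?g w \<partial>L uniform2) * ennreal A =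
            ennreal (D powr q * (\<integral>w. ?g w \<partial>L uniform2) * A)"
          using A by (simp add: ennreal_mult' ennreal_mult'')
        also have "\<dots> \<le> ennreal (C' * (1 + norm x + norm y) * exp (- c * t))"
        proof (rule ennreal_leI)
          have I: "(\<integral>w. ?g w \<partial>L uniform2) \<le> C * exp (- c * t)" using mom[OF h(1,2), of "Suc n"] unfolding h(3) by blast
          have "D powr q * (\<integral>w. ?g w \<partial>L uniform2) * A \<le>
              ((1 + 2 * R) * (1 + norm x + norm y)) * (C * exp (- c * t)) * A"
            using A D I R C(1) by (intro mult_right_mono mult_mono) auto
          also have "\<dots> = ((1 + 2 * R) * A * C) * ((1 + norm x + norm y) * exp (- c * t))" by (simp add: algebra_simps)
          also have "\<dots> \<le> C' * ((1 + norm x + norm y) * exp (- c * t))"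
            by (intro mult_right_mono) (auto simp: C'_def)
          finally show "D powr q * (\<integral>w. ?g w \<partial>L uniform2) * A \<le> C' * (1 + norm x + norm y) * exp (- c * t)"
            by (simp only: mult.assoc)
        qed
        finally show ?thesis .
      qed
      have lim: "AE z in N. (\<lambda>n. Gn n z) \<longlonglongrightarrow> G (F t x (path_from j z)) (F t y (path_from k z))"
        using AE_path_from[OF AE_L_F[OF t, where x = x], of j] AE_path_from[OF AE_L_F[OF t, where x = y], of k]
      proof eventually_elim
        case (elim z)
        show ?case unfolding Gn_def G_def
          by (intro tendsto_intros elim) (use p in auto)
      qed
      have "(\<integral>\<^sup>+z. G (F t x (path_from j z)) (F t y (path_from k z)) \<partial>N) = (\<integral>\<^sup>+z. liminf (\<lambda>n. Gn n z) \<partial>N)"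
        by (rule nn_integral_cong_AE) (use lim in eventually_elim, simp add: lim_imp_Liminf)
      also have "\<dots> \<le> liminf (\<lambda>n. \<integral>\<^sup>+z. Gn n z \<partial>N)" by (rule nn_integral_liminf[OF Gnm])
      also have "\<dots> \<le> ennreal (C' * (1 + norm x + norm y) * exp (- c * t))"
      proof -
        have "(\<lambda>n. t * inverse (real (Suc n))) \<longlonglongrightarrow> t * 0" by (intro tendsto_intros LIMSEQ_inverse_real_of_nat)
        then have "\<forall>\<^sub>F n in sequentially. t / real (Suc n) < h0"
          using C(3) by (intro order_tendstoD) (auto simp: divide_inverse)
        then have "\<forall>\<^sub>F n in sequentially. (\<integral>\<^sup>+z. Gn n z \<partial>N) \<le> ennreal (C' * (1 + norm x + norm y) * exp (- c * t))"
          by eventually_elim (rule Gn_bound)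
        from Liminf_mono[OF this] show ?thesis by (simp add: Liminf_const)
      qed
      finally show "(\<integral>\<^sup>+z. G (F t x (path_from j z)) (F t y (path_from k z)) \<partial>N) \<le>
        ennreal (C' * (1 + norm x + norm y) * exp (- c * t))" .
    qed
  qed
qed

lemma KI_eq:
  assumes t: "0 \<le> t" and f: "test_function B f"
  shows "KI t f (j, x) = (\<integral>z. f (path_from j z t, F t x (path_from j z)) \<partial>N)"
  unfolding KI_def fst_conv snd_conv distr_path_from[symmetric]
  by (rule integral_distr[OF measurable_path_from measurable_F_state[OF t f]])

lemma measurable_path_from_state:
  assumes t: "0 \<le> t" and f: "test_function B f"
  shows "(\<lambda>z. f (path_from j z t, F t x (path_from j z))) \<in> borel_measurable N"
  by (rule measurable_compose[OF measurable_path_from measurable_F_state[OF t f]])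

text \<open>Without a refresh by time t the discrete states may differ, which costs at most 2 * B on
  an event of probability \<open>exp (- 2 * r * t)\<close>. Otherwise the states agree and
  \<open>coupling_estimate\<close> with exponent 1 applies.\<close>

lemma KI_contraction:
  obtains C c where "C > 0" "c > 0" "\<And>B f t z z'. test_function B f \<Longrightarrow> 0 \<le> t \<Longrightarrow>
    \<bar>KI t f z - KI t f z'\<bar> \<le> B * C * (1 + norm (snd z) + norm (snd z')) * exp (- c * t)"
proof -
  interpret N: prob_space N by (rule prob_space_N)
  interpret Lu: prob_space "L uniform2" by (rule prob_space_L)
  interpret D: prob_space "refresh_time r" by (rule refresh_time(1)[OF r])
  obtain C c where C: "C > 0" "c > 0" and est: "\<And>t j k x y. 0 \<le> t \<Longrightarrow>
    (\<integral>\<^sup>+z. ennreal (min 1 (norm (F t x (path_from j z) - F t y (path_from k z)) powr 1)) \<partial>N) \<le>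
      ennreal (C * (1 + norm x + norm y) * exp (- c * t))"
    using coupling_estimate[of 1] by auto
  \<comment> \<open>The slower of the two decays: of the positions and of the probability of no
    refresh.\<close>
  define c' where "c' = min c (2 * r)"
  have c': "c' > 0" using C r by (simp add: c'_def)
  have C2: "2 * C + 2 > 0" using C by simp
  show ?thesis
  proof (rule that[OF C2 c'])
    fix B t and f :: "2 \<times> 'a \<Rightarrow> real" and z z' :: "2 \<times> 'a" assume f: "test_function B f" and t: "0 \<le> (t::real)"
    obtain j x where z: "z = (j, x)" by (cases z)
    obtain k y where z': "z' = (k, y)" by (cases z')
    have B: "0 \<le> B" by (rule test_functionD(3)[OF f])
    define \<delta> where "\<delta> v = min 1 (norm (F t x (path_from j v) - F t y (path_from k v)) powr 1)" for v
    have \<delta>m: "\<delta> \<in> borel_measurable N"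
    proof -
      note [measurable] = measurable_F_path_from[OF t]
      show ?thesis unfolding \<delta>_def[abs_def] by measurable
    qed
    have \<delta>i: "integrable N \<delta>" by (rule N.integrable_const_bound[OF _ \<delta>m, of 1]) (auto simp: \<delta>_def)
    have "ennreal (\<integral>v. \<delta> v \<partial>N) = (\<integral>\<^sup>+v. ennreal (\<delta> v) \<partial>N)"
      by (rule nn_integral_eq_integral[symmetric, OF \<delta>i]) (auto simp: \<delta>_def)
    also have "\<dots> \<le> ennreal (C * (1 + norm x + norm y) * exp (- c * t))"
      unfolding \<delta>_def by (rule est[OF t])
    finally have I\<delta>: "(\<integral>v. \<delta> v \<partial>N) \<le> C * (1 + norm x + norm y) * exp (- c * t)"
      using C by (subst (asm) ennreal_le_iff) auto
    define I where "I v = (indicator (UNIV \<times> {t<..}) v :: real)" for v :: "(real \<Rightarrow> 2) \<times> real"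
    have UP: "UNIV \<in> sets path_space" by (rule space_path_space[THEN subst, of "\<lambda>A. A \<in> sets path_space"]) (rule sets.top)
    have IA: "UNIV \<times> {t<..} \<in> sets N"
      unfolding sets_N by (rule pair_measureI[OF UP]) simp
    have Ii: "integrable N I" unfolding I_def[abs_def]
      by (rule integrable_real_indicator[OF IA]) (simp add: N.emeasure_eq_measure)
    have "emeasure N (UNIV \<times> {t<..}) = emeasure (L uniform2) UNIV * emeasure (refresh_time r) {t<..}"
      unfolding N_def
    proof (rule D.emeasure_pair_measure_Times)
      show "UNIV \<in> sets (L uniform2)" unfolding sets_L by (rule UP)
      show "{t<..} \<in> sets (refresh_time r)" by (simp add: refresh_time(2)[OF r])
    qed
    then have "ennreal (N.prob (UNIV \<times> {t<..})) = ennreal (exp (- 2 * r * t))"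
      using Lu.emeasure_space_1 by (simp add: N.emeasure_eq_measure D.emeasure_eq_measure refresh_time(4)[OF r t])
    then have II: "(\<integral>v. I v \<partial>N) = exp (- 2 * r * t)"
      unfolding I_def by (simp add: sets.Int_space_eq2[OF IA])
    have fm: "integrable N (\<lambda>v. f (path_from l v t, F t u (path_from l v)))" for l u
      by (rule N.integrable_const_bound[OF _ measurable_path_from_state[OF t f], where B = B])
        (use test_functionD(1)[OF f] in auto)
    have pt: "\<bar>f (path_from j v t, F t x (path_from j v)) - f (path_from k v t, F t y (path_from k v))\<bar> \<le> 2 * B * I v + 2 * B * \<delta> v" for v
    proof (cases "t < snd v")
      case True
      then have "I v = 1" by (simp add: I_def indicator_def mem_Times_iff)
      moreover have "0 \<le> B * \<delta> v" using B by (simp add: \<delta>_def)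
      ultimately show ?thesis
        using test_functionD(1)[OF f, of "(path_from j v t, F t x (path_from j v))"]
          test_functionD(1)[OF f, of "(path_from k v t, F t y (path_from k v))"] by simp
    next
      case False
      then have "I v = 0" by (simp add: I_def indicator_def mem_Times_iff)
      have e: "path_from k v t = path_from j v t" using False t by (simp add: path_from_def)
      let ?u = "F t x (path_from j v)" and ?w = "F t y (path_from k v)"
      have 1: "\<bar>f (path_from j v t, ?u) - f (path_from j v t, ?w)\<bar> \<le> B * norm (?u - ?w)" by (rule test_functionD(2)[OF f])
      have 2: "\<bar>f (path_from j v t, ?u) - f (path_from j v t, ?w)\<bar> \<le> 2 * B"
        using test_functionD(1)[OF f, of "(path_from j v t, ?u)"] test_functionD(1)[OF f, of "(path_from j v t, ?w)"] by simp
      have "\<bar>f (path_from j v t, ?u) - f (path_from j v t, ?w)\<bar> \<le> 2 * B * min 1 (norm (?u - ?w))"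
        using 1 2 B by (cases "norm (?u - ?w) \<le> 1") (auto simp: min_def intro: order_trans)
      then show ?thesis unfolding e \<open>I v = 0\<close> \<delta>_def by simp
    qed
    have "\<bar>KI t f z - KI t f z'\<bar> =
        \<bar>\<integral>v. f (path_from j v t, F t x (path_from j v)) - f (path_from k v t, F t y (path_from k v)) \<partial>N\<bar>"
      unfolding z z' KI_eq[OF t f] using fm by simp
    also have "\<dots> \<le> (\<integral>v. \<bar>f (path_from j v t, F t x (path_from j v)) - f (path_from k v t, F t y (path_from k v))\<bar> \<partial>N)"
      by (rule integral_abs_bound)
    also have "\<dots> \<le> (\<integral>v. 2 * B * I v + 2 * B * \<delta> v \<partial>N)"
      by (rule integral_mono[OF _ _ pt]) (use fm Ii \<delta>i in auto)
    also have "\<dots> = 2 * B * exp (- 2 * r * t) + 2 * B * (\<integral>v. \<delta> v \<partial>N)"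
      using Ii \<delta>i II by simp
    also have "\<dots> \<le> 2 * B * (1 + norm x + norm y) * exp (- c' * t) + 2 * B * (C * (1 + norm x + norm y) * exp (- c' * t))"
    proof (rule add_mono)
      have e1: "exp (- 2 * r * t) \<le> exp (- c' * t)" "exp (- c * t) \<le> exp (- c' * t)"
        using t by (auto simp: c'_def intro!: mult_right_mono)
      have "exp (- 2 * r * t) \<le> (1 + norm x + norm y) * exp (- c' * t)"
      proof -
        have "1 * exp (- c' * t) \<le> (1 + norm x + norm y) * exp (- c' * t)" by (intro mult_right_mono) auto
        with e1(1) show ?thesis by linarith
      qed
      then show "2 * B * exp (- 2 * r * t) \<le> 2 * B * (1 + norm x + norm y) * exp (- c' * t)"
        using B by (simp only: mult.assoc) (intro mult_left_mono, auto)
      have "(\<integral>v. \<delta> v \<partial>N) \<le> C * (1 + norm x + norm y) * exp (- c' * t)"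
        by (rule order_trans[OF I\<delta>]) (use e1(2) C in \<open>auto intro!: mult_left_mono\<close>)
      then show "2 * B * (\<integral>v. \<delta> v \<partial>N) \<le> 2 * B * (C * (1 + norm x + norm y) * exp (- c' * t))"
        using B by (intro mult_left_mono) auto
    qed
    also have "\<dots> = B * (2 * C + 2) * (1 + norm (snd z) + norm (snd z')) * exp (- c' * t)"
      by (simp add: z z' algebra_simps)
    finally show "\<bar>KI t f z - KI t f z'\<bar> \<le> B * (2 * C + 2) * (1 + norm (snd z) + norm (snd z')) * exp (- c' * t)" .
  qed
qed

end

section \<open>The Wasserstein estimate\<close>

lemma test_function_ramp:
  fixes C :: "'a::real_normed_vector set"
  shows "test_function (real (Suc n)) (\<lambda>z. if fst z = j then max 0 (1 - real (Suc n) * infdist (snd z) C) else 0)"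
  unfolding test_function_def
proof (intro conjI allI)
  fix z :: "2 \<times> 'a"
  show "\<bar>if fst z = j then max 0 (1 - real (Suc n) * infdist (snd z) C) else 0\<bar> \<le> real (Suc n)"
  proof -
    have "0 \<le> real (Suc n) * infdist (snd z) C" by (intro mult_nonneg_nonneg infdist_nonneg) simp
    then show ?thesis by (auto simp: max_def simp del: of_nat_Suc)
  qed
next
  fix k :: 2 and x y :: 'a
  have *: "\<bar>max 0 (1 - a) - max 0 (1 - b)\<bar> \<le> \<bar>a - b\<bar>" for a b :: real
    by (simp add: max_def abs_if)
  have "\<bar>max 0 (1 - real (Suc n) * infdist x C) - max 0 (1 - real (Suc n) * infdist y C)\<bar> \<le>
      \<bar>real (Suc n) * infdist x C - real (Suc n) * infdist y C\<bar>" by (rule *)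
  also have "\<dots> = real (Suc n) * \<bar>infdist x C - infdist y C\<bar>"
    by (simp only: right_diff_distrib[symmetric] abs_mult abs_of_nat)
  also have "\<dots> \<le> real (Suc n) * norm (x - y)"
    using infdist_triangle_abs[of x C y] by (intro mult_left_mono) (auto simp: dist_norm)
  finally show "\<bar>(if fst (k, x) = j then max 0 (1 - real (Suc n) * infdist (snd (k, x)) C) else 0) -
      (if fst (k, y) = j then max 0 (1 - real (Suc n) * infdist (snd (k, y)) C) else 0)\<bar> \<le> real (Suc n) * norm (x - y)"
    by auto
qed

lemma slice_sets:
  assumes "B \<in> sets borel" shows "{j :: 2} \<times> B \<in> sets (state_space :: (2 \<times> 'a::topological_space) measure)"
  using assms by (intro pair_measureI) auto

text \<open>The ramps decrease to the indicator of the slice; closedness ensures a positive distance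
  to C at every point outside it.\<close>

lemma measure_closed_slice:
  fixes C :: "'a::euclidean_space set" and \<rho> :: "(2 \<times> 'a) measure"
  assumes "prob_space \<rho>" "sets \<rho> = sets state_space" and C: "closed C" "C \<noteq> {}"
  shows "(\<lambda>n. \<integral>z. (if fst z = j then max 0 (1 - real (Suc n) * infdist (snd z) C) else 0) \<partial>\<rho>) \<longlonglongrightarrow> measure \<rho> ({j} \<times> C)"
proof -
  interpret prob_space \<rho> by fact
  note [measurable_cong] = assms(2)
  have S: "{j} \<times> C \<in> sets \<rho>" unfolding assms(2) using C by (intro slice_sets) auto
  have "(\<lambda>n. \<integral>z. (if fst z = j then max 0 (1 - real (Suc n) * infdist (snd z) C) else 0) \<partial>\<rho>) \<longlonglongrightarrow> (\<integral>z. indicator ({j} \<times> C) z \<partial>\<rho>)"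
  proof (rule integral_dominated_convergence[where w = "\<lambda>_. 1"])
    show "(\<lambda>z. if fst z = j then max 0 (1 - real (Suc n) * infdist (snd z) C) else 0) \<in> borel_measurable \<rho>" for n
      using measurable_test_function[OF test_function_ramp[of n j C]] by measurable
    show "AE z in \<rho>. norm (if fst z = j then max 0 (1 - real (Suc n) * infdist (snd z) C) else 0) \<le> (1::real)" for n
      using infdist_nonneg[of _ C] by (auto simp: max_def)
    show "AE z in \<rho>. (\<lambda>n. if fst z = j then max 0 (1 - real (Suc n) * infdist (snd z) C) else 0) \<longlonglongrightarrow> indicator ({j} \<times> C) z"
    proof (rule AE_I2)
      fix z :: "2 \<times> 'a"
      show "(\<lambda>n. if fst z = j then max 0 (1 - real (Suc n) * infdist (snd z) C) else 0) \<longlonglongrightarrow> indicator ({j} \<times> C) z"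
      proof (cases "fst z = j \<and> snd z \<notin> C")
        case True
        have pos: "0 < infdist (snd z) C"
          using True C in_closed_iff_infdist_zero[OF C] infdist_nonneg[of "snd z" C] by (metis order_le_less)
        obtain n0 where n0: "1 < real n0 * infdist (snd z) C" using reals_Archimedean3[OF pos] by blast
        have "\<forall>\<^sub>F n in sequentially. (if fst z = j then max 0 (1 - real (Suc n) * infdist (snd z) C) else 0) = indicator ({j} \<times> C) z"
        proof (rule eventually_sequentiallyI[of n0])
          fix n assume "n0 \<le> n"
          then have "real n0 * infdist (snd z) C \<le> real (Suc n) * infdist (snd z) C"
            using pos by (intro mult_right_mono) auto
          with n0 True show "(if fst z = j then max 0 (1 - real (Suc n) * infdist (snd z) C) else 0) = indicator ({j} \<times> C) z"
            by (auto simp: indicator_def mem_Times_iff simp del: of_nat_Suc)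
        qed
        then show ?thesis by (rule tendsto_eventually)
      next
        case False
        then have "(if fst z = j then max 0 (1 - real (Suc n) * infdist (snd z) C) else 0) = indicator ({j} \<times> C) z" for n
          by (auto simp: indicator_def mem_Times_iff)
        then show ?thesis by simp
      qed
    qed
  qed (use S in auto)
  then show ?thesis by (simp add: sets.Int_space_eq2[OF S])
qed

text \<open>Closed sets are stable under intersection and generate the Borel sets, so agreement on
  closed slices gives equality slice by slice; the two slices then make up the whole
  measure.\<close>

lemma prob_measure_eqI_test_functions:
  fixes \<rho> \<rho>' :: "(2 \<times> 'a::euclidean_space) measure"
  assumes \<rho>: "prob_space \<rho>" "sets \<rho> = sets state_space"
    and \<rho>': "prob_space \<rho>'" "sets \<rho>' = sets state_space"
    and eq: "\<And>B f. test_function B f \<Longrightarrow> (\<integral>z. f z \<partial>\<rho>) = (\<integral>z. f z \<partial>\<rho>')"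
  shows "\<rho> = \<rho>'"
proof -
  interpret A: prob_space \<rho> by fact
  interpret B: prob_space \<rho>' by fact
  note [measurable_cong] = \<rho>(2) \<rho>'(2)
  have closed: "measure \<rho> ({j} \<times> C) = measure \<rho>' ({j} \<times> C)" if "closed C" for j and C :: "'a set"
  proof (cases "C = {}")
    case False
    show ?thesis
      using measure_closed_slice[OF \<rho> that False, of j] measure_closed_slice[OF \<rho>' that False, of j]
      unfolding eq[OF test_function_ramp] by (rule LIMSEQ_unique)
  qed simp
  \<comment> \<open>The part of the measure living in state j, moved to the position space, where
    the generator argument takes place.\<close>
  define m where "m \<rho> j = distr (density \<rho> (\<lambda>z. indicator ({j} \<times> UNIV) z)) borel snd" for \<rho> :: "(2 \<times> 'a) measure" and j
  have m_eq: "emeasure (m \<rho> j) X = emeasure \<rho> ({j} \<times> X)" if \<rho>: "sets \<rho> = sets state_space" and X: "X \<in> sets borel" for \<rho> j X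
  proof -
    note [measurable_cong] = \<rho>
    have [measurable]: "{j} \<times> UNIV \<in> sets \<rho>" unfolding \<rho> by (intro slice_sets) auto
    have sp: "space \<rho> = UNIV" using sets_eq_imp_space_eq[OF \<rho>] by (simp add: space_pair_measure)
    have "emeasure (m \<rho> j) X = emeasure (density \<rho> (\<lambda>z. indicator ({j} \<times> UNIV) z)) (snd -` X \<inter> space \<rho>)"
      unfolding m_def using X by (subst emeasure_distr) auto
    also have "\<dots> = (\<integral>\<^sup>+z. indicator ({j} \<times> UNIV) z * indicator (snd -` X \<inter> space \<rho>) z \<partial>\<rho>)"
      by (rule emeasure_density) (use X in measurable)
    also have "\<dots> = (\<integral>\<^sup>+z. indicator ({j} \<times> X) z \<partial>\<rho>)"
      by (intro nn_integral_cong) (auto simp: indicator_def sp mem_Times_iff)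
    also have "\<dots> = emeasure \<rho> ({j} \<times> X)"
      using slice_sets[OF X, of j] \<rho> by (intro nn_integral_indicator) simp
    finally show ?thesis .
  qed
  have mm: "m \<rho> j = m \<rho>' j" for j
  proof (rule measure_eqI_generator_eq[where E = "Collect closed" and \<Omega> = UNIV and A = "\<lambda>_. UNIV"])
    show "Int_stable (Collect closed :: 'a set set)" by (auto simp: Int_stable_def)
    show "sets (m \<rho> j) = sigma_sets UNIV (Collect closed)" "sets (m \<rho>' j) = sigma_sets UNIV (Collect closed)"
      by (simp_all add: m_def borel_eq_closed)
    show "emeasure (m \<rho> j) (UNIV :: 'a set) \<noteq> \<infinity>" using m_eq[OF \<rho>(2), of UNIV j] by (simp add: A.emeasure_eq_measure)
    fix X :: "'a set" assume "X \<in> Collect closed"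
    then show "emeasure (m \<rho> j) X = emeasure (m \<rho>' j) X"
      using closed[of X j] m_eq[OF \<rho>(2), of X j] m_eq[OF \<rho>'(2), of X j]
      by (simp add: A.emeasure_eq_measure B.emeasure_eq_measure)
  qed auto
  show ?thesis
  proof (rule measure_eqI)
    show "sets \<rho> = sets \<rho>'" using \<rho> \<rho>' by simp
    fix A assume "A \<in> sets \<rho>"
    then have A: "A \<in> sets state_space" using \<rho> by simp
    have sl: "Pair j -` A \<in> sets borel" for j using A by (rule sets_Pair1)
    have "emeasure \<mu> A = (\<Sum>j\<in>UNIV. emeasure \<mu> ({j} \<times> (Pair j -` A)))" if \<mu>: "sets \<mu> = sets state_space" for \<mu> :: "(2 \<times> 'a) measure"
    proof -
      have "A = (\<Union>j\<in>UNIV. {j} \<times> (Pair j -` A))" by auto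
      then have "emeasure \<mu> A = emeasure \<mu> (\<Union>j\<in>UNIV. {j} \<times> (Pair j -` A))" by simp
      also have "\<dots> = (\<Sum>j\<in>UNIV. emeasure \<mu> ({j} \<times> (Pair j -` A)))"
        by (rule sum_emeasure[symmetric]) (use slice_sets[OF sl] \<mu> in \<open>auto simp: disjoint_family_on_def\<close>)
      finally show ?thesis .
    qed
    moreover have "emeasure \<rho> ({j} \<times> (Pair j -` A)) = emeasure \<rho>' ({j} \<times> (Pair j -` A))" for j
      using mm[of j] m_eq[OF \<rho>(2) sl, of j] m_eq[OF \<rho>'(2) sl, of j] by simp
    ultimately show "emeasure \<rho> A = emeasure \<rho>' A" using \<rho> \<rho>' by simp
  qed
qed

section \<open>Evolution of measures, invariance and the coupling with the stationary law\<close>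

context switched_flow begin

text \<open>A random map that represents the kernels for all starting points with the same noise. It
  yields the evolved measure as the image of a product measure, and couples solutions with different
  starting points.\<close>

definition Psi :: "real \<Rightarrow> (2 \<times> 'a) \<times> ((real \<Rightarrow> 2) \<times> real) \<Rightarrow> 2 \<times> 'a" where
  "Psi t p = (path_from (fst (fst p)) (snd p) t, F t (snd (fst p)) (path_from (fst (fst p)) (snd p)))"

lemma measurable_Psi:
  assumes t: "0 \<le> t"
  shows "Psi t \<in> measurable (state_space \<Otimes>\<^sub>M N) state_space"
proof -
  have pm: "(\<lambda>p. path_from j (snd p)) \<in> measurable (state_space \<Otimes>\<^sub>M N) path_space" for j
    by (rule measurable_compose[OF measurable_snd measurable_path_from])
  have "(\<lambda>p. (path_from (fst (fst p)) (snd p) t, F t (snd (fst p)) (path_from (fst (fst p)) (snd p)))) \<in>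
      measurable (state_space \<Otimes>\<^sub>M N) (state_space :: (2 \<times> 'a) measure)"
  proof (rule measurable_compose_countable'[where I = UNIV and g = "\<lambda>p. fst (fst p)"])
    fix j
    show "(\<lambda>p. (path_from j (snd p) t, F t (snd (fst p)) (path_from j (snd p)))) \<in>
        measurable (state_space \<Otimes>\<^sub>M N) (state_space :: (2 \<times> 'a) measure)"
      by (intro measurable_Pair measurable_compose[OF pm measurable_path_eval] measurable_F[OF t _ pm])
        (rule measurable_compose[OF measurable_fst measurable_snd])
  qed auto
  then show ?thesis by (simp add: Psi_def[abs_def])
qed

lemma K_eq: "0 \<le> t \<Longrightarrow> K t z = distr N state_space (\<lambda>\<omega>. Psi t (z, \<omega>))"
  unfolding K_def Psi_def fst_conv snd_conv distr_path_from[symmetric]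
  by (subst distr_distr[OF measurable_state measurable_path_from]) (simp_all add: o_def)

definition evolve :: "real \<Rightarrow> (2 \<times> 'a) measure \<Rightarrow> (2 \<times> 'a) measure" where
  "evolve t \<rho> = distr (\<rho> \<Otimes>\<^sub>M N) state_space (Psi t)"

context
  fixes \<rho> :: "(2 \<times> 'a) measure"
  assumes \<rho>: "prob_space \<rho>" "sets \<rho> = sets state_space"
begin

lemma measurable_Psi': "0 \<le> t \<Longrightarrow> Psi t \<in> measurable (\<rho> \<Otimes>\<^sub>M N) state_space"
  using measurable_Psi by (simp cong: measurable_cong_sets add: sets_pair_measure_cong[OF \<rho>(2) refl])

lemma evolve_emeasure:
  assumes t: "0 \<le> t" and A: "A \<in> sets state_space"
  shows "emeasure (evolve t \<rho>) A = (\<integral>\<^sup>+z. emeasure (K t z) A \<partial>\<rho>)"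
proof -
  interpret N: prob_space N by (rule prob_space_N)
  have m: "(\<lambda>p. indicator A (Psi t p)) \<in> borel_measurable (\<rho> \<Otimes>\<^sub>M N)"
    by (rule measurable_compose[OF measurable_Psi'[OF t] borel_measurable_indicator[OF A]])
  have "emeasure (evolve t \<rho>) A = (\<integral>\<^sup>+p. indicator A (Psi t p) \<partial>(\<rho> \<Otimes>\<^sub>M N))"
    unfolding evolve_def by (rule emeasure_distr_nn_integral[OF measurable_Psi'[OF t] A])
  also have "\<dots> = (\<integral>\<^sup>+z. \<integral>\<^sup>+\<omega>. indicator A (Psi t (z, \<omega>)) \<partial>N \<partial>\<rho>)"
    by (rule N.nn_integral_fst[symmetric, OF m])
  also have "\<dots> = (\<integral>\<^sup>+z. emeasure (K t z) A \<partial>\<rho>)"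
  proof (rule nn_integral_cong)
    fix z
    have "(\<lambda>\<omega>. Psi t (z, \<omega>)) \<in> measurable N state_space"
      by (rule measurable_compose[OF measurable_Pair1' measurable_Psi[OF t]]) (simp add: space_pair_measure)
    then show "(\<integral>\<^sup>+\<omega>. indicator A (Psi t (z, \<omega>)) \<partial>N) = emeasure (K t z) A"
      unfolding K_eq[OF t] by (rule emeasure_distr_nn_integral[symmetric, OF _ A])
  qed
  finally show ?thesis .
qed

lemma evolve_integral:
  assumes t: "0 \<le> t" and f: "test_function B f"
  shows "(\<integral>z. f z \<partial>evolve t \<rho>) = (\<integral>z. KI t f z \<partial>\<rho>)"
proof -
  interpret N: prob_space N by (rule prob_space_N)
  interpret \<rho>: prob_space \<rho> by (rule \<rho>)
  interpret pair_prob_space \<rho> N ..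
  have fm: "(\<lambda>p. f (Psi t p)) \<in> borel_measurable (\<rho> \<Otimes>\<^sub>M N)"
    by (rule measurable_compose[OF measurable_Psi'[OF t] measurable_test_function[OF f]])
  have int: "integrable (\<rho> \<Otimes>\<^sub>M N) (\<lambda>p. f (Psi t p))"
    by (rule P.integrable_const_bound[OF _ fm, where B = B]) (use test_functionD(1)[OF f] in auto)
  have "(\<integral>z. f z \<partial>evolve t \<rho>) = (\<integral>p. f (Psi t p) \<partial>(\<rho> \<Otimes>\<^sub>M N))"
    unfolding evolve_def by (rule integral_distr[OF measurable_Psi'[OF t] measurable_test_function[OF f]])
  also have "\<dots> = (\<integral>z. \<integral>\<omega>. f (Psi t (z, \<omega>)) \<partial>N \<partial>\<rho>)"
    by (rule integral_fst'[symmetric, OF int])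
  also have "\<dots> = (\<integral>z. KI t f z \<partial>\<rho>)"
  proof (rule Bochner_Integration.integral_cong[OF refl])
    fix z :: "2 \<times> 'a"
    show "(\<integral>\<omega>. f (Psi t (z, \<omega>)) \<partial>N) = KI t f z"
      using KI_eq[OF t f, of "fst z" "snd z"] by (simp add: Psi_def)
  qed
  finally show ?thesis .
qed

lemma prob_space_evolve: "0 \<le> t \<Longrightarrow> prob_space (evolve t \<rho>)"
proof -
  assume t: "0 \<le> t"
  interpret N: prob_space N by (rule prob_space_N)
  interpret \<rho>: prob_space \<rho> by (rule \<rho>)
  interpret pair_prob_space \<rho> N ..
  show ?thesis unfolding evolve_def by (rule prob_space_distr[OF measurable_Psi'[OF t]])
qed

end

lemma invariant_measure_iff:
  "invariant_measure (transition_kernel M i \<eta>) \<nu> \<longleftrightarrow>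
    prob_space \<nu> \<and> sets \<nu> = sets state_space \<and> (\<forall>t\<ge>0. evolve t \<nu> = \<nu>)"
proof (cases "prob_space \<nu> \<and> sets \<nu> = sets state_space")
  case True
  then have \<nu>: "prob_space \<nu>" "sets \<nu> = sets state_space" by auto
  have "(\<forall>A\<in>sets \<nu>. emeasure \<nu> A = (\<integral>\<^sup>+z. emeasure (transition_kernel M i \<eta> t z) A \<partial>\<nu>)) \<longleftrightarrow> evolve t \<nu> = \<nu>"
    if t: "0 \<le> t" for t
  proof -
    have "(\<forall>A\<in>sets \<nu>. emeasure \<nu> A = (\<integral>\<^sup>+z. emeasure (transition_kernel M i \<eta> t z) A \<partial>\<nu>)) \<longleftrightarrow>
        (\<forall>A\<in>sets \<nu>. emeasure \<nu> A = emeasure (evolve t \<nu>) A)"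
      using evolve_emeasure[OF \<nu> t] \<nu>(2) by (simp add: transition_kernel_eq[OF t])
    also have "\<dots> \<longleftrightarrow> evolve t \<nu> = \<nu>"
    proof
      assume *: "\<forall>A\<in>sets \<nu>. emeasure \<nu> A = emeasure (evolve t \<nu>) A"
      show "evolve t \<nu> = \<nu>" by (rule measure_eqI) (use * \<nu>(2) in \<open>auto simp: evolve_def\<close>)
    qed simp
    finally show ?thesis .
  qed
  then show ?thesis using True by (auto simp: invariant_measure_def)
next
  case False
  then show ?thesis by (auto simp: invariant_measure_def)
qed

lemma law_mixture: "L \<mu> = distr (measure_pmf \<mu> \<Otimes>\<^sub>M N) path_space (\<lambda>p. path_from (fst p) (snd p))"
proof -
  have "distr (measure_pmf \<mu> \<Otimes>\<^sub>M N) path_space (\<lambda>p s. refreshed (fst p) (\<lambda>t w. w t) \<bar>s\<bar> (snd p)) = L \<mu>"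
    by (rule L_eq[OF switching_process_mixture[OF refreshed_process]])
  then show ?thesis by (simp add: path_from_refreshed)
qed

lemma measurable_path_from_pmf:
  "(\<lambda>p. path_from (fst p) (snd p)) \<in> measurable (measure_pmf \<mu> \<Otimes>\<^sub>M N) path_space"
proof (rule measurable_compose_countable'[where I = UNIV and g = fst])
  show "(\<lambda>p. path_from j (snd p)) \<in> measurable (measure_pmf \<mu> \<Otimes>\<^sub>M N) path_space" for j
    by (rule measurable_compose[OF measurable_snd measurable_path_from])
  show "fst \<in> measurable (measure_pmf \<mu> \<Otimes>\<^sub>M N) (count_space UNIV)"
    using measurable_fst[of "measure_pmf \<mu>" N] by (simp cong: measurable_cong_sets)
qed auto

lemma expectation_mixture:
  assumes t: "0 \<le> t" and f: "test_function B f"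
  shows "(\<integral>w. f (w t, F t x w) \<partial>L \<mu>) = (\<integral>j. KI t f (j, x) \<partial>measure_pmf \<mu>)"
proof -
  interpret N: prob_space N by (rule prob_space_N)
  interpret pair_prob_space "measure_pmf \<mu>" N ..
  let ?g = "\<lambda>p. f (path_from (fst p) (snd p) t, F t x (path_from (fst p) (snd p)))"
  have gm: "?g \<in> borel_measurable (measure_pmf \<mu> \<Otimes>\<^sub>M N)"
    by (rule measurable_compose[OF measurable_path_from_pmf measurable_F_state[OF t f]])
  have int: "integrable (measure_pmf \<mu> \<Otimes>\<^sub>M N) ?g"
    by (rule P.integrable_const_bound[OF _ gm, where B = B]) (use test_functionD(1)[OF f] in auto)
  have "(\<integral>w. f (w t, F t x w) \<partial>L \<mu>) = (\<integral>p. ?g p \<partial>(measure_pmf \<mu> \<Otimes>\<^sub>M N))"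
    unfolding law_mixture by (rule integral_distr[OF measurable_path_from_pmf measurable_F_state[OF t f]])
  also have "\<dots> = (\<integral>j. \<integral>\<omega>. ?g (j, \<omega>) \<partial>N \<partial>measure_pmf \<mu>)" by (rule integral_fst'[symmetric, OF int])
  finally show ?thesis by (simp add: KI_eq[OF t f])
qed

lemma law_eta:
  assumes t: "0 \<le> t"
  shows "distr (M \<mu> x) borel (\<eta> \<mu> x t) = distr (measure_pmf \<mu> \<Otimes>\<^sub>M N) borel (\<lambda>p. F t x (path_from (fst p) (snd p)))"
proof -
  have [measurable]: "i \<mu> x t \<in> measurable (M \<mu> x) (count_space UNIV)" "\<eta> \<mu> x t \<in> borel_measurable (M \<mu> x)"
    using switching_processD(2)[OF process t] measurable_eta[OF t] by auto
  have Fm: "F t x \<in> borel_measurable path_space" using measurable_F[OF t, of "\<lambda>_. x" path_space "\<lambda>w. w"] by simp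
  have "distr (M \<mu> x) borel (\<eta> \<mu> x t) = distr (distr (M \<mu> x) state_space (\<lambda>\<omega>. (i \<mu> x t \<omega>, \<eta> \<mu> x t \<omega>))) borel snd"
    by (subst distr_distr) (simp_all add: o_def)
  also have "\<dots> = distr (L \<mu>) borel (F t x)"
    unfolding law_eq[OF t] by (subst distr_distr) (simp_all add: o_def measurable_state[OF t] cong: measurable_cong_sets)
  also have "\<dots> = distr (measure_pmf \<mu> \<Otimes>\<^sub>M N) borel (\<lambda>p. F t x (path_from (fst p) (snd p)))"
    unfolding law_mixture by (subst distr_distr[OF Fm measurable_path_from_pmf]) (simp add: o_def)
  finally show ?thesis .
qed

text \<open>The same noise drives a start drawn from \<nu> and the given start. Invariance keeps the
  law of the first solution equal to \<nu>, and the bound on its support makes the constant of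
  \<open>coupling_estimate\<close> uniform.\<close>

lemma wasserstein_bound:
  assumes \<nu>: "prob_space \<nu>" "sets \<nu> = sets state_space" and inv: "\<And>t. 0 \<le> t \<Longrightarrow> evolve t \<nu> = \<nu>"
    and supp: "AE z in \<nu>. norm (snd z) \<le> R" and p: "0 < p" "p < 1"
  obtains c c' where "c > 0" "c' > 0"
    "\<And>t. 0 \<le> t \<Longrightarrow> wasserstein p (distr \<nu> borel snd) (distr (M \<mu> x) borel (\<eta> \<mu> x t)) \<le> c * exp (- c' * t)"
proof -
  interpret N: prob_space N by (rule prob_space_N)
  interpret \<nu>: prob_space \<nu> by (rule \<nu>)
  interpret \<nu>\<mu>: pair_prob_space \<nu> "measure_pmf \<mu>" ..
  interpret \<nu>\<mu>N: pair_prob_space "\<nu> \<Otimes>\<^sub>M measure_pmf \<mu>" N ..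
  obtain C c' where C: "C > 0" "c' > 0" and est: "\<And>t j k x y. 0 \<le> t \<Longrightarrow>
    (\<integral>\<^sup>+z. ennreal (min 1 (norm (F t x (path_from j z) - F t y (path_from k z)) powr p)) \<partial>N) \<le>
      ennreal (C * (1 + norm x + norm y) * exp (- c' * t))"
    using coupling_estimate[of p] p by auto
  define c where "c = C * (1 + R + norm x)"
  have c: "c > 0" using C R by (simp add: c_def add_pos_nonneg)
  show ?thesis
  proof (rule that[OF c C(2)])
    fix t :: real assume t: "0 \<le> t"
    \<comment> \<open>Independent factors: the stationary start, the initial state of the given
      solution, and the noise shared by both.\<close>
    define Q where "Q = (\<nu> \<Otimes>\<^sub>M measure_pmf \<mu>) \<Otimes>\<^sub>M N"
    define g where "g p = snd (Psi t p)" for p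
    define g' where "g' p = F t x (path_from (fst p) (snd p))" for p :: "2 \<times> _"
    define U where "U p = g (fst (fst p), snd p)" for p :: "((2 \<times> 'a) \<times> 2) \<times> ((real \<Rightarrow> 2) \<times> real)"
    define V where "V p = g' (snd (fst p), snd p)" for p :: "((2 \<times> 'a) \<times> 2) \<times> ((real \<Rightarrow> 2) \<times> real)"
    have gm: "g \<in> borel_measurable (\<nu> \<Otimes>\<^sub>M N)"
      unfolding g_def by (rule measurable_compose[OF measurable_Psi'[OF \<nu> t] measurable_snd])
    have g'm: "g' \<in> borel_measurable (measure_pmf \<mu> \<Otimes>\<^sub>M N)"
      unfolding g'_def by (rule measurable_F[OF t _ measurable_path_from_pmf]) simp
    have Um [measurable]: "U \<in> borel_measurable Q"
      unfolding U_def Q_def by (rule measurable_compose[OF _ gm]) measurable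
    have Vm [measurable]: "V \<in> borel_measurable Q"
      unfolding V_def Q_def by (rule measurable_compose[OF _ g'm]) measurable
    have dU: "distr Q borel U = distr \<nu> borel snd"
    proof -
      have "distr Q borel U = distr (\<nu> \<Otimes>\<^sub>M N) borel g"
        unfolding Q_def U_def by (rule distr_pair_forget(1)[OF \<nu>(1) _ prob_space_N gm]) (rule prob_space_measure_pmf)
      also have "\<dots> = distr (evolve t \<nu>) borel snd"
        unfolding evolve_def by (subst distr_distr[OF _ measurable_Psi'[OF \<nu> t]]) (simp_all add: g_def[abs_def] o_def)
      finally show ?thesis by (simp add: inv[OF t])
    qed
    have dV: "distr Q borel V = distr (M \<mu> x) borel (\<eta> \<mu> x t)"
    proof -
      have "distr Q borel V = distr (measure_pmf \<mu> \<Otimes>\<^sub>M N) borel g'"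
        unfolding Q_def V_def by (rule distr_pair_forget(2)[OF _ \<nu>(1) prob_space_N g'm]) (rule prob_space_measure_pmf)
      then show ?thesis by (simp add: law_eta[OF t] g'_def[abs_def])
    qed
    have Qp: "prob_space Q" unfolding Q_def by (rule \<nu>\<mu>N.P.prob_space_axioms)
    interpret Q: prob_space Q by (rule Qp)
    define \<Gamma> where "\<Gamma> = distr Q (borel \<Otimes>\<^sub>M borel) (\<lambda>p. (U p, V p))"
    have UV: "(\<lambda>p. (U p, V p)) \<in> measurable Q (borel \<Otimes>\<^sub>M borel)" by measurable
    have "\<Gamma> \<in> couplings (distr \<nu> borel snd) (distr (M \<mu> x) borel (\<eta> \<mu> x t))"
      unfolding couplings_def
    proof (intro CollectI conjI)
      show "prob_space \<Gamma>" unfolding \<Gamma>_def by (rule Q.prob_space_distr[OF UV])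
      show "sets \<Gamma> = sets (borel \<Otimes>\<^sub>M borel)" by (simp add: \<Gamma>_def)
      show "distr \<Gamma> borel fst = distr \<nu> borel snd"
        unfolding \<Gamma>_def dU[symmetric] by (subst distr_distr[OF _ UV]) (simp_all add: o_def)
      show "distr \<Gamma> borel snd = distr (M \<mu> x) borel (\<eta> \<mu> x t)"
        unfolding \<Gamma>_def dV[symmetric] by (subst distr_distr[OF _ UV]) (simp_all add: o_def)
    qed
    then have "wasserstein p (distr \<nu> borel snd) (distr (M \<mu> x) borel (\<eta> \<mu> x t)) \<le>
        (\<integral>z. min 1 (norm (fst z - snd z) powr p) \<partial>\<Gamma>)"
      unfolding wasserstein_def
      by (rule cINF_lower[rotated]) (auto intro!: bdd_belowI[of _ 0] integral_nonneg_AE)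
    also have "\<dots> = (\<integral>p'. min 1 (norm (U p' - V p') powr p) \<partial>Q)"
      unfolding \<Gamma>_def by (subst integral_distr[OF UV]) (simp_all, measurable)
    also have "\<dots> \<le> c * exp (- c' * t)"
    proof -
      have cm: "(\<lambda>p'. min 1 (norm (U p' - V p') powr p)) \<in> borel_measurable Q" by measurable
      have int: "integrable Q (\<lambda>p'. min 1 (norm (U p' - V p') powr p))"
        by (rule Q.integrable_const_bound[OF _ cm, of 1]) auto
      have "ennreal (\<integral>p'. min 1 (norm (U p' - V p') powr p) \<partial>Q) = (\<integral>\<^sup>+p'. ennreal (min 1 (norm (U p' - V p') powr p)) \<partial>Q)"
        by (rule nn_integral_eq_integral[symmetric, OF int]) simp
      also have "\<dots> = (\<integral>\<^sup>+a. \<integral>\<^sup>+\<omega>. ennreal (min 1 (norm (U (a, \<omega>) - V (a, \<omega>)) powr p)) \<partial>N \<partial>(\<nu> \<Otimes>\<^sub>M measure_pmf \<mu>))"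
        unfolding Q_def by (rule N.nn_integral_fst[symmetric]) (use cm in \<open>simp add: Q_def\<close>)
      also have "\<dots> \<le> (\<integral>\<^sup>+a. ennreal (c * exp (- c' * t)) \<partial>(\<nu> \<Otimes>\<^sub>M measure_pmf \<mu>))"
      proof (rule nn_integral_mono_AE)
        have [measurable_cong]: "sets \<nu> = sets state_space" by (rule \<nu>)
        have "AE a in \<nu> \<Otimes>\<^sub>M measure_pmf \<mu>. norm (snd (fst a)) \<le> R"
        proof (rule \<nu>\<mu>.AE_pair_measure)
          show "{a \<in> space (\<nu> \<Otimes>\<^sub>M measure_pmf \<mu>). norm (snd (fst a)) \<le> R} \<in> sets (\<nu> \<Otimes>\<^sub>M measure_pmf \<mu>)" by measurable
          show "AE z in \<nu>. AE j in measure_pmf \<mu>. norm (snd (fst (z, j))) \<le> R" using supp by simp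
        qed
        then show "AE a in \<nu> \<Otimes>\<^sub>M measure_pmf \<mu>. (\<integral>\<^sup>+\<omega>. ennreal (min 1 (norm (U (a, \<omega>) - V (a, \<omega>)) powr p)) \<partial>N) \<le> ennreal (c * exp (- c' * t))"
        proof eventually_elim
          case (elim a)
          have "(\<integral>\<^sup>+\<omega>. ennreal (min 1 (norm (U (a, \<omega>) - V (a, \<omega>)) powr p)) \<partial>N) \<le>
              ennreal (C * (1 + norm (snd (fst a)) + norm x) * exp (- c' * t))"
            unfolding U_def V_def g_def g'_def Psi_def fst_conv snd_conv by (rule est[OF t])
          also have "\<dots> \<le> ennreal (c * exp (- c' * t))"
            using elim C unfolding c_def by (intro ennreal_leI mult_right_mono mult_left_mono) auto
          finally show ?case .
        qed
      qed
      also have "\<dots> = ennreal (c * exp (- c' * t))" by (simp add: \<nu>\<mu>.P.emeasure_space_1)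
      finally show ?thesis using c by (subst (asm) ennreal_le_iff) auto
    qed
    finally show "wasserstein p (distr \<nu> borel snd) (distr (M \<mu> x) borel (\<eta> \<mu> x t)) \<le> c * exp (- c' * t)" .
  qed
qed

end

section \<open>The stationary measure\<close>

context switched_flow begin

text \<open>Here \<open>w s\<close> is read as the state at time -s of a stationary process running
  up to time 0; the result is its path from time -T on, frozen after it has reached time 0.\<close>

definition rev_path :: "real \<Rightarrow> (real \<Rightarrow> 2) \<Rightarrow> real \<Rightarrow> 2" where
  "rev_path T w s = w (T - min \<bar>s\<bar> T)"

lemma measurable_rev_path: "rev_path T \<in> measurable path_space path_space"
  unfolding rev_path_def[abs_def] by (rule measurable_path_spaceI) (rule measurable_path_eval)

text \<open>A function that sees the path only on [0, T] is not affected by freezing at T, so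
  \<open>reversed_law\<close> applies to it.\<close>

lemma
  assumes T: "0 \<le> T" and g: "g \<in> borel_measurable path_space"
    and loc: "\<And>v v'. (\<And>s. 0 \<le> s \<Longrightarrow> s \<le> T \<Longrightarrow> v s = v' s) \<Longrightarrow> g v = g v'"
  shows integral_rev_path: "(\<integral>w. g (rev_path T w) \<partial>L uniform2) = (\<integral>w. (g w :: real) \<partial>L uniform2)"
    and nn_integral_rev_path:
      "(\<integral>\<^sup>+w. ennreal (g (rev_path T w)) \<partial>L uniform2) = (\<integral>\<^sup>+w. ennreal (g w) \<partial>L uniform2)"
proof -
  have m: "(\<lambda>w s. w (min \<bar>s\<bar> T)) \<in> measurable (L uniform2) path_space"
    by (rule measurable_path_spaceI) (simp cong: measurable_cong_sets)
  have m': "rev_path T \<in> measurable (L uniform2) path_space"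
    using measurable_rev_path by (simp cong: measurable_cong_sets)
  have eq: "distr (L uniform2) path_space (rev_path T) = distr (L uniform2) path_space (\<lambda>w s. w (min \<bar>s\<bar> T))"
    using reversed_law[OF canonical_process T] by (simp add: rev_path_def[abs_def])
  have g': "(\<lambda>w. ennreal (g w)) \<in> borel_measurable path_space" using g by measurable
  have loc': "g (\<lambda>s. w (min \<bar>s\<bar> T)) = g w" for w by (rule loc) simp
  show "(\<integral>w. g (rev_path T w) \<partial>L uniform2) = (\<integral>w. g w \<partial>L uniform2)"
    using integral_distr[OF m' g] integral_distr[OF m g] unfolding eq loc' by simp
  show "(\<integral>\<^sup>+w. ennreal (g (rev_path T w)) \<partial>L uniform2) = (\<integral>\<^sup>+w. ennreal (g w) \<partial>L uniform2)"
    using nn_integral_distr[OF m', of "\<lambda>w. ennreal (g w)"] nn_integral_distr[OF m, of "\<lambda>w. ennreal (g w)"] g'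
    unfolding eq loc' by simp
qed

text \<open>From time 1 on both solutions follow the same shifted path, one starting from a point of
  norm at most R, the other from the origin. After reversal this measures the distance between
  consecutive pullbacks.\<close>

lemma one_step_contraction:
  obtains C c where "C > 0" "c > 0" "\<And>t. 0 \<le> t \<Longrightarrow>
    (\<integral>\<^sup>+w. ennreal (min 1 (norm (F (1 + t) 0 w - F t 0 (\<lambda>s. w (1 + s))))) \<partial>L uniform2) \<le>
      ennreal (C * exp (- c * t))"
proof -
  interpret Lu: prob_space "L uniform2" by (rule prob_space_L)
  obtain q0 where q0: "q0 > 0" "\<And>q. 0 < q \<Longrightarrow> q \<le> q0 \<Longrightarrow> \<exists>C c h0. C > 0 \<and> c > 0 \<and> h0 > 0 \<and>
    (\<forall>h m (M :: (real \<Rightarrow> 2) measure) W \<mu>. 0 < h \<longrightarrow> h < h0 \<longrightarrow> switching_process r \<mu> M W \<longrightarrow>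
      integrable M (\<lambda>\<omega>. gain \<kappa> b h m (\<lambda>s. W s \<omega>) powr q) \<and>
      (\<integral>\<omega>. gain \<kappa> b h m (\<lambda>s. W s \<omega>) powr q \<partial>M) \<le> C * exp (- c * (real m * h)))"
    using gain_moment_bound[OF r kb] by blast
  define q where "q = min q0 1"
  have q: "0 < q" "q \<le> q0" "q \<le> 1" using q0 by (auto simp: q_def)
  have sh: "switching_process r uniform2 (L uniform2) (\<lambda>t w. w (1 + t))"
    by (rule switching_process_shift[OF canonical_process]) simp
  obtain C c h0 where C: "C > 0" "c > 0" "h0 > 0" and
    mom: "\<And>h m. 0 < h \<Longrightarrow> h < h0 \<Longrightarrow> integrable (L uniform2) (\<lambda>w. gain \<kappa> b h m (\<lambda>s. w (1 + s)) powr q) \<and>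
      (\<integral>w. gain \<kappa> b h m (\<lambda>s. w (1 + s)) powr q \<partial>L uniform2) \<le> C * exp (- c * (real m * h))"
  proof -
    obtain C c h0 where *: "C > 0" "c > 0" "h0 > 0"
      "\<forall>h m (M :: (real \<Rightarrow> 2) measure) W \<mu>. 0 < h \<longrightarrow> h < h0 \<longrightarrow> switching_process r \<mu> M W \<longrightarrow>
      integrable M (\<lambda>\<omega>. gain \<kappa> b h m (\<lambda>s. W s \<omega>) powr q) \<and>
      (\<integral>\<omega>. gain \<kappa> b h m (\<lambda>s. W s \<omega>) powr q \<partial>M) \<le> C * exp (- c * (real m * h))"
      using q0(2)[OF q(1,2)] by blast
    show thesis by (rule that[OF *(1-3)]) (use *(4) sh in blast)
  qed
  \<comment> \<open>As in \<open>coupling_estimate\<close>, the summand 1 accounts for t =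
    0.\<close>
  define C' where "C' = 1 + (1 + R) * C"
  have C': "C' > 0" using C(1) R by (simp add: C'_def add_pos_nonneg)
  show ?thesis
  proof (rule that[OF C' C(2)])
    fix t :: real assume t: "0 \<le> t"
    define G where "G u v = ennreal (min 1 (norm (u - v)))" for u v :: 'a
    have G1: "G u v \<le> 1" for u v by (simp add: G_def)
    show "(\<integral>\<^sup>+w. ennreal (min 1 (norm (F (1 + t) 0 w - F t 0 (\<lambda>s. w (1 + s))))) \<partial>L uniform2) \<le>
      ennreal (C' * exp (- c * t))"
      unfolding G_def[symmetric]
    proof (cases "t = 0")
      case True
      have "(\<integral>\<^sup>+w. G (F (1 + t) 0 w) (F t 0 (\<lambda>s. w (1 + s))) \<partial>L uniform2) \<le> (\<integral>\<^sup>+w. 1 \<partial>L uniform2)"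
        by (intro nn_integral_mono G1)
      also have "\<dots> = 1" using Lu.emeasure_space_1 by simp
      also have "\<dots> \<le> ennreal (C' * exp (- c * t))" using True C(1) R by (simp add: C'_def)
      finally show "(\<integral>\<^sup>+w. G (F (1 + t) 0 w) (F t 0 (\<lambda>s. w (1 + s))) \<partial>L uniform2) \<le> ennreal (C' * exp (- c * t))" .
    next
      case False
      then have t0: "0 < t" using t by simp
      define Gn where "Gn n w = G (grid t n (F 1 0 w) (\<lambda>s. w (1 + s))) (grid t n 0 (\<lambda>s. w (1 + s)))" for n w
      have shm: "(\<lambda>w s. w (1 + s)) \<in> measurable (L uniform2) path_space"
        by (rule measurable_path_spaceI) (simp cong: measurable_cong_sets)
      have F1m: "(\<lambda>w. F 1 0 w) \<in> borel_measurable (L uniform2)"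
        by (rule measurable_F) (simp_all cong: measurable_cong_sets)
      have Gm: "(\<lambda>z. G (f z) (g z)) \<in> borel_measurable (L uniform2)"
        if [measurable]: "f \<in> borel_measurable (L uniform2)" "g \<in> borel_measurable (L uniform2)" for f g
        unfolding G_def by measurable
      have Gnm: "Gn n \<in> borel_measurable (L uniform2)" for n
        unfolding Gn_def[abs_def] by (intro Gm measurable_grid[OF t] F1m shm) simp
      have Gn_bound: "(\<integral>\<^sup>+w. Gn n w \<partial>L uniform2) \<le> ennreal (C' * exp (- c * t))" if n: "t / real (Suc n) < h0" for n
      proof -
        define h where "h = t / real (Suc n)"
        have h: "0 < h" "h < h0" "real (Suc n) * h = t" using t0 n by (auto simp: h_def simp del: of_nat_Suc)
        let ?g = "\<lambda>w. gain \<kappa> b h (Suc n) (\<lambda>s. w (1 + s)) powr q"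
        have gm: "?g \<in> borel_measurable (L uniform2)" using mom[OF h(1,2), of "Suc n"] by blast
        have "(\<integral>\<^sup>+w. Gn n w \<partial>L uniform2) \<le> (\<integral>\<^sup>+w. ennreal (1 + R) * ennreal (?g w) \<partial>L uniform2)"
        proof (rule nn_integral_mono)
          fix w :: "real \<Rightarrow> 2"
          let ?\<delta> = "norm (grid t n (F 1 0 w) (\<lambda>s. w (1 + s)) - grid t n 0 (\<lambda>s. w (1 + s)))"
          have "min 1 ?\<delta> = min 1 (?\<delta> powr 1)" by simp
          also have "\<dots> \<le> ?\<delta> powr q" by (rule min_one_powr_le) (use q in auto)
          also have "\<dots> \<le> (gain \<kappa> b h (Suc n) (\<lambda>s. w (1 + s)) * R) powr q"
          proof (rule powr_mono2)
            have "?\<delta> \<le> gain \<kappa> b h (Suc n) (\<lambda>s. w (1 + s)) * norm (F 1 0 w - 0)"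
              unfolding grid_def h_def by (rule grid_flow_lipschitz) (use t in simp)
            also have "\<dots> \<le> gain \<kappa> b h (Suc n) (\<lambda>s. w (1 + s)) * R"
              using F_bound[of 1 0 w] R by (intro mult_left_mono less_imp_le[OF gain_pos]) auto
            finally show "?\<delta> \<le> gain \<kappa> b h (Suc n) (\<lambda>s. w (1 + s)) * R" .
          qed (use q in auto)
          also have "\<dots> = ?g w * R powr q"
            by (rule powr_mult)
          also have "\<dots> \<le> ?g w * (1 + R)"
            by (intro mult_left_mono powr_le_one_plus) (use R q in auto)
          finally show "Gn n w \<le> ennreal (1 + R) * ennreal (?g w)"
            unfolding Gn_def G_def using R by (subst ennreal_mult'[symmetric]) (auto intro!: ennreal_leI simp: mult.commute)
        qed
        also have "\<dots> = ennreal (1 + R) * (\<integral>\<^sup>+w. ennreal (?g w) \<partial>L uniform2)"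
          by (rule nn_integral_cmult) (rule measurable_compose[OF gm measurable_ennreal])
        also have "(\<integral>\<^sup>+w. ennreal (?g w) \<partial>L uniform2) = ennreal (\<integral>w. ?g w \<partial>L uniform2)"
          by (rule nn_integral_eq_integral) (use mom[OF h(1,2), of "Suc n"] in auto)
        also have "ennreal (1 + R) * ennreal (\<integral>w. ?g w \<partial>L uniform2) = ennreal ((1 + R) * (\<integral>w. ?g w \<partial>L uniform2))"
          using R by (simp add: ennreal_mult')
        also have "\<dots> \<le> ennreal (C' * exp (- c * t))"
        proof (rule ennreal_leI)
          have "(1 + R) * (\<integral>w. ?g w \<partial>L uniform2) \<le> (1 + R) * (C * exp (- c * t))"
            using mom[OF h(1,2), of "Suc n"] R unfolding h(3) by (intro mult_left_mono) auto
          also have "\<dots> \<le> C' * exp (- c * t)"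
            unfolding mult.assoc[symmetric] by (intro mult_right_mono) (auto simp: C'_def)
          finally show "(1 + R) * (\<integral>w. ?g w \<partial>L uniform2) \<le> C' * exp (- c * t)" .
        qed
        finally show ?thesis .
      qed
      \<comment> \<open>Stationarity gives the shifted path the law \<open>L uniform2\<close>, so
        the almost sure convergence of grids from the origin holds along it.\<close>
      have "AE w in distr (L uniform2) path_space (\<lambda>w s. w (1 + \<bar>s\<bar>)). (\<lambda>n. grid t n 0 w) \<longlonglongrightarrow> F t 0 w"
        unfolding L_eq[OF sh] by (rule AE_L_F[OF t])
      then have sh_lim: "AE w in L uniform2. (\<lambda>n. grid t n 0 (\<lambda>s. w (1 + \<bar>s\<bar>))) \<longlonglongrightarrow> F t 0 (\<lambda>s. w (1 + \<bar>s\<bar>))"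
        by (rule AE_distrD[rotated]) (rule measurable_path_spaceI, simp cong: measurable_cong_sets)
      have e: "grid t n 0 (\<lambda>s. w (1 + \<bar>s\<bar>)) = grid t n 0 (\<lambda>s. w (1 + s))" "F t 0 (\<lambda>s. w (1 + \<bar>s\<bar>)) = F t 0 (\<lambda>s. w (1 + s))"
        for n and w :: "real \<Rightarrow> 2"
        by (rule grid_cong[OF t] F_cong[OF t], simp)+
      have lim: "AE w in L uniform2. (\<lambda>n. Gn n w) \<longlonglongrightarrow> G (F (1 + t) 0 w) (F t 0 (\<lambda>s. w (1 + s)))"
        using AE_L_cocycle[of 1 t, OF zero_le_one t, where x = 0 and \<mu> = uniform2] sh_lim
      proof eventually_elim
        case (elim w)
        show ?case unfolding Gn_def G_def
          by (intro tendsto_intros elim(1) elim(2)[unfolded e])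
      qed
      have "(\<integral>\<^sup>+w. G (F (1 + t) 0 w) (F t 0 (\<lambda>s. w (1 + s))) \<partial>L uniform2) = (\<integral>\<^sup>+w. liminf (\<lambda>n. Gn n w) \<partial>L uniform2)"
        by (rule nn_integral_cong_AE) (use lim in eventually_elim, simp add: lim_imp_Liminf)
      also have "\<dots> \<le> liminf (\<lambda>n. \<integral>\<^sup>+w. Gn n w \<partial>L uniform2)" by (rule nn_integral_liminf[OF Gnm])
      also have "\<dots> \<le> ennreal (C' * exp (- c * t))"
      proof -
        have "(\<lambda>n. t * inverse (real (Suc n))) \<longlonglongrightarrow> t * 0" by (intro tendsto_intros LIMSEQ_inverse_real_of_nat)
        then have "\<forall>\<^sub>F n in sequentially. t / real (Suc n) < h0"
          using C(3) by (intro order_tendstoD) (auto simp: divide_inverse)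
        then have "\<forall>\<^sub>F n in sequentially. (\<integral>\<^sup>+w. Gn n w \<partial>L uniform2) \<le> ennreal (C' * exp (- c * t))"
          by eventually_elim (rule Gn_bound)
        from Liminf_mono[OF this] show ?thesis by (simp add: Liminf_const)
      qed
      finally show "(\<integral>\<^sup>+w. G (F (1 + t) 0 w) (F t 0 (\<lambda>s. w (1 + s))) \<partial>L uniform2) \<le> ennreal (C' * exp (- c * t))" .
    qed
  qed
qed

text \<open>The position at time \<open>0\<close> of the flow started at the origin at time \<open>- n\<close>.\<close>

definition pullback :: "nat \<Rightarrow> (real \<Rightarrow> 2) \<Rightarrow> 'a" where
  "pullback n w = F (real n) 0 (rev_path (real n) w)"

lemma measurable_pullback: "pullback n \<in> borel_measurable path_space"
  unfolding pullback_def[abs_def] by (rule measurable_F[OF _ _ measurable_rev_path]) simp_all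

lemma pullback_bound: "norm (pullback n w) \<le> R"
  using F_bound[of "real n" 0 "rev_path (real n) w"] R by (simp add: pullback_def)

text \<open>The truncated increments have geometrically small means, hence are almost surely
  summable. Summable terms tend to 0, so the truncation is eventually inactive and the increments
  themselves are absolutely summable.\<close>

lemma AE_pullback_Cauchy: "AE w in L uniform2. Cauchy (\<lambda>n. pullback n w)"
proof -
  interpret Lu: prob_space "L uniform2" by (rule prob_space_L)
  obtain C c where C: "C > 0" "c > 0" and est: "\<And>t. 0 \<le> t \<Longrightarrow>
    (\<integral>\<^sup>+w. ennreal (min 1 (norm (F (1 + t) 0 w - F t 0 (\<lambda>s. w (1 + s))))) \<partial>L uniform2) \<le>
      ennreal (C * exp (- c * t))"
    using one_step_contraction by blast
  define \<delta> where "\<delta> n w = min 1 (norm (pullback (Suc n) w - pullback n w))" for n w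
  have \<delta>m: "\<delta> n \<in> borel_measurable path_space" for n
  proof -
    note [measurable] = measurable_pullback
    show ?thesis unfolding \<delta>_def[abs_def] by measurable
  qed
  have I: "(\<integral>\<^sup>+w. ennreal (\<delta> n w) \<partial>L uniform2) \<le> ennreal (C * exp (- c) ^ n)" for n
  proof -
    define g where "g v = min 1 (norm (F (1 + real n) 0 v - F (real n) 0 (\<lambda>s. v (1 + s))))" for v
    have "\<delta> n w = g (rev_path (1 + real n) w)" for w
    proof -
      \<comment> \<open>Consecutive pullbacks share the driving path over the last n units of time;
        the longer one only has an additional first unit.\<close>
      have "F (real n) 0 (rev_path (real n) w) = F (real n) 0 (\<lambda>s. rev_path (1 + real n) w (1 + s))"
      proof (rule F_cong)
        fix s :: real assume s: "0 \<le> s" "s \<le> real n"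
        then show "rev_path (real n) w s = rev_path (1 + real n) w (1 + s)" by (simp add: rev_path_def min_def)
      qed simp
      then show ?thesis by (simp add: \<delta>_def g_def pullback_def add.commute)
    qed
    then have "(\<integral>\<^sup>+w. ennreal (\<delta> n w) \<partial>L uniform2) = (\<integral>\<^sup>+w. ennreal (g (rev_path (1 + real n) w)) \<partial>L uniform2)" by simp
    also have "\<dots> = (\<integral>\<^sup>+w. ennreal (g w) \<partial>L uniform2)"
    proof (rule nn_integral_rev_path)
      have [measurable]: "(\<lambda>v. F (1 + real n) 0 v) \<in> borel_measurable path_space"
        by (rule measurable_F) simp_all
      have [measurable]: "(\<lambda>v. F (real n) 0 (\<lambda>s. v (1 + s))) \<in> borel_measurable path_space"
        by (rule measurable_F) (auto intro!: measurable_path_spaceI measurable_path_eval)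
      show "g \<in> borel_measurable path_space" unfolding g_def[abs_def] by measurable
      fix v v' :: "real \<Rightarrow> 2" assume eq: "\<And>s. 0 \<le> s \<Longrightarrow> s \<le> 1 + real n \<Longrightarrow> v s = v' s"
      have "F (1 + real n) 0 v = F (1 + real n) 0 v'" by (rule F_cong) (auto intro: eq)
      moreover have "F (real n) 0 (\<lambda>s. v (1 + s)) = F (real n) 0 (\<lambda>s. v' (1 + s))" by (rule F_cong) (auto intro: eq)
      ultimately show "g v = g v'" by (simp add: g_def)
    qed simp
    also have "\<dots> \<le> ennreal (C * exp (- c * real n))" unfolding g_def by (rule est) simp
    also have "exp (- c * real n) = exp (- c) ^ n" by (simp add: exp_of_nat_mult[symmetric] mult.commute)
    finally show ?thesis .
  qed
  have "(\<integral>\<^sup>+w. (\<Sum>n. ennreal (\<delta> n w)) \<partial>L uniform2) = (\<Sum>n. \<integral>\<^sup>+w. ennreal (\<delta> n w) \<partial>L uniform2)"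
    by (rule nn_integral_suminf) (use \<delta>m in \<open>simp cong: measurable_cong_sets\<close>)
  also have "\<dots> \<le> (\<Sum>n. ennreal (C * exp (- c) ^ n))"
    by (rule suminf_le) (use I in auto)
  also have "\<dots> < \<infinity>"
  proof -
    have "summable (\<lambda>n. C * exp (- c) ^ n)" using C by (intro summable_mult summable_geometric) simp
    then show ?thesis using C by (subst suminf_ennreal2) auto
  qed
  finally have fin: "(\<integral>\<^sup>+w. (\<Sum>n. ennreal (\<delta> n w)) \<partial>L uniform2) \<noteq> \<infinity>" by simp
  have "AE w in L uniform2. (\<Sum>n. ennreal (\<delta> n w)) \<noteq> \<infinity>"
    by (rule nn_integral_PInf_AE[OF _ fin]) (use \<delta>m in \<open>intro borel_measurable_suminf_order, simp cong: measurable_cong_sets\<close>)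
  then show ?thesis
  proof eventually_elim
    case (elim w)
    have nn: "0 \<le> \<delta> n w" for n by (simp add: \<delta>_def)
    have "summable (\<lambda>n. \<delta> n w)" by (rule summable_suminf_not_top[OF nn]) (use elim in simp)
    then have "(\<lambda>n. \<delta> n w) \<longlonglongrightarrow> 0" by (rule summable_LIMSEQ_zero)
    then have ev: "\<forall>\<^sub>F n in sequentially. \<delta> n w < 1" by (rule order_tendstoD) simp
    have "\<forall>\<^sub>F n in sequentially. norm (pullback (Suc n) w - pullback n w) \<le> \<delta> n w"
      using ev by eventually_elim (auto simp: \<delta>_def min_def split: if_splits)
    then have "summable (\<lambda>n. pullback (Suc n) w - pullback n w)"
      by (rule summable_comparison_test_ev[OF _ \<open>summable (\<lambda>n. \<delta> n w)\<close>])
    then have "convergent (\<lambda>n. \<Sum>k<n. pullback (Suc k) w - pullback k w)" by (simp add: summable_iff_convergent)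
    then have "convergent (\<lambda>n. (\<Sum>k<n. pullback (Suc k) w - pullback k w) + pullback 0 w)"
      by (intro convergent_add convergent_const)
    then show "Cauchy (\<lambda>n. pullback n w)" by (simp add: sum_lessThan_telescope[of "\<lambda>k. pullback k w"] Cauchy_convergent_iff)
  qed
qed

definition pullback_limit :: "(real \<Rightarrow> 2) \<Rightarrow> 'a" where
  "pullback_limit w = (if Cauchy (\<lambda>n. pullback n w) then lim (\<lambda>n. pullback n w) else 0)"

lemma pullback_tendsto: "Cauchy (\<lambda>n. pullback n w) \<Longrightarrow> (\<lambda>n. pullback n w) \<longlonglongrightarrow> pullback_limit w"
  by (simp add: pullback_limit_def Cauchy_convergent_iff convergent_LIMSEQ_iff)

lemma pullback_limit_bound: "norm (pullback_limit w) \<le> R"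
proof (cases "Cauchy (\<lambda>n. pullback n w)")
  case True
  show ?thesis
    by (rule tendsto_upperbound[OF tendsto_norm[OF pullback_tendsto[OF True]]])
      (auto intro!: always_eventually pullback_bound)
qed (use R in \<open>simp add: pullback_limit_def\<close>)

lemma measurable_pullback_limit: "pullback_limit \<in> borel_measurable path_space"
proof -
  note [measurable] = measurable_pullback
  show ?thesis unfolding pullback_limit_def[abs_def] by measurable
qed

text \<open>The limit position is paired with \<open>w 0\<close>, the state at which every reversed
  path ends, so that both components belong to the same time.\<close>

definition stat :: "(2 \<times> 'a) measure" where
  "stat = distr (L uniform2) state_space (\<lambda>w. (w 0, pullback_limit w))"

lemma measurable_stat: "(\<lambda>w. (w 0, pullback_limit w)) \<in> measurable (L uniform2) state_space"
  using measurable_pullback_limit measurable_path_eval[of 0] by (simp cong: measurable_cong_sets)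

lemma stat: "prob_space stat" "sets stat = sets state_space" "AE z in stat. norm (snd z) \<le> R"
proof -
  interpret Lu: prob_space "L uniform2" by (rule prob_space_L)
  show "prob_space stat" unfolding stat_def by (rule Lu.prob_space_distr[OF measurable_stat])
  show "sets stat = sets state_space" by (simp add: stat_def)
  show "AE z in stat. norm (snd z) \<le> R"
    unfolding stat_def
    by (subst AE_distr_iff[OF measurable_stat]) (measurable, simp add: pullback_limit_bound)
qed

text \<open>Reversal exchanges the almost sure limit of pullbacks for a limit of forward
  expectations from the origin; the remaining proofs about \<open>stat\<close> use only the
  latter.\<close>

lemma stat_expectation:
  assumes f: "test_function B f"
  shows "(\<lambda>n. \<integral>j. KI (real n) f (j, 0) \<partial>measure_pmf uniform2) \<longlonglongrightarrow> (\<integral>z. f z \<partial>stat)"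
proof -
  interpret Lu: prob_space "L uniform2" by (rule prob_space_L)
  have fm: "(\<lambda>w. f (w s, g w)) \<in> borel_measurable (L uniform2)" if "g \<in> borel_measurable path_space" for g s
  proof -
    have "(\<lambda>w. (w s, g w)) \<in> measurable path_space state_space"
      by (intro measurable_Pair measurable_path_eval that)
    from measurable_compose[OF this measurable_test_function[OF f]] show ?thesis by (simp cong: measurable_cong_sets)
  qed
  have "(\<lambda>n. \<integral>w. f (w 0, pullback n w) \<partial>L uniform2) \<longlonglongrightarrow> (\<integral>w. f (w 0, pullback_limit w) \<partial>L uniform2)"
  proof (rule integral_dominated_convergence[where w = "\<lambda>_. B"])
    show "AE w in L uniform2. (\<lambda>n. f (w 0, pullback n w)) \<longlonglongrightarrow> f (w 0, pullback_limit w)"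
      using AE_pullback_Cauchy by eventually_elim (rule test_function_tendsto[OF f pullback_tendsto])
    show "AE w in L uniform2. norm (f (w 0, pullback n w)) \<le> B" for n using test_functionD(1)[OF f] by simp
  qed (use fm measurable_pullback measurable_pullback_limit in auto)
  moreover have "(\<integral>w. f (w 0, pullback n w) \<partial>L uniform2) = (\<integral>j. KI (real n) f (j, 0) \<partial>measure_pmf uniform2)" for n
  proof -
    have "(\<integral>w. f (w 0, pullback n w) \<partial>L uniform2) = (\<integral>w. (\<lambda>v. f (v (real n), F (real n) 0 v)) (rev_path (real n) w) \<partial>L uniform2)"
      by (simp add: pullback_def rev_path_def)
    also have "\<dots> = (\<integral>w. f (w (real n), F (real n) 0 w) \<partial>L uniform2)"
    proof (rule integral_rev_path)
      show "(\<lambda>v. f (v (real n), F (real n) 0 v)) \<in> borel_measurable path_space" by (rule measurable_F_state[OF _ f]) simp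
      fix v v' :: "real \<Rightarrow> 2" assume eq: "\<And>s. 0 \<le> s \<Longrightarrow> s \<le> real n \<Longrightarrow> v s = v' s"
      have "F (real n) 0 v = F (real n) 0 v'" by (rule F_cong) (auto intro: eq)
      then show "f (v (real n), F (real n) 0 v) = f (v' (real n), F (real n) 0 v')" using eq[of "real n"] by simp
    qed simp
    also have "\<dots> = (\<integral>j. KI (real n) f (j, 0) \<partial>measure_pmf uniform2)" by (rule expectation_mixture[OF _ f]) simp
    finally show ?thesis .
  qed
  moreover have "(\<integral>z. f z \<partial>stat) = (\<integral>w. f (w 0, pullback_limit w) \<partial>L uniform2)"
    unfolding stat_def by (rule integral_distr[OF measurable_stat measurable_test_function[OF f]])
  ultimately show ?thesis by simp
qed

lemma integrable_KI:
  assumes "0 \<le> t" "test_function B f" "prob_space \<rho>" "sets \<rho> = sets state_space"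
  shows "integrable \<rho> (KI t f)"
proof -
  interpret prob_space \<rho> by fact
  have "KI t f \<in> borel_measurable \<rho>"
    using measurable_test_function[OF test_function_KI[OF assms(1,2)]] assms(4) by (simp cong: measurable_cong_sets)
  then show ?thesis using KI_bound[OF assms(1,2)] by (intro integrable_const_bound[of _ B]) auto
qed

text \<open>By the semigroup property the operators for times n and t commute, and after a long time
  n the function \<open>KI (real n) f\<close> is nearly constant on the ball of radius R. Applying
  the operator for time t once more therefore changes its value at the origin arbitrarily
  little.\<close>

lemma stat_invariant:
  assumes t: "0 \<le> t"
  shows "evolve t stat = stat"
proof (rule prob_measure_eqI_test_functions[OF prob_space_evolve[OF stat(1,2) t] _ stat(1,2)])
  show "sets (evolve t stat) = sets state_space" by (simp add: evolve_def)
  fix B :: real and f :: "2 \<times> 'a \<Rightarrow> real" assume f: "test_function B f"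
  obtain C c where C: "C > 0" "c > 0" and con: "\<And>B f t z z'. test_function B f \<Longrightarrow> 0 \<le> t \<Longrightarrow>
    \<bar>KI t f z - KI t f z'\<bar> \<le> B * C * (1 + norm (snd z) + norm (snd z')) * exp (- c * t)"
    using KI_contraction by blast
  have close: "\<bar>KI (real n) (KI t f) (j, 0) - KI (real n) f (j, 0)\<bar> \<le> B * C * (1 + R) * exp (- c * real n)" for n j
  proof -
    interpret Lj: prob_space "L (return_pmf j)" by (rule prob_space_L)
    let ?K = "KI (real n) f"
    have K: "test_function (B * exp (b * real n)) ?K" by (rule test_function_KI[OF _ f]) simp
    have int: "integrable (L (return_pmf j)) (\<lambda>w. ?K (w t, F t 0 w))"
      by (rule bounded_integrable_L[OF measurable_F_state[OF t K]]) (rule KI_bound[OF _ f], simp)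
    have e: "KI (real n) (KI t f) (j, 0) = KI t ?K (j, 0)"
      using KI_semigroup[OF _ t f, of "real n" "(j, 0)"] KI_semigroup[OF t _ f, of "real n" "(j, 0)"]
      by (simp add: add.commute)
    have "KI t ?K (j, 0) - ?K (j, 0) = (\<integral>w. ?K (w t, F t 0 w) - ?K (j, 0) \<partial>L (return_pmf j))"
      using int Lj.prob_space by (simp add: KI_def[of t])
    then have "\<bar>KI (real n) (KI t f) (j, 0) - ?K (j, 0)\<bar> = \<bar>\<integral>w. ?K (w t, F t 0 w) - ?K (j, 0) \<partial>L (return_pmf j)\<bar>"
      by (simp only: e)
    also have "\<dots> \<le> (\<integral>w. \<bar>?K (w t, F t 0 w) - ?K (j, 0)\<bar> \<partial>L (return_pmf j))" by (rule integral_abs_bound)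
    also have "\<dots> \<le> (\<integral>w. B * C * (1 + R) * exp (- c * real n) \<partial>L (return_pmf j))"
    proof (rule integral_mono)
      fix w
      have "\<bar>?K (w t, F t 0 w) - ?K (j, 0)\<bar> \<le> B * C * (1 + norm (F t 0 w) + norm (0::'a)) * exp (- c * real n)"
        using con[OF f, of "real n" "(w t, F t 0 w)" "(j, 0)"] by simp
      also have "\<dots> \<le> B * C * (1 + R) * exp (- c * real n)"
        using F_bound[OF t, of 0 w] R C test_functionD(3)[OF f]
        by (intro mult_right_mono mult_left_mono) auto
      finally show "\<bar>?K (w t, F t 0 w) - ?K (j, 0)\<bar> \<le> B * C * (1 + R) * exp (- c * real n)" .
    qed (use int in auto)
    also have "\<dots> = B * C * (1 + R) * exp (- c * real n)" using Lj.prob_space by simp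
    finally show ?thesis .
  qed
  have diff: "(\<lambda>n. (\<integral>j. KI (real n) (KI t f) (j, 0) \<partial>measure_pmf uniform2) - (\<integral>j. KI (real n) f (j, 0) \<partial>measure_pmf uniform2)) \<longlonglongrightarrow> 0"
  proof (rule Lim_null_comparison[OF always_eventually])
    have int: "integrable (measure_pmf uniform2) g" for g :: "2 \<Rightarrow> real"
      by (rule integrable_measure_pmf_finite) simp
    show "\<forall>n. norm ((\<integral>j. KI (real n) (KI t f) (j, 0) \<partial>measure_pmf uniform2) - (\<integral>j. KI (real n) f (j, 0) \<partial>measure_pmf uniform2))
        \<le> B * C * (1 + R) * exp (- c * real n)"
    proof
      fix n
      have "norm ((\<integral>j. KI (real n) (KI t f) (j, 0) \<partial>measure_pmf uniform2) - (\<integral>j. KI (real n) f (j, 0) \<partial>measure_pmf uniform2)) =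
          \<bar>\<integral>j. KI (real n) (KI t f) (j, 0) - KI (real n) f (j, 0) \<partial>measure_pmf uniform2\<bar>"
        using int by simp
      also have "\<dots> \<le> (\<integral>j. \<bar>KI (real n) (KI t f) (j, 0) - KI (real n) f (j, 0)\<bar> \<partial>measure_pmf uniform2)"
        by (rule integral_abs_bound)
      also have "\<dots> \<le> (\<integral>j. B * C * (1 + R) * exp (- c * real n) \<partial>measure_pmf uniform2)"
        by (rule integral_mono[OF int int close])
      finally show "norm ((\<integral>j. KI (real n) (KI t f) (j, 0) \<partial>measure_pmf uniform2) - (\<integral>j. KI (real n) f (j, 0) \<partial>measure_pmf uniform2))
        \<le> B * C * (1 + R) * exp (- c * real n)" by simp
    qed
    have "(\<lambda>n. B * C * (1 + R) * exp (- c) ^ n) \<longlonglongrightarrow> B * C * (1 + R) * 0"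
      using C by (intro tendsto_intros LIMSEQ_power_zero) simp
    then show "(\<lambda>n. B * C * (1 + R) * exp (- c * real n)) \<longlonglongrightarrow> 0"
      by (simp add: exp_of_nat_mult[symmetric] mult.commute)
  qed
  have "(\<integral>z. KI t f z \<partial>stat) - (\<integral>z. f z \<partial>stat) = 0"
    by (rule LIMSEQ_unique[OF tendsto_diff[OF stat_expectation[OF test_function_KI[OF t f]] stat_expectation[OF f]] diff])
  then show "(\<integral>z. f z \<partial>evolve t stat) = (\<integral>z. f z \<partial>stat)"
    by (simp add: evolve_integral[OF stat(1,2) t f])
qed

text \<open>From every starting point the expectations converge to that under \<open>stat\<close>.
  Integrating over an invariant measure keeps them constant in n, and the bound of f dominates,
  whatever the tails of the measure.\<close>

lemma stat_unique:
  assumes \<nu>: "prob_space \<nu>" "sets \<nu> = sets state_space" and inv: "\<And>t. 0 \<le> t \<Longrightarrow> evolve t \<nu> = \<nu>"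
  shows "\<nu> = stat"
proof (rule prob_measure_eqI_test_functions[OF \<nu> stat(1,2)])
  fix B :: real and f :: "2 \<times> 'a \<Rightarrow> real" assume f: "test_function B f"
  interpret \<nu>: prob_space \<nu> by (rule \<nu>)
  interpret S: prob_space stat by (rule stat)
  obtain C c where C: "C > 0" "c > 0" and con: "\<And>B f t z z'. test_function B f \<Longrightarrow> 0 \<le> t \<Longrightarrow>
    \<bar>KI t f z - KI t f z'\<bar> \<le> B * C * (1 + norm (snd z) + norm (snd z')) * exp (- c * t)"
    using KI_contraction by blast
  let ?m = "\<integral>z. f z \<partial>stat"
  have close: "\<bar>KI (real n) f z - ?m\<bar> \<le> B * C * (1 + norm (snd z) + R) * exp (- c) ^ n" for n z
  proof -
    have int: "integrable stat (KI (real n) f)" by (rule integrable_KI[OF _ f stat(1,2)]) simp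
    have "?m = (\<integral>z'. KI (real n) f z' \<partial>stat)"
      using evolve_integral[OF stat(1,2) _ f, of "real n"] stat_invariant[of "real n"] by simp
    then have "KI (real n) f z - ?m = (\<integral>z'. KI (real n) f z - KI (real n) f z' \<partial>stat)"
      using int S.prob_space by simp
    then have "\<bar>KI (real n) f z - ?m\<bar> = \<bar>\<integral>z'. KI (real n) f z - KI (real n) f z' \<partial>stat\<bar>"
      by (simp only:)
    also have "\<dots> \<le> (\<integral>z'. \<bar>KI (real n) f z - KI (real n) f z'\<bar> \<partial>stat)" by (rule integral_abs_bound)
    also have "\<dots> \<le> (\<integral>z'. B * C * (1 + norm (snd z) + R) * exp (- c) ^ n \<partial>stat)"
    proof (rule integral_mono_AE)
      show "AE z' in stat. \<bar>KI (real n) f z - KI (real n) f z'\<bar> \<le> B * C * (1 + norm (snd z) + R) * exp (- c) ^ n"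
        using stat(3)
      proof eventually_elim
        case (elim z')
        have "\<bar>KI (real n) f z - KI (real n) f z'\<bar> \<le> B * C * (1 + norm (snd z) + norm (snd z')) * exp (- c * real n)"
          by (rule con[OF f]) simp
        also have "\<dots> \<le> B * C * (1 + norm (snd z) + R) * exp (- c * real n)"
          using elim C test_functionD(3)[OF f] by (intro mult_right_mono mult_left_mono) auto
        finally show ?case by (simp add: exp_of_nat_mult[symmetric] mult.commute)
      qed
    qed (use int in auto)
    also have "\<dots> = B * C * (1 + norm (snd z) + R) * exp (- c) ^ n" using S.prob_space by simp
    finally show ?thesis .
  qed
  have "(\<lambda>n. \<integral>z. KI (real n) f z \<partial>\<nu>) \<longlonglongrightarrow> (\<integral>z. ?m \<partial>\<nu>)"
  proof (rule integral_dominated_convergence[where w = "\<lambda>_. B"])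
    show "KI (real n) f \<in> borel_measurable \<nu>" for n
      by (rule borel_measurable_integrable[OF integrable_KI[OF _ f \<nu>]]) simp
    show "AE z in \<nu>. norm (KI (real n) f z) \<le> B" for n using KI_bound[OF _ f, of "real n"] by simp
    show "AE z in \<nu>. (\<lambda>n. KI (real n) f z) \<longlonglongrightarrow> ?m"
    proof (rule AE_I2)
      fix z
      have "(\<lambda>n. KI (real n) f z - ?m) \<longlonglongrightarrow> 0"
      proof (rule Lim_null_comparison[OF always_eventually])
        show "\<forall>n. norm (KI (real n) f z - ?m) \<le> B * C * (1 + norm (snd z) + R) * exp (- c) ^ n" using close by simp
        have "(\<lambda>n. B * C * (1 + norm (snd z) + R) * exp (- c) ^ n) \<longlonglongrightarrow> B * C * (1 + norm (snd z) + R) * 0"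
          using C by (intro tendsto_intros LIMSEQ_power_zero) simp
        then show "(\<lambda>n. B * C * (1 + norm (snd z) + R) * exp (- c) ^ n) \<longlonglongrightarrow> 0" by simp
      qed
      then show "(\<lambda>n. KI (real n) f z) \<longlonglongrightarrow> ?m" by (simp add: LIM_zero_iff)
    qed
  qed simp_all
  moreover have "(\<integral>z. KI (real n) f z \<partial>\<nu>) = (\<integral>z. f z \<partial>\<nu>)" for n
    using evolve_integral[OF \<nu> _ f, of "real n"] inv[of "real n"] by simp
  ultimately have "(\<lambda>n::nat. \<integral>z. f z \<partial>\<nu>) \<longlonglongrightarrow> ?m" using \<nu>.prob_space by simp
  then show "(\<integral>z. f z \<partial>\<nu>) = ?m" by (simp add: LIMSEQ_const_iff)
qed

theorem exponential_ergodicity: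
  "\<exists>\<pi>. stationary_measure (transition_kernel M i \<eta>) \<pi> \<and>
    (\<forall>\<pi>'. stationary_measure (transition_kernel M i \<eta>) \<pi>' \<longrightarrow> \<pi>' = \<pi>) \<and>
    (\<forall>\<mu> x p. 0 < p \<longrightarrow> p < 1 \<longrightarrow>
      (\<exists>c c'. c > 0 \<and> c' > 0 \<and>
        (\<forall>t\<ge>0. wasserstein p \<pi> (distr (M \<mu> x) borel (\<eta> \<mu> x t)) \<le> c * exp (- c' * t))))"
proof (intro exI[of _ "distr stat borel snd"] conjI allI impI)
  show "stationary_measure (transition_kernel M i \<eta>) (distr stat borel snd)"
    unfolding stationary_measure_def invariant_measure_iff using stat(1,2) stat_invariant by blast
  show "\<pi>' = distr stat borel snd" if "stationary_measure (transition_kernel M i \<eta>) \<pi>'" for \<pi>'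
    using that unfolding stationary_measure_def invariant_measure_iff using stat_unique by blast
  fix \<mu> x and p :: real assume p: "0 < p" "p < 1"
  show "\<exists>c c'. c > 0 \<and> c' > 0 \<and>
      (\<forall>t\<ge>0. wasserstein p (distr stat borel snd) (distr (M \<mu> x) borel (\<eta> \<mu> x t)) \<le> c * exp (- c' * t))"
    using wasserstein_bound[OF stat(1,2) stat_invariant stat(3) p, of \<mu> x] by metis
qed

end

section \<open>Existence of the flow\<close>

text \<open>Staying in j at all points of a dyadic grid has probability at least
  \<open>exp (- r * h)\<close>, uniformly in the refinement. The intersection of these decreasing
  events is thus not null and meets P; right-continuity extends the constancy from dyadic points to
  [0, h).\<close>

lemma constant_path_exists:
  assumes sp: "switching_process r (return_pmf j) M W" and r: "0 \<le> r" and h: "0 < h"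
    and P: "AE \<omega> in M. P \<omega>" and rc: "\<And>\<omega>. P \<omega> \<Longrightarrow> right_continuous_path (\<lambda>t. W t \<omega>)"
  obtains \<omega> where "P \<omega>" "\<And>s. 0 \<le> s \<Longrightarrow> s < h \<Longrightarrow> W s \<omega> = j"
proof -
  interpret prob_space M by (rule switching_processD(1)[OF sp])
  define A where "A n = {\<omega>\<in>space M. \<forall>k\<le>2^n. W (real k * (h / 2^n)) \<omega> = j}" for n :: nat
  have A_sets: "A n \<in> sets M" for n
  proof -
    have [measurable]: "W (real k * (h / 2^n)) \<in> measurable M (count_space UNIV)" for k
      by (rule switching_processD(2)[OF sp]) (use h in simp)
    show ?thesis unfolding A_def by measurable
  qed
  have lower: "exp (- r * h) \<le> measure M (A n)" for n
  proof -
    define \<delta> where "\<delta> = h / 2^n"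
    have \<delta>: "0 < \<delta>" "2^n * \<delta> = h" using h by (simp_all add: \<delta>_def)
    have sq: "0 \<le> (1 - exp (- r * \<delta>))\<^sup>2" by simp
    have "exp (- 2 * r * \<delta>) = (exp (- r * \<delta>))\<^sup>2" by (simp add: power2_eq_square exp_add[symmetric])
    \<comment> \<open>With x = \<open>exp (- r * \<delta>)\<close> this is x \<le> (1 + x^2) /
      2.\<close>
    with sq have stay: "exp (- r * \<delta>) \<le> switch_prob r \<delta> j j"
      by (simp add: switch_prob_def power2_diff)
    have "measure M (A n) = fdd r (return_pmf j) (\<lambda>k. real k * \<delta>) (\<lambda>_. j) (2^n)"
      unfolding A_def \<delta>_def[symmetric]
      by (intro switching_processD(3)[OF sp] monoI mult_right_mono of_nat_mono less_imp_le[OF \<delta>(1)]) simp_all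
    also have "\<dots> = switch_prob r \<delta> j j ^ (2^n)"
    proof -
      have "real (Suc k) * \<delta> - real k * \<delta> = \<delta>" for k by (simp add: algebra_simps)
      moreover have "j = 0 \<or> j = 1" using UNIV_2_01 by blast
      ultimately show ?thesis by (auto simp: fdd_def sum_UNIV_2 indicator_def simp del: of_nat_Suc)
    qed
    also have "\<dots> \<ge> exp (- r * \<delta>) ^ (2^n)" by (intro power_mono stay) simp
    also have "exp (- r * \<delta>) ^ (2^n) = exp (- r * h)"
      unfolding exp_of_nat_mult[symmetric] \<delta>(2)[symmetric] by (simp add: mult_ac)
    finally show ?thesis .
  qed
  have "decseq A"
  proof (rule decseq_SucI, rule subsetI)
    fix n \<omega> assume "\<omega> \<in> A (Suc n)"
    then have \<omega>: "\<omega> \<in> space M" "\<And>k. k \<le> 2 ^ Suc n \<Longrightarrow> W (real k * (h / 2 ^ Suc n)) \<omega> = j"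
      unfolding A_def by blast+
    have "W (real k * (h / 2 ^ n)) \<omega> = j" if "k \<le> 2 ^ n" for k
      using \<omega>(2)[of "2 * k"] that by simp
    then show "\<omega> \<in> A n" using \<omega>(1) by (simp add: A_def)
  qed
  then have "(\<lambda>n. measure M (A n)) \<longlonglongrightarrow> measure M (\<Inter>n. A n)"
    using A_sets by (intro finite_Lim_measure_decseq) auto
  then have "exp (- r * h) \<le> measure M (\<Inter>n. A n)" by (rule LIMSEQ_le_const) (use lower in blast)
  then have pos: "0 < measure M (\<Inter>n. A n)" using exp_gt_zero[of "- r * h"] by linarith
  have "\<exists>\<omega>\<in>\<Inter>n. A n. P \<omega>"
  proof (rule ccontr)
    assume none: "\<not> (\<exists>\<omega>\<in>\<Inter>n. A n. P \<omega>)"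
    have "AE \<omega> in M. \<omega> \<notin> (\<Inter>n. A n)" using P by eventually_elim (use none in blast)
    then have "measure M (\<Inter>n. A n) = 0" using A_sets by (intro prob_eq_0[THEN iffD2]) auto
    with pos show False by simp
  qed
  then obtain \<omega> where \<omega>: "\<And>n. \<omega> \<in> A n" "P \<omega>" by blast
  show thesis
  proof (rule that[OF \<omega>(2)])
    fix s :: real assume s: "0 \<le> s" "s < h"
    obtain N where N: "\<And>n. N \<le> n \<Longrightarrow> W (next_grid (h / real (Suc n)) s) \<omega> = W s \<omega>"
      using right_continuous_next_grid[OF rc[OF \<omega>(2)] h s(1)] by (auto simp: eventually_sequentially)
    \<comment> \<open>The index \<open>2 ^ N - 1\<close> is at least N and selects the dyadic grid
      among all equidistant ones.\<close>
    have S: "real (Suc (2 ^ N - 1)) = 2 ^ N" by simp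
    have "N \<le> 2 ^ N - (1::nat)" using less_exp[of N] by linarith
    from N[OF this] have eq: "W (next_grid (h / 2 ^ N) s) \<omega> = W s \<omega>" unfolding S .
    define k where "k = nat \<lceil>s / (h / 2 ^ N)\<rceil>"
    have "0 \<le> s / (h / 2 ^ N)" using s h by simp
    then have k: "next_grid (h / 2 ^ N) s = real k * (h / 2 ^ N)" by (simp add: k_def next_grid_def)
    have "s / (h / 2 ^ N) \<le> of_int (2 ^ N)" using s h by (simp add: divide_simps)
    then have "\<lceil>s / (h / 2 ^ N)\<rceil> \<le> 2 ^ N" by (rule ceiling_le)
    then have "k \<le> 2 ^ N" by (simp add: k_def nat_le_iff)
    then have "W (real k * (h / 2 ^ N)) \<omega> = j" using \<omega>(1)[of N] unfolding A_def by blast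
    with eq k show "W s \<omega> = j" by simp
  qed
qed

lemma drift_solvable:
  assumes sa: "stochastic_approximation \<alpha> \<epsilon> X' d G r (return_pmf j) x M i \<eta>" and r: "0 \<le> r" and h: "0 \<le> h"
  shows "\<exists>f. f 0 = x \<and> solves_inclusion (drift \<alpha> \<epsilon> X' d G j) 0 h f"
proof -
  have sp: "switching_process r (return_pmf j) M i"
    using sa unfolding stochastic_approximation_def by (blast intro: markov_chain_switching_process)
  let ?P = "\<lambda>\<omega>. right_continuous_path (\<lambda>t. i t \<omega>) \<and> \<eta> 0 \<omega> = x \<and>
    continuous_on {0..} (\<lambda>t. \<eta> t \<omega>) \<and> (\<forall>a b. 0 \<le> a \<longrightarrow> a < b \<longrightarrow> (\<forall>s\<in>{a..<b}. i s \<omega> = i a \<omega>) \<longrightarrow>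
      solves_inclusion (drift \<alpha> \<epsilon> X' d G (i a \<omega>)) a b (\<lambda>t. \<eta> t \<omega>))"
  have ae: "AE \<omega> in M. ?P \<omega>"
    using sa unfolding stochastic_approximation_def by blast
  \<comment> \<open>The horizon is enlarged because solutions are provided on intervals of positive
    length only, while h may be 0.\<close>
  have h1: "0 < h + 1" using h by simp
  obtain \<omega> where P: "?P \<omega>" and const: "\<And>s. 0 \<le> s \<Longrightarrow> s < h + 1 \<Longrightarrow> i s \<omega> = j"
    by (rule constant_path_exists[OF sp r h1 ae]) blast+
  have "\<forall>s\<in>{0..<h + 1}. i s \<omega> = i 0 \<omega>"
  proof
    fix s assume "s \<in> {0..<h + 1}"
    then show "i s \<omega> = i 0 \<omega>" using const[of s] const[of 0] h1 by simp
  qed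
  with P h1 have "solves_inclusion (drift \<alpha> \<epsilon> X' d G (i 0 \<omega>)) 0 (h + 1) (\<lambda>t. \<eta> t \<omega>)" by blast
  then have "solves_inclusion (drift \<alpha> \<epsilon> X' d G j) 0 (h + 1) (\<lambda>t. \<eta> t \<omega>)" using const[of 0] h1 by simp
  then have "solves_inclusion (drift \<alpha> \<epsilon> X' d G j) 0 h (\<lambda>t. \<eta> t \<omega>)"
    by (rule solves_inclusion_subinterval) (use h in auto)
  with P show ?thesis by (intro exI[of _ "\<lambda>t. \<eta> t \<omega>"]) blast
qed

theorem theorem5p5:
  fixes \<alpha> \<epsilon> r \<mu>_min :: real
    and X' :: "(real^'n) set" and d :: "real^'n" and G :: "real^'n^'m"
    and M :: "2 pmf \<Rightarrow> real^'n \<Rightarrow> 'w measure"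
    and i :: "2 pmf \<Rightarrow> real^'n \<Rightarrow> real \<Rightarrow> 'w \<Rightarrow> 2"
    and \<eta> :: "2 pmf \<Rightarrow> real^'n \<Rightarrow> real \<Rightarrow> 'w \<Rightarrow> real^'n"
  assumes "\<alpha> > 0" and "\<epsilon> > 0" and "r > 0"
    and "subspace X'" and "d \<in> X'"
    and "symmetric_matrix (laplacian G)" and "negative_definite (laplacian G)"
    and "is_min_eigenvalue (data_op \<alpha> X' - \<epsilon> *\<^sub>R laplacian G) \<mu>_min"
    and "\<mu>_min > 0" and "\<mu>_min > 1 / \<epsilon>"
    and "\<And>\<mu> x. stochastic_approximation \<alpha> \<epsilon> X' d G r \<mu> x (M \<mu> x) (i \<mu> x) (\<eta> \<mu> x)"
  shows "\<exists>\<pi>. stationary_measure (transition_kernel M i \<eta>) \<pi> \<and>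
    (\<forall>\<pi>'. stationary_measure (transition_kernel M i \<eta>) \<pi>' \<longrightarrow> \<pi>' = \<pi>) \<and>
    (\<forall>\<mu> x p. 0 < p \<longrightarrow> p < 1 \<longrightarrow>
      (\<exists>c c'. c > 0 \<and> c' > 0 \<and>
        (\<forall>t\<ge>0. wasserstein p \<pi> (distr (M \<mu> x) borel (\<eta> \<mu> x t)) \<le> c * exp (- c' * t))))"
proof -
  note sa = assms(11)
  have eig: "is_min_eigenvalue (stiffness \<alpha> \<epsilon> X' G) \<mu>_min" using assms(8) by (simp only: stiffness_def)
  \<comment> \<open>The radius from \<open>drift_dissipative\<close>, outside which both drifts
    point inward.\<close>
  define R where "R = max (norm (data_vec \<alpha> X' d) / \<mu>_min) (2 * CARD('n))"
  have R: "0 \<le> R" by (simp add: R_def le_max_iff_disj)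
  have b: "0 < 1 / \<epsilon>" using assms(2) by simp
  interpret inc: switched_inclusion "drift \<alpha> \<epsilon> X' d G" \<mu>_min "1 / \<epsilon>" R
  proof
    show "0 < 1 / \<epsilon>" "1 / \<epsilon> < \<mu>_min" "0 \<le> R" by (fact b assms(10) R)+
  next
    fix j :: 2 and x y v v'
    assume "v \<in> drift \<alpha> \<epsilon> X' d G j x" "v' \<in> drift \<alpha> \<epsilon> X' d G j y"
    then show "(v - v') \<bullet> (x - y) \<le> (if j = 0 then - \<mu>_min else 1 / \<epsilon>) * (norm (x - y))\<^sup>2"
      by (rule drift_one_sided_lipschitz[OF assms(2,4,6) eig])
  next
    fix j :: 2 and x v
    assume "v \<in> drift \<alpha> \<epsilon> X' d G j x" "R \<le> norm x"
    then show "v \<bullet> x \<le> 0" unfolding R_def by (rule drift_dissipative[OF assms(2,4,6) eig assms(9)])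
  next
    fix \<rho> :: real
    obtain C where "C \<ge> 0" "\<And>j x v. norm x \<le> \<rho> \<Longrightarrow> v \<in> drift \<alpha> \<epsilon> X' d G j x \<Longrightarrow> norm v \<le> C"
      by (rule drift_locally_bounded[OF assms(2,4), where \<rho> = \<rho> and \<alpha> = \<alpha> and d = d and G = G]) (rule that)
    then show "\<exists>C\<ge>0. \<forall>j x v. norm x \<le> \<rho> \<longrightarrow> v \<in> drift \<alpha> \<epsilon> X' d G j x \<longrightarrow> norm v \<le> C" by blast
  next
    fix j :: 2 and x :: "real^'n" and h :: real assume "0 \<le> h"
    then show "\<exists>f. f 0 = x \<and> solves_inclusion (drift \<alpha> \<epsilon> X' d G j) 0 h f"
      by (rule drift_solvable[OF sa less_imp_le[OF assms(3)]])
  qed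
  interpret switched_flow r \<mu>_min "1 / \<epsilon>" R inc.flow M i \<eta>
  proof
    show "0 < r" "0 < 1 / \<epsilon>" "1 / \<epsilon> < \<mu>_min" "0 \<le> R" by (fact assms(3) b assms(10) R)+
  next
    fix h :: real and j x y assume "0 \<le> h"
    then show "norm (inc.flow j h x - inc.flow j h y) \<le> exp (rate \<mu>_min (1 / \<epsilon>) j * h) * norm (x - y)"
      unfolding rate_def by (rule inc.flow_lipschitz)
    show "norm (inc.flow j h x) \<le> max (norm x) R" using \<open>0 \<le> h\<close> by (rule inc.flow_norm_le)
  next
    fix \<mu> x
    show "switching_process r \<mu> (M \<mu> x) (i \<mu> x)"
      using sa[of \<mu> x] unfolding stochastic_approximation_def by (blast intro: markov_chain_switching_process)
    show "\<eta> \<mu> x t \<in> borel_measurable (M \<mu> x)" if "0 \<le> t" for t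
      using sa[of \<mu> x] that unfolding stochastic_approximation_def by blast
    have "AE \<omega> in M \<mu> x. right_continuous_path (\<lambda>t. i \<mu> x t \<omega>) \<and> \<eta> \<mu> x 0 \<omega> = x \<and>
       continuous_on {0..} (\<lambda>t. \<eta> \<mu> x t \<omega>) \<and>
       (\<forall>a b. 0 \<le> a \<longrightarrow> a < b \<longrightarrow> (\<forall>s\<in>{a..<b}. i \<mu> x s \<omega> = i \<mu> x a \<omega>) \<longrightarrow>
          solves_inclusion (drift \<alpha> \<epsilon> X' d G (i \<mu> x a \<omega>)) a b (\<lambda>t. \<eta> \<mu> x t \<omega>))"
      using sa[of \<mu> x] unfolding stochastic_approximation_def by blast
    then show "AE \<omega> in M \<mu> x. \<eta> \<mu> x 0 \<omega> = x \<and>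
      (\<forall>s t. 0 \<le> s \<longrightarrow> 0 \<le> t \<longrightarrow>
        (\<lambda>n. grid_flow inc.flow (t / real (Suc n)) (Suc n) (\<eta> \<mu> x s \<omega>) (\<lambda>u. i \<mu> x (s + u) \<omega>))
          \<longlonglongrightarrow> \<eta> \<mu> x (s + t) \<omega>)"
    proof eventually_elim
      case (elim \<omega>)
      show ?case
      proof (intro conjI allI impI)
        show "\<eta> \<mu> x 0 \<omega> = x" using elim by blast
        fix s t :: real assume "0 \<le> s" "0 \<le> t"
        show "(\<lambda>n. grid_flow inc.flow (t / real (Suc n)) (Suc n) (\<eta> \<mu> x s \<omega>) (\<lambda>u. i \<mu> x (s + u) \<omega>))
          \<longlonglongrightarrow> \<eta> \<mu> x (s + t) \<omega>"
          by (rule inc.grid_flow_converges_shifted[where w = "\<lambda>u. i \<mu> x u \<omega>" and \<eta> = "\<lambda>t. \<eta> \<mu> x t \<omega>"])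
            (use elim \<open>0 \<le> s\<close> \<open>0 \<le> t\<close> in blast)+
      qed
    qed
  qed
  show ?thesis by (rule exponential_ergodicity)
qed

end
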